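(* Let $n\geq 2$ and let $V$ be the $(n+1)$-dimensional permutation representation of the symmetric group $S_{n+1}$. The Artin–Schelter regular algebras of global dimension $n+1$ which are $S_{n+1}$-deformations of the polynomial ring $\mathbb{C}[V]$ and are domains are parametrized by $\mathbf{V}(xy)\subset\mathbb{A}^2$, with one line corresponding to quantum algebras and the other line corresponding to differential polynomial rings.
   Context: All algebras are positively graded, connected $\mathbb{C}$-algebras, finitely generated in degree 1. $\mathbf{V}(xy)$ denotes the Zariski closed subset of the affine plane $\mathbb{A}^2$ (with coordinates $x,y$) defined by $xy=0$. $\mathbb{C}[V]=T(V)/(V\wedge V)$ is the polynomial ring on $V$ with the induced $S_{n+1}$-action. An $S_{n+1}$-deformation of $\mathbb{C}[V]$ is a graded algebra $B=T(V)/R$ with $B_1\cong V$ as $S_{n+1}$-representation, on which $S_{n+1}$ acts by gradation preserving automorphisms, such that $B_k\cong\mathbb{C}[V]_k$ as $S_{n+1}$-representations for all $k\in\mathbb{N}$. Let $x_0,\dots,x_n$ be the basis of $V$ with $\sigma(x_i)=x_{\sigma(i)}$ for $\sigma\in S_{n+1}$, and put $y_i=x_0-x_i$ for $1\leq i\leq n$ and $v=\sum_{i=0}^n x_i$; write $[a,b]=ab-ba$. The quantum algebras (skew polynomial rings over $\mathbb{C}[y_1,\dots,y_n]$) are those with generators $y_1,\dots,y_n,v$ and relations of the form $y_iv-a\,vy_i=0$ ($1\leq i\leq n$), $[y_i,y_j]=0$ ($1\leq i<j\leq n$), with $a$ a scalar parameter. The differential polynomial rings (over $\mathbb{C}[y_1,\dots,y_n]$)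 are those with generators $y_1,\dots,y_n,v$ and relations of the form $vy_i-y_iv=c\,y_i\big((n-1)y_i-2\sum_{j=1,j\neq i}^n y_j\big)$ ($1\leq i\leq n$), $[y_i,y_j]=0$ ($1\leq i<j\leq n$), with $c$ a scalar parameter.
   Formalization: The point of V(xy) given by the quantum algebra with a = 0 is excluded: there y_i v = 0, so that algebra is not a domain; the algebras in question, taken as relation ideals in T(V), correspond bijectively to all other points of V(xy). *)

theory Defs
  imports
    Complex_Main
    "HOL-Library.Poly_Mapping"
    "HOL-Library.Extended_Nat"
    "HOL-Library.FuncSet"
    "HOL-Combinatorics.Permutations"
    "HOL-Algebra.QuotRing"
    "HOL-Algebra.Module"
begin

section \<open>Connected graded complex algebras\<close>

text \<open>A graded algebra is a (not necessarily commutative) ring together with the structure map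
  \<open>scal\<close> from the complex numbers and the family \<open>piece\<close> of its homogeneous components.\<close>

record 'a graded_algebra = "'a ring" +
  scal :: "complex \<Rightarrow> 'a"
  piece :: "nat \<Rightarrow> 'a set"

locale connected_graded_algebra = ring A for A :: "('a, 'z) graded_algebra_scheme" (structure) +
  assumes scal_closed: "scal A c \<in> carrier A"
    and scal_add: "scal A (c + d) = scal A c \<oplus> scal A d"
    and scal_mult: "scal A (c * d) = scal A c \<otimes> scal A d"
    and scal_one: "scal A 1 = \<one>"
    and scal_central: "a \<in> carrier A \<Longrightarrow> scal A c \<otimes> a = a \<otimes> scal A c"
    and piece_subgroup: "additive_subgroup (piece A k) A"
    and piece_mult: "a \<in> piece A k \<Longrightarrow> b \<in> piece A l \<Longrightarrow> a \<otimes> b \<in> piece A (k + l)"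
    and direct_sum: "a \<in> carrier A \<Longrightarrow>
      \<exists>!f. (\<forall>k. f k \<in> piece A k) \<and> finite {k. f k \<noteq> \<zero>} \<and> a = finsum A f {k. f k \<noteq> \<zero>}"
    and connected: "piece A 0 = range (scal A)"
    and nontrivial: "\<one> \<noteq> \<zero>"

text \<open>The locale \<open>domain\<close> of the library includes commutativity.\<close>

definition nc_domain :: "('a, 'z) ring_scheme \<Rightarrow> bool" where
  "nc_domain A \<longleftrightarrow> ring A \<and> \<one>\<^bsub>A\<^esub> \<noteq> \<zero>\<^bsub>A\<^esub> \<and>
     (\<forall>a \<in> carrier A. \<forall>b \<in> carrier A. a \<otimes>\<^bsub>A\<^esub> b = \<zero>\<^bsub>A\<^esub> \<longrightarrow> a = \<zero>\<^bsub>A\<^esub> \<or> b = \<zero>\<^bsub>A\<^esub>)"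

definition polynomial_growth :: "('a, 'z) graded_algebra_scheme \<Rightarrow> bool" where
  "polynomial_growth A \<longleftrightarrow> (\<exists>C m. \<forall>k. \<exists>S. finite S \<and> card S \<le> C * (k + 1) ^ m \<and> S \<subseteq> piece A k \<and>
     piece A k \<subseteq> {finsum A (\<lambda>s. scal A (c s) \<otimes>\<^bsub>A\<^esub> s) S | c. True})"


section \<open>Left modules, projective resolutions, global dimension\<close>

text \<open>The library's locale \<open>module\<close> requires a commutative base ring; only its record type is
  reused here.\<close>

locale left_module = R?: ring A + M?: abelian_group M
  for A :: "('a, 'z) ring_scheme" (structure) and M :: "('a, 'b) module" (structure) +
  assumes smult_closed: "a \<in> carrier A \<Longrightarrow> x \<in> carrier M \<Longrightarrow> a \<odot>\<^bsub>M\<^esub> x \<in> carrier M"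
    and smult_l_distr: "a \<in> carrier A \<Longrightarrow> b \<in> carrier A \<Longrightarrow> x \<in> carrier M \<Longrightarrow>
      (a \<oplus>\<^bsub>A\<^esub> b) \<odot>\<^bsub>M\<^esub> x = a \<odot>\<^bsub>M\<^esub> x \<oplus>\<^bsub>M\<^esub> b \<odot>\<^bsub>M\<^esub> x"
    and smult_r_distr: "a \<in> carrier A \<Longrightarrow> x \<in> carrier M \<Longrightarrow> y \<in> carrier M \<Longrightarrow>
      a \<odot>\<^bsub>M\<^esub> (x \<oplus>\<^bsub>M\<^esub> y) = a \<odot>\<^bsub>M\<^esub> x \<oplus>\<^bsub>M\<^esub> a \<odot>\<^bsub>M\<^esub> y"
    and smult_assoc: "a \<in> carrier A \<Longrightarrow> b \<in> carrier A \<Longrightarrow> x \<in> carrier M \<Longrightarrow>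
      (a \<otimes>\<^bsub>A\<^esub> b) \<odot>\<^bsub>M\<^esub> x = a \<odot>\<^bsub>M\<^esub> (b \<odot>\<^bsub>M\<^esub> x)"
    and smult_one: "x \<in> carrier M \<Longrightarrow> \<one>\<^bsub>A\<^esub> \<odot>\<^bsub>M\<^esub> x = x"

definition left_hom ::
  "('a, 'z) ring_scheme \<Rightarrow> ('a, 'b) module \<Rightarrow> ('a, 'c) module \<Rightarrow> ('b \<Rightarrow> 'c) set" where
  "left_hom A M N = {f \<in> carrier M \<rightarrow>\<^sub>E carrier N.
     (\<forall>x \<in> carrier M. \<forall>y \<in> carrier M. f (x \<oplus>\<^bsub>M\<^esub> y) = f x \<oplus>\<^bsub>N\<^esub> f y) \<and>
     (\<forall>a \<in> carrier A. \<forall>x \<in> carrier M. f (a \<odot>\<^bsub>M\<^esub> x) = a \<odot>\<^bsub>N\<^esub> f x)}"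

text \<open>The modules occurring in resolutions, and the modules tested by the global dimension, have
  their carriers inside the element type \<open>'a\<close> of the ring. HOL has no quantification over types; for
  infinite \<open>'a\<close> nothing is lost: every module with at most as many elements as \<open>'a\<close>, in particular
  every cyclic left module, has an isomorphic copy on \<open>'a\<close>, a module of this size has a free cover of
  this size, and by Auslander's theorem the global dimension is attained on cyclic modules.\<close>

definition projective_module :: "('a, 'z) ring_scheme \<Rightarrow> ('a, 'a) module \<Rightarrow> bool" where
  "projective_module A P \<longleftrightarrow> left_module A P \<and>
     (\<forall>(M :: ('a, 'a) module) (N :: ('a, 'a) module). \<forall>g \<in> left_hom A M N. \<forall>f \<in> left_hom A P N.
        left_module A M \<and> left_module A N \<and> g ` carrier M = carrier N \<longrightarrow>
        (\<exists>h \<in> left_hom A P M. \<forall>x \<in> carrier P. g (h x) = f x))"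

text \<open>\<open>\<dots> \<rightarrow> P 2 \<rightarrow> P 1 \<rightarrow> P 0 \<rightarrow> M \<rightarrow> 0\<close>, with \<open>\<delta> i\<close> mapping \<open>P (i + 1)\<close> to \<open>P i\<close>.\<close>

definition projective_resolution ::
  "('a, 'z) ring_scheme \<Rightarrow> ('a, 'b) module \<Rightarrow> (nat \<Rightarrow> ('a, 'a) module) \<Rightarrow> (nat \<Rightarrow> 'a \<Rightarrow> 'a)
     \<Rightarrow> ('a \<Rightarrow> 'b) \<Rightarrow> bool" where
  "projective_resolution A M P \<delta> \<epsilon> \<longleftrightarrow>
     (\<forall>i. projective_module A (P i)) \<and>
     (\<forall>i. \<delta> i \<in> left_hom A (P (Suc i)) (P i)) \<and>
     \<epsilon> \<in> left_hom A (P 0) M \<and>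
     \<epsilon> ` carrier (P 0) = carrier M \<and>
     {x \<in> carrier (P 0). \<epsilon> x = \<zero>\<^bsub>M\<^esub>} = \<delta> 0 ` carrier (P 1) \<and>
     (\<forall>i. {x \<in> carrier (P (Suc i)). \<delta> i x = \<zero>\<^bsub>P i\<^esub>} = \<delta> (Suc i) ` carrier (P (Suc (Suc i))))"

definition projective_dimension :: "('a, 'z) ring_scheme \<Rightarrow> ('a, 'b) module \<Rightarrow> enat" where
  "projective_dimension A M = Inf {enat d | d. \<exists>P \<delta> \<epsilon>. projective_resolution A M P \<delta> \<epsilon> \<and>
     (\<forall>i > d. carrier (P i) = {\<zero>\<^bsub>P i\<^esub>})}"

definition global_dimension :: "('a, 'z) ring_scheme \<Rightarrow> enat" where
  "global_dimension A = Sup {projective_dimension A M | M :: ('a, 'a) module. left_module A M}"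


section \<open>Artin--Schelter regular algebras\<close>

text \<open>The augmentation of a connected graded algebra, that is, the quotient map by the ideal
  generated by the elements of positive degree.\<close>

definition augmentation :: "('a, 'z) graded_algebra_scheme \<Rightarrow> 'a \<Rightarrow> complex" where
  "augmentation A a = (THE c. a \<ominus>\<^bsub>A\<^esub> scal A c \<in> Idl\<^bsub>A\<^esub> (\<Union>k \<in> {1..}. piece A k))"

definition trivial_module :: "('a, 'z) graded_algebra_scheme \<Rightarrow> ('a, complex) module" where
  "trivial_module A = \<lparr>carrier = UNIV, mult = (*), one = 1, zero = 0, add = (+),
     smult = (\<lambda>a z. augmentation A a * z)\<rparr>"

definition regular_module :: "('a, 'z) ring_scheme \<Rightarrow> ('a, 'a) module" where
  "regular_module A = \<lparr>carrier = carrier A, mult = mult A, one = one A, zero = zero A, add = add A,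
     smult = mult A\<rparr>"

text \<open>The complex \<open>Hom\<^sub>A(P, A)\<close>, whose cohomology for a projective resolution \<open>P\<close> of the
  trivial module is \<open>Ext\<^sub>A(\<complex>, A)\<close>.\<close>

definition cocycles ::
  "('a, 'z) ring_scheme \<Rightarrow> (nat \<Rightarrow> ('a, 'a) module) \<Rightarrow> (nat \<Rightarrow> 'a \<Rightarrow> 'a) \<Rightarrow> nat \<Rightarrow> ('a \<Rightarrow> 'a) set" where
  "cocycles A P \<delta> i = {f \<in> left_hom A (P i) (regular_module A).
     \<forall>x \<in> carrier (P (Suc i)). f (\<delta> i x) = \<zero>\<^bsub>A\<^esub>}"

fun coboundaries ::
  "('a, 'z) ring_scheme \<Rightarrow> (nat \<Rightarrow> ('a, 'a) module) \<Rightarrow> (nat \<Rightarrow> 'a \<Rightarrow> 'a) \<Rightarrow> nat \<Rightarrow> ('a \<Rightarrow> 'a) set" where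
  "coboundaries A P \<delta> 0 = {\<lambda>x \<in> carrier (P 0). \<zero>\<^bsub>A\<^esub>}"
| "coboundaries A P \<delta> (Suc i) =
     {\<lambda>x \<in> carrier (P (Suc i)). g (\<delta> i x) | g. g \<in> left_hom A (P i) (regular_module A)}"

text \<open>\<open>Ext\<^sup>i(\<complex>, A) = 0\<close> for \<open>i \<noteq> d\<close>, and \<open>Ext\<^sup>d(\<complex>, A) \<cong> \<complex>\<close> as right \<open>A\<close>-modules; the isomorphism is
  given as a surjection \<open>\<psi>\<close> from the cocycles whose kernel is the group of coboundaries.\<close>

definition gorenstein :: "('a, 'z) graded_algebra_scheme \<Rightarrow> nat \<Rightarrow> bool" where
  "gorenstein A d \<longleftrightarrow> (\<exists>P \<delta> \<epsilon>. projective_resolution A (trivial_module A) P \<delta> \<epsilon> \<and>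
     (\<forall>i. i \<noteq> d \<longrightarrow> cocycles A P \<delta> i = coboundaries A P \<delta> i) \<and>
     (\<exists>\<psi> :: ('a \<Rightarrow> 'a) \<Rightarrow> complex.
        (\<forall>f \<in> cocycles A P \<delta> d. \<forall>g \<in> cocycles A P \<delta> d.
           \<psi> (\<lambda>x \<in> carrier (P d). f x \<oplus>\<^bsub>A\<^esub> g x) = \<psi> f + \<psi> g) \<and>
        (\<forall>f \<in> cocycles A P \<delta> d. \<forall>a \<in> carrier A.
           \<psi> (\<lambda>x \<in> carrier (P d). f x \<otimes>\<^bsub>A\<^esub> a) = \<psi> f * augmentation A a) \<and>
        \<psi> ` cocycles A P \<delta> d = UNIV \<and>
        {f \<in> cocycles A P \<delta> d. \<psi> f = 0} = coboundaries A P \<delta> d))"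

definition AS_regular :: "('a, 'z) graded_algebra_scheme \<Rightarrow> nat \<Rightarrow> bool" where
  "AS_regular A d \<longleftrightarrow> connected_graded_algebra A \<and> polynomial_growth A \<and>
     global_dimension A = enat d \<and> gorenstein A d"


section \<open>The tensor algebra of the permutation representation\<close>

text \<open>Words form a monoid under concatenation, so \<open>nat list \<Rightarrow>\<^sub>0 complex\<close> becomes, with the
  convolution product of the library, the free algebra on countably many letters.\<close>

instantiation list :: (type) monoid_add
begin

definition zero_list_def: "0 = ([] :: 'a list)"

definition plus_list_def: "xs + ys = xs @ (ys :: 'a list)"

instance
  by standard (simp_all add: zero_list_def plus_list_def)

end

type_synonym ncpoly = "nat list \<Rightarrow>\<^sub>0 complex"

definition const :: "complex \<Rightarrow> ncpoly" where
  "const c = Poly_Mapping.single [] c"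

text \<open>\<open>T(V)\<close> for \<open>V\<close> with basis \<open>x\<^sub>0, \<dots>, x\<^sub>n\<close>.\<close>

definition tensor_alg :: "nat \<Rightarrow> ncpoly ring" where
  "tensor_alg n = \<lparr>carrier = {f. \<forall>w \<in> Poly_Mapping.keys f. set w \<subseteq> {0..n}},
     mult = (*), one = 1, zero = 0, add = (+)\<rparr>"

definition tensor_piece :: "nat \<Rightarrow> nat \<Rightarrow> ncpoly set" where
  "tensor_piece n k = {f \<in> carrier (tensor_alg n). \<forall>w \<in> Poly_Mapping.keys f. length w = k}"

definition hom_component :: "nat \<Rightarrow> ncpoly \<Rightarrow> ncpoly" where
  "hom_component k f =
     (\<Sum>w \<in> {w \<in> Poly_Mapping.keys f. length w = k}. Poly_Mapping.single w (Poly_Mapping.lookup f w))"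

text \<open>The algebra automorphism of \<open>T(V)\<close> with \<open>x\<^sub>i \<mapsto> x\<^bsub>\<sigma>(i)\<^esub>\<close>.\<close>

definition perm_act :: "(nat \<Rightarrow> nat) \<Rightarrow> ncpoly \<Rightarrow> ncpoly" where
  "perm_act \<sigma> f =
     (\<Sum>w \<in> Poly_Mapping.keys f. Poly_Mapping.single (map \<sigma> w) (Poly_Mapping.lookup f w))"

text \<open>\<open>T(V)/R\<close> for a homogeneous ideal \<open>R\<close>.\<close>

definition quotient_alg :: "nat \<Rightarrow> ncpoly set \<Rightarrow> (ncpoly set) graded_algebra" where
  "quotient_alg n R = ring.extend (tensor_alg n Quot R)
     (graded_algebra.fields (\<lambda>c. R +>\<^bsub>tensor_alg n\<^esub> const c)
        (\<lambda>k. {R +>\<^bsub>tensor_alg n\<^esub> f | f. f \<in> tensor_piece n k}))"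

text \<open>The degree \<open>k\<close> components of \<open>T(V)/I\<close> and \<open>T(V)/J\<close> (with \<open>I\<close>, \<open>J\<close> stable under \<open>S\<^bsub>n+1\<^esub>\<close>) are
  isomorphic representations; \<open>\<sigma>\<close> acts on cosets elementwise.\<close>

definition piece_iso :: "nat \<Rightarrow> ncpoly set \<Rightarrow> ncpoly set \<Rightarrow> nat \<Rightarrow> bool" where
  "piece_iso n I J k \<longleftrightarrow> (\<exists>\<phi>.
     bij_betw \<phi> (piece (quotient_alg n I) k) (piece (quotient_alg n J) k) \<and>
     (\<forall>X \<in> piece (quotient_alg n I) k. \<forall>Y \<in> piece (quotient_alg n I) k.
        \<phi> (X \<oplus>\<^bsub>quotient_alg n I\<^esub> Y) = \<phi> X \<oplus>\<^bsub>quotient_alg n J\<^esub> \<phi> Y) \<and>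
     (\<forall>c. \<forall>X \<in> piece (quotient_alg n I) k.
        \<phi> (scal (quotient_alg n I) c \<otimes>\<^bsub>quotient_alg n I\<^esub> X)
          = scal (quotient_alg n J) c \<otimes>\<^bsub>quotient_alg n J\<^esub> \<phi> X) \<and>
     (\<forall>\<sigma>. \<sigma> permutes {0..n} \<longrightarrow>
        (\<forall>X \<in> piece (quotient_alg n I) k. \<phi> (perm_act \<sigma> ` X) = perm_act \<sigma> ` \<phi> X)))"

text \<open>The ideal generated by \<open>V \<and> V\<close>, so that \<open>\<complex>[V] = T(V)/(V \<and> V)\<close>.\<close>

definition comm_ideal :: "nat \<Rightarrow> ncpoly set" where
  "comm_ideal n = Idl\<^bsub>tensor_alg n\<^esub> {f * g - g * f | f g. f \<in> tensor_piece n 1 \<and> g \<in> tensor_piece n 1}"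

text \<open>\<open>T(V)/R\<close> is an \<open>S\<^bsub>n+1\<^esub>\<close>-deformation of \<open>\<complex>[V]\<close>. Stability of \<open>R\<close> says that the action on \<open>V\<close>
  extends to automorphisms of \<open>T(V)/R\<close>; \<open>V\<close> itself is the degree one component of \<open>T(V)/{0}\<close>.\<close>

definition S_deformation :: "nat \<Rightarrow> ncpoly set \<Rightarrow> bool" where
  "S_deformation n R \<longleftrightarrow>
     ideal R (tensor_alg n) \<and>
     (\<forall>f \<in> R. \<forall>k. hom_component k f \<in> R) \<and>
     (\<forall>\<sigma>. \<sigma> permutes {0..n} \<longrightarrow> perm_act \<sigma> ` R = R) \<and>
     piece_iso n R {0} 1 \<and>
     (\<forall>k. piece_iso n R (comm_ideal n) k)"


section \<open>The two families\<close>

definition xx :: "nat \<Rightarrow> ncpoly" where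
  "xx i = Poly_Mapping.single [i] 1"

definition yy :: "nat \<Rightarrow> ncpoly" where
  "yy i = xx 0 - xx i"

definition vv :: "nat \<Rightarrow> ncpoly" where
  "vv n = (\<Sum>i = 0..n. xx i)"

definition y_commutators :: "nat \<Rightarrow> ncpoly set" where
  "y_commutators n = {yy i * yy j - yy j * yy i | i j. 1 \<le> i \<and> i < j \<and> j \<le> n}"

definition delta_poly :: "nat \<Rightarrow> nat \<Rightarrow> ncpoly" where
  "delta_poly n i =
     yy i * (const (of_nat n - 1) * yy i - const 2 * (\<Sum>j \<in> {1..n} - {i}. yy j))"

definition quantum_ideal :: "nat \<Rightarrow> complex \<Rightarrow> ncpoly set" where
  "quantum_ideal n a = Idl\<^bsub>tensor_alg n\<^esub>
     ({yy i * vv n - const a * vv n * yy i | i. 1 \<le> i \<and> i \<le> n} \<union> y_commutators n)"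

definition differential_ideal :: "nat \<Rightarrow> complex \<Rightarrow> ncpoly set" where
  "differential_ideal n c = Idl\<^bsub>tensor_alg n\<^esub>
     ({vv n * yy i - yy i * vv n - const c * delta_poly n i | i. 1 \<le> i \<and> i \<le> n} \<union> y_commutators n)"

text \<open>A common family over the affine plane: it restricts to the quantum algebras, with parameter
  \<open>a = 1 + p\<close>, on the line \<open>q = 0\<close> and to the differential polynomial rings, with parameter
  \<open>c = q\<close>, on the line \<open>p = 0\<close>. The lines meet in the commutative polynomial ring. At the
  point \<open>(-1, 0)\<close>, where \<open>a = 0\<close>, the relations read \<open>y\<^sub>i v = 0\<close>, so that this single member of the family
  over \<open>xy = 0\<close> is not a domain.\<close>

definition family_ideal :: "nat \<Rightarrow> complex \<times> complex \<Rightarrow> ncpoly set" where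
  "family_ideal n = (\<lambda>(p, q). Idl\<^bsub>tensor_alg n\<^esub>
     ({yy i * vv n - const (1 + p) * vv n * yy i + const q * delta_poly n i | i. 1 \<le> i \<and> i \<le> n}
       \<union> y_commutators n))"

definition V_xy :: "(complex \<times> complex) set" where
  "V_xy = {(x, y). x * y = 0}"

end

theory Submission
  imports "HOL-Computational_Algebra.Polynomial" "HOL-Library.Multiset_Order" Defs
begin


text \<open>Why the theorem is true. Write \<open>y_i\<close>, \<open>v\<close> as in the definitions.

The deformations are few. An isomorphism of representations in degree two is a linear equivariant
surjection from \<open>T(V)\<close> in degree two onto the quadratic polynomials with kernel \<open>R\<close> in that degree.
The commutator \<open>[y_i, y_j]\<close> changes sign under the three transpositions of \<open>0, i, j\<close>, while no quadratic
monomial separates three letters, so it is sent to zero and lies in \<open>R\<close>. The elements of degree two that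
change sign under \<open>(0 1)\<close> and are fixed by the other letters have images in a plane; three of them give a
relation \<open>A y_1 v + B v y_1 + C \<delta>_1\<close>. Absence of zero divisors makes \<open>A\<close> and \<open>B\<close> nonzero, and comparing the
two ways of moving \<open>v\<close> to the left in \<open>y_1 y_2 v\<close> gives \<open>p q = 0\<close>. Hence a family ideal is contained in \<open>R\<close>,
and equality of the dimensions gives equality (\<open>classification\<close>).

The members of the family have all the properties. If \<open>p q = 0\<close>, then \<open>T(V)\<close> acts from the right on the space with
basis \<open>v^j y^M\<close> as the relations dictate, and the annihilator of the unit is the family ideal
(\<open>family_ideal_kernel\<close>). This is the PBW theorem; it gives the Hilbert series, the symmetry and, for
\<open>p \<noteq> -1\<close>, by leading coefficients in \<open>v\<close>, the absence of zero divisors.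

Regularity. Adjoining \<open>y_1, \<dots>, y_n, v\<close> one after the other is a chain of Ore extensions of the
complex numbers, each of which raises the global dimension by at most one (\<open>ore_extension_pdle\<close>). For the
lower bound and the Gorenstein condition, the trivial module has a Koszul resolution whose differentials are
products with \<open>y_i\<close> and with linear forms \<open>a^k v - q(L_1 + \<dots> + L_k)\<close>, where \<open>a = 1 + p\<close> and \<open>\<delta>_i = y_i L_i\<close>;
the correction terms make the squares of the cube commute. The resolution and its dual are exact by one
statement on cubes of abelian groups (\<open>cube_exact\<close>), applied to right and to left multiplications. The
differentials have entries in the augmentation ideal, so the resolution cannot be shortened.\<close>

text \<open>Short notation: \<open>x +[R] y\<close> is addition in the ring or module \<open>R\<close>, and so on; \<open>a **[M] x\<close> is the
action of a scalar; \<open>x |: M\<close> says that \<open>x\<close> lies in the carrier.\<close>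

abbreviation add_at ("_ +[_]/ _" [65, 0, 66] 65) where "x +[R] y \<equiv> x \<oplus>\<^bsub>R\<^esub> y"
abbreviation minus_at ("_ -[_]/ _" [65, 0, 66] 65) where "x -[R] y \<equiv> x \<ominus>\<^bsub>R\<^esub> y"
abbreviation neg_at ("-[_] _" [0, 81] 80) where "-[R] x \<equiv> \<ominus>\<^bsub>R\<^esub> x"
abbreviation mult_at ("_ *[_]/ _" [70, 0, 71] 70) where "x *[R] y \<equiv> x \<otimes>\<^bsub>R\<^esub> y"
abbreviation act_at ("_ **[_]/ _" [70, 0, 71] 70) where "a **[M] x \<equiv> a \<odot>\<^bsub>M\<^esub> x"
abbreviation zero_at ("0[_]") where "0[R] \<equiv> \<zero>\<^bsub>R\<^esub>"
abbreviation one_at ("1[_]") where "1[R] \<equiv> \<one>\<^bsub>R\<^esub>"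
abbreviation in_carrier (infix "|:" 50) where "x |: M \<equiv> x \<in> carrier M"
abbreviation iff (infixr "<->" 25) where "P <-> Q \<equiv> (P :: bool) = Q"
abbreviation lmod where "lmod \<equiv> left_module"
abbreviation restrict_ring (infixl "on:" 65) where "R on: A \<equiv> R\<lparr>carrier := A\<rparr>"
abbreviation subset (infix "<=:" 50) where "A <=: B \<equiv> A \<subseteq> B"
abbreviation TP where "TP \<equiv> tensor_piece"
abbreviation lookup where "lookup \<equiv> Poly_Mapping.lookup"
abbreviation keys where "keys \<equiv> Poly_Mapping.keys"
abbreviation single where "single \<equiv> Poly_Mapping.single"

section \<open>Homomorphisms of left modules\<close>

text \<open>Homomorphisms without the requirement of being undefined off the carrier, which would get in the way of composition.\<close>

definition mhom :: "('a, 'z) ring_scheme => ('a, 'b) module => ('a, 'c) module => ('b => 'c) => bool" where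
 "mhom A M N f <-> (ALL x:carrier M. f x |: N) &
  (ALL x:carrier M. ALL y:carrier M. f (x +[M] y) = f x +[N] f y) &
  (ALL a:carrier A. ALL x:carrier M. f (a **[M] x) = a **[N] f x)"

lemma mhomI:
 assumes "!!x. x |: M ==> f x |: N"
  and "!!x y. x |: M ==> y |: M ==> f (x +[M] y) = f x +[N] f y"
  and "!!a x. a |: A ==> x |: M ==> f (a **[M] x) = a **[N] f x"
 shows "mhom A M N f"
 using assms by (auto simp: mhom_def)

lemma mhomD:
 assumes "mhom A M N f"
 shows "x |: M ==> f x |: N"
  and "x |: M ==> y |: M ==> f (x +[M] y) = f x +[N] f y"
  and "a |: A ==> x |: M ==> f (a **[M] x) = a **[N] f x"
 using assms by (auto simp: mhom_def)

lemma mhom_cong: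
 assumes "mhom A M N f" "lmod A M" "!!x. x |: M ==> f x = g x"
 shows "mhom A M N g"
proof -
 interpret left_module A M by fact
 show ?thesis using assms(1,3) by (simp add: mhom_def smult_closed)
qed

lemma mhom_comp: "mhom A M N f ==> mhom A N K g ==> mhom A M K (%x. g (f x))"
 by (auto simp: mhom_def)
lemma left_hom_iff: "lmod A M ==> f : left_hom A M N <-> mhom A M N f & f : extensional (carrier M)"
 by (auto simp: left_hom_def mhom_def PiE_def Pi_def)
lemma restrict_left_hom:
 assumes "lmod A M" "mhom A M N f"
 shows "restrict f (carrier M) : left_hom A M N"
 using assms mhom_cong[OF assms(2,1), of "restrict f (carrier M)"]
 by (auto simp: left_hom_iff)

context left_module
begin

lemma M_abelian: "abelian_group M" by (rule M.abelian_group_axioms)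
lemma smult_zero [simp]: assumes "a |: A" shows "a **[M] 0[M] = 0[M]"
proof -
 have "a **[M] 0[M] +[M] a **[M] 0[M] = a **[M] 0[M]"
  using assms by (simp add: smult_r_distr[symmetric] smult_closed)
 thus ?thesis using assms by (simp add: M.add.l_cancel_one smult_closed)
qed

lemma zero_smult [simp]: assumes "x |: M" shows "0[A] **[M] x = 0[M]"
proof -
 have "0[A] **[M] x +[M] 0[A] **[M] x = 0[A] **[M] x"
  using assms by (simp add: smult_l_distr[symmetric] smult_closed)
 thus ?thesis using assms by (simp add: M.add.l_cancel_one smult_closed)
qed

lemma smult_minus: assumes "a |: A" "x |: M"
 shows "a **[M] (-[M] x) = -[M] (a **[M] x)"
proof -
 have "a **[M] (-[M] x) +[M] a **[M] x = 0[M]"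
  using assms by (simp add: smult_r_distr[symmetric] M.l_neg)
 thus ?thesis using assms by (simp add: M.minus_equality smult_closed)
qed

lemma smult_diff: assumes "a |: A" "x |: M" "y |: M"
 shows "a **[M] (x -[M] y) = a **[M] x -[M] a **[M] y"
 using assms by (simp add: a_minus_def smult_r_distr smult_minus)

lemma sub_module:
 assumes "S <=: carrier M" "0[M] : S" "!!x y. x : S ==> y : S ==> x +[M] y : S"
  "!!a x. a |: A ==> x : S ==> a **[M] x : S"
 shows "lmod A ((M on: S))"
proof -
 have neg: "-[M] x : S" if "x : S" for x
 proof -
  have x: "x |: M" using that assms by auto
  have "(-[A] 1[A]) **[M] x +[M] 1[A] **[M] x = 0[M]"
   using x by (subst smult_l_distr[symmetric]) (auto simp: R.l_neg)
  hence "(-[A] 1[A]) **[M] x = -[M] x"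
   using x by (simp add: smult_one M.minus_equality smult_closed)
  thus ?thesis using assms(4)[of "-[A] 1[A]" x] that by simp
 qed
 have in_M: "x : S ==> x |: M" for x using assms by auto
 have "abelian_group ((M on: S))"
 proof (rule abelian_groupI)
  fix x assume x: "x |: ((M on: S))"
  show "EX y:carrier ((M on: S)). y +[(M on: S)] x = 0[(M on: S)]"
   using x neg[of x] M.l_neg[OF in_M[of x]] by auto
 qed (use assms(2,3) in_M in "auto simp: M.a_ac")
 thus ?thesis using assms(4) in_M
  by (auto simp: left_module_def left_module_axioms_def R.ring_axioms smult_l_distr smult_r_distr smult_assoc smult_one)
qed

end

lemma left_moduleD: "lmod A M ==> abelian_group M" "lmod A M ==> ring A"
 by (auto simp: left_module_def)
lemma mhom_zero:
 assumes "lmod A M" "lmod A N" "mhom A M N f"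
 shows "f 0[M] = 0[N]"
proof -
 interpret M: left_module A M by fact
 interpret N: left_module A N by fact
 have "f (0[A] **[M] 0[M]) = 0[A] **[N] f 0[M]" using mhomD(3)[OF assms(3), of "0[A]" "0[M]"] by simp
 thus ?thesis using mhomD(1)[OF assms(3)] by simp
qed

lemma mhom_neg:
 assumes "lmod A M" "lmod A N" "mhom A M N f" "x |: M"
 shows "f (-[M] x) = -[N] f x"
proof -
 interpret M: left_module A M by fact
 interpret N: left_module A N by fact
 have "f (-[M] x) +[N] f x = 0[N]"
  using mhomD(2)[OF assms(3), of "-[M] x" x] assms(4) mhom_zero[OF assms(1-3)] by (simp add: M.M.l_neg)
 thus ?thesis using mhomD(1)[OF assms(3)] assms(4) by (simp add: N.M.minus_equality)
qed

lemma mhom_diff: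
 assumes "lmod A M" "lmod A N" "mhom A M N f" "x |: M" "y |: M"
 shows "f (x -[M] y) = f x -[N] f y"
 using assms mhom_neg[OF assms(1-3)] mhomD[OF assms(3)] abelian_group.a_inv_closed[OF left_moduleD(1)[OF assms(1)]]
 by (simp add: a_minus_def)

lemma mhom_add:
 assumes "lmod A M" "lmod A N" "mhom A M N f" "mhom A M N g"
 shows "mhom A M N (%x. f x +[N] g x)"
proof -
 interpret N: left_module A N by fact
 show ?thesis
  by (rule mhomI) (auto simp: mhomD[OF assms(3)] mhomD[OF assms(4)] N.M.a_ac N.smult_r_distr)
qed

lemma mhom_minus:
 assumes "lmod A M" "lmod A N" "mhom A M N f" "mhom A M N g"
 shows "mhom A M N (%x. f x -[N] g x)"
proof -
 interpret N: left_module A N by fact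
 show ?thesis
  by (rule mhomI) (auto simp: mhomD[OF assms(3)] mhomD[OF assms(4)] N.M.a_ac N.smult_r_distr
    a_minus_def N.smult_minus N.M.minus_add)
qed

definition ker_mod :: "('a, 'b) module => ('a, 'c) module => ('b => 'c) => ('a, 'b) module" where
 "ker_mod M N f = M\<lparr>carrier := {x : carrier M. f x = 0[N]}\<rparr>"

lemma ker_mod_simps [simp]:
 "x |: (ker_mod M N f) <-> x |: M & f x = 0[N]"
 "zero (ker_mod M N f) = zero M" "add (ker_mod M N f) = add M" "smult (ker_mod M N f) = smult M"
 by (auto simp: ker_mod_def)

lemma carrier_ker_mod: "carrier (ker_mod M N f) = {x : carrier M. f x = 0[N]}"
 by auto
lemma ker_mod_module:
 assumes "lmod A M" "lmod A N" "mhom A M N f"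
 shows "lmod A (ker_mod M N f)"
proof -
 interpret M: left_module A M by fact
 interpret N: left_module A N by fact
 show ?thesis unfolding ker_mod_def
  by (rule M.sub_module) (auto simp: mhomD[OF assms(3)] mhom_zero[OF assms] M.smult_closed)
qed

section \<open>Transport of modules along injections, direct sums\<close>

definition transport :: "('b => 'c) => ('a, 'b) module => ('a, 'c) module" where
 "transport e M = (let i = inv_into (carrier M) e in
  \<lparr>carrier = e ` carrier M, mult = (%x y. x), one = e 0[M], zero = e 0[M],
   add = (%x y. e (i x +[M] i y)), smult = (%a x. e (a **[M] i x))\<rparr>)"

lemma transport_simps [simp]:
 "carrier (transport e M) = e ` carrier M" "zero (transport e M) = e 0[M]"
 "add (transport e M) x y = e (inv_into (carrier M) e x +[M] inv_into (carrier M) e y)"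
 "smult (transport e M) a x = e (a **[M] inv_into (carrier M) e x)"
 by (simp_all add: transport_def Let_def)

lemma transport_module:
 assumes "lmod A M" "inj_on e (carrier M)"
 shows "lmod A (transport e M)"
proof -
 interpret M: left_module A M by fact
 have "abelian_group (transport e M)"
 proof (rule abelian_groupI)
  fix x assume "x |: (transport e M)"
  then obtain y where y: "y |: M" "x = e y" by auto
  show "EX y:carrier (transport e M). y +[transport e M] x = 0[transport e M]"
   using y M.M.l_neg[of y] assms(2) by (intro bexI[of _ "e (-[M] y)"]) auto
 qed (auto simp: assms(2) M.M.a_ac)
 thus ?thesis
  by (auto simp: left_module_def left_module_axioms_def assms(2) M.R.ring_axioms M.smult_closed
    M.smult_l_distr M.smult_r_distr M.smult_assoc M.smult_one)
qed

lemma transport_hom: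
 assumes "lmod A M" "inj_on e (carrier M)"
 shows "mhom A M (transport e M) e" "mhom A (transport e M) M (inv_into (carrier M) e)"
proof -
 interpret M: left_module A M by fact
 show "mhom A M (transport e M) e" "mhom A (transport e M) M (inv_into (carrier M) e)"
  by (auto simp: mhom_def assms(2) M.smult_closed)
qed

text \<open>An infinite type absorbs pairs, so that constructions on products can be carried back to the ring type.\<close>

lemma pair_injection:
 assumes "infinite (UNIV :: 'a set)"
 obtains pr :: "'a => 'a => 'a" where "!!x y x' y'. pr x y = pr x' y' <-> x = x' & y = y'"
proof -
 obtain f :: "'a \<times> 'a => 'a" where "bij_betw f (UNIV \<times> UNIV) UNIV"
  using card_of_Times_same_infinite[OF assms] card_of_ordIso by blast
 hence "inj f" by (simp add: bij_betw_def)
 hence "f (x, y) = f (x', y') <-> x = x' & y = y'" for x y x' y' by (auto dest: injD)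
 thus thesis by (rule that[of "%x y. f (x, y)"])
qed

definition prod_mod :: "('a, 'b) module => ('a, 'c) module => ('a, 'b \<times> 'c) module" where
 "prod_mod M N = \<lparr>carrier = carrier M \<times> carrier N, mult = (%x y. x), one = (0[M], 0[N]),
  zero = (0[M], 0[N]), add = (%x y. (fst x +[M] fst y, snd x +[N] snd y)),
  smult = (%a x. (a **[M] fst x, a **[N] snd x))\<rparr>"

lemma prod_mod_module:
 assumes "lmod A M" "lmod A N"
 shows "lmod A (prod_mod M N)"
proof -
 interpret M: left_module A M by fact
 interpret N: left_module A N by fact
 have "abelian_group (prod_mod M N)"
 proof (rule abelian_groupI)
  fix x assume x: "x |: (prod_mod M N)"
  show "EX y:carrier (prod_mod M N). y +[prod_mod M N] x = 0[prod_mod M N]"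
   using x by (intro bexI[of _ "(-[M] fst x, -[N] snd x)"]) (auto simp: prod_mod_def M.M.l_neg N.M.l_neg)
 qed (auto simp: prod_mod_def M.M.a_ac N.M.a_ac)
 thus ?thesis
  by (auto simp: left_module_def left_module_axioms_def M.R.ring_axioms prod_mod_def
   M.smult_closed M.smult_l_distr M.smult_r_distr M.smult_assoc M.smult_one
   N.smult_closed N.smult_l_distr N.smult_r_distr N.smult_assoc N.smult_one)
qed

text \<open>Modules with carrier in the infinite type of the ring elements are closed under direct sums.\<close>

lemma direct_sum_exists:
 fixes M N :: "('a, 'a) module"
 assumes "lmod A M" "lmod A N" "infinite (UNIV :: 'a set)"
 obtains D :: "('a, 'a) module" and p1 p2 pr where "lmod A D" "mhom A D M p1" "mhom A D N p2"
  "!!x y. x |: M ==> y |: N ==> pr x y |: D & p1 (pr x y) = x & p2 (pr x y) = y"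
  "!!z. z |: D ==> pr (p1 z) (p2 z) = z"
proof -
 obtain q :: "'a => 'a => 'a" where q: "!!x y x' y'. q x y = q x' y' <-> x = x' & y = y'"
  using pair_injection[OF assms(3)] by blast
 let ?e = "%z. q (fst z) (snd z)"
 let ?P = "prod_mod M N" let ?D = "transport ?e ?P"
 have P: "lmod A ?P" using assms by (simp add: prod_mod_module)
 have inj: "inj_on ?e (carrier ?P)" by (auto simp: inj_on_def q prod_eq_iff)
 have pM: "mhom A ?P M fst" and pN: "mhom A ?P N snd" by (auto simp: mhom_def prod_mod_def)
 note h = transport_hom[OF P inj]
 have i: "inv_into (carrier ?P) ?e (q x y) = (x, y)" if "x |: M" "y |: N" for x y
  using inv_into_f_f[OF inj, of "(x, y)"] that by (simp add: prod_mod_def)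
 show thesis
 proof (rule that[of ?D "%z. fst (inv_into (carrier ?P) ?e z)" "%z. snd (inv_into (carrier ?P) ?e z)" q])
  show "lmod A ?D" using transport_module[OF P inj] .
  show "mhom A ?D M (%z. fst (inv_into (carrier ?P) ?e z))"
   using mhom_comp[OF h(2) pM] .
  show "mhom A ?D N (%z. snd (inv_into (carrier ?P) ?e z))"
   using mhom_comp[OF h(2) pN] .
  show "!!x y. x |: M ==> y |: N ==> q x y |: ?D &
   fst (inv_into (carrier ?P) ?e (q x y)) = x & snd (inv_into (carrier ?P) ?e (q x y)) = y"
   using i by (force simp: prod_mod_def image_def)
  fix z assume "z |: ?D"
  then obtain x y where "x |: M" "y |: N" "z = q x y" by (auto simp: prod_mod_def)
  thus "q (fst (inv_into (carrier ?P) ?e z)) (snd (inv_into (carrier ?P) ?e z)) = z" using i by simp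
 qed
qed

section \<open>Projective modules\<close>

text \<open>Lifting against modules on the ring type, for a module on any type: direct sums and induced modules live on other types before transport.\<close>

definition proj :: "('a, 'z) ring_scheme => ('a, 'b) module => bool" where
 "proj A P <-> left_module A P &
  (ALL (M :: ('a, 'a) module) (N :: ('a, 'a) module) g f.
    left_module A M --> left_module A N --> mhom A M N g --> g ` carrier M = carrier N --> mhom A P N f -->
    (EX h. mhom A P M h & (ALL x:carrier P. g (h x) = f x)))"

lemma projI:
 fixes P :: "('a, 'b) module"
 assumes "lmod A P"
  "!!(M :: ('a, 'a) module) (N :: ('a, 'a) module) g f.
    left_module A M ==> left_module A N ==> mhom A M N g ==> g ` carrier M = carrier N ==> mhom A P N f ==>
    EX h. mhom A P M h & (ALL x:carrier P. g (h x) = f x)"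
 shows "proj A P"
 using assms unfolding proj_def by blast

lemma proj_lift:
 fixes P :: "('a, 'b) module" and M N :: "('a, 'a) module"
 assumes "proj A P" "lmod A M" "lmod A N" "mhom A M N g" "g ` carrier M = carrier N" "mhom A P N f"
 obtains h where "mhom A P M h" "!!x. x |: P ==> g (h x) = f x"
 using assms unfolding proj_def by metis

lemma proj_module: "proj A P ==> left_module A P"
 by (simp add: proj_def)
lemma projective_module_iff: "projective_module A P <-> proj A P"
proof
 assume P: "projective_module A P"
 hence m: "lmod A P" by (simp add: projective_module_def)
 show "proj A P"
 proof (rule projI[OF m])
  fix M N :: "('a, 'a) module" and g f
  assume h: "lmod A M" "lmod A N" "mhom A M N g" "g ` carrier M = carrier N" "mhom A P N f"
  have 1: "restrict g (carrier M) : left_hom A M N" "restrict f (carrier P) : left_hom A P N"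
   using h m by (simp_all add: restrict_left_hom)
  have im: "restrict g (carrier M) ` carrier M = carrier N" using h(4) by (simp add: image_restrict_eq)
  obtain k where k: "k : left_hom A P M" "ALL x:carrier P. restrict g (carrier M) (k x) = restrict f (carrier P) x"
   using P 1 h(1,2) im unfolding projective_module_def by blast
  have kk: "mhom A P M k" using k(1) m by (simp add: left_hom_iff)
  show "EX h. mhom A P M h & (ALL x:carrier P. g (h x) = f x)"
   using kk k(2) mhomD(1)[OF kk] by (intro exI[of _ k]) auto
 qed
next
 assume P: "proj A P"
 hence m: "lmod A P" by (rule proj_module)
 show "projective_module A P" unfolding projective_module_def
 proof (intro conjI allI ballI impI m)
  fix M N :: "('a, 'a) module" and g f
  assume h: "g : left_hom A M N" "f : left_hom A P N" "lmod A M & left_module A N & g ` carrier M = carrier N"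
  obtain k where k: "mhom A P M k" "!!x. x |: P ==> g (k x) = f x"
   using proj_lift[OF P, of M N g f] h m by (auto simp: left_hom_iff)
  show "EX h:left_hom A P M. ALL x:carrier P. g (h x) = f x"
   using restrict_left_hom[OF m k(1)] k(2) by (intro bexI[of _ "restrict k (carrier P)"]) auto
 qed
qed

text \<open>A retract of a projective module is projective.\<close>

lemma proj_retract:
 assumes "proj A P" "lmod A Q" "mhom A P Q r" "mhom A Q P s" "!!x. x |: Q ==> r (s x) = x"
 shows "proj A Q"
proof (rule projI[OF assms(2)])
 fix M N :: "('a, 'a) module" and g f
 assume h: "lmod A M" "lmod A N" "mhom A M N g" "g ` carrier M = carrier N" "mhom A Q N f"
 obtain k where k: "mhom A P M k" "!!x. x |: P ==> g (k x) = f (r x)"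
  using proj_lift[OF assms(1) h(1-4) mhom_comp[OF assms(3) h(5)]] by blast
 show "EX h. mhom A Q M h & (ALL x:carrier Q. g (h x) = f x)"
  using mhom_comp[OF assms(4) k(1)] k(2) mhomD(1)[OF assms(4)] assms(5)
  by (intro exI[of _ "%x. k (s x)"]) auto
qed

text \<open>An extension of projective modules is projective, since it splits.\<close>

lemma proj_extension:
 fixes Z X :: "('a, 'a) module"
 assumes Z: "lmod A Z" and p: "mhom A Z X p" "p ` carrier Z = carrier X"
  and X: "proj A X" and K: "proj A (ker_mod Z X p)"
 shows "proj A Z"
proof (rule projI[OF Z])
 fix M N :: "('a, 'a) module" and g f
 assume h: "lmod A M" "lmod A N" "mhom A M N g" "g ` carrier M = carrier N" "mhom A Z N f"
 let ?K = "ker_mod Z X p"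
 interpret Z: left_module A Z by fact
 interpret N: left_module A N by fact
 note Xm = proj_module[OF X]
 have idX: "mhom A X X (%x. x)" by (simp add: mhom_def)
 obtain s where s: "mhom A X Z s" "!!x. x |: X ==> p (s x) = x"
  using proj_lift[OF X Z Xm p idX] by blast
 have fK: "mhom A ?K N f" using h(5) by (auto simp: mhom_def)
 obtain h1 where h1: "mhom A ?K M h1" "!!x. x |: ?K ==> g (h1 x) = f x"
  using proj_lift[OF K h(1-4) fK] by blast
 obtain h2 where h2: "mhom A X M h2" "!!x. x |: X ==> g (h2 x) = f (s x)"
  using proj_lift[OF X h(1-4) mhom_comp[OF s(1) h(5)]] by blast
 let ?r = "%z. z -[Z] s (p z)"
 have sp: "mhom A Z Z (%z. s (p z))" using mhom_comp[OF p(1) s(1)] .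
 have "mhom A Z Z (%z. z)" by (simp add: mhom_def)
 hence rZ: "mhom A Z Z ?r" using mhom_minus[OF Z Z _ sp] by simp
 have pr: "p (?r z) = 0[X]" if "z |: Z" for z
  using that mhom_diff[OF Z Xm p(1), of z "s (p z)"] mhomD(1)[OF sp] mhomD(1)[OF p(1)] s(2)
   abelian_group.r_neg[OF left_moduleD(1)[OF Xm]] by (simp add: a_minus_def)
 have r: "mhom A Z ?K ?r" using rZ pr by (auto simp: mhom_def)
 let ?h = "%z. h1 (?r z) +[M] h2 (p z)"
 have "mhom A Z M ?h"
  using mhom_add[OF Z h(1) mhom_comp[OF r h1(1)] mhom_comp[OF p(1) h2(1)]] .
 moreover have "g (?h z) = f z" if z: "z |: Z" for z
 proof -
  have 1: "s (p z) |: Z" "p z |: X" "?r z |: ?K" "?r z |: Z"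
   using z mhomD(1)[OF sp] mhomD(1)[OF p(1)] mhomD(1)[OF r] mhomD(1)[OF rZ] by auto
  have "g (?h z) = f (?r z) +[N] f (s (p z))"
   using 1 mhomD(2)[OF h(3)] mhomD(1)[OF h1(1)] mhomD(1)[OF h2(1)] h1(2) h2(2) by simp
  also have "... = f (?r z +[Z] s (p z))" using mhomD(2)[OF h(5)] 1 by simp
  also have "?r z +[Z] s (p z) = z" using z 1(1) by (simp add: a_minus_def Z.M.a_assoc Z.M.l_neg)
  finally show ?thesis .
 qed
 ultimately show "EX h. mhom A Z M h & (ALL x:carrier Z. g (h x) = f x)" by blast
qed

definition zero_mod :: "'b => ('a, 'b) module" where
 "zero_mod z = \<lparr>carrier = {z}, mult = (%x y. x), one = z, zero = z, add = (%x y. z), smult = (%a x. z)\<rparr>"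

lemma zero_mod_module: "ring A ==> left_module A (zero_mod z)"
 by (auto simp: left_module_def left_module_axioms_def zero_mod_def intro!: abelian_groupI)
lemma trivial_carrier_proj:
 assumes P: "lmod A P" and c: "carrier P = {0[P]}"
 shows "proj A P"
proof (rule projI[OF P])
 fix M N :: "('a, 'a) module" and g f
 assume h: "lmod A M" "lmod A N" "mhom A M N g" "g ` carrier M = carrier N" "mhom A P N f"
 interpret M: left_module A M by fact
 interpret P: left_module A P by fact
 have "mhom A P M (%x. 0[M])" by (auto simp: mhom_def)
 thus "EX h. mhom A P M h & (ALL x:carrier P. g (h x) = f x)"
  using c mhom_zero[OF h(1-3)] mhom_zero[OF P h(2,5)] by (intro exI[of _ "%x. 0[M]"]) auto
qed

lemma (in left_module) minus_zero_M: "-[M] 0[M] = 0[M]"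
 by (rule M.minus_equality) auto

section \<open>Projective dimension\<close>

text \<open>Recursion along a resolution: a bound \<open>d\<close> for the projective dimension, witnessed by one cover and a bound for its kernel.\<close>

primrec pdle :: "('a, 'z) ring_scheme => nat => ('a, 'a) module => bool" where
 "pdle A 0 M = proj A M"
| "pdle A (Suc d) M = (left_module A M & (EX P e. proj A P & mhom A P M e & e ` carrier P = carrier M &
  pdle A d (ker_mod P M e)))"

lemma pdle_module: "pdle A d M ==> left_module A M"
 by (cases d) (auto dest: proj_module)
lemma pdle_SucI:
 assumes "lmod A M" "proj A P" "mhom A P M e" "e ` carrier P = carrier M" "pdle A d (ker_mod P M e)"
 shows "pdle A (Suc d) M"
 using assms by auto

lemma pdle_SucE:
 assumes "pdle A (Suc d) M"
 obtains P e where "proj A P" "mhom A P M e" "e ` carrier P = carrier M" "pdle A d (ker_mod P M e)"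
 using assms by auto

declare pdle.simps(2) [simp del]

text \<open>Both modules have the same covers and kernels; this frees the later constructions from the choice of a coding.\<close>

lemma pdle_iso:
 fixes M N :: "('a, 'a) module"
 assumes "pdle A d M" "lmod A N" "mhom A M N f" "mhom A N M g"
  "!!x. x |: M ==> g (f x) = x" "!!y. y |: N ==> f (g y) = y"
 shows "pdle A d N"
proof (cases d)
 case 0
 thus ?thesis using proj_retract[of A M N f g] assms by simp
next
 case (Suc k)
 note M = pdle_module[OF assms(1)]
 obtain P e where P: "proj A P" "mhom A P M e" "e ` carrier P = carrier M" "pdle A k (ker_mod P M e)"
  using assms(1) Suc by (auto elim: pdle_SucE)
 have "f (e x) = 0[N] <-> e x = 0[M]" if "x |: P" for x
  using assms(5) mhomD(1)[OF P(2) that] mhom_zero[OF M assms(2,3)] mhom_zero[OF assms(2) M assms(4)] by metis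
 hence "{x : carrier P. f (e x) = 0[N]} = {x : carrier P. e x = 0[M]}" by blast
 hence "ker_mod P N (%x. f (e x)) = ker_mod P M e" by (simp add: ker_mod_def)
 moreover have "(%x. f (e x)) ` carrier P = carrier N"
 proof
  show "(%x. f (e x)) ` carrier P <=: carrier N" using mhomD(1)[OF assms(3)] mhomD(1)[OF P(2)] by auto
  show "carrier N <=: (%x. f (e x)) ` carrier P"
  proof
   fix y assume y: "y |: N"
   hence "g y : e ` carrier P" using mhomD(1)[OF assms(4)] P(3) by auto
   then obtain x where "x |: P" "g y = e x" by auto
   thus "y : (%x. f (e x)) ` carrier P" using assms(6)[OF y] by (intro image_eqI[of _ _ x]) auto
  qed
 qed
 ultimately show ?thesis
  using Suc P(4) pdle_SucI[OF assms(2) P(1) mhom_comp[OF P(2) assms(3)]] by simp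
qed

lemma pdle_Suc: "pdle A d M ==> pdle A (Suc d) M"
proof (induction d arbitrary: M)
 case 0
 hence P: "proj A M" by simp
 note m = proj_module[OF P]
 interpret left_module A M by fact
 have id: "mhom A M M (%x. x)" by (simp add: mhom_def)
 have "proj A (ker_mod M M (%x. x))"
  by (rule trivial_carrier_proj[OF ker_mod_module[OF m m id]]) auto
 thus ?case using pdle_SucI[OF m P id] by simp
next
 case (Suc d)
 from Suc.prems show ?case
  by (rule pdle_SucE) (blast intro: pdle_SucI pdle_module Suc)
qed

lemma image_carrier_module:
 assumes "lmod A K" "lmod A N" "mhom A K N g"
 shows "lmod A (N\<lparr>carrier := g ` carrier K\<rparr>)"
proof -
 interpret K: left_module A K by fact
 interpret N: left_module A N by fact
 show ?thesis
 proof (rule N.sub_module)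
  show "0[N] : g ` carrier K" using mhom_zero[OF assms] K.M.zero_closed by (intro image_eqI[of _ _ "0[K]"]) simp_all
  show "x +[N] y : g ` carrier K" if "x : g ` carrier K" "y : g ` carrier K" for x y
   using that by (auto simp: mhomD(2)[OF assms(3), symmetric])
  show "a **[N] x : g ` carrier K" if "a |: A" "x : g ` carrier K" for a x
   using that by (auto simp: mhomD(3)[OF assms(3), symmetric] K.smult_closed)
 qed (use mhomD(1)[OF assms(3)] in auto)
qed

lemma proj_lift_image:
 fixes K N :: "('a, 'a) module" and Q :: "('a, 'b) module"
 assumes "proj A Q" "lmod A K" "lmod A N" "mhom A K N g" "mhom A Q N f"
  "f ` carrier Q <=: g ` carrier K"
 obtains h where "mhom A Q K h" "!!x. x |: Q ==> g (h x) = f x"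
proof -
 let ?N = "N\<lparr>carrier := g ` carrier K\<rparr>"
 have "mhom A K ?N g" "mhom A Q ?N f" using assms(4-6) by (auto simp: mhom_def)
 thus thesis
  using proj_lift[OF assms(1,2) image_carrier_module[OF assms(2-4)], of g f] that by auto
qed

lemma direct_sum_proj:
 fixes P1 P2 :: "('a, 'a) module"
 assumes "proj A P1" "proj A P2" "infinite (UNIV :: 'a set)"
 obtains D :: "('a, 'a) module" and p1 p2 pr where "proj A D" "mhom A D P1 p1" "mhom A D P2 p2"
  "!!x y. x |: P1 ==> y |: P2 ==> pr x y |: D"
  "!!x y. x |: P1 ==> y |: P2 ==> p1 (pr x y) = x"
  "!!x y. x |: P1 ==> y |: P2 ==> p2 (pr x y) = y"
  "!!z. z |: D ==> pr (p1 z) (p2 z) = z"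
  "mhom A P1 D (%u. pr u 0[P2])"
proof -
 note m = proj_module[OF assms(1)] proj_module[OF assms(2)]
 obtain D :: "('a, 'a) module" and p1 p2 pr where D: "lmod A D" "mhom A D P1 p1" "mhom A D P2 p2"
  and pr: "!!x y. x |: P1 ==> y |: P2 ==> pr x y |: D & p1 (pr x y) = x & p2 (pr x y) = y"
  and pr2: "!!z. z |: D ==> pr (p1 z) (p2 z) = z"
  using direct_sum_exists[OF m assms(3)] by blast
 interpret D: left_module A D by fact
 interpret P1: left_module A P1 by fact
 interpret P2: left_module A P2 by fact
 have eq: "x = y" if "x |: D" "y |: D" "p1 x = p1 y" "p2 x = p2 y" for x y
  using that pr2 by metis
 have inj: "mhom A P1 D (%u. pr u 0[P2])"
 proof (rule mhomI)
  show "pr x 0[P2] |: D" if "x |: P1" for x using that pr by simp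
  show "pr (x +[P1] y) 0[P2] = pr x 0[P2] +[D] pr y 0[P2]" if "x |: P1" "y |: P1" for x y
   by (rule eq) (use that in "simp_all add: pr mhomD(2)[OF D(2)] mhomD(2)[OF D(3)]")
  show "pr (a **[P1] x) 0[P2] = a **[D] pr x 0[P2]" if "a |: A" "x |: P1" for a x
   by (rule eq) (use that in "simp_all add: pr mhomD(3)[OF D(2)] mhomD(3)[OF D(3)] D.smult_closed P1.smult_closed")
 qed
 have "proj A D"
 proof (rule proj_extension[OF D(1,3) _ assms(2)])
  show "p2 ` carrier D = carrier P2"
   using pr[OF P1.M.zero_closed] mhomD(1)[OF D(3)] by (force simp: image_iff)
  show "proj A (ker_mod D P2 p2)"
  proof (rule proj_retract[OF assms(1) ker_mod_module[OF D(1) m(2) D(3)]])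
   show "mhom A P1 (ker_mod D P2 p2) (%u. pr u 0[P2])" using inj pr by (auto simp: mhom_def)
   show "mhom A (ker_mod D P2 p2) P1 p1" using D(2) by (auto simp: mhom_def)
   show "pr (p1 x) 0[P2] = x" if "x |: (ker_mod D P2 p2)" for x using that pr2[of x] by auto
  qed
 qed
 thus thesis using that[of D p1 p2 pr] D pr pr2 inj by blast
qed

text \<open>The horseshoe argument: resolutions of the two ends of an extension add up to a resolution of
 the middle term.\<close>

lemma pdle_extension:
 fixes Z X :: "('a, 'a) module"
 assumes inf: "infinite (UNIV :: 'a set)"
 shows "lmod A Z ==> mhom A Z X p ==> p ` carrier Z = carrier X ==> pdle A d X
  ==> pdle A d (ker_mod Z X p) ==> pdle A d Z"
proof (induction d arbitrary: Z X p)
 case 0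
 thus ?case using proj_extension[of A Z X p] by simp
next
 case (Suc d)
 note Z = Suc.prems(1) and p = Suc.prems(2,3)
 note X = pdle_module[OF Suc.prems(4)]
 let ?K = "ker_mod Z X p"
 note K = pdle_module[OF Suc.prems(5)]
 obtain P1 e1 where P1: "proj A P1" "mhom A P1 ?K e1" "e1 ` carrier P1 = carrier ?K" "pdle A d (ker_mod P1 ?K e1)"
  using Suc.prems(5) by (rule pdle_SucE)
 obtain P2 e2 where P2: "proj A P2" "mhom A P2 X e2" "e2 ` carrier P2 = carrier X" "pdle A d (ker_mod P2 X e2)"
  using Suc.prems(4) by (rule pdle_SucE)
 obtain h where h: "mhom A P2 Z h" "!!x. x |: P2 ==> p (h x) = e2 x"
  using proj_lift[OF P2(1) Z X p P2(2)] by blast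
 obtain D :: "('a, 'a) module" and p1 p2 pr where D: "proj A D" "mhom A D P1 p1" "mhom A D P2 p2"
  and pr: "!!x y. x |: P1 ==> y |: P2 ==> pr x y |: D"
  "!!x y. x |: P1 ==> y |: P2 ==> p1 (pr x y) = x"
  "!!x y. x |: P1 ==> y |: P2 ==> p2 (pr x y) = y"
  "!!z. z |: D ==> pr (p1 z) (p2 z) = z"
  "mhom A P1 D (%u. pr u 0[P2])"
  using direct_sum_proj[OF P1(1) P2(1) inf] by blast
 interpret D: left_module A D by (rule proj_module[OF D(1)])
 interpret P1: left_module A P1 by (rule proj_module[OF P1(1)])
 interpret P2: left_module A P2 by (rule proj_module[OF P2(1)])
 interpret Z: left_module A Z by fact
 interpret X: left_module A X by fact
 have e1Z: "mhom A P1 Z e1" using P1(2) by (auto simp: mhom_def)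
 have pe1: "p (e1 u) = 0[X]" if "u |: P1" for u using mhomD(1)[OF P1(2) that] by simp
 let ?E = "%z. e1 (p1 z) +[Z] h (p2 z)"
 have E: "mhom A D Z ?E"
  using mhom_add[OF D.left_module_axioms Z mhom_comp[OF D(2) e1Z] mhom_comp[OF D(3) h(1)]] .
 have pE: "p (?E z) = e2 (p2 z)" if "z |: D" for z
  using that mhomD(2)[OF p(1)] mhomD(1)[OF e1Z] mhomD(1)[OF h(1)] mhomD(1)[OF D(2)] mhomD(1)[OF D(3)]
   pe1 h(2) mhomD(1)[OF P2(2)] by simp
 have Esurj: "?E ` carrier D = carrier Z"
 proof (intro equalityI subsetI)
  fix z assume z: "z |: Z"
  hence "p z : e2 ` carrier P2" using mhomD(1)[OF p(1)] P2(3) by simp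
  then obtain w where w: "w |: P2" "p z = e2 w" by auto
  have hw: "h w |: Z" "p (h w) = p z" using w mhomD(1)[OF h(1)] h(2) by auto
  have "z -[Z] h w |: ?K"
   using z hw mhom_diff[OF Z X p(1), of z "h w"] mhomD(1)[OF p(1) z] by (simp add: a_minus_def X.M.r_neg)
  then obtain u where u: "u |: P1" "e1 u = z -[Z] h w" using P1(3) by (metis imageE)
  have "?E (pr u w) = z" using u w pr(2,3) z hw(1) by (simp add: a_minus_def Z.M.a_assoc Z.M.l_neg)
  thus "z : ?E ` carrier D" using pr(1)[OF u(1) w(1)] by (intro image_eqI[of _ _ "pr u w"]) simp_all
 qed (use mhomD(1)[OF E] in auto)
 let ?Z1 = "ker_mod D Z ?E" and ?K2 = "ker_mod P2 X e2"
 have Z1: "lmod A ?Z1" by (rule ker_mod_module[OF D.left_module_axioms Z E])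
 have K2: "lmod A ?K2" by (rule ker_mod_module[OF P2.left_module_axioms X P2(2)])
 have p2: "mhom A ?Z1 ?K2 p2"
 proof (rule mhomI)
  fix z assume "z |: ?Z1"
  hence z: "z |: D" "?E z = 0[Z]" by auto
  show "p2 z |: ?K2" using pE[OF z(1)] z mhomD(1)[OF D(3)] mhom_zero[OF Z X p(1)] by simp
 qed (auto simp: mhomD[OF D(3)])
 have p2s: "p2 ` carrier ?Z1 = carrier ?K2"
 proof (intro equalityI subsetI)
  fix w assume "w |: ?K2"
  hence w: "w |: P2" "e2 w = 0[X]" by auto
  have hw: "h w |: Z" using w mhomD(1)[OF h(1)] by simp
  have "-[Z] h w |: ?K" using hw mhom_neg[OF Z X p(1) hw] h(2)[OF w(1)] w(2) by simp
  then obtain u where u: "u |: P1" "e1 u = -[Z] h w" using P1(3) by (metis imageE)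
  have "pr u w |: ?Z1" using pr(1-3) u w hw by (simp add: Z.M.l_neg)
  thus "w : p2 ` carrier ?Z1" using pr(3)[OF u(1) w(1)] by (intro image_eqI[of _ _ "pr u w"]) simp_all
 qed (use mhomD(1)[OF p2] in auto)
 have "pdle A d (ker_mod ?Z1 ?K2 p2)"
 proof (rule pdle_iso[OF P1(4) ker_mod_module[OF Z1 K2 p2]])
  have h0: "h 0[P2] = 0[Z]" using mhom_zero[OF P2.left_module_axioms Z h(1)] .
  show "mhom A (ker_mod P1 ?K e1) (ker_mod ?Z1 ?K2 p2) (%u. pr u 0[P2])"
   using pr(5) pr(2,3) h0 by (auto simp: mhom_def)
  show "mhom A (ker_mod ?Z1 ?K2 p2) (ker_mod P1 ?K e1) p1"
  proof (rule mhomI)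
   fix z assume "z |: (ker_mod ?Z1 ?K2 p2)"
   hence z: "z |: D" "e1 (p1 z) +[Z] h (p2 z) = 0[Z]" "p2 z = 0[P2]" by auto
   thus "p1 z |: (ker_mod P1 ?K e1)" using h0 mhomD(1)[OF D(2)] mhomD(1)[OF e1Z] by simp
  qed (auto simp: mhomD[OF D(2)])
  show "p1 (pr x 0[P2]) = x" if "x |: (ker_mod P1 ?K e1)" for x using that pr(2) by simp
  show "pr (p1 y) 0[P2] = y" if "y |: (ker_mod ?Z1 ?K2 p2)" for y using that pr(4)[of y] by simp
 qed
 hence "pdle A d ?Z1" using Suc.IH[OF Z1 p2 p2s P2(4)] by simp
 thus ?case by (rule pdle_SucI[OF Z D(1) E Esurj])
qed

text \<open>If a module is the cokernel of an injection between modules of projective dimension at most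
 \<open>d\<close>, then its own projective dimension is at most \<open>d + 1\<close>.\<close>

lemma pdle_cokernel:
 fixes X Y M :: "('a, 'a) module"
 assumes inf: "infinite (UNIV :: 'a set)"
  and M: "lmod A M" and f: "mhom A X Y f" "inj_on f (carrier X)"
  and q: "mhom A Y M q" "q ` carrier Y = carrier M"
  and ex: "!!y. y |: Y ==> q y = 0[M] <-> y : f ` carrier X"
  and pd: "pdle A d X" "pdle A d Y"
 shows "pdle A (Suc d) M"
proof -
 note X = pdle_module[OF pd(1)] and Y = pdle_module[OF pd(2)]
 interpret X: left_module A X by fact
 interpret Y: left_module A Y by fact
 define i where "i = inv_into (carrier X) f"
 have i: "i (f x) = x" if "x |: X" for x using that f(2) by (simp add: i_def)
 have ker: "mhom A (ker_mod Y M q) X i"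
 proof (rule mhomI)
  show "i y |: X" if "y |: (ker_mod Y M q)" for y
   using that ex i by auto
  fix y assume "y |: (ker_mod Y M q)"
  then obtain x where x: "x |: X" "y = f x" using ex by auto
  show "i (a **[ker_mod Y M q] y) = a **[X] i y" if "a |: A" for a
   using x that mhomD(3)[OF f(1), of a x, symmetric] i by (simp add: X.smult_closed)
  fix y' assume "y' |: (ker_mod Y M q)"
  then obtain x' where x': "x' |: X" "y' = f x'" using ex by auto
  show "i (y +[ker_mod Y M q] y') = i y +[X] i y'"
   using x x' mhomD(2)[OF f(1), of x x', symmetric] i by simp
 qed
 show ?thesis
 proof (cases d)
  case 0
  have "proj A (ker_mod Y M q)"
  proof (rule proj_retract)
   show "proj A X" using pd(1) 0 by simp
   show "lmod A (ker_mod Y M q)" by (rule ker_mod_module[OF Y M q(1)])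
   show "mhom A X (ker_mod Y M q) f" using f(1) ex by (auto simp: mhom_def)
   show "mhom A (ker_mod Y M q) X i" by (rule ker)
   show "f (i x) = x" if "x |: (ker_mod Y M q)" for x using that ex i by auto
  qed
  thus ?thesis using pdle_SucI[OF M _ q] pd(2) 0 by simp
 next
  case (Suc k)
  obtain P e where P: "proj A P" "mhom A P Y e" "e ` carrier P = carrier Y" "pdle A k (ker_mod P Y e)"
   using pd(2) Suc by (auto elim: pdle_SucE)
  let ?E = "%x. q (e x)"
  note Pm = proj_module[OF P(1)]
  have E: "mhom A P M ?E" by (rule mhom_comp[OF P(2) q(1)])
  let ?Z = "ker_mod P M ?E"
  have Z: "lmod A ?Z" by (rule ker_mod_module[OF Pm M E])
  have eZ: "mhom A ?Z (ker_mod Y M q) e" using P(2) by (auto simp: mhom_def)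
  let ?p = "%z. i (e z)"
  have p: "mhom A ?Z X ?p" by (rule mhom_comp[OF eZ ker])
  have ps: "?p ` carrier ?Z = carrier X"
  proof (intro equalityI subsetI)
   fix x assume x: "x |: X"
   hence "f x : e ` carrier P" using P(3) mhomD(1)[OF f(1)] by auto
   then obtain z where z: "z |: P" "e z = f x" by auto
   have "z |: ?Z" using z x ex[of "f x"] mhomD(1)[OF f(1)] by auto
   thus "x : ?p ` carrier ?Z" using z i[OF x] by (intro image_eqI[of _ _ z]) auto
  qed (use mhomD(1)[OF p] in auto)
  have "carrier (ker_mod ?Z X ?p) = carrier (ker_mod P Y e)"
  proof (intro equalityI subsetI)
   fix z assume "z |: (ker_mod ?Z X ?p)"
   hence z: "z |: P" "q (e z) = 0[M]" "i (e z) = 0[X]" by auto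
   then obtain x where x: "x |: X" "e z = f x" using ex mhomD(1)[OF P(2)] by blast
   hence "x = 0[X]" using i z(3) by auto
   thus "z |: (ker_mod P Y e)" using z x mhom_zero[OF X Y f(1)] by auto
  next
   fix z assume "z |: (ker_mod P Y e)"
   hence z: "z |: P" "e z = f 0[X]" using mhom_zero[OF X Y f(1)] by auto
   have "q (e z) = 0[M]" using z(1) ex[OF mhomD(1)[OF P(2) z(1)]] z(2) by auto
   thus "z |: (ker_mod ?Z X ?p)" using z i[of "0[X]"] by auto
  qed
  hence "ker_mod ?Z X ?p = ker_mod P Y e" unfolding ker_mod_def by auto
  hence "pdle A d ?Z"
   using pdle_extension[OF inf Z p ps pd(1)] P(4) pdle_Suc[of A k] Suc by simp
  moreover have "?E ` carrier P = carrier M" using P(3) q(2) by (metis image_image)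
  ultimately show ?thesis using pdle_SucI[OF M P(1) E] by simp
 qed
qed

lemma left_hom_mhom: "f : left_hom A M N ==> mhom A M N f"
 by (auto simp: left_hom_def mhom_def)
lemma projective_resolutionD:
 assumes "projective_resolution A M P dlt \<epsilon>"
 shows "proj A (P i)" "mhom A (P (Suc i)) (P i) (dlt i)" "mhom A (P 0) M \<epsilon>" "\<epsilon> ` carrier (P 0) = carrier M"
  "x |: (P 0) ==> \<epsilon> x = 0[M] <-> x : dlt 0 ` carrier (P 1)"
  "y |: (P (Suc i)) ==> dlt i y = 0[P i] <-> y : dlt (Suc i) ` carrier (P (Suc (Suc i)))"
proof -
 note r = assms[unfolded projective_resolution_def]
 show "proj A (P i)" "mhom A (P (Suc i)) (P i) (dlt i)" "mhom A (P 0) M \<epsilon>" "\<epsilon> ` carrier (P 0) = carrier M"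
  using r by (auto simp: projective_module_iff intro: left_hom_mhom)
 show "x |: (P 0) ==> \<epsilon> x = 0[M] <-> x : dlt 0 ` carrier (P 1)" using r by blast
 show "y |: (P (Suc i)) ==> dlt i y = 0[P i] <-> y : dlt (Suc i) ` carrier (P (Suc (Suc i)))"
  using r by blast
qed

text \<open>A resolution may be given by maps that are not restricted to their domains.\<close>

lemma projective_resolutionI:
 fixes M :: "('a, 'b) module"
 assumes "!!i. proj A (P i)" "!!i. mhom A (P (Suc i)) (P i) (dlt i)" "mhom A (P 0) M \<epsilon>" "\<epsilon> ` carrier (P 0) = carrier M"
  "!!x. x |: (P 0) ==> \<epsilon> x = 0[M] <-> x : dlt 0 ` carrier (P 1)"
  "!!i y. y |: (P (Suc i)) ==> dlt i y = 0[P i] <-> y : dlt (Suc i) ` carrier (P (Suc (Suc i)))"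
 shows "projective_resolution A M P (%i. restrict (dlt i) (carrier (P (Suc i)))) (restrict \<epsilon> (carrier (P 0)))"
 unfolding projective_resolution_def
proof (intro conjI allI)
 fix i
 show "projective_module A (P i)" using assms(1) by (simp add: projective_module_iff)
 show "restrict (dlt i) (carrier (P (Suc i))) : left_hom A (P (Suc i)) (P i)"
  by (rule restrict_left_hom[OF proj_module[OF assms(1)] assms(2)])
 show "{x : carrier (P (Suc i)). restrict (dlt i) (carrier (P (Suc i))) x = 0[P i]} =
    restrict (dlt (Suc i)) (carrier (P (Suc (Suc i)))) ` carrier (P (Suc (Suc i)))"
  using assms(6)[of _ i] mhomD(1)[OF assms(2), of _ "Suc i"] by auto
next
 show "restrict \<epsilon> (carrier (P 0)) : left_hom A (P 0) M"
  by (rule restrict_left_hom[OF proj_module[OF assms(1)] assms(3)])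
 show "restrict \<epsilon> (carrier (P 0)) ` carrier (P 0) = carrier M" using assms(4) by simp
 show "{x : carrier (P 0). restrict \<epsilon> (carrier (P 0)) x = 0[M]} =
   restrict (dlt 0) (carrier (P (Suc 0))) ` carrier (P 1)"
  using assms(5) mhomD(1)[OF assms(2), of _ 0] by auto
qed

lemma zero_mod_simps [simp]:
 "carrier (zero_mod z) = {z}" "zero (zero_mod z) = z" "add (zero_mod z) x y = z" "smult (zero_mod z) a x = z"
 by (simp_all add: zero_mod_def)

lemma pdle_resolution:
 assumes "pdle A d M"
 shows "EX P dlt \<epsilon>. projective_resolution A M P dlt \<epsilon> & (ALL i > d. carrier (P i) = {0[P i]})"
 using assms
proof (induction d arbitrary: M)
 case 0
 hence P: "proj A M" by simp
 note m = proj_module[OF P]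
 interpret left_module A M by fact
 let ?P = "%i :: nat. case i of 0 => M | Suc i => zero_mod 0[M]"
 have z: "proj A (zero_mod 0[M])"
  using trivial_carrier_proj[OF zero_mod_module[OF R.ring_axioms]] by simp
 have "projective_resolution A M ?P (%i. restrict (%x. 0[M]) (carrier (?P (Suc i)))) (restrict (%x. x) (carrier (?P 0)))"
  by (rule projective_resolutionI)
   (auto simp: P z mhom_def split: nat.split)
 moreover have "ALL i > 0. carrier (?P i) = {0[?P i]}" by (auto split: nat.split)
 ultimately show ?case by blast
next
 case (Suc d)
 then obtain Q e where Q: "lmod A M" "proj A Q" "mhom A Q M e" "e ` carrier Q = carrier M" "pdle A d (ker_mod Q M e)"
  using pdle_module[OF Suc.prems] by (auto elim: pdle_SucE)
 let ?K = "ker_mod Q M e"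
 obtain P dlt \<epsilon> where P: "projective_resolution A ?K P dlt \<epsilon>" "ALL i > d. carrier (P i) = {0[P i]}"
  using Suc.IH[OF Q(5)] by blast
 note r = projective_resolutionD[OF P(1)]
 let ?P = "%i. case i of 0 => Q | Suc i => P i" and ?d = "%i. case i of 0 => \<epsilon> | Suc i => dlt i"
 have "mhom A (P 0) Q \<epsilon>" using r(3) by (auto simp: mhom_def)
 hence hom: "mhom A (?P (Suc i)) (?P i) (?d i)" for i using r(2) by (cases i) auto
 have "projective_resolution A M ?P (%i. restrict (?d i) (carrier (?P (Suc i)))) (restrict e (carrier (?P 0)))"
 proof (rule projective_resolutionI)
  show "proj A (?P i)" for i using Q r by (auto split: nat.split)
  show "mhom A (?P (Suc i)) (?P i) (?d i)" for i by (rule hom)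
  show "mhom A (?P 0) M e" "e ` carrier (?P 0) = carrier M" using Q by auto
  show "e x = 0[M] <-> x : ?d 0 ` carrier (?P 1)" if "x |: (?P 0)" for x
   using that r(4) by simp
  show "?d i y = 0[?P i] <-> y : ?d (Suc i) ` carrier (?P (Suc (Suc i)))" if "y |: (?P (Suc i))" for i y
   using that r(5,6) by (cases i) auto
 qed
 moreover have "ALL i > Suc d. carrier (?P i) = {0[?P i]}" using P(2) by (auto split: nat.split)
 ultimately show ?case by blast
qed

lemma pdle_projective_dimension: "pdle A d M ==> projective_dimension A M <= enat d"
 unfolding projective_dimension_def using pdle_resolution[of A d M] by (intro Inf_lower) blast
lemma global_dimension_le:
 fixes A :: "('a, 'z) ring_scheme"
 assumes "!!M :: ('a, 'a) module. left_module A M ==> pdle A d M"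
 shows "global_dimension A <= enat d"
 unfolding global_dimension_def using assms by (intro Sup_least) (auto intro: pdle_projective_dimension)

section \<open>Comparison of resolutions\<close>

text \<open>Lift step by step through the exact sequence, each time by projectivity of the next module.\<close>

lemma comparison_map:
 fixes M :: "('a, 'a) module"
 assumes M: "lmod A M" and F: "projective_resolution A M F dF eF" and P: "projective_resolution A M P d e"
 obtains f where "!!i. mhom A (F i) (P i) (f i)" "!!x. x |: (F 0) ==> e (f 0 x) = eF x"
  "!!i x. x |: (F (Suc i)) ==> d i (f (Suc i) x) = f i (dF i x)"
proof -
 note rF = projective_resolutionD[OF F] and rP = projective_resolutionD[OF P]
 have mF: "lmod A (F i)" and mP: "lmod A (P i)" for i
  using proj_module[OF rF(1)] proj_module[OF rP(1)] by auto
 obtain f0 where f0: "mhom A (F 0) (P 0) f0" "!!x. x |: (F 0) ==> e (f0 x) = eF x"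
  using proj_lift[OF rF(1) mP M rP(3,4) rF(3)] by blast
 define Pr where "Pr n f <-> mhom A (F n) (P n) f & (ALL x:carrier (F (Suc n)). f (dF n x) : d n ` carrier (P (Suc n)))
  & (n = 0 --> f = f0)" for n f
 define Q where "Q n f f' <-> (ALL x:carrier (F (Suc n)). d n (f' x) = f (dF n x))" for n f f'
 have "Pr 0 f0"
 proof -
  have "f0 (dF 0 x) : d 0 ` carrier (P (Suc 0))" if x: "x |: (F (Suc 0))" for x
  proof -
   have 1: "dF 0 x |: (F 0)" using mhomD(1)[OF rF(2) x] .
   hence "eF (dF 0 x) = 0[M]" using rF(5) x by auto
   thus ?thesis using rP(5)[of "f0 (dF 0 x)"] f0(2)[OF 1] mhomD(1)[OF f0(1) 1] by simp
  qed
  thus ?thesis using f0(1) by (simp add: Pr_def)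
 qed
 moreover have "EX f'. Pr (Suc n) f' & Q n f f'" if "Pr n f" for n f
 proof -
  have f: "mhom A (F n) (P n) f" "!!x. x |: (F (Suc n)) ==> f (dF n x) : d n ` carrier (P (Suc n))"
   using that by (auto simp: Pr_def)
  obtain f' where f': "mhom A (F (Suc n)) (P (Suc n)) f'" "!!x. x |: (F (Suc n)) ==> d n (f' x) = f (dF n x)"
   using proj_lift_image[OF rF(1) mP mP rP(2) mhom_comp[OF rF(2) f(1)]] f(2) by blast
  have "f' (dF (Suc n) x) : d (Suc n) ` carrier (P (Suc (Suc n)))" if x: "x : carrier (F (Suc (Suc n)))" for x
  proof -
   have 1: "dF (Suc n) x |: (F (Suc n))" using mhomD(1)[OF rF(2) x] .
   hence "dF n (dF (Suc n) x) = 0[F n]" using rF(6) x by auto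
   thus ?thesis using rP(6)[of "f' (dF (Suc n) x)" n] f'(2)[OF 1] mhomD(1)[OF f'(1) 1] mhom_zero[OF mF mP f(1)] by simp
  qed
  thus ?thesis using f' by (auto simp: Pr_def Q_def)
 qed
 ultimately obtain f where f: "!!n. Pr n (f n)" "!!n. Q n (f n) (f (Suc n))"
  using dependent_nat_choice[of Pr Q] by blast
 show thesis
 proof (rule that[of f])
  show "mhom A (F i) (P i) (f i)" for i using f(1)[of i] by (simp add: Pr_def)
  show "e (f 0 x) = eF x" if "x |: (F 0)" for x using f(1)[of 0] f0(2)[OF that] by (simp add: Pr_def)
  show "d i (f (Suc i) x) = f i (dF i x)" if "x |: (F (Suc i))" for i x
   using f(2)[of i] that by (simp add: Q_def)
 qed
qed

text \<open>Two lifts of the same map agree up to homotopy; for the zero map only the homotopy remains.\<close>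

lemma null_homotopy:
 fixes M :: "('a, 'a) module"
 assumes M: "lmod A M" and F: "projective_resolution A M F dF eF"
  and u: "!!i. mhom A (F i) (F i) (u i)" "!!x. x |: (F 0) ==> eF (u 0 x) = 0[M]"
  "!!i x. x |: (F (Suc i)) ==> dF i (u (Suc i) x) = u i (dF i x)"
 obtains h where "!!i. mhom A (F i) (F (Suc i)) (h i)"
  "!!i x. x |: (F (Suc i)) ==> u (Suc i) x = dF (Suc i) (h (Suc i) x) +[F (Suc i)] h i (dF i x)"
proof -
 note rF = projective_resolutionD[OF F]
 have mF: "lmod A (F i)" for i using proj_module[OF rF(1)] .
 have ab: "abelian_group (F i)" for i using left_moduleD(1)[OF mF] .
 define Pr where "Pr n h <-> mhom A (F n) (F (Suc n)) h &
  (ALL x:carrier (F (Suc n)). u (Suc n) x -[F (Suc n)] h (dF n x) : dF (Suc n) ` carrier (F (Suc (Suc n))))" for n h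
 define Q where "Q n h h' <-> (ALL x:carrier (F (Suc n)). dF (Suc n) (h' x) = u (Suc n) x -[F (Suc n)] h (dF n x))" for n h h'
 have dd: "dF n (dF (Suc n) x) = 0[F n]" if x: "x : carrier (F (Suc (Suc n)))" for n x
  using rF(6)[of "dF (Suc n) x" n] mhomD(1)[OF rF(2) x] x by auto
 have "u 0 ` carrier (F 0) <=: dF 0 ` carrier (F (Suc 0))" using rF(5) u(2) mhomD(1)[OF u(1)[of 0]] by auto
 then obtain h0 where h0: "mhom A (F 0) (F (Suc 0)) h0" "!!x. x |: (F 0) ==> dF 0 (h0 x) = u 0 x"
  using proj_lift_image[OF rF(1) mF mF rF(2) u(1)] by blast
 have "Pr 0 h0" unfolding Pr_def
 proof (intro conjI ballI h0(1))
  fix x assume x: "x |: (F (Suc 0))"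
  note 1 = mhomD(1)[OF rF(2) x] mhomD(1)[OF u(1) x]
  note 2 = mhomD(1)[OF h0(1) 1(1)] mhomD(1)[OF u(1) 1(1)]
  have "dF 0 (u (Suc 0) x -[F (Suc 0)] h0 (dF 0 x)) = 0[F 0]"
   using mhom_diff[OF mF mF rF(2) 1(2) 2(1)] u(3)[OF x] h0(2)[OF 1(1)] 2(2) abelian_group.r_neg[OF ab]
   by (simp add: a_minus_def)
  thus "u (Suc 0) x -[F (Suc 0)] h0 (dF 0 x) : dF (Suc 0) ` carrier (F (Suc (Suc 0)))"
   using rF(6) 1(2) 2(1) abelian_group.minus_closed[OF ab] by blast
 qed
 moreover have "EX h'. Pr (Suc n) h' & Q n h h'" if "Pr n h" for n h
 proof -
  have h: "mhom A (F n) (F (Suc n)) h"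
   "!!x. x |: (F (Suc n)) ==> u (Suc n) x -[F (Suc n)] h (dF n x) : dF (Suc n) ` carrier (F (Suc (Suc n)))"
   using that by (auto simp: Pr_def)
  have uh: "mhom A (F (Suc n)) (F (Suc n)) (%x. u (Suc n) x -[F (Suc n)] h (dF n x))"
   by (rule mhom_minus[OF mF mF u(1) mhom_comp[OF rF(2) h(1)]])
  obtain h' where h': "mhom A (F (Suc n)) (F (Suc (Suc n))) h'"
   "!!x. x |: (F (Suc n)) ==> dF (Suc n) (h' x) = u (Suc n) x -[F (Suc n)] h (dF n x)"
   using proj_lift_image[OF rF(1) mF mF rF(2) uh] h(2) by blast
  have "u (Suc (Suc n)) x -[F (Suc (Suc n))] h' (dF (Suc n) x) : dF (Suc (Suc n)) ` carrier (F (Suc (Suc (Suc n))))"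
   if x: "x : carrier (F (Suc (Suc n)))" for x
  proof -
   note 1 = mhomD(1)[OF rF(2) x] mhomD(1)[OF u(1) x]
   note 2 = mhomD(1)[OF h'(1) 1(1)] mhomD(1)[OF u(1) 1(1)]
   interpret Fn: left_module A "F (Suc n)" by (rule mF)
   have "dF (Suc n) (h' (dF (Suc n) x)) = u (Suc n) (dF (Suc n) x)"
    using h'(2)[OF 1(1)] dd[OF x] mhom_zero[OF mF mF h(1)] 2(2)
    by (simp add: a_minus_def Fn.minus_zero_M)
   hence "dF (Suc n) (u (Suc (Suc n)) x -[F (Suc (Suc n))] h' (dF (Suc n) x)) = 0[F (Suc n)]"
    using mhom_diff[OF mF mF rF(2) 1(2) 2(1)] u(3)[OF x] 2(2) abelian_group.r_neg[OF ab]
    by (simp add: a_minus_def)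
   thus ?thesis using rF(6) 1(2) 2(1) abelian_group.minus_closed[OF ab] by blast
  qed
  thus ?thesis using h' by (auto simp: Pr_def Q_def)
 qed
 ultimately obtain h where h: "!!n. Pr n (h n)" "!!n. Q n (h n) (h (Suc n))"
  using dependent_nat_choice[of Pr Q] by blast
 show thesis
 proof (rule that[of h])
  show hom: "mhom A (F i) (F (Suc i)) (h i)" for i using h(1)[of i] by (simp add: Pr_def)
  fix i x assume x: "x |: (F (Suc i))"
  interpret Fi: left_module A "F (Suc i)" by (rule mF)
  show "u (Suc i) x = dF (Suc i) (h (Suc i) x) +[F (Suc i)] h i (dF i x)"
   using h(2)[of i] x mhomD(1)[OF u(1) x] mhomD(1)[OF hom mhomD(1)[OF rF(2) x]]
   by (simp add: Q_def a_minus_def Fi.M.a_assoc Fi.M.l_neg)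
 qed
qed

text \<open>If some resolution is shorter than \<open>F\<close>, then the last differential of \<open>F\<close> splits: the identity of
 \<open>F\<close> is homotopic to a map that factors through the shorter resolution.\<close>

lemma short_resolution_splits:
 fixes M :: "('a, 'a) module"
 assumes M: "lmod A M" and F: "projective_resolution A M F dF eF" and P: "projective_resolution A M P d e"
  and short: "carrier (P (Suc k)) = {0[P (Suc k)]}" and last: "carrier (F (Suc (Suc k))) = {0[F (Suc (Suc k))]}"
 obtains h where "mhom A (F k) (F (Suc k)) h" "!!x. x |: (F (Suc k)) ==> h (dF k x) = x"
proof -
 note rF = projective_resolutionD[OF F] and rP = projective_resolutionD[OF P]
 have mF: "lmod A (F i)" and mP: "lmod A (P i)" for i
  using proj_module[OF rF(1)] proj_module[OF rP(1)] by auto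
 have ab: "abelian_group (F i)" for i using left_moduleD(1)[OF mF] .
 obtain f where f: "!!i. mhom A (F i) (P i) (f i)" "!!x. x |: (F 0) ==> e (f 0 x) = eF x"
  "!!i x. x |: (F (Suc i)) ==> d i (f (Suc i) x) = f i (dF i x)"
  using comparison_map[OF M F P] by blast
 obtain g where g: "!!i. mhom A (P i) (F i) (g i)" "!!x. x |: (P 0) ==> eF (g 0 x) = e x"
  "!!i x. x |: (P (Suc i)) ==> dF i (g (Suc i) x) = g i (d i x)"
  using comparison_map[OF M P F] by blast
 define u where "u i x = x -[F i] g i (f i x)" for i x
 have gf: "mhom A (F i) (F i) (%x. g i (f i x))" for i by (rule mhom_comp[OF f(1) g(1)])
 have id: "mhom A (F i) (F i) (%x. x)" for i by (simp add: mhom_def)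
 have u1: "mhom A (F i) (F i) (u i)" for i unfolding u_def by (rule mhom_minus[OF mF mF id gf])
 have u2: "eF (u 0 x) = 0[M]" if x: "x |: (F 0)" for x
  unfolding u_def using mhom_diff[OF mF M rF(3) x mhomD(1)[OF gf x]] g(2) f(2) mhomD(1)[OF f(1) x] x
   mhomD(1)[OF rF(3) x] abelian_group.r_neg[OF left_moduleD(1)[OF M]] by (simp add: a_minus_def)
 have u3: "dF i (u (Suc i) x) = u i (dF i x)" if x: "x |: (F (Suc i))" for i x
  unfolding u_def using mhom_diff[OF mF mF rF(2) x mhomD(1)[OF gf x]] g(3)[OF mhomD(1)[OF f(1) x]] f(3)[OF x] by simp
 obtain h where h: "!!i. mhom A (F i) (F (Suc i)) (h i)"
  "!!i x. x |: (F (Suc i)) ==> u (Suc i) x = dF (Suc i) (h (Suc i) x) +[F (Suc i)] h i (dF i x)"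
  using null_homotopy[OF M F u1 u2 u3] by blast
 show thesis
 proof (rule that[OF h(1)])
  fix x assume x: "x |: (F (Suc k))"
  interpret Fk: left_module A "F (Suc k)" by (rule mF)
  note Fk.minus_zero_M [simp]
  have "f (Suc k) x = 0[P (Suc k)]" using mhomD(1)[OF f(1) x] short by simp
  hence "u (Suc k) x = x" using mhom_zero[OF mP mF g(1)] x by (simp add: u_def a_minus_def)
  moreover have "h (Suc k) x = 0[F (Suc (Suc k))]" using mhomD(1)[OF h(1) x] last by simp
  ultimately show "h k (dF k x) = x"
   using h(2)[OF x] mhom_zero[OF mF mF rF(2)] mhomD(1)[OF h(1) mhomD(1)[OF rF(2) x]] by simp
 qed
qed

section \<open>Modules over division rings\<close>

text \<open>Zorn: a maximal partial section on a submodule is total, since over a division ring it extends to one more vector by any choice of a preimage.\<close>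

lemma division_ring_proj:
 fixes P :: "('a, 'b) module"
 assumes P: "lmod K P" and inv: "!!a. a |: K ==> a ~= 0[K] ==> EX b:carrier K. b *[K] a = 1[K]"
 shows "proj K P"
proof (rule projI[OF P])
 fix M N :: "('a, 'a) module" and g f
 assume h: "lmod K M" "lmod K N" "mhom K M N g" "g ` carrier M = carrier N" "mhom K P N f"
 interpret P: left_module K P by fact
 interpret M: left_module K M by fact
 interpret N: left_module K N by fact
 define Gr where "Gr = {G. G <=: carrier P \<times> carrier M & (0[P], 0[M]) : G
  & (ALL x m y k. (x, m) : G --> (y, k) : G --> (x +[P] y, m +[M] k) : G)
  & (ALL a:carrier K. ALL x m. (x, m) : G --> (a **[P] x, a **[M] m) : G)
  & (ALL x m. (x, m) : G --> g m = f x) & (ALL m. (0[P], m) : G --> m = 0[M])}"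
 have "EX G:Gr. ALL X:Gr. G <=: X --> X = G"
 proof (rule subset_Zorn_nonempty)
  show "Gr ~= {}"
  proof -
   have "{(0[P], 0[M])} : Gr" using mhom_zero[OF h(1-3)] mhom_zero[OF P h(2,5)] by (simp add: Gr_def)
   thus ?thesis by blast
  qed
  fix C assume C: "C ~= {}" "subset.chain Gr C"
  hence sub: "G : Gr" if "G : C" for G using that by (auto simp: subset.chain_def)
  have two: "EX G:C. u : G & w : G" if "u : \<Union>C" "w : \<Union>C" for u w
  proof -
   from that obtain G H where GH: "G : C" "u : G" "H : C" "w : H" by auto
   hence "G <=: H \<or> H <=: G" using C(2) by (auto simp: subset.chain_def)
   thus ?thesis using GH by blast
  qed
  note S = sub[unfolded Gr_def mem_Collect_eq]
  show "\<Union>C \<in> Gr" unfolding Gr_def mem_Collect_eq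
  proof (intro conjI allI impI ballI)
   show "\<Union>C <=: carrier P \<times> carrier M" by (rule Union_least) (rule conjunct1[OF S])
   show "(0[P], 0[M]) : \<Union>C"
   proof -
    obtain G where G: "G : C" using C(1) by blast
    thus ?thesis by (rule UnionI) (rule conjunct1[OF conjunct2[OF S[OF G]]])
   qed
   show "(x +[P] y, m +[M] k) : \<Union>C" if "(x, m) : \<Union>C" "(y, k) : \<Union>C" for x m y k
    using two[OF that] S by blast
   show "(a **[P] x, a **[M] m) : \<Union>C" if "a |: K" "(x, m) : \<Union>C" for a x m
    using that S by blast
   show "g m = f x" if "(x, m) : \<Union>C" for x m using that S by blast
   show "m = 0[M]" if "(0[P], m) : \<Union>C" for m using that S by blast
  qed
 qed
 then obtain G where G: "G : Gr" and max: "ALL X:Gr. G <=: X --> X = G" by (rule bexE)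
 note GG = G[unfolded Gr_def mem_Collect_eq]
 have G0: "(0[P], 0[M]) : G"
  and Gc: "!!x m. (x, m) : G ==> x |: P" "!!x m. (x, m) : G ==> m |: M"
  and Ga: "!!x m y k. (x, m) : G ==> (y, k) : G ==> (x +[P] y, m +[M] k) : G"
  and Gs: "!!a x m. a |: K ==> (x, m) : G ==> (a **[P] x, a **[M] m) : G"
  and Gg: "!!x m. (x, m) : G ==> g m = f x" and Gz: "!!m. (0[P], m) : G ==> m = 0[M]"
  using GG by (simp_all only: simp_thms) (elim conjE; blast)+
 have total: "EX m. (x, m) : G" if x: "x |: P" for x
 proof (rule ccontr)
  assume no: "\<nexists>m. (x, m) : G"
  have "f x : g ` carrier M" using mhomD(1)[OF h(5) x] h(4) by simp
  then obtain m where m: "m |: M" "g m = f x" by auto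
  define X where "X = {(x1 +[P] c **[P] x, m1 +[M] c **[M] m) | x1 m1 c. (x1, m1) : G & c |: K}"
  have XI: "(x1 +[P] c **[P] x, m1 +[M] c **[M] m) : X" if "(x1, m1) : G" "c |: K" for x1 m1 c
   using that by (auto simp: X_def)
  have XE: "EX x1 m1 c. (x1, m1) : G & c |: K & y = x1 +[P] c **[P] x & k = m1 +[M] c **[M] m"
   if "(y, k) : X" for y k using that by (auto simp: X_def)
  have "X : Gr" unfolding Gr_def mem_Collect_eq
  proof (intro conjI allI impI ballI)
   show "X <=: carrier P \<times> carrier M" using Gc x m(1) by (auto simp: X_def P.smult_closed M.smult_closed)
   show "(0[P], 0[M]) : X" using XI[OF G0 P.R.zero_closed] x m(1) by simp
  next
   fix y k y' k' assume "(y, k) : X" "(y', k') : X"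
   then obtain x1 m1 c x2 m2 d where 1: "(x1, m1) : G" "c |: K" "y = x1 +[P] c **[P] x" "k = m1 +[M] c **[M] m"
    and 2: "(x2, m2) : G" "d |: K" "y' = x2 +[P] d **[P] x" "k' = m2 +[M] d **[M] m"
    using XE by meson
   have "y +[P] y' = (x1 +[P] x2) +[P] (c +[K] d) **[P] x" "k +[M] k' = (m1 +[M] m2) +[M] (c +[K] d) **[M] m"
    using 1 2 Gc x m(1) by (simp_all add: P.smult_l_distr M.smult_l_distr P.smult_closed M.smult_closed P.M.a_ac M.M.a_ac)
   thus "(y +[P] y', k +[M] k') : X" using XI[OF Ga[OF 1(1) 2(1)], of "c +[K] d"] 1 2 by simp
  next
   fix a y k assume a: "a |: K" and "(y, k) : X"
   then obtain x1 m1 c where 1: "(x1, m1) : G" "c |: K" "y = x1 +[P] c **[P] x" "k = m1 +[M] c **[M] m"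
    using XE by meson
   have "a **[P] y = a **[P] x1 +[P] (a *[K] c) **[P] x" "a **[M] k = a **[M] m1 +[M] (a *[K] c) **[M] m"
    using 1 Gc x m(1) a by (simp_all add: P.smult_r_distr M.smult_r_distr P.smult_closed M.smult_closed P.smult_assoc M.smult_assoc)
   thus "(a **[P] y, a **[M] k) : X" using XI[OF Gs[OF a 1(1)], of "a *[K] c"] 1 a by simp
  next
   fix y k assume "(y, k) : X"
   then obtain x1 m1 c where 1: "(x1, m1) : G" "c |: K" "y = x1 +[P] c **[P] x" "k = m1 +[M] c **[M] m"
    using XE by meson
   thus "g k = f y" using Gc x m Gg by (simp add: mhomD[OF h(3)] mhomD[OF h(5)] P.smult_closed M.smult_closed)
  next
   fix k assume "(0[P], k) : X"
   then obtain x1 m1 c where 1: "(x1, m1) : G" "c |: K" "0[P] = x1 +[P] c **[P] x" "k = m1 +[M] c **[M] m"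
    using XE by meson
   show "k = 0[M]"
   proof (cases "c = 0[K]")
    case True
    hence "x1 = 0[P]" using 1 Gc[OF 1(1)] x by simp
    thus ?thesis using 1 True Gz[of m1] m(1) by simp
   next
    case False
    then obtain b where b: "b |: K" "b *[K] c = 1[K]" using inv[OF 1(2)] by blast
    have "-[P] (c **[P] x) = x1" using 1 Gc[OF 1(1)] x P.M.minus_equality[of x1 "c **[P] x"] by (simp add: P.smult_closed)
    hence "c **[P] x = -[P] x1" using 1(2) x by (metis P.M.minus_minus P.smult_closed)
    also have "... = (-[K] 1[K]) **[P] x1"
    proof (rule P.M.minus_equality)
     show "(-[K] 1[K]) **[P] x1 +[P] x1 = 0[P]"
      using P.smult_l_distr[of "-[K] 1[K]" "1[K]" x1] Gc[OF 1(1)] by (simp add: P.R.l_neg P.smult_one)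
    qed (use Gc[OF 1(1)] in "simp_all add: P.smult_closed")
    finally have "b **[P] (c **[P] x) = b **[P] ((-[K] 1[K]) **[P] x1)" by simp
    hence "x = b **[P] ((-[K] 1[K]) **[P] x1)" using b 1(2) x by (simp add: P.smult_assoc[symmetric] P.smult_one)
    hence "(x, b **[M] ((-[K] 1[K]) **[M] m1)) : G" using Gs[OF b(1) Gs[OF _ 1(1), of "-[K] 1[K]"]] by simp
    thus ?thesis using no by blast
   qed
  qed
  moreover have "G <=: X"
  proof
   fix u assume "u : G"
   then obtain y k where u: "u = (y, k)" "(y, k) : G" by (cases u) auto
   thus "u : X" using XI[OF u(2) P.R.zero_closed] Gc[OF u(2)] x m(1) by simp
  qed
  ultimately have "X = G" using max by simp
  moreover have "(x, m) : X" using XI[OF G0 P.R.one_closed] x m(1) by (simp add: P.smult_one M.smult_one)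
  ultimately show False using no by blast
 qed
 have single: "m = k" if "(x, m) : G" "(x, k) : G" for x m k
 proof -
  have n: "(-[K] 1[K]) **[M] k = -[M] k" "(-[K] 1[K]) **[P] x = -[P] x"
   using M.smult_l_distr[of "-[K] 1[K]" "1[K]" k] P.smult_l_distr[of "-[K] 1[K]" "1[K]" x] Gc[OF that(2)]
   by (auto intro!: P.M.minus_equality[symmetric] M.M.minus_equality[symmetric] simp: P.R.l_neg P.smult_one M.smult_one P.smult_closed M.smult_closed)
  have "(x +[P] -[P] x, m +[M] -[M] k) : G" using Ga[OF that(1) Gs[OF _ that(2), of "-[K] 1[K]"]] n by simp
  hence "m +[M] -[M] k = 0[M]" using Gz Gc[OF that(1)] by (simp add: P.M.r_neg)
  thus ?thesis using Gc[OF that(1)] Gc[OF that(2)] M.M.minus_equality[of m "-[M] k"] by simp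
 qed
 define k where "k x = (THE m. (x, m) : G)" for x
 have k: "(x, k x) : G" if x: "x |: P" for x
  using theI'[of "%m. (x, m) : G"] total[OF x] single unfolding k_def by blast
 have "mhom K P M k"
 proof (rule mhomI)
  show "k x |: M" if "x |: P" for x using Gc(2)[OF k[OF that]] .
  show "k (x +[P] y) = k x +[M] k y" if "x |: P" "y |: P" for x y
   using single[OF k Ga[OF k[OF that(1)] k[OF that(2)]]] that by simp
  show "k (a **[P] x) = a **[M] k x" if "a |: K" "x |: P" for a x
   using single[OF k Gs[OF that(1) k[OF that(2)]]] that by (simp add: P.smult_closed)
 qed
 thus "EX h. mhom K P M h & (ALL x:carrier P. g (h x) = f x)" using Gg[OF k] by blast
qed

section \<open>Coding finite sequences\<close>

lemma list_injection:
 assumes "infinite (UNIV :: 'a set)"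
 obtains e :: "'a list => 'a" where "inj e"
proof -
 obtain pr :: "'a => 'a => 'a" where pr: "!!x y x' y'. pr x y = pr x' y' <-> x = x' & y = y'"
  using pair_injection[OF assms] by blast
 obtain c0 c1 :: 'a where c: "c0 ~= c1" using assms by (metis UNIV_I ex_new_if_finite finite.emptyI finite_insert insertI1)
 define e where "e = rec_list (pr c0 c0) (%x _ r. pr c1 (pr x r))"
 have e: "e [] = pr c0 c0" "e (x # xs) = pr c1 (pr x (e xs))" for x xs by (simp_all add: e_def)
 have "xs = ys" if "e xs = e ys" for xs ys
  using that
 proof (induction xs arbitrary: ys)
  case Nil
  thus ?case using c by (cases ys) (auto simp: e pr)
 next
  case (Cons x xs)
  thus ?case using c by (cases ys) (auto simp: e pr)
 qed
 hence "inj e" by (auto intro: injI)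
 thus thesis by (rule that)
qed

text \<open>Finite sequences over an infinite type are no more numerous than the type, so free modules of infinite rank can be coded on it.\<close>

lemma sequence_injection:
 assumes "infinite (UNIV :: 'a set)"
 obtains e :: "(nat => 'a) => 'a" where "inj_on e {F. EX m. ALL j >= m. F j = z}"
proof -
 obtain l :: "'a list => 'a" where l: "inj l" using list_injection[OF assms] by blast
 define b where "b F = (LEAST m. ALL j >= m. F j = z)" for F :: "nat => 'a"
 have b: "F j = z" if "EX m. ALL j >= m. F j = z" "j >= b F" for F j
 proof -
  from that(1) obtain m where "ALL j >= m. F j = z" by blast
  hence "ALL j >= b F. F j = z" unfolding b_def by (rule LeastI)
  thus ?thesis using that(2) by blast
 qed
 have "inj_on (%F. l (map F [0..<b F])) {F. EX m. ALL j >= m. F j = z}"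
 proof (rule inj_onI)
  fix F G assume F: "F : {F. EX m. ALL j >= m. F j = z}" and G: "G : {F. EX m. ALL j >= m. F j = z}"
   and "l (map F [0..<b F]) = l (map G [0..<b G])"
  hence eq: "map F [0..<b F] = map G [0..<b G]" using l by (auto dest: injD)
  have "length (map F [0..<b F]) = length (map G [0..<b G])" using eq by (rule arg_cong)
  hence bb: "b F = b G" by (simp only: length_map length_upt minus_nat.diff_0)
  show "F = G"
  proof
   fix j show "F j = G j"
    using eq bb b[of F j] b[of G j] F G by (cases "j < b F") (auto simp: map_eq_conv)
  qed
 qed
 thus thesis by (rule that)
qed

section \<open>Finitely supported sequences\<close>

primrec psum :: "('b, 'm) ring_scheme => (nat => 'b) => nat => 'b" where
 "psum G f 0 = 0[G]"
| "psum G f (Suc m) = psum G f m +[G] f m"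

definition seqs :: "('b, 'm) ring_scheme => (nat => 'b) set" where
 "seqs G = {F. (ALL j. F j |: G) & (EX m. ALL j >= m. F j = 0[G])}"

definition bound :: "('b, 'm) ring_scheme => (nat => 'b) => nat" where
 "bound G F = (LEAST m. ALL j >= m. F j = 0[G])"

definition sg :: "('b, 'm) ring_scheme => nat => 'b => nat => 'b" where
 "sg G j x = (%i. if i = j then x else 0[G])"

definition addmap :: "('b, 'm) ring_scheme => ('c, 'k) ring_scheme => ('b => 'c) => bool" where
 "addmap G H f <-> (ALL x:carrier G. f x |: H) &
  (ALL x:carrier G. ALL y:carrier G. f (x +[G] y) = f x +[H] f y)"

text \<open>The additive map on finitely supported sequences with given values on the summands.\<close>

definition lin :: "('b, 'm) ring_scheme => ('c, 'k) ring_scheme => (nat => 'b => 'c) => (nat => 'b) => 'c" where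
 "lin G H Phi F = psum H (%j. Phi j (F j)) (bound G F)"

lemma psum_closed: "abelian_group G ==> (!!j. f j |: G) ==> psum G f m |: G"
 by (induction m) (auto intro: abelian_groupE)
lemma psum_extend:
 assumes G: "abelian_group G" "!!j. f j |: G" "!!j. j >= m ==> f j = 0[G]" "m <= k"
 shows "psum G f k = psum G f m"
proof -
 interpret abelian_group G by fact
 show ?thesis using assms(4)
  by (induction k rule: dec_induct) (auto simp: assms psum_closed)
qed

lemma psum_add:
 assumes G: "abelian_group G" "!!j. f j |: G" "!!j. g j |: G"
 shows "psum G (%j. f j +[G] g j) m = psum G f m +[G] psum G g m"
proof -
 interpret abelian_group G by fact
 show ?thesis by (induction m) (simp_all add: assms psum_closed a_ac)
qed

lemma bound:
 assumes "F : seqs G" "j >= bound G F"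
 shows "F j = 0[G]"
proof -
 obtain m where "ALL j >= m. F j = 0[G]" using assms(1) unfolding seqs_def by blast
 hence "ALL j >= bound G F. F j = 0[G]" unfolding bound_def by (rule LeastI)
 thus ?thesis using assms(2) by blast
qed

lemma bound_le: "(!!j. j >= m ==> F j = 0[G]) ==> bound G F <= m"
 unfolding bound_def by (rule Least_le) auto
lemma addmap_zero:
 assumes "abelian_group G" "abelian_group H" "addmap G H f"
 shows "f 0[G] = 0[H]"
proof -
 interpret G: abelian_group G by fact
 interpret H: abelian_group H by fact
 have "f 0[G] |: H" "f (0[G] +[G] 0[G]) = f 0[G] +[H] f 0[G]"
  using assms(3) G.zero_closed unfolding addmap_def by blast+
 thus ?thesis using H.add.l_cancel_one'[of "f 0[G]" "f 0[G]"] by simp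
qed

lemma lin_bound:
 assumes "abelian_group G" "abelian_group H" "!!j. addmap G H (Phi j)" "F : seqs G" "!!j. j >= m ==> F j = 0[G]"
 shows "lin G H Phi F = psum H (%j. Phi j (F j)) m"
 unfolding lin_def
 by (rule psum_extend[symmetric])
  (use assms addmap_zero[OF assms(1-3)] bound[OF assms(4)] bound_le[of m F G] in "auto simp: addmap_def seqs_def")

lemma lin_closed:
 assumes "abelian_group H" "!!j. addmap G H (Phi j)" "F : seqs G"
 shows "lin G H Phi F |: H"
 unfolding lin_def by (rule psum_closed) (use assms in "auto simp: addmap_def seqs_def")

lemma seqs_add:
 assumes "abelian_group G" "F : seqs G" "F' : seqs G"
 shows "(%j. F j +[G] F' j) : seqs G"
proof -
 interpret abelian_group G by fact
 have "F j +[G] F' j = 0[G]" if "j >= max (bound G F) (bound G F')" for j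
  using that bound[OF assms(2), of j] bound[OF assms(3), of j] by simp
 thus ?thesis using assms(2,3) unfolding seqs_def by blast
qed

lemma seqs_neg:
 assumes "abelian_group G" "F : seqs G"
 shows "(%j. -[G] F j) : seqs G"
proof -
 interpret abelian_group G by fact
 have "-[G] F j = 0[G]" if "j >= bound G F" for j
  using that bound[OF assms(2), of j] minus_equality[of "0[G]" "0[G]"] by simp
 thus ?thesis using assms(2) unfolding seqs_def by blast
qed

lemma sg_seqs:
 assumes "abelian_group G" "x |: G"
 shows "sg G j x : seqs G"
proof -
 have "ALL i >= Suc j. sg G j x i = 0[G]" by (simp add: sg_def)
 moreover have "sg G j x i |: G" for i using assms by (simp add: sg_def abelian_groupE)
 ultimately show ?thesis unfolding seqs_def by blast
qed

lemma lin_add: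
 assumes "abelian_group G" "abelian_group H" "!!j. addmap G H (Phi j)" "F : seqs G" "F' : seqs G"
 shows "lin G H Phi (%j. F j +[G] F' j) = lin G H Phi F +[H] lin G H Phi F'"
proof -
 interpret G: abelian_group G by fact
 let ?m = "max (bound G F) (bound G F')"
 have z: "F j = 0[G]" "F' j = 0[G]" if "j >= ?m" for j
  using that bound[OF assms(4), of j] bound[OF assms(5), of j] by auto
 have c: "F j |: G" "F' j |: G" for j using assms(4,5) by (auto simp: seqs_def)
 have "lin G H Phi (%j. F j +[G] F' j) = psum H (%j. Phi j (F j +[G] F' j)) ?m"
  by (rule lin_bound[OF assms(1-3) seqs_add[OF assms(1,4,5)]]) (simp add: z)
 also have "(%j. Phi j (F j +[G] F' j)) = (%j. Phi j (F j) +[H] Phi j (F' j))"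
  using assms(3) c by (auto simp: addmap_def)
 also have "psum H ... ?m = psum H (%j. Phi j (F j)) ?m +[H] psum H (%j. Phi j (F' j)) ?m"
  by (rule psum_add[OF assms(2)]) (use assms(3) c in "auto simp: addmap_def")
 also have "... = lin G H Phi F +[H] lin G H Phi F'"
  using lin_bound[OF assms(1-3) assms(4), of ?m] lin_bound[OF assms(1-3) assms(5), of ?m] z by simp
 finally show ?thesis .
qed

lemma psum_zero: "abelian_group G ==> (!!j. j < m ==> f j = 0[G]) ==> psum G f m = 0[G]"
proof (induction m)
 case (Suc m)
 interpret abelian_group G by fact
 show ?case using Suc by simp
qed simp

lemma lin_sg:
 assumes "abelian_group G" "abelian_group H" "!!j. addmap G H (Phi j)" "x |: G"
 shows "lin G H Phi (sg G k x) = Phi k x"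
proof -
 interpret H: abelian_group H by fact
 have "lin G H Phi (sg G k x) = psum H (%j. Phi j (sg G k x j)) (Suc k)"
  by (rule lin_bound[OF assms(1-3) sg_seqs[OF assms(1,4)]]) (auto simp: sg_def)
 also have "... = psum H (%j. Phi j (sg G k x j)) k +[H] Phi k x" by (simp add: sg_def)
 also have "psum H (%j. Phi j (sg G k x j)) k = 0[H]"
  by (rule psum_zero[OF assms(2)]) (auto simp: sg_def addmap_zero[OF assms(1-3)])
 also have "0[H] +[H] Phi k x = Phi k x" using assms(3,4) by (auto simp: addmap_def)
 finally show ?thesis .
qed

lemma seqs_induct [consumes 2, case_names sg add]:
 assumes G: "abelian_group G" and F: "F : seqs G"
  and sg: "!!j x. x |: G ==> P (sg G j x)"
  and add: "!!F F'. F : seqs G ==> F' : seqs G ==> P F ==> P F' ==> P (%j. F j +[G] F' j)"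
 shows "P F"
proof -
 interpret abelian_group G by fact
 have "P F" if "F : seqs G" "!!j. j >= m ==> F j = 0[G]" for m F
  using that
 proof (induction m arbitrary: F)
  case 0
  have "F = sg G 0 0[G]" using 0(2) by (auto simp: sg_def)
  thus ?case using sg by simp
 next
  case (Suc m)
  let ?F = "%j. if j = m then 0[G] else F j"
  have c: "F j |: G" for j using Suc.prems(1) by (simp add: seqs_def)
  have 1: "?F j = 0[G]" if "j >= m" for j using that Suc.prems(2)[of j] by auto
  have "?F j |: G" for j using c by simp
  hence 2: "?F : seqs G" using 1 unfolding seqs_def by blast
  have "P (%j. ?F j +[G] sg G m (F m) j)"
   by (rule add[OF 2 sg_seqs[OF G c] Suc.IH[OF 2 1] sg[OF c]])
  moreover have "(%j. ?F j +[G] sg G m (F m) j) = F" using c by (auto simp: sg_def)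
  ultimately show ?case by simp
 qed
 thus ?thesis using F bound[OF F] by blast
qed

section \<open>Ore extensions: induced modules\<close>

text \<open>The ring \<open>B\<close> is free as a right module over its subring \<open>A\<close> with basis \<open>1, t, t\<^sup>2, ...\<close>;
 \<open>kap j\<close> is the \<open>j\<close>-th coordinate function. The last assumption is the commutation rule
 \<open>a t = t sig(a) + dlt(a)\<close> of an Ore extension.\<close>

locale ore_extension = ring B for B :: "('a, 'z) ring_scheme" (structure) +
 fixes A :: "'a set" and t :: 'a and kap :: "nat => 'a => 'a"
 assumes A_ring: "ring ((B on: A))" and A_sub: "A <=: carrier B" and t: "t |: B"
  and kap_A: "b |: B ==> kap j b : A"
  and kap_add: "b |: B ==> c |: B ==> kap j (b \<oplus> c) = kap j b \<oplus> kap j c"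
  and kap_mult: "b |: B ==> a : A ==> kap j (b \<otimes> a) = kap j b \<otimes> a"
  and kap_t: "b |: B ==> kap 0 (t \<otimes> b) = \<zero>" "b |: B ==> kap (Suc j) (t \<otimes> b) = kap j b"
  and kap_const: "a : A ==> kap 0 a = a" "a : A ==> kap (Suc j) a = \<zero>"
  and kap_fin: "b |: B ==> EX m. ALL j >= m. kap j b = \<zero>"
  and kap_inj: "b |: B ==> (!!j. kap j b = \<zero>) ==> b = \<zero>"
  and commute: "a : A ==> a \<otimes> t = t \<otimes> kap (Suc 0) (a \<otimes> t) \<oplus> kap 0 (a \<otimes> t)"
begin

abbreviation BA where "BA \<equiv> (B on: A)"

lemma A_in [simp]: "a : A ==> a |: B" using A_sub by auto
lemma t_pow [simp]: "t [^] (k :: nat) |: B" using t by simp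
lemma A_closed [simp]: "\<one> : A" "\<zero> : A" "a : A ==> b : A ==> a \<oplus> b : A" "a : A ==> b : A ==> a \<otimes> b : A"
proof -
 interpret BA: ring BA by (rule A_ring)
 show "\<one> : A" "\<zero> : A" "a : A ==> b : A ==> a \<oplus> b : A" "a : A ==> b : A ==> a \<otimes> b : A"
  using BA.one_closed BA.zero_closed BA.a_closed BA.m_closed by simp_all
qed

lemma A_neg [simp]: assumes "a : A" shows "\<ominus> a : A"
proof -
 interpret BA: ring BA by (rule A_ring)
 obtain b where b: "b : A" "b \<oplus> a = \<zero>"
  using BA.a_inv_closed[of a] BA.l_neg[of a] assms by auto
 thus ?thesis using minus_equality[of b a] assms by simp
qed

lemma kap_pow: "a : A ==> kap i (t [^] k \<otimes> a) = (if i = k then a else \<zero>)"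
proof (induction k arbitrary: i)
 case 0
 thus ?case using kap_const by (cases i) simp_all
next
 case (Suc k)
 have "t [^] Suc k \<otimes> a = t \<otimes> (t [^] k \<otimes> a)" using t Suc.prems by (simp only: nat_pow_Suc2 m_assoc[OF t t_pow] A_in)
 thus ?case using Suc kap_t by (cases i) simp_all
qed

lemma B_induct [consumes 1, case_names mono add]:
 assumes b: "b |: B" and mono: "!!k a. a : A ==> P (t [^] (k :: nat) \<otimes> a)"
  and add: "!!b c. b |: B ==> c |: B ==> P b ==> P c ==> P (b \<oplus> c)"
 shows "P b"
proof -
 have "P b" if "b |: B" "!!j. j >= m ==> kap j b = \<zero>" for m b
  using that
 proof (induction m arbitrary: b)
  case 0
  hence "b = \<zero>" using kap_inj by simp
  thus ?case using mono[of \<zero> 0] by simp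
 next
  case (Suc m)
  let ?a = "kap m b"
  have a: "?a : A" using kap_A Suc.prems(1) by simp
  let ?b = "b \<oplus> t [^] m \<otimes> (\<ominus> ?a)"
  have b: "?b |: B" using a Suc.prems(1) by simp
  have "kap j ?b = \<zero>" if "j >= m" for j
  proof -
   have "kap j ?b = kap j b \<oplus> (if j = m then \<ominus> ?a else \<zero>)"
    using a Suc.prems(1) kap_pow[of "\<ominus> ?a" j m] by (simp add: kap_add)
   thus ?thesis using Suc.prems(2)[of j] that a by (auto simp: r_neg)
  qed
  hence "P ?b" using Suc.IH[OF b] by blast
  hence "P (?b \<oplus> t [^] m \<otimes> ?a)" using add[OF b _ _ mono[OF a]] a by simp
  moreover have "?b \<oplus> t [^] m \<otimes> ?a = b"
   using a Suc.prems(1) by (simp add: a_assoc r_distr[symmetric] l_neg)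
  ultimately show ?case by simp
 qed
 thus ?thesis using b kap_fin[OF b] by blast
qed

definition act :: "('a, 'b) module => 'a => (nat => 'b) => nat => 'b" where
 "act N b F = (%i. lin N N (%j n. kap i (b \<otimes> t [^] j) **[N] n) F)"

text \<open>The induced module \<open>B \<otimes>\<^sub>A N\<close>; the sequence \<open>F\<close> stands for the sum of all \<open>t\<^sup>j \<otimes> F j\<close>.\<close>

definition Ind :: "('a, 'b) module => ('a, nat => 'b) module" where
 "Ind N = \<lparr>carrier = seqs N, mult = (%F G. F), one = (%j. 0[N]), zero = (%j. 0[N]),
  add = (%F G j. F j +[N] G j), smult = act N\<rparr>"

definition tens :: "('a, 'b) module => 'a => 'b => nat => 'b" where
 "tens N c n = (%j. kap j c **[N] n)"

lemma Ind_simps [simp]: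
 "carrier (Ind N) = seqs N" "zero (Ind N) = (%j. 0[N])" "add (Ind N) F G = (%j. F j +[N] G j)"
 "smult (Ind N) = act N"
 by (simp_all add: Ind_def)

context
 fixes N :: "('a, 'b) module"
 assumes N: "lmod BA N"
begin

interpretation N: left_module BA N by (rule N)

lemma N_ab: "abelian_group N" by (rule N.M_abelian)
lemma N_smult_closed [simp]: "a : A ==> x |: N ==> a **[N] x |: N"
 using N.smult_closed[of a x] by simp
lemma act_addmap: "b |: B ==> addmap N N (%n. kap i (b \<otimes> t [^] j) **[N] n)" for j :: nat
 using kap_A[of "b \<otimes> t [^] j" i] N.smult_r_distr[of "kap i (b \<otimes> t [^] j)"] by (auto simp: addmap_def)
lemma tens_seqs: assumes "c |: B" "n |: N" shows "tens N c n : seqs N"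
proof -
 obtain m where "ALL j >= m. kap j c = \<zero>" using kap_fin[OF assms(1)] by blast
 hence "ALL j >= m. tens N c n j = 0[N]" using N.zero_smult[of n] assms(2) by (simp add: tens_def)
 moreover have "tens N c n j |: N" for j using assms kap_A[OF assms(1)] by (simp add: tens_def)
 ultimately show ?thesis unfolding seqs_def by blast
qed

lemma tens_add: "c |: B ==> d |: B ==> n |: N ==>
 tens N (c \<oplus> d) n = (%j. tens N c n j +[N] tens N d n j)"
 using kap_A N.smult_l_distr by (auto simp: tens_def kap_add)

lemma tens_mono: "a : A ==> n |: N ==> tens N (t [^] k \<otimes> a) n = sg N k (a **[N] n)" for k :: nat
 using N.zero_smult[of n] by (auto simp: tens_def sg_def kap_pow)
lemma tens_pow: "n |: N ==> tens N (t [^] k) n = sg N k n" for k :: nat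
 using tens_mono[of \<one> n k] N.smult_one[of n] by simp
lemma act_sg: "b |: B ==> n |: N ==> act N b (sg N j n) = tens N (b \<otimes> t [^] j) n"
 unfolding act_def tens_def using lin_sg[OF N_ab N_ab act_addmap] by auto
lemma act_add_right:
 "b |: B ==> F : seqs N ==> G : seqs N ==> act N b (%j. F j +[N] G j) = (%i. act N b F i +[N] act N b G i)"
 unfolding act_def using lin_add[OF N_ab N_ab act_addmap] by auto

lemma act_seqs: assumes b: "b |: B" and F: "F : seqs N" shows "act N b F : seqs N"
 using N_ab F
proof (induction rule: seqs_induct)
 case (sg j x)
 thus ?case using act_sg b tens_seqs by simp
next
 case (add F F')
 thus ?case using act_add_right b seqs_add[OF N_ab] by simp
qed

lemma act_tens:
 assumes b: "b |: B" and c: "c |: B" and n: "n |: N"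
 shows "act N b (tens N c n) = tens N (b \<otimes> c) n"
 using c
proof (induction rule: B_induct)
 case (mono k a)
 have "kap j (b \<otimes> t [^] k) **[N] (a **[N] n) = kap j (b \<otimes> (t [^] k \<otimes> a)) **[N] n" for j
  using N.smult_assoc[of "kap j (b \<otimes> t [^] k)" a n] kap_A kap_mult[of "b \<otimes> t [^] k" a j] mono b n
  by (simp add: m_assoc)
 thus ?case using mono n b by (simp add: tens_mono act_sg) (simp add: tens_def)
next
 case (add c d)
 thus ?case using b n by (simp add: tens_add r_distr act_add_right tens_seqs)
qed

lemma act_mult: assumes "b |: B" "c |: B" "F : seqs N" shows "act N (b \<otimes> c) F = act N b (act N c F)"
 using N_ab assms(3)
proof (induction rule: seqs_induct)
 case (sg j x)
 thus ?case using assms by (simp add: act_sg act_tens m_assoc)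
next
 case (add F F')
 thus ?case using assms by (simp add: act_add_right act_seqs)
qed

lemma act_add_left: assumes "b |: B" "c |: B" "F : seqs N"
 shows "act N (b \<oplus> c) F = (%i. act N b F i +[N] act N c F i)"
 using N_ab assms(3)
proof (induction rule: seqs_induct)
 case (sg j x)
 thus ?case using assms by (simp add: act_sg l_distr tens_add)
next
 case (add F F')
 have "act N b F i |: N" "act N c F i |: N" "act N b F' i |: N" "act N c F' i |: N" for i
  using add act_seqs assms by (auto simp: seqs_def)
 thus ?case using add assms by (simp add: act_add_right N.M.a_ac)
qed

lemma act_one: assumes "F : seqs N" shows "act N \<one> F = F"
 using N_ab assms
proof (induction rule: seqs_induct)
 case (sg j x)
 thus ?case by (simp add: act_sg tens_pow)
next
 case (add F F')
 thus ?case by (simp add: act_add_right)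
qed

lemma Ind_module: "lmod B (Ind N)"
proof -
 have c: "F j |: N" if "F : seqs N" for F j using that by (simp add: seqs_def)
 have "abelian_group (Ind N)"
 proof (rule abelian_groupI)
  fix F assume F: "F |: (Ind N)"
  show "EX G:carrier (Ind N). G +[Ind N] F = 0[Ind N]"
   using F seqs_neg[OF N_ab, of F] c by (intro bexI[of _ "%j. -[N] F j"]) (auto simp: N.M.l_neg)
 qed (auto simp: seqs_add[OF N_ab] c N.M.a_ac, auto simp: seqs_def)
 thus ?thesis
  by (auto simp: left_module_def left_module_axioms_def ring_axioms act_seqs act_add_left act_add_right act_mult act_one)
qed

text \<open>The universal property: \<open>A\<close>-linear maps into \<open>B\<close>-modules extend to the induced module.\<close>

definition ext :: "('a, 'c) module => ('b => 'c) => (nat => 'b) => 'c" where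
 "ext M phi F = lin N M (%j n. t [^] j **[M] phi n) F"

lemma ext_hom:
 assumes M: "lmod B M" and phi: "mhom BA N M phi"
 shows "mhom B (Ind N) M (ext M phi)" "n |: N ==> ext M phi (sg N j n) = t [^] j **[M] phi n"
proof -
 interpret M: left_module B M by fact
 note phi' = mhomD[OF phi, simplified]
 have am: "addmap N M (%n. t [^] j **[M] phi n)" for j :: nat
  using phi' by (auto simp: addmap_def M.smult_closed M.smult_r_distr)
 show sg: "ext M phi (sg N j n) = t [^] j **[M] phi n" if "n |: N" for n j
  unfolding ext_def using lin_sg[OF N_ab M.M_abelian am that] .
 have add: "ext M phi (%j. F j +[N] G j) = ext M phi F +[M] ext M phi G" if "F : seqs N" "G : seqs N" for F G
  unfolding ext_def using lin_add[OF N_ab M.M_abelian am that] .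
 have cl: "ext M phi F |: M" if "F : seqs N" for F
  unfolding ext_def using lin_closed[OF M.M_abelian am that] .
 have tens: "ext M phi (tens N c n) = c **[M] phi n" if "c |: B" "n |: N" for c n
  using that(1)
 proof (induction rule: B_induct)
  case (mono k a)
  thus ?case using that(2) phi' by (simp add: tens_mono sg M.smult_assoc)
 next
  case (add c d)
  thus ?case using that(2) phi' by (simp add: tens_add \<open>!!F G. F : seqs N ==> G : seqs N ==> _ = _\<close> tens_seqs M.smult_l_distr)
 qed
 have smult: "ext M phi (act N b F) = b **[M] ext M phi F" if b: "b |: B" and F: "F : seqs N" for b F
  using N_ab F
 proof (induction rule: seqs_induct)
  case (sg j x)
  thus ?case using b phi' \<open>!!n j. n |: N ==> ext M phi (sg N j n) = _\<close> by (simp add: act_sg tens M.smult_assoc)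
 next
  case (add F F')
  thus ?case using b \<open>!!F G. F : seqs N ==> G : seqs N ==> _ = _\<close> by (simp add: act_add_right act_seqs cl M.smult_r_distr)
 qed
 show "mhom B (Ind N) M (ext M phi)" by (rule mhomI) (simp_all add: cl add smult)
qed

end

lemma Ind_hom_eq:
 assumes N: "lmod BA N" and M: "lmod B M" and f: "mhom B (Ind N) M f" and g: "mhom B (Ind N) M g"
  and eq: "!!n. n |: N ==> f (sg N 0 n) = g (sg N 0 n)" and F: "F : seqs N"
 shows "f F = g F"
proof -
 note ab = N_ab[OF N]
 show ?thesis using ab F
 proof (induction rule: seqs_induct)
  case (sg j x)
  have "sg N j x = act N (t [^] j) (sg N 0 x)" using sg by (simp add: act_sg[OF N] tens_pow[OF N])
  thus ?case using mhomD(3)[OF f, of "t [^] j" "sg N 0 x"] mhomD(3)[OF g, of "t [^] j" "sg N 0 x"] sg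
    eq[of x] sg_seqs[OF ab] by simp
 next
  case (add F F')
  thus ?case using mhomD(2)[OF f, of F F'] mhomD(2)[OF g, of F F'] by simp
 qed
qed

lemma restrict_module:
 assumes "lmod B M"
 shows "lmod BA M"
proof -
 interpret M: left_module B M by fact
 show ?thesis unfolding left_module_def left_module_axioms_def
  using A_ring by (simp add: M.M_abelian M.smult_closed M.smult_l_distr M.smult_r_distr M.smult_assoc M.smult_one)
qed

lemma restrict_hom: "mhom B M N f ==> mhom BA M N f"
 by (simp add: mhom_def)
lemma Ind_proj:
 fixes P :: "('a, 'b) module"
 assumes P: "proj BA P"
 shows "proj B (Ind P)"
proof -
 note Pm = proj_module[OF P]
 note ab = N_ab[OF Pm]
 interpret P: left_module BA P by (rule Pm)
 show ?thesis
 proof (rule projI[OF Ind_module[OF Pm]])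
  fix M N :: "('a, 'a) module" and g f
  assume h: "lmod B M" "lmod B N" "mhom B M N g" "g ` carrier M = carrier N" "mhom B (Ind P) N f"
  have "mhom BA P N (%n. f (sg P 0 n))"
  proof (rule mhomI)
   show "f (sg P 0 x) |: N" if "x |: P" for x
    using mhomD(1)[OF h(5)] sg_seqs[OF ab that] by simp
   show "f (sg P 0 (x +[P] y)) = f (sg P 0 x) +[N] f (sg P 0 y)" if "x |: P" "y |: P" for x y
   proof -
    have "sg P 0 (x +[P] y) = (%j. sg P 0 x j +[P] sg P 0 y j)" by (auto simp: sg_def)
    thus ?thesis using mhomD(2)[OF h(5), of "sg P 0 x" "sg P 0 y"] sg_seqs[OF ab] that by simp
   qed
   show "f (sg P 0 (a **[P] x)) = a **[N] f (sg P 0 x)" if "a |: BA" "x |: P" for a x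
   proof -
    have "sg P 0 (a **[P] x) = act P a (sg P 0 x)"
     using that tens_mono[OF Pm, of a x 0] by (simp add: act_sg[OF Pm])
    thus ?thesis using mhomD(3)[OF h(5), of a "sg P 0 x"] sg_seqs[OF ab] that by simp
   qed
  qed
  then obtain k where k: "mhom BA P M k" "!!x. x |: P ==> g (k x) = f (sg P 0 x)"
   using proj_lift[OF P restrict_module[OF h(1)] restrict_module[OF h(2)] restrict_hom[OF h(3)] h(4)] by blast
  note e = ext_hom[OF Pm h(1) k(1)]
  interpret M: left_module B M by fact
  have "g (ext P M k F) = f F" if "F : seqs P" for F
  proof (rule Ind_hom_eq[OF Pm h(2) mhom_comp[OF e(1) h(3)] h(5) _ that])
   fix n assume n: "n |: P"
   show "g (ext P M k (sg P 0 n)) = f (sg P 0 n)"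
    using e(2)[OF n, of 0] k(2)[OF n] mhomD(1)[OF k(1) n] by (simp add: M.smult_one)
  qed
  thus "EX h. mhom B (Ind P) M h & (ALL x:carrier (Ind P). g (h x) = f x)"
   using e(1) by (intro exI[of _ "ext P M k"]) simp
 qed
qed

lemma Ind_map:
 assumes P: "lmod BA P" and N: "lmod BA N" and e: "mhom BA P N e"
 shows "mhom B (Ind P) (Ind N) (%F j. e (F j))"
proof -
 note abP = N_ab[OF P] and abN = N_ab[OF N]
 note e' = mhomD[OF e, simplified]
 have e0: "e 0[P] = 0[N]" by (rule mhom_zero[OF P N e])
 have c: "F j |: P" if "F : seqs P" for F j using that by (simp add: seqs_def)
 have s: "(%j. e (F j)) : seqs N" if "F : seqs P" for F
 proof -
  have "ALL j >= bound P F. e (F j) = 0[N]" using bound[OF that] e0 by simp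
  moreover have "e (F j) |: N" for j using e'(1) c[OF that] by simp
  ultimately show ?thesis unfolding seqs_def by blast
 qed
 have t: "(%j. e (tens P b n j)) = tens N b (e n)" if "b |: B" "n |: P" for b n
  using that e'(3) kap_A by (auto simp: tens_def)
 have sgl: "(%i. e (sg P j x i)) = sg N j (e x)" for j x by (auto simp: sg_def e0)
 have "(%j. e (act P b F j)) = act N b (%j. e (F j))" if b: "b |: B" and F: "F : seqs P" for b F
  using abP F
 proof (induction rule: seqs_induct)
  case (sg j x)
  thus ?case using b e'(1) by (simp add: act_sg[OF P] act_sg[OF N] t sgl)
 next
  case (add F F')
  hence "(%j. e (act P b (%j. F j +[P] F' j) j)) = (%j. e (act P b F j) +[N] e (act P b F' j))"
   using b act_seqs[OF P b] by (simp add: act_add_right[OF P] e'(2) c)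
  also have "... = (%j. act N b (%j. e (F j)) j +[N] act N b (%j. e (F' j)) j)"
   using fun_cong[OF add(3)] fun_cong[OF add(4)] by simp
  also have "... = act N b (%j. e (F j) +[N] e (F' j))" using act_add_right[OF N b s s] add by simp
  also have "... = act N b (%j. e (F j +[P] F' j))" using e'(2) c add by simp
  finally show ?case .
 qed
 thus ?thesis by (intro mhomI) (simp_all add: s e'(2) c)
qed

end

lemma (in abelian_group) minus_eq_zero_iff:
 assumes "x |: G" "y |: G"
 shows "x \<ominus> y = \<zero> <-> x = y"
proof
 assume "x \<ominus> y = \<zero>"
 thus "x = y" using assms minus_equality[of x "\<ominus> y"] by (simp add: a_minus_def)
qed (use assms in "simp add: a_minus_def r_neg")

lemma (in abelian_group) cancel_minus_add:
 assumes "x |: G" "y |: G"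
 shows "x \<oplus> \<ominus> (y \<oplus> x) = \<ominus> y"
proof -
 have "x \<oplus> \<ominus> (y \<oplus> x) = \<ominus> y \<oplus> (x \<oplus> \<ominus> x)" using assms by (simp add: minus_add a_ac)
 thus ?thesis using assms by (simp add: r_neg)
qed

lemma mhom_inj:
 assumes "lmod A M" "lmod A N" "mhom A M N f"
  "!!x. x |: M ==> f x = 0[N] ==> x = 0[M]"
 shows "inj_on f (carrier M)"
proof (rule inj_onI)
 interpret M: left_module A M by fact
 interpret N: left_module A N by fact
 fix x y assume xy: "x |: M" "y |: M" "f x = f y"
 have "f (x -[M] y) = 0[N]"
  using mhom_diff[OF assms(1-3) xy(1,2)] xy mhomD(1)[OF assms(3)] by (simp add: a_minus_def N.M.r_neg)
 hence "x -[M] y = 0[M]" using assms(4) xy by simp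
 thus "x = y" using xy by (simp add: M.M.minus_eq_zero_iff)
qed

lemma psum_ker_mod: "psum (ker_mod P N e) f m = psum P f m"
 by (induction m) simp_all
lemma seqs_ker_mod: "seqs (ker_mod P N e) = {F : seqs P. ALL j. e (F j) = 0[N]}"
 by (auto simp: seqs_def)

context ore_extension
begin

lemma act_ker_mod: "act (ker_mod P N e) b F = act P b F"
 by (simp add: act_def lin_def psum_ker_mod bound_def)
lemma Ind_sequence_injection:
 fixes N :: "('a, 'a) module"
 assumes "infinite (UNIV :: 'a set)"
 obtains e :: "(nat => 'a) => 'a" where "inj_on e (seqs N)"
proof -
 obtain e :: "(nat => 'a) => 'a" where "inj_on e {F. EX m. ALL j >= m. F j = 0[N]}"
  using sequence_injection[OF assms] by blast
 hence "inj_on e (seqs N)" by (rule inj_on_subset) (auto simp: seqs_def)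
 thus thesis by (rule that)
qed

lemma Ind_pdle:
 fixes N :: "('a, 'a) module"
 assumes inf: "infinite (UNIV :: 'a set)"
 shows "pdle BA d N ==> inj_on e (seqs N) ==> pdle B d (transport e (Ind N))"
proof (induction d arbitrary: N e)
 case (0 N e)
 hence N: "proj BA N" by simp
 have I: "lmod B (Ind N)" "inj_on e (carrier (Ind N))" using Ind_module[OF proj_module[OF N]] 0 by simp_all
 have "proj B (transport e (Ind N))"
  by (rule proj_retract[OF Ind_proj[OF N] transport_module[OF I] transport_hom[OF I]])
   (use 0(2) in auto)
 thus ?case by simp
next
 case (Suc d N e)
 note N = pdle_module[OF Suc.prems(1)]
 from Suc.prems(1) obtain P e0 where P: "proj BA P" "mhom BA P N e0" "e0 ` carrier P = carrier N" "pdle BA d (ker_mod P N e0)"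
  by (rule pdle_SucE)
 note Pm = proj_module[OF P(1)]
 obtain e2 :: "(nat => 'a) => 'a" where e2: "inj_on e2 (seqs P)" using Ind_sequence_injection[OF inf] by blast
 let ?K = "ker_mod P N e0" and ?Q = "transport e2 (Ind P)" and ?T = "transport e (Ind N)"
 note K = ker_mod_module[OF Pm N P(2)]
 have IP: "lmod B (Ind P)" "inj_on e2 (carrier (Ind P))" using Ind_module[OF Pm] e2 by simp_all
 have IN: "lmod B (Ind N)" "inj_on e (carrier (Ind N))" using Ind_module[OF N] Suc.prems(2) by simp_all
 have Q: "proj B ?Q"
  by (rule proj_retract[OF Ind_proj[OF P(1)] transport_module[OF IP] transport_hom[OF IP]]) (use e2 in auto)
 note T = transport_module[OF IN]
 note Qm = proj_module[OF Q]
 define E where "E x = e (%j. e0 (inv_into (seqs P) e2 x j))" for x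
 have E: "mhom B ?Q ?T E" unfolding E_def
  using mhom_comp[OF mhom_comp[OF transport_hom(2)[OF IP] Ind_map[OF Pm N P(2)]] transport_hom(1)[OF IN]] by simp
 have Ev: "E (e2 F) = e (%j. e0 (F j))" if "F : seqs P" for F using that e2 by (simp add: E_def)
 have e00: "e0 0[P] = 0[N]" by (rule mhom_zero[OF Pm N P(2)])
 interpret P: left_module BA P by (rule Pm)
 interpret N: left_module BA N by (rule N)
 have Es: "E ` carrier ?Q = carrier ?T"
 proof (intro equalityI subsetI)
  fix y assume "y |: ?T"
  then obtain G where G: "G : seqs N" "y = e G" by auto
  define F where "F j = (if G j = 0[N] then 0[P] else (SOME x. x |: P & e0 x = G j))" for j
  have F: "F j |: P & e0 (F j) = G j" for j
  proof (cases "G j = 0[N]")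
   case False
   have "G j : e0 ` carrier P" using G(1) P(3) by (simp add: seqs_def)
   hence "EX x. x |: P & e0 x = G j" by auto
   thus ?thesis using someI_ex[of "%x. x |: P & e0 x = G j"] False by (simp add: F_def)
  qed (simp add: F_def e00)
  have "ALL j >= bound N G. F j = 0[P]" using bound[OF G(1)] by (simp add: F_def)
  hence Fs: "F : seqs P" using F unfolding seqs_def by blast
  have "E (e2 F) = y" using Ev[OF Fs] F G(2) by simp
  thus "y : E ` carrier ?Q" using Fs by (intro image_eqI[of _ _ "e2 F"]) simp_all
 qed (use mhomD(1)[OF E] in auto)
 have sub: "seqs ?K <=: seqs P" by (auto simp: seqs_ker_mod)
 have e2K: "inj_on e2 (seqs ?K)" by (rule inj_on_subset[OF e2 sub])
 have IK: "lmod B (Ind ?K)" "inj_on e2 (carrier (Ind ?K))" using Ind_module[OF K] e2K by simp_all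
 have inv: "inv_into (seqs ?K) e2 x = inv_into (seqs P) e2 x" if "x : e2 ` seqs ?K" for x
 proof -
  from that obtain F where F: "F : seqs ?K" "x = e2 F" by blast
  moreover have "F : seqs P" using F(1) sub by blast
  ultimately show ?thesis using e2 e2K by simp
 qed
 have carr: "carrier (ker_mod ?Q ?T E) = e2 ` seqs ?K"
 proof -
  have "E (e2 F) = e (%j. 0[N]) <-> F : seqs ?K" if F: "F : seqs P" for F
  proof -
   have "(%j. e0 (F j)) : seqs N" using mhomD(1)[OF Ind_map[OF Pm N P(2)], of F] F by simp
   moreover have "(%j. 0[N]) : seqs N" by (auto simp: seqs_def)
   ultimately show ?thesis using Suc.prems(2) F Ev[OF F] by (auto simp: inj_on_eq_iff seqs_ker_mod fun_eq_iff)
  qed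
  thus ?thesis using sub by (auto simp: carrier_ker_mod)
 qed
 have "pdle B d (ker_mod ?Q ?T E)"
 proof (rule pdle_iso[OF Suc.IH[OF P(4) e2K]])
  show "lmod B (ker_mod ?Q ?T E)" by (rule ker_mod_module[OF Qm T E])
  show "mhom B (transport e2 (Ind ?K)) (ker_mod ?Q ?T E) (%x. x)"
   unfolding mhom_def carr by (simp add: inv act_ker_mod)
  show "mhom B (ker_mod ?Q ?T E) (transport e2 (Ind ?K)) (%x. x)"
   unfolding mhom_def carr by (simp add: inv act_ker_mod)
 qed simp_all
 thus ?case by (rule pdle_SucI[OF T Q E Es])
qed

section \<open>Ore extensions: global dimension\<close>

definition twist :: "('a, 'b) module => ('a, 'b) module" where
 "twist M = M\<lparr>smult := %a m. kap (Suc 0) (a \<otimes> t) **[M] m\<rparr>"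

lemma twist_simps [simp]: "carrier (twist M) = carrier M" "zero (twist M) = zero M" "add (twist M) = add M"
 "smult (twist M) a m = kap (Suc 0) (a \<otimes> t) **[M] m"
 by (simp_all add: twist_def)

lemma seqs_twist: "seqs (twist M) = seqs M" by (simp add: seqs_def)
lemma sg_twist: "sg (twist M) j x = sg M j x" by (auto simp: sg_def fun_eq_iff)

abbreviation sig where "sig a \<equiv> kap (Suc 0) (a \<otimes> t)"
abbreviation dlt where "dlt a \<equiv> kap 0 (a \<otimes> t)"

lemma sig_in [simp]: "a : A ==> sig a : A" "a : A ==> dlt a : A"
 using kap_A t by simp_all
lemma sig_mult: assumes "a : A" "b : A" shows "sig (a \<otimes> b) = sig a \<otimes> sig b"
proof -
 have "a \<otimes> b \<otimes> t = a \<otimes> (t \<otimes> sig b \<oplus> dlt b)" using assms t commute[of b] by (simp add: m_assoc)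
 also have "... = a \<otimes> t \<otimes> sig b \<oplus> a \<otimes> dlt b"
  using assms t sig_in[OF assms(2)] by (simp add: r_distr m_assoc del: sig_in)
 finally show ?thesis using assms t kap_const(2)[of "a \<otimes> dlt b" 0] sig_in[OF assms(2)] sig_in[OF assms(1)]
  by (simp add: kap_add kap_mult del: sig_in)
qed

lemma sig_one: "sig \<one> = \<one>"
 using kap_pow[of \<one> 1 1] t by simp
text \<open>The coefficient of \<open>t\<close> in \<open>a t\<close> is multiplicative in \<open>a\<close>; the twist is the pullback along it.\<close>

lemma twist_module:
 assumes M: "lmod B M"
 shows "lmod BA (twist M)"
proof -
 interpret M: left_module B M by fact
 have ab: "abelian_group (twist M)"
 proof (rule abelian_groupI)
  fix x assume "x |: (twist M)"
  thus "EX y:carrier (twist M). y +[twist M] x = 0[twist M]"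
   using M.M.l_neg[of x] by (intro bexI[of _ "-[M] x"]) simp_all
 qed (simp_all add: M.M.a_ac)
 have "sig (a \<oplus> b) = sig a \<oplus> sig b" if "a : A" "b : A" for a b
  using that t by (simp add: l_distr kap_add)
 thus ?thesis unfolding left_module_def left_module_axioms_def
  using A_ring ab by (simp add: M.smult_closed M.smult_l_distr M.smult_r_distr M.smult_assoc M.smult_one sig_mult sig_one)
qed

context
 fixes M :: "('a, 'b) module"
 assumes M: "lmod B M"
begin

interpretation M: left_module B M by (rule M)

definition phi :: "'b => nat => 'b" where
 "phi m = (%i. sg M (Suc 0) m i -[M] sg M 0 (t **[M] m) i)"

lemma phi_seqs: assumes "m |: M" shows "phi m : seqs M"
 using seqs_add[OF M.M_abelian sg_seqs[OF M.M_abelian assms, of 1]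
   seqs_neg[OF M.M_abelian sg_seqs[OF M.M_abelian M.smult_closed[OF t assms], of 0]]]
 by (simp add: phi_def a_minus_def)

lemma phi_hom: "mhom BA (twist M) (Ind M) phi"
proof (rule mhomI)
 note RM = restrict_module[OF M]
 note [simp] = M.smult_closed M.minus_zero_M
 show "phi x |: (Ind M)" if "x |: (twist M)" for x using that phi_seqs by simp
 show "phi (x +[twist M] y) = phi x +[Ind M] phi y" if "x |: (twist M)" "y |: (twist M)" for x y
  using that t by (auto simp: phi_def sg_def a_minus_def M.M.minus_add M.smult_r_distr M.M.a_ac)
 fix a x assume ax: "a |: BA" "x |: (twist M)"
 hence a: "a : A" and x: "x |: M" by simp_all
 have tx: "t **[M] x |: M" using t x by simp
 have "act M a (sg M (Suc 0) x) = tens M (t [^] Suc 0 \<otimes> sig a \<oplus> t [^] (0::nat) \<otimes> dlt a) x"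
  using a x commute[OF a] t by (simp add: act_sg[OF RM])
 also have "... = (%j. sg M (Suc 0) (sig a **[M] x) j +[M] sg M 0 (dlt a **[M] x) j)"
  using a x t by (subst tens_add[OF RM]) (simp_all only: tens_mono[OF RM] sig_in A_in m_closed t_pow)
 finally have 1: "act M a (sg M (Suc 0) x) = ..." .
 have 2: "act M a (sg M 0 (t **[M] x)) = sg M 0 (a **[M] (t **[M] x))"
  using a tx tens_mono[OF RM a tx, of 0] by (simp add: act_sg[OF RM])
 have 3: "a **[M] (t **[M] x) = t **[M] (sig a **[M] x) +[M] dlt a **[M] x"
  using a x t commute[OF a] by (simp add: M.smult_assoc[symmetric] M.smult_l_distr[symmetric])
 note IM = Ind_module[OF RM]
 interpret I: left_module B "Ind M" by (rule IM)
 have s: "sg M (Suc 0) x |: (Ind M)" "sg M 0 (t **[M] x) |: (Ind M)"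
  using sg_seqs[OF M.M_abelian] x tx by simp_all
 have neg: "-[Ind M] F = (%j. -[M] F j)" if "F : seqs M" for F
  by (rule I.M.minus_equality) (use that seqs_neg[OF M.M_abelian that] in "auto simp: M.M.l_neg seqs_def")
 have act_neg: "act M a (%i. -[M] F i) = (%i. -[M] act M a F i)" if F: "F : seqs M" for F
  using I.smult_minus[of a F] F a neg[OF F] neg[OF act_seqs[OF RM _ F]] by simp
 have "act M a (phi x) = (%i. act M a (sg M (Suc 0) x) i +[M] act M a (%i. -[M] sg M 0 (t **[M] x) i) i)"
  unfolding phi_def a_minus_def using a s seqs_neg[OF M.M_abelian] by (intro act_add_right[OF RM]) simp_all
 also have "... = (%i. sg M (Suc 0) (sig a **[M] x) i +[M] sg M 0 (dlt a **[M] x) i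
   -[M] sg M 0 (t **[M] (sig a **[M] x) +[M] dlt a **[M] x) i)"
  using s by (simp add: 1 act_neg 2 3 a_minus_def)
 also have "... = phi (sig a **[M] x)"
  using a x t by (auto simp: phi_def sg_def a_minus_def M.M.cancel_minus_add fun_eq_iff)
 finally show "phi (a **[twist M] x) = a **[Ind M] phi x" by simp
qed

definition tau :: "(nat => 'b) => nat => 'b" where
 "tau = ext (twist M) (Ind M) phi"

lemma tau_hom: "mhom B (Ind (twist M)) (Ind M) tau"
 unfolding tau_def by (rule ext_hom[OF twist_module[OF M] Ind_module[OF restrict_module[OF M]] phi_hom])
lemma tau_apply:
 assumes F: "F : seqs M"
 shows "tau F i = (if i = 0 then 0[M] else F (i - 1)) -[M] t **[M] F i"
 using M.M_abelian F
proof (induction arbitrary: i rule: seqs_induct)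
 note RM = restrict_module[OF M]
 note [simp] = M.smult_closed M.minus_zero_M
 case (sg j x)
 have tx: "t **[M] x |: M" using t sg by simp
 interpret I: left_module B "Ind M" by (rule Ind_module[OF RM])
 have neg: "-[Ind M] F = (%j. -[M] F j)" if "F : seqs M" for F
  by (rule I.M.minus_equality) (use that seqs_neg[OF M.M_abelian that] in "auto simp: M.M.l_neg seqs_def")
 have s: "sg M (Suc 0) x : seqs M" "sg M 0 (t **[M] x) : seqs M"
  using sg_seqs[OF M.M_abelian] sg tx by simp_all
 have "tau (sg M j x) = act M (t [^] j) (phi x)"
  using ext_hom(2)[OF twist_module[OF M] Ind_module[OF RM] phi_hom, of x j] sg by (simp add: tau_def sg_twist)
 also have "phi x = sg M (Suc 0) x -[Ind M] sg M 0 (t **[M] x)" using neg[OF s(2)] by (simp add: phi_def a_minus_def)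
 also have "act M (t [^] j) ... = act M (t [^] j) (sg M (Suc 0) x) -[Ind M] act M (t [^] j) (sg M 0 (t **[M] x))"
  using I.smult_diff[of "t [^] j" "sg M (Suc 0) x" "sg M 0 (t **[M] x)"] s by simp
 also have "act M (t [^] j) (sg M (Suc 0) x) = sg M (Suc j) x"
  using sg t tens_pow[OF RM sg, of "Suc j"] by (simp add: act_sg[OF RM])
 also have "act M (t [^] j) (sg M 0 (t **[M] x)) = sg M j (t **[M] x)"
  using tx t tens_pow[OF RM tx, of j] by (simp add: act_sg[OF RM])
 finally have "tau (sg M j x) = (%i. sg M (Suc j) x i -[M] sg M j (t **[M] x) i)"
  using neg[OF sg_seqs[OF M.M_abelian tx]] by (simp add: a_minus_def)
 thus ?case using t by (auto simp: sg_def a_minus_def)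
next
 note [simp] = M.smult_closed M.minus_zero_M
 case (add F F')
 have c: "F j |: M" "F' j |: M" for j using add(1,2) by (auto simp: seqs_def)
 have "tau (%j. F j +[M] F' j) i = tau F i +[M] tau F' i"
  using mhomD(2)[OF tau_hom, of F F'] add by (simp add: seqs_twist)
 also have "... = (if i = 0 then 0[M] else F (i - 1) +[M] F' (i - 1)) -[M] t **[M] (F i +[M] F' i)"
  unfolding add(3) add(4) using c t by (simp add: a_minus_def M.M.minus_add M.smult_r_distr M.M.a_ac)
 finally show ?case .
qed

lemma tau_zero_imp:
 assumes F: "F : seqs M" and z: "tau F = (%j. 0[M])"
 shows "F = (%j. 0[M])"
proof -
 have c: "F j |: M" for j using F by (auto simp: seqs_def)
 have step: "F j = t **[M] F (Suc j)" for j
  using fun_cong[OF z, of "Suc j"] c t by (simp add: tau_apply[OF F] M.smult_closed M.M.minus_eq_zero_iff)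
 have "F (bound M F - k) = 0[M]" for k
 proof (induction k)
  case 0
  thus ?case using bound[OF F] by simp
 next
  case (Suc k)
  show ?case
  proof (cases "bound M F - k = 0")
   case False
   hence "Suc (bound M F - Suc k) = bound M F - k" by simp
   thus ?thesis using step[of "bound M F - Suc k"] Suc t by simp
  qed (use Suc in simp)
 qed
 hence "F (bound M F - (bound M F - j)) = 0[M]" for j .
 hence "F j = 0[M]" for j
  using bound[OF F, of j] by (cases "j >= bound M F") (simp_all, metis diff_diff_cancel le_cases)
 thus ?thesis by blast
qed

definition ev :: "(nat => 'b) => 'b" where
 "ev = ext M M (%m. m)"

lemma ev_hom: "mhom B (Ind M) M ev" "m |: M ==> ev (sg M j m) = t [^] j **[M] m"
 unfolding ev_def using ext_hom[OF restrict_module[OF M] M, of "%m. m"] by (auto simp: mhom_def)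
lemma ev_tau: assumes "F : seqs M" shows "ev (tau F) = 0[M]"
proof (rule Ind_hom_eq[OF twist_module[OF M] M, where f = "%F. ev (tau F)" and g = "%F. 0[M]" and F = F])
 note [simp] = M.smult_closed
 note RM = restrict_module[OF M]
 show "mhom B (Ind (twist M)) M (%F. ev (tau F))" by (rule mhom_comp[OF tau_hom ev_hom(1)])
 show "mhom B (Ind (twist M)) M (%F. 0[M])" by (simp add: mhom_def)
 show "F : seqs (twist M)" using assms by (simp add: seqs_twist)
 fix m assume m: "m |: (twist M)"
 interpret I: left_module B "Ind M" by (rule Ind_module[OF RM])
 have tm: "t **[M] m |: M" using m t by simp
 have s: "sg M (Suc 0) m : seqs M" "sg M 0 (t **[M] m) : seqs M" "sg M 0 m : seqs M"
  using sg_seqs[OF M.M_abelian] m tm by simp_all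
 have neg: "-[Ind M] F = (%j. -[M] F j)" if "F : seqs M" for F
  by (rule I.M.minus_equality) (use that seqs_neg[OF M.M_abelian that] in "auto simp: M.M.l_neg seqs_def")
 have "tau (sg M 0 m) = (%i. sg M (Suc 0) m i -[M] sg M 0 (t **[M] m) i)"
  using tau_apply[OF s(3)] m t by (auto simp: sg_def fun_eq_iff)
 also have "... = sg M (Suc 0) m -[Ind M] sg M 0 (t **[M] m)" using neg[OF s(2)] by (simp add: a_minus_def)
 finally have "ev (tau (sg M 0 m)) = t [^] Suc 0 **[M] m -[M] t [^] (0 :: nat) **[M] (t **[M] m)"
  using mhom_diff[OF I.left_module_axioms M ev_hom(1), of "sg M (Suc 0) m" "sg M 0 (t **[M] m)"] s m tm by (simp add: ev_hom(2))
 thus "ev (tau (sg (twist M) 0 m)) = 0[M]" using t tm m by (simp add: sg_twist M.smult_one a_minus_def M.M.r_neg)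
qed

lemma ev_zero_imp:
 assumes F: "F : seqs M" and z: "ev F = 0[M]"
 shows "F : tau ` seqs M"
proof -
 note RM = restrict_module[OF M]
 interpret I: left_module B "Ind M" by (rule Ind_module[OF RM])
 interpret T: left_module B "Ind (twist M)" by (rule Ind_module[OF twist_module[OF M]])
 have "F : tau ` seqs M" if "F : seqs M" "ev F = 0[M]" "!!j. j >= m ==> F j = 0[M]" for m F
  using that
 proof (induction m arbitrary: F)
  case 0
  hence "F = (%j. 0[M])" by auto
  moreover have "tau (%j. 0[M]) = (%j. 0[M])"
   using mhom_zero[OF T.left_module_axioms I.left_module_axioms tau_hom] by simp
  moreover have "(%j. 0[M]) : seqs M" by (auto simp: seqs_def)
  ultimately show ?case by (metis image_eqI)
 next
  case (Suc m)
  have c: "F j |: M" for j using Suc.prems(1) by (simp add: seqs_def)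
  show ?case
  proof (cases m)
   case 0
   have F0: "F = sg M 0 (F 0)" using Suc.prems(3) 0 by (auto simp: sg_def)
   hence "ev F = F 0" using ev_hom(2)[of "F 0" 0] c by (simp add: M.smult_one)
   hence "F 0 = 0[M]" using Suc.prems(2) by simp
   hence "F j = 0[M]" if "j >= m" for j using Suc.prems(3)[of j] that 0 by (cases j) auto
   thus ?thesis using Suc.IH[OF Suc.prems(1,2)] by blast
  next
   case (Suc k)
   let ?x = "F m" let ?s = "sg M k ?x"
   have s: "?s : seqs M" using sg_seqs[OF M.M_abelian c] .
   have ts: "tau ?s : seqs M" using mhomD(1)[OF tau_hom, of ?s] s by (simp add: seqs_twist)
   let ?F = "F -[Ind M] tau ?s"
   have Fs: "?F : seqs M" using I.M.minus_closed[of F "tau ?s"] Suc.prems(1) ts by simp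
   have neg: "-[Ind M] G = (%j. -[M] G j)" if "G : seqs M" for G
    by (rule I.M.minus_equality) (use that seqs_neg[OF M.M_abelian that] in "auto simp: M.M.l_neg seqs_def")
   have "ev ?F = 0[M]"
    using mhom_diff[OF I.left_module_axioms M ev_hom(1), of F "tau ?s"] Suc.prems ts ev_tau[OF s] by (simp add: a_minus_def M.minus_zero_M)
   moreover have "?F j = 0[M]" if "j >= m" for j
    using that Suc tau_apply[OF s, of j] c t Suc.prems(3)[of j] neg[OF ts]
    by (auto simp: sg_def a_minus_def M.smult_closed M.M.r_neg M.minus_zero_M)
   ultimately have "?F : tau ` seqs M" using Suc.IH[OF Fs] by blast
   then obtain G where G: "G : seqs M" "?F = tau G" by blast
   have "F = ?F +[Ind M] tau ?s"
    using Suc.prems(1) ts I.M.a_assoc[of F "-[Ind M] tau ?s" "tau ?s"] I.M.l_neg[of "tau ?s"] I.M.r_zero[of F] I.M.a_inv_closed[of "tau ?s"]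
    by (simp only: a_minus_def Ind_simps(1))
   also have "... = tau (%j. G j +[M] ?s j)"
    using mhomD(2)[OF tau_hom, of G ?s] G s by (simp add: seqs_twist)
   finally show ?thesis using seqs_add[OF M.M_abelian G(1) s] by blast
  qed
 qed
 thus ?thesis using F z bound[OF F] by blast
qed

end

text \<open>Every module \<open>M\<close> is the cokernel of an injection \<open>B \<otimes> M1 \<rightarrow> B \<otimes> M\<close>, where \<open>\<otimes>\<close> is over \<open>A\<close> and \<open>M1\<close> is the twist of \<open>M\<close>: \<open>t^j \<otimes> m\<close> goes to \<open>t^(j+1) \<otimes> m - t^j \<otimes> t m\<close>. Induction is exact and preserves projectivity, because \<open>B\<close> is free over \<open>A\<close>.\<close>

theorem ore_extension_pdle:
 assumes inf: "infinite (UNIV :: 'a set)"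
  and A: "!!N :: ('a, 'a) module. left_module BA N ==> pdle BA d N"
  and M: "lmod B (M :: ('a, 'a) module)"
 shows "pdle B (Suc d) M"
proof -
 interpret M: left_module B M by (rule M)
 obtain e :: "(nat => 'a) => 'a" where e: "inj_on e (seqs M)" using Ind_sequence_injection[OF inf] by blast
 note RM = restrict_module[OF M] and TM = twist_module[OF M]
 let ?X = "transport e (Ind (twist M))" and ?Y = "transport e (Ind M)"
 have IX: "lmod B (Ind (twist M))" "inj_on e (carrier (Ind (twist M)))"
  using Ind_module[OF TM] e by (simp_all add: seqs_twist)
 have IY: "lmod B (Ind M)" "inj_on e (carrier (Ind M))" using Ind_module[OF RM] e by simp_all
 define i where "i = inv_into (seqs M) e"
 have i: "i (e F) = F" if "F : seqs M" for F using e that by (simp add: i_def)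
 have iX: "mhom B ?X (Ind (twist M)) i" using transport_hom(2)[OF IX] by (simp add: i_def seqs_twist)
 have iY: "mhom B ?Y (Ind M) i" using transport_hom(2)[OF IY] by (simp add: i_def)
 let ?f = "%x. e (tau M (i x))" and ?q = "%y. ev M (i y)"
 have taus: "tau M F : seqs M" if "F : seqs M" for F using mhomD(1)[OF tau_hom[OF M], of F] that by (simp add: seqs_twist)
 show ?thesis
 proof (rule pdle_cokernel[OF inf M])
  show f: "mhom B ?X ?Y ?f" by (rule mhom_comp[OF mhom_comp[OF iX tau_hom[OF M]] transport_hom(1)[OF IY]])
  show "mhom B ?Y M ?q" by (rule mhom_comp[OF iY ev_hom(1)[OF M]])
  show "?q ` carrier ?Y = carrier M"
  proof (intro equalityI subsetI)
   fix m assume m: "m |: M"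
   have s: "sg M 0 m : seqs M" using sg_seqs[OF M.M_abelian m] .
   have "?q (e (sg M 0 m)) = m" using i[OF s] ev_hom(2)[OF M m, of 0] m by (simp add: M.smult_one)
   thus "m : ?q ` carrier ?Y" using s by (intro image_eqI[of _ _ "e (sg M 0 m)"]) simp_all
  qed (use mhomD(1)[OF ev_hom(1)[OF M]] i in auto)
  have zs: "(%j. 0[M]) : seqs M" by (auto simp: seqs_def)
  show "inj_on ?f (carrier ?X)"
  proof (rule mhom_inj[OF transport_module[OF IX] transport_module[OF IY] f])
   fix x assume "x |: ?X" and z: "?f x = 0[?Y]"
   then obtain F where F: "F : seqs M" "x = e F" by (auto simp: seqs_twist)
   have "tau M F = (%j. 0[M])" using z F i[OF F(1)] taus[OF F(1)] zs e by (auto dest: inj_onD)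
   thus "x = 0[?X]" using tau_zero_imp[OF M F(1)] F(2) by simp
  qed
  show "?q y = 0[M] <-> y : ?f ` carrier ?X" if "y |: ?Y" for y
  proof
   from that obtain F where F: "F : seqs M" "y = e F" by auto
   show "y : ?f ` carrier ?X" if "?q y = 0[M]"
   proof -
    have "F : tau M ` seqs M" using ev_zero_imp[OF M F(1)] that F i by simp
    then obtain G where G: "G : seqs M" "F = tau M G" by blast
    thus ?thesis using F i by (intro image_eqI[of _ _ "e G"]) (simp_all add: seqs_twist)
   qed
  next
   assume "y : ?f ` carrier ?X"
   then obtain G where G: "G : seqs M" "y = e (tau M G)" using i by (auto simp: seqs_twist)
   thus "?q y = 0[M]" using i[OF taus[OF G(1)]] ev_tau[OF M G(1)] by simp
  qed
  show "pdle B d ?X" by (rule Ind_pdle[OF inf A[OF TM]]) (simp add: seqs_twist e)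
  show "pdle B d ?Y" by (rule Ind_pdle[OF inf A[OF RM] e])
 qed
qed

end

section \<open>Cubes of abelian groups\<close>

definition pm :: "nat set => nat => 'u => 'u :: ab_group_add" where
 "pm T s x = (if even (card {u : T. s < u}) then x else - x)"

text \<open>The simplicial sign \<open>pm\<close> counts the larger elements, which makes the square of the differential vanish on commuting squares.\<close>

definition kd :: "nat => (nat set => nat => 'u => 'u) => (nat set => 'u) => nat set => 'u :: ab_group_add" where
 "kd N c f T = (\<Sum>s \<in> {..<N} - T. pm T s (c T s (f (insert s T))))"

definition chain :: "nat => nat => 'u set => (nat set => 'u :: ab_group_add) => bool" where
 "chain N i U f <-> (ALL T. f T : U) & (ALL T. f T ~= 0 --> T <=: {..<N} & card T = i)"

definition span_below :: "(nat set => nat => 'u => 'u) => 'u set => nat set => nat => 'u :: ab_group_add set" where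
 "span_below c U T k = {\<Sum>s<k. c T s (g s) | g. ALL s. g s : U}"

locale subgroup_set =
 fixes U :: "'u :: ab_group_add set"
 assumes U0: "0 : U" and U_add: "x : U ==> y : U ==> x + y : U" and U_neg: "x : U ==> - x : U"
begin

lemma U_sum: "(!!i. i : I ==> f i : U) ==> sum f I : U"
 by (induction I rule: infinite_finite_induct) (auto intro: U0 U_add)
lemma U_pm: "x : U ==> pm T s x : U"
 by (simp add: pm_def U_neg)

end

lemma pm_add: "pm T s (x + y) = pm T s x + pm T s y"
 by (simp add: pm_def)
lemma pm_neg: "pm T s (- x) = - pm T s x"
 by (simp add: pm_def)
lemma pm_0 [simp]: "pm T s 0 = 0"
 by (simp add: pm_def)

definition additive_on :: "'u set => ('u => 'u :: ab_group_add) => bool" where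
 "additive_on U f <-> (ALL x:U. f x : U) & (ALL x:U. ALL y:U. f (x + y) = f x + f y)"

context subgroup_set
begin

lemma additive_on_0: "additive_on U f ==> f 0 = 0"
 using U0 by (auto simp: additive_on_def) (metis add_cancel_right_right add_0)
lemma additive_on_neg: "additive_on U f ==> x : U ==> f (- x) = - f x"
 using additive_on_0[of f] U_neg[of x] unfolding additive_on_def by (metis add.right_inverse add_eq_0_iff)
lemma additive_on_pm: "additive_on U f ==> x : U ==> f (pm T s x) = pm T s (f x)"
 by (simp add: pm_def additive_on_neg)
lemma additive_on_sum: "additive_on U f ==> (!!i. i : I ==> g i : U) ==> f (sum g I) = (\<Sum>i \<in> I. f (g i))"
proof (induction I rule: infinite_finite_induct)
 case (insert i I)
 thus ?case using U_sum[of I g] by (simp add: additive_on_def)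
qed (simp_all add: additive_on_0)

lemma kd_add:
 assumes "!!T s. additive_on U (c T s)" "!!T. f T : U" "!!T. g T : U"
 shows "kd N c (%T. f T + g T) T = kd N c f T + kd N c g T"
proof -
 have "c T s (f S + g S) = c T s (f S) + c T s (g S)" for s S
  using assms unfolding additive_on_def by blast
 thus ?thesis by (simp add: kd_def pm_add sum.distrib)
qed

lemma kd_neg:
 assumes "!!T s. additive_on U (c T s)" "!!T. f T : U"
 shows "kd N c (%T. - f T) T = - kd N c f T"
 using additive_on_neg[OF assms(1,2)] by (simp add: kd_def pm_neg sum_negf)

text \<open>A cube whose edges are injective modulo the edges of smaller index has no homology in positive
 degrees. The total complex of an \<open>(N + 1)\<close>-cube is the mapping cone of the map between the total
 complexes of two opposite faces, and the hypothesis makes this map injective on homology in degree 0.\<close>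

text \<open>Induction on the number of directions: the cube is the mapping cone of its two opposite faces, and regularity of the last direction removes the homology that the cone could add.\<close>

theorem cube_exact:
 assumes c: "!!T s. additive_on U (c T s)"
  and comm: "!!T s r u. s ~: T ==> r ~: T ==> s ~= r ==> s < N ==> r < N ==> u : U ==>
   c T s (c (insert s T) r u) = c T r (c (insert r T) s u)"
  and reg: "!!T k u. k < N ==> T <=: {k<..<N} ==> u : U ==> c T k u : span_below c U T k ==>
   u : span_below c U (insert k T) k"
  and f: "chain N (Suc i) U f" and z: "!!T. kd N c f T = 0"
 shows "EX g. chain N (Suc (Suc i)) U g & f = kd N c g"
 using assms
proof (induction N arbitrary: i f c)
 case 0
 have "f T = 0" for T using 0(4) by (auto simp: chain_def)
 thus ?case using U0 by (intro exI[of _ "%T. 0"]) (auto simp: chain_def kd_def)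
next
 case (Suc N)
 note c = Suc.prems(1) and comm = Suc.prems(2) and reg = Suc.prems(3)
 note z = Suc.prems(5)
 have fU: "f T : U" for T using Suc.prems(4) by (simp add: chain_def)
 have f0: "T <=: {..<Suc N} & card T = Suc i" if "f T ~= 0" for T using Suc.prems(4) that by (simp add: chain_def)
 have c0: "c T s 0 = 0" for T s using additive_on_0[OF c] .
 have cU: "c T s u : U" if "u : U" for T s u using c that by (simp add: additive_on_def)
 define d where "d T s = c (insert N T) s" for T s
 have pmN: "pm T N x = x" if "T <=: {..<N}" for T and x :: 'u
 proof -
  have "{u : T. N < u} = {}" using that by auto
  thus ?thesis by (simp only: pm_def card.empty even_zero if_True)
 qed
 have pmi: "pm (insert N T) s x = - pm T s x" if "T <=: {..<N}" "s < N" for T s and x :: 'u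
 proof -
  have "{u : insert N T. s < u} = insert N {u : T. s < u}" "N ~: {u : T. s < u}" "finite {u : T. s < u}"
   using that finite_subset[of T "{..<N}"] by auto
  thus ?thesis by (simp add: pm_def)
 qed
 \<comment> \<open>the differential of the large cube in terms of the two faces\<close>
 have kd0: "kd (Suc N) c h T = kd N c h T + c T N (h (insert N T))" if "T <=: {..<N}" for h T
 proof -
  have "{..<Suc N} - T = insert N ({..<N} - T)" using that by auto
  thus ?thesis using that by (simp add: kd_def pmN)
 qed
 have kd1: "kd (Suc N) c h (insert N T) = - kd N d (%S. h (insert N S)) T" if "T <=: {..<N}" for h T
 proof -
  have "{..<Suc N} - insert N T = {..<N} - T" using that by auto
  thus ?thesis using that by (simp add: kd_def d_def pmi sum_negf insert_commute)
 qed
 have kd_out: "kd N c' h T = 0" if "\<not> T <=: {..<N}" "!!T. \<not> T <=: {..<N} ==> h T = 0" "!!T s. c' T s 0 = 0" for c' h T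
  using that by (simp add: kd_def)
 define f2 where "f2 T = (if T <=: {..<N} then f (insert N T) else 0)" for T
 define f1 where "f1 T = (if T <=: {..<N} then f T else 0)" for T
 have f1U: "f1 T : U" and f2U: "f2 T : U" for T using fU U0 by (simp_all add: f1_def f2_def)
 have f2c: "chain N i U f2"
 proof -
  have "card T = i" if "f2 T ~= 0" for T
  proof -
   have T: "T <=: {..<N}" "f (insert N T) ~= 0" using that by (auto simp: f2_def split: if_splits)
   hence "card (insert N T) = Suc i" using f0 by blast
   moreover have "N ~: T" "finite T" using T(1) finite_subset[of T "{..<N}"] by auto
   ultimately show ?thesis by simp
  qed
  thus ?thesis using f2U by (auto simp: chain_def f2_def split: if_splits)
 qed
 have f1c: "chain N (Suc i) U f1" using f1U f0 by (auto simp: chain_def f1_def split: if_splits)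
 have kd_eq: "kd N c' h T = kd N c' h' T" if "!!T. T <=: {..<N} ==> h T = h' T" "T <=: {..<N}" for c' h h' T
  unfolding kd_def by (intro sum.cong refl arg_cong[of _ _ "pm _ _"] arg_cong[of _ _ "c' _ _"] that(1)) (use that(2) in auto)
 have c2: "additive_on U (d T s)" for T s unfolding d_def by (rule c)
 have d0: "d T s 0 = 0" for T s by (simp add: d_def c0)
 have z2: "kd N d f2 T = 0" for T
 proof (cases "T <=: {..<N}")
  case True
  have "kd N d f2 T = kd N d (%S. f (insert N S)) T" by (rule kd_eq) (use True in "auto simp: f2_def")
  thus ?thesis using kd1[OF True, of f] z[of "insert N T"] by simp
 qed (rule kd_out, auto simp: f2_def d0)
 have z1: "kd N c f1 T = - c T N (f2 T)" for T
 proof (cases "T <=: {..<N}")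
  case True
  have "kd N c f1 T = kd N c f T" by (rule kd_eq) (use True in "auto simp: f1_def")
  thus ?thesis using kd0[OF True, of f] z[of T] True by (simp add: f2_def eq_neg_iff_add_eq_0)
 next
  case False
  have "kd N c f1 T = 0" by (rule kd_out[OF False]) (simp_all add: f1_def c0)
  thus ?thesis using False by (simp add: f2_def c0)
 qed
 have comm2: "d T s (d (insert s T) r u) = d T r (d (insert r T) s u)"
  if "s ~: T" "r ~: T" "s ~= r" "s < N" "r < N" "u : U" for T s r u
  using comm[of s "insert N T" r u] that by (simp add: d_def insert_commute)
 obtain g2 where g2: "chain N (Suc i) U g2" "f2 = kd N d g2"
 proof (cases i)
  case 0
  define w where "w = f2 {}"
  have w: "w : U" using f2U by (simp add: w_def)
  have "kd N c f1 {} = - c {} N w" using z1 by (simp add: w_def)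
  moreover have "kd N c f1 {} = (\<Sum>s<N. c {} s (f1 {s}))" by (simp add: kd_def pm_def)
  ultimately have "c {} N w = (\<Sum>s<N. c {} s (- f1 {s}))"
   by (simp only: additive_on_neg[OF c f1U] sum_negf) simp
  hence "c {} N w : span_below c U {} N" using U_neg[OF f1U] by (auto simp: span_below_def)
  hence "w : span_below c U {N} N" using reg[of N "{}" w] w by simp
  then obtain g where g: "!!s. g s : U" "w = (\<Sum>s<N. c {N} s (g s))" by (auto simp: span_below_def)
  define g2 where "g2 T = (\<Sum>s \<in> {s. s < N & T = {s}}. g s)" for T
  have g2s: "g2 {s} = g s" if "s < N" for s
  proof -
   have "{r. r < N & {s} = {r}} = {s}" using that by auto
   thus ?thesis by (simp add: g2_def)
  qed
  have g20: "T <=: {..<N} & card T = 1" if "g2 T ~= 0" for T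
  proof -
   have "{s. s < N & T = {s}} ~= {}" using that unfolding g2_def by (metis sum.empty)
   thus ?thesis by auto
  qed
  have ch: "chain N (Suc i) U g2" using g20 0 U_sum[of _ g] g(1) by (auto simp: chain_def g2_def)
  have "f2 T = kd N d g2 T" for T
  proof (cases "T = {}")
   case True
   have "kd N d g2 {} = (\<Sum>s<N. c {N} s (g s))" using g2s by (simp add: kd_def pm_def d_def)
   thus ?thesis using True g(2) by (simp add: w_def)
  next
   case False
   have "f2 T = 0"
   proof (rule ccontr)
    assume "f2 T ~= 0"
    hence "T <=: {..<N}" "card T = 0" using f2c 0 by (auto simp: chain_def)
    thus False using False finite_subset[of T "{..<N}"] by simp
   qed
   moreover have "g2 (insert s T) = 0" if "s : {..<N} - T" for s
   proof (rule ccontr)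
    assume "g2 (insert s T) ~= 0"
    hence "card (insert s T) = 1" using g20 by blast
    thus False using False that by (auto simp: card_1_singleton_iff)
   qed
   ultimately show ?thesis by (simp add: kd_def d0)
  qed
  thus thesis using that[OF ch] by blast
 next
  case (Suc j)
  have "EX g. chain N (Suc (Suc j)) U g & f2 = kd N d g"
  proof (rule Suc.IH[OF c2 comm2 _ _ z2])
   show "chain N (Suc j) U f2" using f2c Suc by simp
   fix T k u assume a: "k < N" "T <=: {k<..<N}" "u : U" "d T k u : span_below d U T k"
   have "insert N T <=: {k<..<Suc N}" using a(1,2) by auto
   hence "u : span_below c U (insert k (insert N T)) k"
    using reg[of k "insert N T" u] a by (simp add: d_def span_below_def)
   thus "u : span_below d U (insert k T) k" by (simp add: d_def span_below_def insert_commute)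
  qed
  thus thesis using that Suc by blast
 qed
 have g2U: "g2 T : U" for T using g2(1) by (simp add: chain_def)
 have g2o: "g2 T = 0" if "\<not> T <=: {..<N}" for T using g2(1) that by (auto simp: chain_def)
 define h where "h T = f1 T + c T N (g2 T)" for T
 have hc: "chain N (Suc i) U h"
  using f1c g2(1) cU U_add c0 unfolding chain_def h_def by (metis add_0)
 have kcg: "kd N c (%T. c T N (g2 T)) T = c T N (f2 T)" for T
 proof (cases "T <=: {..<N}")
  case True
  have "kd N c (%T. c T N (g2 T)) T = (\<Sum>s \<in> {..<N} - T. pm T s (c T N (d T s (g2 (insert s T)))))"
   unfolding kd_def d_def
   by (intro sum.cong refl arg_cong[of _ _ "pm _ _"] comm) (use True g2U in auto)
  also have "... = (\<Sum>s \<in> {..<N} - T. c T N (pm T s (d T s (g2 (insert s T)))))"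
   using cU g2U by (intro sum.cong refl additive_on_pm[OF c, symmetric]) (simp add: d_def)
  also have "... = c T N (f2 T)"
   unfolding g2(2) kd_def by (rule additive_on_sum[OF c, symmetric]) (simp add: d_def U_pm cU g2U)
  finally show ?thesis .
 next
  case False
  have "kd N c (%T. c T N (g2 T)) T = 0" by (rule kd_out[OF False]) (simp_all add: c0 g2o)
  thus ?thesis using False by (simp add: f2_def c0)
 qed
 have zh: "kd N c h T = 0" for T
  unfolding h_def by (subst kd_add[OF c f1U cU[OF g2U]]) (simp add: kcg z1)
 obtain g1 where g1: "chain N (Suc (Suc i)) U g1" "h = kd N c g1"
 proof -
  have "EX g. chain N (Suc (Suc i)) U g & h = kd N c g"
  proof (rule Suc.IH[OF c _ _ hc zh])
   fix T k u assume a: "k < N" "T <=: {k<..<N}" "u : U" "c T k u : span_below c U T k"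
   have "T <=: {k<..<Suc N}" using a(2) by force
   thus "u : span_below c U (insert k T) k" using reg[of k T u] a by simp
  qed (use comm in auto)
  thus thesis using that by blast
 qed
 define g where "g T = (if N : T then - g2 (T - {N}) else g1 T)" for T
 have gc: "chain (Suc N) (Suc (Suc i)) U g"
 proof -
  have "T <=: {..<Suc N} & card T = Suc (Suc i)" if "g T ~= 0" for T
  proof (cases "N : T")
   case True
   hence "g2 (T - {N}) ~= 0" using that by (simp add: g_def)
   hence *: "T - {N} <=: {..<N}" "card (T - {N}) = Suc i" using g2(1) unfolding chain_def by blast+
   have "finite T" using finite_subset[OF *(1)] by simp
   hence "card T = Suc (Suc i)" using *(2) True by (metis card_Suc_Diff1)
   moreover have "T <=: {..<Suc N}" using *(1) True by (auto simp: less_Suc_eq)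
   ultimately show ?thesis by blast
  next
   case False
   hence "g1 T ~= 0" using that by (simp add: g_def)
   hence "T <=: {..<N}" "card T = Suc (Suc i)" using g1(1) unfolding chain_def by blast+
   thus ?thesis by (auto simp: less_Suc_eq)
  qed
  moreover have "g T : U" for T using g1(1) g2U U_neg by (simp add: g_def chain_def)
  ultimately show ?thesis by (simp add: chain_def)
 qed
 have "f T = kd (Suc N) c g T" for T
 proof (cases "T <=: {..<Suc N}")
  case out: False
  have "f T = 0" using f0 out by blast
  moreover have "g (insert s T) = 0" for s using gc out unfolding chain_def by (meson insert_subset)
  ultimately show ?thesis by (simp add: kd_def c0)
 next
  case T: True
  show ?thesis
  proof (cases "N : T")
   case False
   hence TN: "T <=: {..<N}" using T by (auto simp: less_Suc_eq)
   have "kd (Suc N) c g T = kd N c g T + c T N (- g2 T)" using kd0[OF TN, of g] False by (simp add: g_def)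
   also have "kd N c g T = kd N c g1 T" by (rule kd_eq) (use TN in "auto simp: g_def")
   also have "... = h T" using g1(2) by simp
   finally show ?thesis using TN additive_on_neg[OF c g2U] by (simp add: h_def f1_def)
  next
   case True
   define S where "S = T - {N}"
   have S: "S <=: {..<N}" "T = insert N S" "N ~: S" using T True by (auto simp: S_def less_Suc_eq)
   have "kd (Suc N) c g T = - kd N d (%S. g (insert N S)) S" unfolding S(2) by (rule kd1[OF S(1)])
   also have "kd N d (%S. g (insert N S)) S = kd N d (%S. - g2 S) S"
    by (rule kd_eq[OF _ S(1)]) (auto simp: g_def intro!: arg_cong[of _ _ g2])
   also have "... = - kd N d g2 S" by (rule kd_neg[OF c2 g2U])
   also have "- (- kd N d g2 S) = f2 S" using g2(2) by simp
   also have "f2 S = f T" using S by (simp add: f2_def)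
   finally show ?thesis by simp
  qed
 qed
 thus ?case using gc by blast
qed

text \<open>The two ways of removing two elements carry opposite signs and equal maps.\<close>

lemma kd_kd:
 assumes c: "!!T s. additive_on U (c T s)"
  and comm: "!!T s r u. s ~: T ==> r ~: T ==> s ~= r ==> s < N ==> r < N ==> u : U ==>
   c T s (c (insert s T) r u) = c T r (c (insert r T) s u)"
  and f: "!!T. f T : U" and T: "finite T"
 shows "kd N c (kd N c f) T = 0"
proof -
 have cU: "c T s u : U" if "u : U" for T s u using c that by (simp add: additive_on_def)
 let ?I = "{..<N} - T"
 let ?a = "%s r. pm T s (pm (insert s T) r (c T s (c (insert s T) r (f (insert r (insert s T))))))"
 have anti: "?a s r = - ?a r s" if "s : ?I" "r : ?I" "s < r" for s r
 proof -
  have 1: "{u : insert s T. r < u} = {u : T. r < u}" using that by auto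
  have "{u : insert r T. s < u} = insert r {u : T. s < u}" using that by auto
  hence 2: "card {u : insert r T. s < u} = Suc (card {u : T. s < u})" using that T by simp
  have 3: "c T s (c (insert s T) r (f (insert r (insert s T)))) = c T r (c (insert r T) s (f (insert s (insert r T))))"
   using comm[of s T r "f (insert r (insert s T))"] that f by (simp add: insert_commute)
  show ?thesis unfolding 3 pm_def 1 2 by simp
 qed
 have "kd N c (kd N c f) T = (\<Sum>s \<in> ?I. \<Sum>r \<in> ?I - {s}. ?a s r)"
  unfolding kd_def
 proof (rule sum.cong[OF refl])
  fix s assume s: "s : ?I"
  have "{..<N} - insert s T = ?I - {s}" by auto
  hence "c T s (\<Sum>r \<in> {..<N} - insert s T. pm (insert s T) r (c (insert s T) r (f (insert r (insert s T)))))
   = (\<Sum>r \<in> ?I - {s}. pm (insert s T) r (c T s (c (insert s T) r (f (insert r (insert s T))))))"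
   using additive_on_sum[OF c, of "?I - {s}"] by (simp add: U_pm cU f additive_on_pm[OF c])
  moreover have "pm T s (sum h J) = (\<Sum>r \<in> J. pm T s (h r))" for h :: "nat => 'u" and J
   by (simp add: pm_def sum_negf)
  ultimately show "pm T s (c T s (\<Sum>r \<in> {..<N} - insert s T. pm (insert s T) r (c (insert s T) r (f (insert r (insert s T)))))) =
   (\<Sum>r \<in> ?I - {s}. ?a s r)" by simp
 qed
 also have "... = (\<Sum>s \<in> ?I. \<Sum>r \<in> {r : ?I. r < s}. ?a s r) + (\<Sum>s \<in> ?I. \<Sum>r \<in> {r : ?I. s < r}. ?a s r)"
  unfolding sum.distrib[symmetric]
 proof (rule sum.cong[OF refl])
  fix s assume "s : ?I"
  have split: "?I - {s} = {r : ?I. r < s} \<union> {r : ?I. s < r}" by auto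
  show "(\<Sum>r \<in> ?I - {s}. ?a s r) = (\<Sum>r \<in> {r : ?I. r < s}. ?a s r) + (\<Sum>r \<in> {r : ?I. s < r}. ?a s r)"
   unfolding split
  proof (rule sum.union_disjoint)
   show "finite {r : ?I. r < s}" "finite {r : ?I. s < r}" by simp_all
   show "{r : ?I. r < s} \<inter> {r : ?I. s < r} = {}" by force
  qed
 qed
 also have "(\<Sum>s \<in> ?I. \<Sum>r \<in> {r : ?I. r < s}. ?a s r) = (\<Sum>s \<in> ?I. \<Sum>r \<in> {r : ?I. s < r}. ?a r s)"
  by (rule sum.swap_restrict) auto
 also have "... = (\<Sum>s \<in> ?I. \<Sum>r \<in> {r : ?I. s < r}. - ?a s r)"
 proof (intro sum.cong refl)
  fix s r assume sr: "s : ?I" "r : {r : ?I. s < r}"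
  have "?a s r = - ?a r s" by (rule anti[OF sr(1)]) (use sr(2) in blast)+
  from arg_cong[OF this, of uminus] show "?a r s = - ?a s r" unfolding minus_minus by (rule sym)
 qed
 finally show ?thesis by (simp add: sum_negf)
qed

end

section \<open>Koszul complexes over a noncommutative ring\<close>

lemma mhom_finsum:
 assumes "lmod A M" "lmod A N" "mhom A M N g" "!!i. i : I ==> m i |: M"
 shows "g (finsum M m I) = finsum N (%i. g (m i)) I"
proof -
 interpret M: left_module A M by fact
 interpret N: left_module A N by fact
 show ?thesis using assms(4)
  by (induction I rule: infinite_finite_induct) (auto simp: mhom_zero[OF assms(1-3)] mhomD[OF assms(3)] Pi_def)
qed

lemma (in left_module) smult_finsum:
 assumes "a |: A" "!!i. i : I ==> m i |: M"
 shows "a **[M] finsum M m I = finsum M (%i. a **[M] m i) I"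
 using assms(2)
 by (induction I rule: infinite_finite_induct) (auto simp: assms(1) smult_r_distr smult_closed Pi_def)

text \<open>\<open>co\<close> identifies \<open>B\<close> with the subgroup \<open>U\<close> of a type of class \<open>ab_group_add\<close>, and \<open>mul\<close> is the
 multiplication of \<open>B\<close> seen there. The entries \<open>w T s\<close> of the differential may depend on the subset \<open>T\<close>, which
 accounts for the failure of commutativity.\<close>

text \<open>The weights \<open>w T s\<close> depend on the vertex \<open>T\<close>, since the variables of a noncommutative ring commute only after a correction.\<close>

locale koszul = ring B + subgroup_set U
 for B :: "('a, 'z) graded_algebra_scheme" (structure) and U :: "'u :: ab_group_add set" +
 fixes co :: "'a => 'u" and mul :: "'u => 'u => 'u" and N :: nat and w :: "nat set => nat => 'u"
 assumes bij: "bij_betw co (carrier B) U"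
  and co_add: "a |: B ==> b |: B ==> co (a \<oplus> b) = co a + co b"
  and co_mult: "a |: B ==> b |: B ==> co (a \<otimes> b) = mul (co a) (co b)"
  and w_in: "w T s : U"
  and w_comm: "s ~: T ==> r ~: T ==> s ~= r ==> s < N ==> r < N ==>
   mul (w (insert s T) r) (w T s) = mul (w (insert r T) s) (w T r)"
  and infinite_type: "infinite (UNIV :: 'a set)"
  and N_pos: "N > 0"
begin

text \<open>The edges of the cube of the Koszul complex, and those of the cube of its dual; in the latter a subset
 stands for its complement, which leads to the additional sign.\<close>

definition rc :: "nat set => nat => 'u => 'u" where
 "rc T s u = mul u (w T s)"

definition lc :: "nat set => nat => 'u => 'u" where
 "lc T s u = (if even (N - 1 - s) then mul (w ({..<N} - T - {s}) s) u else - mul (w ({..<N} - T - {s}) s) u)"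

end

text \<open>Regularity on both sides: right multiplications serve the resolution, left multiplications its dual. The augmentation ideal is described by the same generators on either side.\<close>

locale koszul_regular = koszul B U co mul N w
 for B :: "('a, 'z) graded_algebra_scheme" (structure) and U :: "'u :: ab_group_add set" and co mul N w +
 assumes reg_right: "k < N ==> T <=: {k<..<N} ==> u : U ==> rc T k u : span_below rc U T k ==>
   u : span_below rc U (insert k T) k"
  and reg_left: "k < N ==> T <=: {k<..<N} ==> u : U ==> lc T k u : span_below lc U T k ==>
   u : span_below lc U (insert k T) k"
  and aug_add: "a |: B ==> b |: B ==> augmentation B (a \<oplus> b) = augmentation B a + augmentation B b"
  and aug_mult: "a |: B ==> b |: B ==> augmentation B (a \<otimes> b) = augmentation B a * augmentation B b"
  and aug_one: "augmentation B \<one> = 1"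
  and aug_surj: "EX a:carrier B. augmentation B a = z"
  and aug_right: "b |: B ==> augmentation B b = 0 <-> co b : span_below rc U {} N"
  and aug_left: "b |: B ==> augmentation B b = 0 <-> co b : span_below lc U {} N"
  and aug_w: "b |: B ==> co b = w T s ==> augmentation B b = 0"

context koszul
begin

definition dec :: "'u => 'a" where "dec = inv_into (carrier B) co"

lemma co_in [simp]: "b |: B ==> co b : U" using bij by (auto simp: bij_betw_def)
lemma dec_in [simp]: "u : U ==> dec u |: B"
 unfolding dec_def using bij by (metis bij_betw_def inv_into_into)
lemma co_dec [simp]: "u : U ==> co (dec u) = u"
 unfolding dec_def using bij by (metis bij_betw_def f_inv_into_f)
lemma dec_co [simp]: "b |: B ==> dec (co b) = b"
 unfolding dec_def using bij by (metis bij_betw_def inv_into_f_f)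
lemma co_zero [simp]: "co \<zero> = 0"
 using co_add[of \<zero> \<zero>] by simp
lemma dec_0 [simp]: "dec 0 = \<zero>" using dec_co[of \<zero>] by simp
lemma mul_in [simp]: "x : U ==> y : U ==> mul x y : U"
 using co_mult[of "dec x" "dec y"] co_in[of "dec x \<otimes> dec y"] by simp
lemma mul_dec: "x : U ==> y : U ==> dec (mul x y) = dec x \<otimes> dec y"
 using co_mult[of "dec x" "dec y"] dec_co[of "dec x \<otimes> dec y"] by simp
lemma dec_add: "x : U ==> y : U ==> dec (x + y) = dec x \<oplus> dec y"
 using co_add[of "dec x" "dec y"] dec_co[of "dec x \<oplus> dec y"] by simp
lemma mul_assoc:
 assumes "x : U" "y : U" "z : U"
 shows "mul (mul x y) z = mul x (mul y z)"
proof -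
 have "mul (mul x y) z = co (dec x \<otimes> dec y \<otimes> dec z)" using assms by (simp add: co_mult)
 also have "dec x \<otimes> dec y \<otimes> dec z = dec x \<otimes> (dec y \<otimes> dec z)" using assms by (intro m_assoc dec_in)
 finally show ?thesis using assms by (simp add: co_mult)
qed

lemma mul_addl:
 assumes "x : U" "y : U" "z : U"
 shows "mul (x + y) z = mul x z + mul y z"
proof -
 have "mul (co (dec x \<oplus> dec y)) (co (dec z)) = co (dec x \<otimes> dec z \<oplus> dec y \<otimes> dec z)"
  using assms by (simp only: co_mult[symmetric] l_distr dec_in a_closed)
 thus ?thesis using assms by (simp add: co_add co_mult)
qed

lemma mul_addr:
 assumes "x : U" "y : U" "z : U"
 shows "mul x (y + z) = mul x y + mul x z"
proof -
 have "mul (co (dec x)) (co (dec y \<oplus> dec z)) = co (dec x \<otimes> dec y \<oplus> dec x \<otimes> dec z)"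
  using assms by (simp only: co_mult[symmetric] r_distr dec_in a_closed)
 thus ?thesis using assms by (simp add: co_add co_mult)
qed

lemma mul_one [simp]: "x : U ==> mul (co \<one>) x = x" "x : U ==> mul x (co \<one>) = x"
 using co_mult[of \<one> "dec x"] co_mult[of "dec x" \<one>] by simp_all
lemma mul_l_additive: "x : U ==> additive_on U (mul x)"
 by (simp add: additive_on_def mul_addr)
lemma mul_r_additive: "x : U ==> additive_on U (%y. mul y x)"
 by (simp add: additive_on_def mul_addl)
lemma mul_0 [simp]: "x : U ==> mul x 0 = 0" "x : U ==> mul 0 x = 0"
 using additive_on_0[OF mul_l_additive, of x] additive_on_0[OF mul_r_additive, of x] by simp_all
lemma mul_neg: "x : U ==> y : U ==> mul x (- y) = - mul x y" "x : U ==> y : U ==> mul (- x) y = - mul x y"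
 using additive_on_neg[OF mul_l_additive, of x y] additive_on_neg[OF mul_r_additive, of y x] by simp_all
lemma mul_pm: "x : U ==> y : U ==> mul x (pm T s y) = pm T s (mul x y)"
 "x : U ==> y : U ==> mul (pm T s x) y = pm T s (mul x y)"
 by (simp_all add: pm_def mul_neg)

lemma mul_sum: "x : U ==> (!!i. i : I ==> f i : U) ==> mul x (sum f I) = (\<Sum>i \<in> I. mul x (f i))"
 "x : U ==> (!!i. i : I ==> f i : U) ==> mul (sum f I) x = (\<Sum>i \<in> I. mul (f i) x)"
 using additive_on_sum[OF mul_l_additive, of x I f] additive_on_sum[OF mul_r_additive, of x I f] by simp_all

lemma rc_additive: "additive_on U (rc T s)"
 unfolding rc_def by (rule mul_r_additive[OF w_in])
lemma rc_comm: "s ~: T ==> r ~: T ==> s ~= r ==> s < N ==> r < N ==> u : U ==>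
  rc T s (rc (insert s T) r u) = rc T r (rc (insert r T) s u)"
 by (simp add: rc_def mul_assoc w_in w_comm)

lemma lc_additive: "additive_on U (lc T s)"
proof (cases "even (N - 1 - s)")
 case True
 thus ?thesis using mul_l_additive[OF w_in] by (simp add: lc_def[abs_def])
next
 case False
 thus ?thesis using mul_l_additive[OF w_in] by (simp add: lc_def[abs_def] additive_on_def U_neg)
qed

lemma lc_comm:
 assumes "s ~: T" "r ~: T" "s ~= r" "s < N" "r < N" "u : U"
 shows "lc T s (lc (insert s T) r u) = lc T r (lc (insert r T) s u)"
proof -
 obtain S where S: "S = {..<N} - T - {s} - {r}" by blast
 have eqs: "{..<N} - T - {s} = insert r S" "{..<N} - insert s T - {r} = S"
  "{..<N} - T - {r} = insert s S" "{..<N} - insert r T - {s} = S"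
  using assms S by auto
 have "mul (w (insert r S) s) (mul (w S r) u) = mul (w (insert s S) r) (mul (w S s) u)"
  using assms w_comm[of r S s] S by (simp add: mul_assoc[symmetric] w_in)
 thus ?thesis unfolding lc_def eqs using assms(6) by (simp add: mul_neg w_in U_neg)
qed

definition FS :: "(nat set => 'u) set" where
 "FS = {f. (ALL T. f T : U) & (ALL T. f T ~= 0 --> T <=: {..<N})}"

lemma FS_injection: "EX e :: (nat set => 'u) => 'a. inj_on e FS"
proof -
 obtain l :: "'a list => 'a" where l: "inj l" using list_injection[OF infinite_type] by blast
 obtain Ts where Ts: "set Ts = Pow {..<N}" using finite_list[of "Pow {..<N}"] by auto
 have "inj_on (%f. l (map (%T. dec (f T)) Ts)) FS"
 proof (rule inj_onI)
  fix f g assume f: "f : FS" and g: "g : FS" and "l (map (%T. dec (f T)) Ts) = l (map (%T. dec (g T)) Ts)"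
  hence eq: "dec (f T) = dec (g T)" if "T <=: {..<N}" for T using l Ts that by (auto dest: injD)
  show "f = g"
  proof
   fix T
   show "f T = g T"
   proof (cases "T <=: {..<N}")
    case True
    thus ?thesis using arg_cong[OF eq[OF True], of co] f g by (simp add: FS_def)
   next
    case False
    hence "f T = 0" "g T = 0" using f g by (auto simp: FS_def)
    thus ?thesis by simp
   qed
  qed
 qed
 thus ?thesis by blast
qed

definition en :: "(nat set => 'u) => 'a" where "en = (SOME e. inj_on e FS)"
definition de :: "'a => nat set => 'u" where "de = inv_into FS en"

lemma de_en: "f : FS ==> de (en f) = f"
 unfolding de_def en_def using someI_ex[OF FS_injection] by (rule inv_into_f_f)
lemma chain_FS: "chain N i U f ==> f : FS"
 by (auto simp: chain_def FS_def)

text \<open>The free module of chains of degree \<open>i\<close>, with carrier coded into the type of ring elements.\<close>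

definition Kos :: "nat => ('a, 'a) module" where
 "Kos i = \<lparr>carrier = en ` {f. chain N i U f}, mult = (%x y. x), one = en (%T. 0), zero = en (%T. 0),
  add = (%x y. en (%T. de x T + de y T)), smult = (%b x. en (%T. mul (co b) (de x T)))\<rparr>"

lemma chain_zero: "chain N i U (%T. 0)" by (simp add: chain_def U0)
lemma chain_add: "chain N i U f ==> chain N i U g ==> chain N i U (%T. f T + g T)"
 unfolding chain_def by (metis U_add add_0)
lemma chain_neg: "chain N i U f ==> chain N i U (%T. - f T)"
 by (simp add: chain_def U_neg)
lemma chain_smult: assumes "b : U" "chain N i U f" shows "chain N i U (%T. mul b (f T))"
proof -
 have "f T ~= 0" if "mul b (f T) ~= 0" for T using that assms by (metis mul_0(1))
 thus ?thesis using assms by (simp add: chain_def)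
qed
lemma chain_in: "chain N i U f ==> f T : U" by (simp add: chain_def)
lemma Kos_carrier: "x |: (Kos i) <-> (EX f. chain N i U f & x = en f)"
 by (auto simp: Kos_def)
lemma Kos_en [simp]: "chain N i U f ==> en f |: (Kos i)" by (auto simp: Kos_carrier)
lemma Kos_zero: "0[Kos i] = en (%T. 0)" by (simp add: Kos_def)
lemma Kos_add: "chain N i U f ==> chain N i U g ==> en f +[Kos i] en g = en (%T. f T + g T)"
 by (simp add: Kos_def de_en[OF chain_FS])
lemma Kos_smult: "chain N i U f ==> b **[Kos i] en f = en (%T. mul (co b) (f T))"
 by (simp add: Kos_def de_en[OF chain_FS])
lemma en_eq_iff: "chain N i U f ==> chain N j U g ==> en f = en g <-> f = g"
 by (metis chain_FS de_en)
lemma Kos_module: "lmod B (Kos i)"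
proof -
 have "abelian_group (Kos i)"
 proof (rule abelian_groupI)
  fix x assume "x |: (Kos i)"
  then obtain f where f: "chain N i U f" "x = en f" by (auto simp: Kos_carrier)
  show "EX y:carrier (Kos i). y +[Kos i] x = 0[Kos i]"
   using f chain_neg[OF f(1)] by (intro bexI[of _ "en (%T. - f T)"]) (auto simp: Kos_add Kos_zero)
 next
  fix x y z assume "x |: (Kos i)" "y |: (Kos i)" "z |: (Kos i)"
  then obtain f g h where "chain N i U f" "x = en f" "chain N i U g" "y = en g" "chain N i U h" "z = en h"
   by (auto simp: Kos_carrier)
  thus "x +[Kos i] y +[Kos i] z = x +[Kos i] (y +[Kos i] z)"
   by (simp add: Kos_add chain_add add.assoc)
 next
  fix x y assume "x |: (Kos i)" "y |: (Kos i)"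
  then obtain f g where "chain N i U f" "x = en f" "chain N i U g" "y = en g"
   by (auto simp: Kos_carrier)
  thus "x +[Kos i] y |: (Kos i)" "x +[Kos i] y = y +[Kos i] x"
   by (simp_all add: Kos_add chain_add add.commute)
 next
  show "0[Kos i] |: (Kos i)" by (simp add: Kos_zero chain_zero)
  fix x assume "x |: (Kos i)"
  then obtain f where "chain N i U f" "x = en f" by (auto simp: Kos_carrier)
  thus "0[Kos i] +[Kos i] x = x" by (simp add: Kos_zero Kos_add chain_zero)
 qed
 thus ?thesis unfolding left_module_def left_module_axioms_def
 proof (intro conjI allI impI ring_axioms)
  fix a x assume a: "a |: B" and "x |: (Kos i)"
  then obtain f where f: "chain N i U f" "x = en f" by (auto simp: Kos_carrier)
  note sm = chain_smult[OF co_in f(1)]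
  show "a **[Kos i] x |: (Kos i)" using f a sm by (simp add: Kos_smult)
  { fix b assume b: "b |: B"
   show "(a \<oplus> b) **[Kos i] x = a **[Kos i] x +[Kos i] b **[Kos i] x"
    using f a b sm by (simp add: Kos_smult Kos_add co_add mul_addl chain_in)
   show "a \<otimes> b **[Kos i] x = a **[Kos i] (b **[Kos i] x)"
    using f a b sm by (simp add: Kos_smult co_mult mul_assoc chain_in) }
  fix y assume "y |: (Kos i)"
  then obtain g where g: "chain N i U g" "y = en g" by (auto simp: Kos_carrier)
  show "a **[Kos i] (x +[Kos i] y) = a **[Kos i] x +[Kos i] a **[Kos i] y"
   using f g a sm chain_smult[OF co_in g(1)] chain_add[OF f(1) g(1)] by (simp add: Kos_smult Kos_add mul_addr chain_in)
 next
  fix x assume "x |: (Kos i)"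
  then obtain f where f: "chain N i U f" "x = en f" by (auto simp: Kos_carrier)
  thus "\<one> **[Kos i] x = x" by (simp add: Kos_smult chain_in)
 qed
qed

definition Ix :: "nat => nat set set" where "Ix i = {T. T <=: {..<N} & card T = i}"

definition bas :: "nat set => nat set => 'u" where "bas S T = (if T = S then co \<one> else 0)"

lemma finite_Ix [simp]: "finite (Ix i)" by (simp add: Ix_def)
lemma bas_chain: "S : Ix i ==> chain N i U (bas S)" by (auto simp: chain_def bas_def Ix_def U0)
lemma chain_zero_outside: "chain N i U f ==> T ~: Ix i ==> f T = 0" by (auto simp: chain_def Ix_def)
text \<open>A map out of a free module is determined by its values on the basis.\<close>

lemma Kos_hom_expand:
 assumes M: "lmod B M" and F: "mhom B (Kos i) M F" and f: "chain N i U f"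
 shows "F (en f) = finsum M (%S. dec (f S) **[M] F (en (bas S))) (Ix i)"
proof -
 interpret M: left_module B M by fact
 interpret K: left_module B "Kos i" by (rule Kos_module)
 have tr: "chain N i U (%T. if T : J then f T else 0)" for J
  using f U0 by (auto simp: chain_def)
 have "F (en (%T. if T : J then f T else 0)) = finsum M (%S. dec (f S) **[M] F (en (bas S))) J"
  if "finite J" "J <=: Ix i" for J
  using that
 proof (induction J rule: finite_induct)
  case empty
  thus ?case using mhom_zero[OF K.left_module_axioms M F] by (simp add: Kos_zero)
 next
  case (insert S J)
  have cl: "F (en (bas S')) |: M" if "S' : insert S J" for S'
   using that insert.prems mhomD(1)[OF F] bas_chain by auto
  have "(%T. if T : insert S J then f T else 0) = (%T. mul (co (dec (f S))) (bas S T) + (if T : J then f T else 0))"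
   using insert.hyps(2) chain_in[OF f] by (auto simp: bas_def fun_eq_iff)
  hence "en (%T. if T : insert S J then f T else 0) =
   dec (f S) **[Kos i] en (bas S) +[Kos i] en (%T. if T : J then f T else 0)"
   using insert.prems bas_chain[of S i] chain_smult[of "f S" i "bas S"] chain_in[OF f]
   by (simp add: Kos_smult Kos_add tr)
  also have "F ... = dec (f S) **[M] F (en (bas S)) +[M] F (en (%T. if T : J then f T else 0))"
   using insert.prems bas_chain[of S i] chain_in[OF f] by (simp add: mhomD[OF F] K.smult_closed tr)
  finally show ?case using insert chain_in[OF f] cl by (simp add: M.smult_closed Pi_def)
 qed
 from this[of "Ix i"] have "F (en (%T. if T : Ix i then f T else 0)) = finsum M (%S. dec (f S) **[M] F (en (bas S))) (Ix i)" by simp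
 moreover have "(%T. if T : Ix i then f T else 0) = f" using chain_zero_outside[OF f] by auto
 ultimately show ?thesis by simp
qed

lemma Kos_hom_exists:
 assumes M: "lmod B M" and m: "!!S. S : Ix i ==> m S |: M"
 shows "mhom B (Kos i) M (%x. finsum M (%S. dec (de x S) **[M] m S) (Ix i))"
proof -
 interpret M: left_module B M by fact
 let ?h = "%x. finsum M (%S. dec (de x S) **[M] m S) (Ix i)"
 have h: "?h (en f) = finsum M (%S. dec (f S) **[M] m S) (Ix i)" if "chain N i U f" for f
  using de_en[OF chain_FS[OF that]] by simp
 show ?thesis
 proof (rule mhomI)
  fix x assume "x |: (Kos i)"
  then obtain f where f: "chain N i U f" "x = en f" by (auto simp: Kos_carrier)
  have cl: "dec (f S) **[M] m S |: M" if "S : Ix i" for S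
   using m[OF that] chain_in[OF f(1)] by (simp add: M.smult_closed)
  show "?h x |: M" using f h cl by (simp add: Pi_def)
  { fix a assume a: "a |: B"
   have ch: "chain N i U (%T. mul (co a) (f T))" by (rule chain_smult[OF co_in[OF a] f(1)])
   have "?h (a **[Kos i] x) = finsum M (%S. dec (mul (co a) (f S)) **[M] m S) (Ix i)"
    using f h[OF ch] by (simp add: Kos_smult)
   also have "... = finsum M (%S. a **[M] (dec (f S) **[M] m S)) (Ix i)"
    using a chain_in[OF f(1)] m cl by (intro M.M.finsum_cong') (auto simp: mul_dec M.smult_assoc M.smult_closed)
   also have "... = a **[M] ?h x" using f h a cl by (simp add: M.smult_finsum)
   finally show "?h (a **[Kos i] x) = a **[M] ?h x" . }
  fix y assume "y |: (Kos i)"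
  then obtain g where g: "chain N i U g" "y = en g" by (auto simp: Kos_carrier)
  have cl2: "dec (g S) **[M] m S |: M" if "S : Ix i" for S
   using m[OF that] chain_in[OF g(1)] by (simp add: M.smult_closed)
  have "?h (x +[Kos i] y) = finsum M (%S. dec (f S + g S) **[M] m S) (Ix i)"
   using f g h[OF chain_add[OF f(1) g(1)]] by (simp add: Kos_add)
  also have "... = finsum M (%S. dec (f S) **[M] m S +[M] dec (g S) **[M] m S) (Ix i)"
   using chain_in[OF f(1)] chain_in[OF g(1)] m cl cl2 by (intro M.M.finsum_cong') (auto simp: dec_add M.smult_l_distr)
  also have "... = ?h x +[M] ?h y" using f g h cl cl2 by (simp add: M.M.finsum_addf Pi_def)
  finally show "?h (x +[Kos i] y) = ?h x +[M] ?h y" .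
 qed
qed

lemma Kos_proj: "proj B (Kos i)"
proof (rule projI[OF Kos_module])
 fix M K :: "('a, 'a) module" and g f
 assume h: "lmod B M" "lmod B K" "mhom B M K g" "g ` carrier M = carrier K" "mhom B (Kos i) K f"
 have "EX m. m |: M & g m = f (en (bas S))" if "S : Ix i" for S
  using mhomD(1)[OF h(5), of "en (bas S)"] bas_chain[OF that] h(4) by force
 then obtain m where m: "!!S. S : Ix i ==> m S |: M" "!!S. S : Ix i ==> g (m S) = f (en (bas S))"
  by metis
 let ?h = "%x. finsum M (%S. dec (de x S) **[M] m S) (Ix i)"
 interpret M: left_module B M by fact
 interpret K: left_module B K by fact
 have "g (?h x) = f x" if "x |: (Kos i)" for x
 proof -
  from that obtain \<chi> where c: "chain N i U \<chi>" "x = en \<chi>" by (auto simp: Kos_carrier)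
  have d: "de x = \<chi>" using c de_en[OF chain_FS] by blast
  have "g (?h x) = finsum K (%S. g (dec (\<chi> S) **[M] m S)) (Ix i)"
   unfolding d by (rule mhom_finsum[OF h(1-3)]) (simp add: M.smult_closed chain_in[OF c(1)] m)
  also have "... = finsum K (%S. dec (\<chi> S) **[K] f (en (bas S))) (Ix i)"
   using mhomD(1)[OF h(5)] bas_chain by (intro K.M.finsum_cong') (auto simp: mhomD[OF h(3)] m chain_in[OF c(1)] K.smult_closed)
  also have "... = f x" using Kos_hom_expand[OF h(2,5) c(1)] c(2) by simp
  finally show ?thesis .
 qed
 thus "EX k. mhom B (Kos i) M k & (ALL x:carrier (Kos i). g (k x) = f x)"
  using Kos_hom_exists[OF h(1), of i m] m(1) by blast
qed

definition kdiff :: "'a => 'a" where "kdiff x = en (kd N rc (de x))"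

lemma kd_chain:
 assumes c: "!!T s. additive_on U (c T s)" and f: "chain N (Suc i) U f"
 shows "chain N i U (kd N c f)"
proof -
 have "T <=: {..<N} & card T = i" if "kd N c f T ~= 0" for T
 proof -
  from that obtain s where s: "s : {..<N} - T" "pm T s (c T s (f (insert s T))) ~= 0"
   unfolding kd_def by (meson sum.not_neutral_contains_not_neutral)
  have "f (insert s T) ~= 0" using s(2) additive_on_0[OF c] by auto
  hence "insert s T <=: {..<N}" "card (insert s T) = Suc i" using f by (auto simp: chain_def)
  thus ?thesis using s(1) finite_subset[of T "{..<N}"] by auto
 qed
 moreover have "kd N c f T : U" for T
  unfolding kd_def using c f by (intro U_sum U_pm) (auto simp: additive_on_def chain_def)
 ultimately show ?thesis by (simp add: chain_def)
qed

lemma kdiff_en: "chain N (Suc i) U f ==> kdiff (en f) = en (kd N rc f)"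
 by (simp add: kdiff_def de_en[OF chain_FS])
lemma kdiff_hom: "mhom B (Kos (Suc i)) (Kos i) kdiff"
proof (rule mhomI)
 fix x assume "x |: (Kos (Suc i))"
 then obtain f where f: "chain N (Suc i) U f" "x = en f" by (auto simp: Kos_carrier)
 note kf = kd_chain[OF rc_additive f(1)]
 show "kdiff x |: (Kos i)" using f kdiff_en kf by simp
 { fix a assume a: "a |: B"
  have "kd N rc (%T. mul (co a) (f T)) = (%T. mul (co a) (kd N rc f T))"
   using a chain_in[OF f(1)] by (auto simp: kd_def fun_eq_iff mul_sum U_pm rc_def mul_pm mul_assoc w_in)
  thus "kdiff (a **[Kos (Suc i)] x) = a **[Kos i] kdiff x"
   using f kf kdiff_en chain_smult[OF co_in[OF a] f(1)] by (simp add: Kos_smult) }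
 fix y assume "y |: (Kos (Suc i))"
 then obtain g where g: "chain N (Suc i) U g" "y = en g" by (auto simp: Kos_carrier)
 have "kd N rc (%T. f T + g T) = (%T. kd N rc f T + kd N rc g T)"
  by (rule ext, rule kd_add) (rule rc_additive chain_in[OF f(1)] chain_in[OF g(1)])+
 thus "kdiff (x +[Kos (Suc i)] y) = kdiff x +[Kos i] kdiff y"
  using f g kf kd_chain[OF rc_additive g(1)] kdiff_en chain_add[OF f(1) g(1)] by (simp add: Kos_add)
qed

lemma chain_finite: "chain N i U f ==> f T ~= 0 ==> finite T"
 by (meson chain_def finite_lessThan finite_subset)
lemma kd_kd_chain:
 assumes c: "!!T s. additive_on U (c T s)"
  and comm: "!!T s r u. s ~: T ==> r ~: T ==> s ~= r ==> s < N ==> r < N ==> u : U ==>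
   c T s (c (insert s T) r u) = c T r (c (insert r T) s u)"
  and f: "chain N (Suc (Suc i)) U f"
 shows "kd N c (kd N c f) = (%T. 0)"
proof
 fix T
 have "chain N i U (kd N c (kd N c f))" by (intro kd_chain c f)
 thus "kd N c (kd N c f) T = 0"
  using kd_kd[where c = c and f = f and T = T and N = N, OF c comm chain_in[OF f]] chain_finite by blast
qed

end

context koszul
begin

lemma degree_zero_image:
 assumes c: "!!T s. additive_on U (c T s)" and f: "chain N 0 U f"
 shows "f {} : span_below c U {} N <-> (EX g. chain N (Suc 0) U g & f = kd N c g)"
proof
 assume "f {} : span_below c U {} N"
 then obtain g where g: "!!s. g s : U" "f {} = (\<Sum>s<N. c {} s (g s))" by (auto simp: span_below_def)
 define g2 where "g2 T = (\<Sum>s \<in> {s. s < N & T = {s}}. g s)" for T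
 have g2s: "g2 {s} = g s" if "s < N" for s
 proof -
  have "{r. r < N & {s} = {r}} = {s}" using that by auto
  thus ?thesis by (simp add: g2_def)
 qed
 have g20: "T <=: {..<N} & card T = Suc 0" if "g2 T ~= 0" for T
 proof -
  have "{s. s < N & T = {s}} ~= {}" using that unfolding g2_def by (metis sum.empty)
  thus ?thesis by auto
 qed
 have ch: "chain N (Suc 0) U g2" using g20 U_sum[of _ g] g(1) by (auto simp: chain_def g2_def)
 have "f T = kd N c g2 T" for T
 proof (cases "T = {}")
  case True
  thus ?thesis using g2s g(2) by (simp add: kd_def pm_def)
 next
  case False
  have "T ~: Ix 0" using False finite_subset[of T "{..<N}"] by (auto simp: Ix_def)
  hence "f T = 0" "kd N c g2 T = 0"
   using chain_zero_outside[OF f] chain_zero_outside[OF kd_chain[OF c ch]] by auto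
  thus ?thesis by simp
 qed
 thus "EX g. chain N (Suc 0) U g & f = kd N c g" using ch by blast
next
 assume "EX g. chain N (Suc 0) U g & f = kd N c g"
 then obtain g where g: "chain N (Suc 0) U g" "f = kd N c g" by blast
 hence "f {} = (\<Sum>s<N. c {} s (g {s}))" by (simp add: kd_def pm_def)
 thus "f {} : span_below c U {} N" using chain_in[OF g(1)] by (auto simp: span_below_def)
qed

lemma chain_beyond: "i > N ==> chain N i U f ==> f = (%T. 0)"
 by (rule ext, rule ccontr) (metis (no_types, lifting) card_lessThan card_mono chain_def finite_lessThan leD)
lemma Kos_beyond: assumes "i > N" shows "carrier (Kos i) = {0[Kos i]}"
proof -
 have "{f. chain N i U f} = {%T. 0}" using chain_beyond[OF assms] chain_zero[of i] by blast
 thus ?thesis by (simp add: Kos_def)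
qed

section \<open>The dual complex\<close>

lemma regular_left_module: "lmod B (regular_module B)"
proof -
 have "abelian_group (regular_module B)"
  by (rule abelian_groupI) (auto simp: regular_module_def a_ac intro!: bexI[of _ "\<ominus> _"] l_neg)
 thus ?thesis
  by (auto simp: left_module_def left_module_axioms_def regular_module_def ring_axioms l_distr r_distr m_assoc)
qed

lemma regular_simps [simp]: "carrier (regular_module B) = carrier B" "zero (regular_module B) = \<zero>"
 "add (regular_module B) x y = x \<oplus> y" "smult (regular_module B) a x = a \<otimes> x"
 by (simp_all add: regular_module_def)

lemma co_finsum:
 assumes "!!i. i : I ==> f i |: B"
 shows "co (finsum (regular_module B) f I) = (\<Sum>i \<in> I. co (f i))"
proof -
 interpret R: left_module B "regular_module B" by (rule regular_left_module)
 have "finsum (regular_module B) f I |: B & co (finsum (regular_module B) f I) = (\<Sum>i \<in> I. co (f i))"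
  using assms
 proof (induction I rule: infinite_finite_induct)
  case (insert i I)
  thus ?case by (simp add: R.M.finsum_insert Pi_def co_add)
 qed auto
 thus ?thesis by blast
qed

definition dual_hom :: "nat => (nat set => 'u) => 'a => 'a" where
 "dual_hom i psi x = dec (\<Sum>S \<in> Ix i. mul (de x S) (psi S))"

definition dual_chain :: "nat => ('a => 'a) => nat set => 'u" where
 "dual_chain i F S = (if S : Ix i then co (F (en (bas S))) else 0)"

lemma dual_chain_chain:
 assumes "mhom B (Kos i) (regular_module B) F"
 shows "chain N i U (dual_chain i F)"
 using mhomD(1)[OF assms Kos_en[OF bas_chain]] by (auto simp: chain_def dual_chain_def Ix_def U0)

lemma dual_hom_chain:
 assumes F: "mhom B (Kos i) (regular_module B) F" and x: "x |: (Kos i)"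
 shows "F x = dual_hom i (dual_chain i F) x"
proof -
 obtain f where f: "chain N i U f" "x = en f" using x by (auto simp: Kos_carrier)
 have cl: "F (en (bas S)) |: B" if "S : Ix i" for S
  using mhomD(1)[OF F Kos_en[OF bas_chain[OF that]]] by simp
 have "co (F x) = (\<Sum>S \<in> Ix i. co (dec (f S) \<otimes> F (en (bas S))))"
  unfolding f(2) Kos_hom_expand[OF regular_left_module F f(1)]
  by (subst co_finsum) (simp_all add: cl chain_in[OF f(1)])
 also have "... = (\<Sum>S \<in> Ix i. mul (f S) (dual_chain i F S))"
  by (rule sum.cong) (simp_all add: cl chain_in[OF f(1)] co_mult dual_chain_def)
 finally have "co (F x) = (\<Sum>S \<in> Ix i. mul (de x S) (dual_chain i F S))" using de_en[OF chain_FS[OF f(1)]] f(2) by simp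
 thus ?thesis using dec_co[of "F x"] mhomD(1)[OF F x] by (simp add: dual_hom_def)
qed

lemma dual_hom_hom:
 assumes "chain N i U psi"
 shows "mhom B (Kos i) (regular_module B) (dual_hom i psi)"
proof -
 have "mhom B (Kos i) (regular_module B) (%x. finsum (regular_module B) (%S. dec (de x S) **[regular_module B] dec (psi S)) (Ix i))"
  by (rule Kos_hom_exists[OF regular_left_module]) (simp add: chain_in[OF assms])
 thus ?thesis
 proof (rule mhom_cong[OF _ Kos_module])
  fix x assume x: "x |: (Kos i)"
  then obtain f where f: "chain N i U f" "x = en f" by (auto simp: Kos_carrier)
  have d: "de x S : U" for S using f de_en[OF chain_FS[OF f(1)]] chain_in[OF f(1)] by simp
  let ?s = "finsum (regular_module B) (%S. dec (de x S) **[regular_module B] dec (psi S)) (Ix i)"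
  interpret R: left_module B "regular_module B" by (rule regular_left_module)
  have "?s |: (regular_module B)" by (rule R.M.finsum_closed) (simp add: Pi_def d chain_in[OF assms])
  moreover have "co ?s = (\<Sum>S \<in> Ix i. mul (de x S) (psi S))"
   by (subst co_finsum) (simp_all add: d chain_in[OF assms] co_mult)
  ultimately show "?s = dual_hom i psi x" unfolding dual_hom_def using dec_co[of ?s] by simp
 qed
qed

lemma dual_hom_en: "chain N i U f ==> dual_hom i psi (en f) = dec (\<Sum>S \<in> Ix i. mul (f S) (psi S))"
 by (simp add: dual_hom_def de_en[OF chain_FS])
lemma dual_hom_bas:
 assumes psi: "chain N i U psi" and S: "S : Ix i"
 shows "dual_hom i psi (en (bas S)) = dec (psi S)"
proof -
 have "(\<Sum>T \<in> Ix i. mul (bas S T) (psi T)) = (\<Sum>T \<in> Ix i. if T = S then psi S else 0)"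
  by (rule sum.cong) (auto simp: bas_def chain_in[OF psi])
 also have "... = psi S" using S by simp
 finally show ?thesis by (simp add: dual_hom_en[OF bas_chain[OF S]])
qed

definition dstar :: "(nat set => 'u) => nat set => 'u" where
 "dstar psi S = (\<Sum>s \<in> S. pm (S - {s}) s (mul (w (S - {s}) s) (psi (S - {s}))))"

text \<open>Dualising turns a right multiplication into a left one and a subset into its complement.\<close>

lemma dual_hom_kdiff:
 assumes psi: "chain N i U psi" and f: "chain N (Suc i) U f"
 shows "dual_hom i psi (kdiff (en f)) = dual_hom (Suc i) (dstar psi) (en f)"
proof -
 note fU = chain_in[OF f] and psiU = chain_in[OF psi]
 let ?g = "%T s. pm T s (mul (f (insert s T)) (mul (w T s) (psi T)))"
 have fin: "finite S" if "S : Ix j" for S j using that finite_subset[of S "{..<N}"] by (auto simp: Ix_def)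
 have "(\<Sum>T \<in> Ix i. mul (kd N rc f T) (psi T)) = (\<Sum>T \<in> Ix i. \<Sum>s \<in> {..<N} - T. ?g T s)"
  by (rule sum.cong) (simp_all add: kd_def mul_sum(2) U_pm rc_def w_in fU psiU mul_pm mul_assoc)
 also have "... = (\<Sum>(T, s) \<in> (SIGMA T : Ix i. {..<N} - T). ?g T s)"
  by (rule sum.Sigma) simp_all
 also have "... = (\<Sum>(S, s) \<in> (SIGMA S : Ix (Suc i). S). pm (S - {s}) s (mul (f S) (mul (w (S - {s}) s) (psi (S - {s})))))"
 proof (rule sum.reindex_bij_witness[where i = "%(S, s). (S - {s}, s)" and j = "%(T, s). (insert s T, s)"])
  fix a assume "a : (SIGMA T : Ix i. {..<N} - T)"
  then obtain T s where a: "a = (T, s)" "T : Ix i" "s < N" "s ~: T" by auto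
  thus "(case case a of (T, s) => (insert s T, s) of (S, s) => (S - {s}, s)) = a" by simp
  show "(case a of (T, s) => (insert s T, s)) : (SIGMA S : Ix (Suc i). S)"
   using a fin[of T i] by (auto simp: Ix_def)
  show "(case case a of (T, s) => (insert s T, s) of (S, s) => pm (S - {s}) s (mul (f S) (mul (w (S - {s}) s) (psi (S - {s}))))) =
    (case a of (T, s) => ?g T s)" using a by simp
 next
  fix b assume "b : (SIGMA S : Ix (Suc i). S)"
  then obtain S s where b: "b = (S, s)" "S : Ix (Suc i)" "s : S" by auto
  thus "(case case b of (S, s) => (S - {s}, s) of (T, s) => (insert s T, s)) = b" by (simp add: insert_absorb)
  show "(case b of (S, s) => (S - {s}, s)) : (SIGMA T : Ix i. {..<N} - T)" using b by (auto simp: Ix_def)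
 qed
 also have "... = (\<Sum>S \<in> Ix (Suc i). \<Sum>s \<in> S. pm (S - {s}) s (mul (f S) (mul (w (S - {s}) s) (psi (S - {s})))))"
  by (rule sum.Sigma[symmetric]) (use fin in auto)
 also have "... = (\<Sum>S \<in> Ix (Suc i). mul (f S) (dstar psi S))"
  by (rule sum.cong) (simp_all add: dstar_def mul_sum(1) U_pm fU psiU w_in mul_pm)
 finally show ?thesis
  using kdiff_en[OF f] dual_hom_en[OF kd_chain[OF rc_additive f]] dual_hom_en[OF f] by simp
qed

definition cmp :: "(nat set => 'u) => nat set => 'u" where
 "cmp psi T = (if T <=: {..<N} then psi ({..<N} - T) else 0)"

lemma cmp_chain: assumes "chain N i U psi" "i <= N" shows "chain N (N - i) U (cmp psi)"
proof -
 have "card T = N - i" if "T <=: {..<N}" "psi ({..<N} - T) ~= 0" for T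
 proof -
  have "card ({..<N} - T) = i" using assms(1) that(2) by (simp add: chain_def)
  moreover have "card ({..<N} - T) = N - card T" "card T <= N"
   using that(1) card_Diff_subset[of T "{..<N}"] finite_subset[OF that(1)] card_mono[OF _ that(1)] by auto
  ultimately show ?thesis by simp
 qed
 thus ?thesis using assms(1) U0 by (auto simp: chain_def cmp_def split: if_splits)
qed

lemma cmp_cmp: "chain N i U psi ==> cmp (cmp psi) = psi"
 by (rule ext) (auto simp: cmp_def double_diff chain_def)
lemma dstar_cmp:
 assumes S: "S <=: {..<N}" and psi: "!!T. psi T : U"
 shows "dstar psi S = kd N lc (cmp psi) ({..<N} - S)"
proof -
 have *: "{..<N} - ({..<N} - S) = S" using S by auto
 have "pm (S - {s}) s (mul (w (S - {s}) s) (psi (S - {s}))) =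
   pm ({..<N} - S) s (lc ({..<N} - S) s (cmp psi (insert s ({..<N} - S))))" if s: "s : S" for s
 proof -
  have sN: "s < N" using s S by auto
  have "{..<N} - insert s ({..<N} - S) = S - {s}" "insert s ({..<N} - S) <=: {..<N}" using s S by auto
  hence c: "cmp psi (insert s ({..<N} - S)) = psi (S - {s})" by (simp add: cmp_def)
  let ?X = "{u : {..<N} - S. s < u}" and ?Y = "{u : S - {s}. s < u}"
  have "?X \<union> ?Y = {s<..<N}" using S by auto
  moreover have "?X \<inter> ?Y = {}" by auto
  moreover have "finite ?X" "finite ?Y" using finite_subset[OF S] by simp_all
  ultimately have "card ?X + card ?Y = N - Suc s" by (metis card_Un_disjoint card_greaterThanLessThan)
  hence "N - 1 - s = card ?X + card ?Y" by simp
  hence ev: "even (N - 1 - s) <-> (even (card ?X) <-> even (card ?Y))" by (simp only: even_add)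
  have sgn: "(if b then m else - m) = (if a then (if a = b then m else - m) else - (if a = b then m else - m))"
   for a b and m :: 'u by simp
  show ?thesis unfolding c lc_def * pm_def ev by (rule sgn)
 qed
 thus ?thesis unfolding kd_def dstar_def * by (intro sum.cong refl)
qed

end

section \<open>The Gorenstein property and the lower bound for the global dimension\<close>

context koszul_regular
begin

abbreviation "aug \<equiv> augmentation B"

lemma rc_exact:
 assumes "chain N (Suc i) U f" "kd N rc f = (%T. 0)"
 shows "EX g. chain N (Suc (Suc i)) U g & f = kd N rc g"
 by (rule cube_exact[OF rc_additive rc_comm reg_right assms(1)]) (simp_all add: assms(2))

lemma lc_exact:
 assumes "chain N (Suc i) U f" "kd N lc f = (%T. 0)"
 shows "EX g. chain N (Suc (Suc i)) U g & f = kd N lc g"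
 by (rule cube_exact[OF lc_additive lc_comm reg_left assms(1)]) (simp_all add: assms(2))

lemma aug_zero: "aug \<zero> = 0"
 using aug_add[of \<zero> \<zero>] by simp
lemma trivial_simps [simp]: "carrier (trivial_module B) = UNIV" "zero (trivial_module B) = 0"
 "add (trivial_module B) x y = x + y" "smult (trivial_module B) a z = aug a * z"
 by (simp_all add: trivial_module_def)

lemma trivial_left_module: "lmod B (trivial_module B)"
proof -
 have "abelian_group (trivial_module B)"
  by (rule abelian_groupI) (auto intro: exI[of _ "- _"])
 thus ?thesis
  by (auto simp: left_module_def left_module_axioms_def ring_axioms aug_add aug_mult aug_one algebra_simps)
qed

definition eps :: "'a => complex" where "eps x = aug (dec (de x {}))"

lemma eps_en: "chain N 0 U f ==> eps (en f) = aug (dec (f {}))"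
 by (simp add: eps_def de_en[OF chain_FS])

abbreviation "kres i \<equiv> restrict kdiff (carrier (Kos (Suc i)))"
abbreviation "eres \<equiv> restrict eps (carrier (Kos 0))"

lemma kdiff_zero_iff:
 assumes "chain N (Suc i) U f"
 shows "kdiff (en f) = 0[Kos i] <-> kd N rc f = (%T. 0)"
 using kdiff_en[OF assms] en_eq_iff[OF kd_chain[OF rc_additive assms] chain_zero] by (simp add: Kos_zero)

text \<open>Exactness in positive degrees is \<open>cube_exact\<close> for right multiplications; in degree zero the image is the augmentation ideal.\<close>

lemma koszul_resolution: "projective_resolution B (trivial_module B) Kos kres eres"
proof (rule projective_resolutionI)
 show "proj B (Kos i)" for i by (rule Kos_proj)
 show "mhom B (Kos (Suc i)) (Kos i) kdiff" for i by (rule kdiff_hom)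
 show "mhom B (Kos 0) (trivial_module B) eps"
 proof (rule mhomI)
  fix x assume "x |: (Kos 0)"
  then obtain f where f: "chain N 0 U f" "x = en f" by (auto simp: Kos_carrier)
  show "eps x |: (trivial_module B)" by simp
  show "eps (a **[Kos 0] x) = a **[trivial_module B] eps x" if "a |: B" for a
   using f that chain_smult[OF co_in[OF that] f(1)] by (simp add: Kos_smult eps_en mul_dec chain_in[OF f(1)] aug_mult)
  fix y assume "y |: (Kos 0)"
  then obtain g where g: "chain N 0 U g" "y = en g" by (auto simp: Kos_carrier)
  show "eps (x +[Kos 0] y) = eps x +[trivial_module B] eps y"
   using f g chain_add[OF f(1) g(1)] by (simp add: Kos_add eps_en dec_add chain_in[OF f(1)] chain_in[OF g(1)] aug_add)
 qed
 show "eps ` carrier (Kos 0) = carrier (trivial_module B)"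
 proof (intro equalityI subsetI)
  fix z :: complex
  obtain a where a: "a |: B" "aug a = z" using aug_surj by blast
  define f where "f T = (if T = {} then co a else 0)" for T :: "nat set"
  have f: "chain N 0 U f" using a by (auto simp: chain_def f_def U0)
  have "eps (en f) = z" using eps_en[OF f] a by (simp add: f_def)
  thus "z : eps ` carrier (Kos 0)" using Kos_en[OF f] by blast
 qed simp
 show "eps x = 0[trivial_module B] <-> x : kdiff ` carrier (Kos 1)" if "x |: (Kos 0)" for x
 proof -
  from that obtain f where f: "chain N 0 U f" "x = en f" by (auto simp: Kos_carrier)
  have "eps x = 0 <-> f {} : span_below rc U {} N"
   using f eps_en[OF f(1)] aug_right[of "dec (f {})"] chain_in[OF f(1)] by simp
  also have "... <-> (EX g. chain N (Suc 0) U g & f = kd N rc g)" by (rule degree_zero_image[OF rc_additive f(1)])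
  also have "... <-> x : kdiff ` carrier (Kos 1)"
  proof
   assume "EX g. chain N (Suc 0) U g & f = kd N rc g"
   then obtain g where g: "chain N (Suc 0) U g" "f = kd N rc g" by blast
   thus "x : kdiff ` carrier (Kos 1)" using kdiff_en[OF g(1)] f(2) by (intro image_eqI[of _ _ "en g"]) simp_all
  next
   assume "x : kdiff ` carrier (Kos 1)"
   then obtain g where g: "chain N (Suc 0) U g" "x = kdiff (en g)" by (auto simp: Kos_carrier)
   hence "f = kd N rc g" using f kdiff_en[OF g(1)] en_eq_iff[OF f(1) kd_chain[OF rc_additive g(1)]] by simp
   thus "EX g. chain N (Suc 0) U g & f = kd N rc g" using g(1) by blast
  qed
  finally show ?thesis by simp
 qed
 show "kdiff y = 0[Kos i] <-> y : kdiff ` carrier (Kos (Suc (Suc i)))" if "y |: (Kos (Suc i))" for i y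
 proof -
  from that obtain f where f: "chain N (Suc i) U f" "y = en f" by (auto simp: Kos_carrier)
  show ?thesis
  proof
   assume "kdiff y = 0[Kos i]"
   hence "kd N rc f = (%T. 0)" using kdiff_zero_iff[OF f(1)] f(2) by simp
   then obtain g where g: "chain N (Suc (Suc i)) U g" "f = kd N rc g" using rc_exact[OF f(1)] by blast
   thus "y : kdiff ` carrier (Kos (Suc (Suc i)))" using kdiff_en[OF g(1)] f(2) by (intro image_eqI[of _ _ "en g"]) simp_all
  next
   assume "y : kdiff ` carrier (Kos (Suc (Suc i)))"
   then obtain g where g: "chain N (Suc (Suc i)) U g" "y = kdiff (en g)" by (auto simp: Kos_carrier)
   have "kd N rc (kd N rc g) = (%T. 0)" by (rule kd_kd_chain[OF rc_additive rc_comm g(1)])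
   thus "kdiff y = 0[Kos i]"
    using g kdiff_en[OF g(1)] kdiff_zero_iff[OF kd_chain[OF rc_additive g(1)]] by simp
  qed
 qed
qed

lemma left_hom_regular:
 "F : left_hom B (Kos i) (regular_module B) <-> mhom B (Kos i) (regular_module B) F & F : extensional (carrier (Kos i))"
 by (rule left_hom_iff[OF Kos_module])

lemma cocycle_iff: "F : cocycles B Kos kres i <->
  F : left_hom B (Kos i) (regular_module B) & (ALL x:carrier (Kos (Suc i)). F (kdiff x) = \<zero>)"
 by (auto simp: cocycles_def)

lemma coboundary_Suc_iff: "F : coboundaries B Kos kres (Suc i) <->
  (EX g:left_hom B (Kos i) (regular_module B). F = (\<lambda>x \<in> carrier (Kos (Suc i)). g (kdiff x)))"
proof -
 have "(\<lambda>x \<in> carrier (Kos (Suc i)). g (kres i x)) = (\<lambda>x \<in> carrier (Kos (Suc i)). g (kdiff x))" for g :: "'a => 'a"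
  by (auto simp: restrict_def)
 thus ?thesis by auto
qed

lemma coboundary_cocycle:
 assumes "F : coboundaries B Kos kres i"
 shows "F : cocycles B Kos kres i"
proof (cases i)
 case 0
 hence F: "F = (\<lambda>x \<in> carrier (Kos 0). \<zero>)" using assms by simp
 have "mhom B (Kos 0) (regular_module B) (%x. \<zero>)" by (simp add: mhom_def)
 from restrict_left_hom[OF Kos_module this] show ?thesis
  using F 0 mhomD(1)[OF kdiff_hom] by (simp add: cocycle_iff)
next
 case (Suc j)
 then obtain g where g: "g : left_hom B (Kos j) (regular_module B)" "F = (\<lambda>x \<in> carrier (Kos (Suc j)). g (kdiff x))"
  using assms coboundary_Suc_iff by auto
 have gh: "mhom B (Kos j) (regular_module B) g" using g(1) by (rule left_hom_mhom)
 have "F : left_hom B (Kos (Suc j)) (regular_module B)"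
  unfolding g(2) by (rule restrict_left_hom[OF Kos_module mhom_comp[OF kdiff_hom gh]])
 moreover have "F (kdiff x) = \<zero>" if x: "x : carrier (Kos (Suc (Suc j)))" for x
 proof -
  obtain f where f: "chain N (Suc (Suc j)) U f" "x = en f" using x by (auto simp: Kos_carrier)
  have "kd N rc (kd N rc f) = (%T. 0)" by (rule kd_kd_chain[OF rc_additive rc_comm f(1)])
  hence "kdiff (kdiff x) = 0[Kos j]"
   using f kdiff_en[OF f(1)] kdiff_zero_iff[OF kd_chain[OF rc_additive f(1)]] by simp
  thus ?thesis using mhomD(1)[OF kdiff_hom x] mhom_zero[OF Kos_module regular_left_module gh] by (simp add: g(2))
 qed
 ultimately show ?thesis using Suc by (simp add: cocycle_iff)
qed

text \<open>A cocycle given by \<open>psi\<close> is a cycle of the dual cube.\<close>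

lemma cocycle_dual:
 assumes F: "F : cocycles B Kos kres i" and i: "i < N"
 shows "kd N lc (cmp (dual_chain i F)) = (%T. 0)"
proof
 fix T
 have Fh: "mhom B (Kos i) (regular_module B) F" using F by (auto simp: cocycle_iff intro: left_hom_mhom)
 let ?psi = "dual_chain i F"
 have psi: "chain N i U ?psi" by (rule dual_chain_chain[OF Fh])
 have ch: "chain N (Suc (N - Suc i)) U (cmp ?psi)" using cmp_chain[OF psi] i by (simp add: Suc_diff_Suc)
 note kch = kd_chain[OF lc_additive ch]
 have dsU: "chain N (Suc i) U (%S. if S : Ix (Suc i) then dstar ?psi S else 0)"
  using U0 chain_in[OF psi] by (auto simp: chain_def Ix_def dstar_def w_in intro!: U_sum U_pm)
 show "kd N lc (cmp ?psi) T = 0"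
 proof (cases "{..<N} - T : Ix (Suc i) & T <=: {..<N}")
  case True
  let ?S = "{..<N} - T"
  have T: "T = {..<N} - ?S" using True by auto
  have "dual_hom i ?psi (kdiff (en (bas ?S))) = \<zero>"
   using F bas_chain[of ?S "Suc i"] True dual_hom_chain[OF Fh, of "kdiff (en (bas ?S))"] mhomD(1)[OF kdiff_hom]
   by (simp add: cocycle_iff)
  hence "dual_hom (Suc i) (dstar ?psi) (en (bas ?S)) = \<zero>"
   using dual_hom_kdiff[OF psi bas_chain[of ?S]] True by simp
  moreover have "dual_hom (Suc i) (dstar ?psi) (en (bas ?S)) =
    dual_hom (Suc i) (%S. if S : Ix (Suc i) then dstar ?psi S else 0) (en (bas ?S))"
   unfolding dual_hom_def by (intro arg_cong[of _ _ dec] sum.cong) auto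
  moreover have "... = dec (dstar ?psi ?S)" using dual_hom_bas[OF dsU] True by simp
  ultimately have "dec (dstar ?psi ?S) = \<zero>" by simp
  moreover have "dstar ?psi ?S : U" using chain_in[OF dsU, of ?S] True by simp
  ultimately have "dstar ?psi ?S = 0" by (metis co_dec co_zero)
  thus ?thesis using dstar_cmp[of ?S ?psi] chain_in[OF psi] T by simp
 next
  case False
  have "T ~: Ix (N - Suc i)"
  proof
   assume "T : Ix (N - Suc i)"
   hence T: "T <=: {..<N}" "card T = N - Suc i" by (auto simp: Ix_def)
   hence "card ({..<N} - T) = Suc i" using card_Diff_subset[of T "{..<N}"] finite_subset[OF T(1)] i by simp
   thus False using False T by (auto simp: Ix_def)
  qed
  thus ?thesis by (rule chain_zero_outside[OF kch])
 qed
qed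

lemma dual_boundary:
 assumes Fh: "F : left_hom B (Kos (Suc j)) (regular_module B)" and j: "Suc j <= N"
  and \<eta>: "chain N (N - j) U \<eta>" "cmp (dual_chain (Suc j) F) = kd N lc \<eta>"
 shows "F : coboundaries B Kos kres (Suc j)"
proof -
 have F: "mhom B (Kos (Suc j)) (regular_module B) F" "F : extensional (carrier (Kos (Suc j)))"
  using Fh by (auto simp: left_hom_regular)
 let ?psi = "dual_chain (Suc j) F"
 have psi: "chain N (Suc j) U ?psi" by (rule dual_chain_chain[OF F(1)])
 define \<xi> where "\<xi> = cmp \<eta>"
 have \<xi>: "chain N j U \<xi>" using cmp_chain[OF \<eta>(1)] j by (simp add: \<xi>_def)
 have c\<xi>: "cmp \<xi> = \<eta>" unfolding \<xi>_def by (rule cmp_cmp[OF \<eta>(1)])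
 have ds: "dstar \<xi> S = ?psi S" if "S : Ix (Suc j)" for S
 proof -
  have S: "S <=: {..<N}" using that by (simp add: Ix_def)
  have "dstar \<xi> S = kd N lc \<eta> ({..<N} - S)" using dstar_cmp[OF S chain_in[OF \<xi>]] c\<xi> by simp
  also have "... = ?psi ({..<N} - ({..<N} - S))" by (simp add: \<eta>(2)[symmetric] cmp_def)
  also have "{..<N} - ({..<N} - S) = S" using S by auto
  finally show ?thesis .
 qed
 let ?g = "restrict (dual_hom j \<xi>) (carrier (Kos j))"
 have "F = (\<lambda>x \<in> carrier (Kos (Suc j)). ?g (kdiff x))"
 proof (rule extensionalityI[OF F(2)])
  show "(\<lambda>x \<in> carrier (Kos (Suc j)). ?g (kdiff x)) : extensional (carrier (Kos (Suc j)))" by simp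
  fix x assume x: "x |: (Kos (Suc j))"
  then obtain f where f: "chain N (Suc j) U f" "x = en f" by (auto simp: Kos_carrier)
  have "?g (kdiff x) = dual_hom (Suc j) (dstar \<xi>) x"
   using f dual_hom_kdiff[OF \<xi> f(1)] mhomD(1)[OF kdiff_hom x] by simp
  also have "... = dual_hom (Suc j) ?psi x" unfolding dual_hom_def using ds by (intro arg_cong[of _ _ dec] sum.cong) auto
  also have "... = F x" using dual_hom_chain[OF F(1) x] by simp
  finally show "F x = (\<lambda>x \<in> carrier (Kos (Suc j)). ?g (kdiff x)) x" using x by simp
 qed
 thus ?thesis using coboundary_Suc_iff restrict_left_hom[OF Kos_module dual_hom_hom[OF \<xi>]] by blast
qed

lemma cocycle_boundary:
 assumes F: "F : cocycles B Kos kres i" and i: "i ~= N"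
 shows "F : coboundaries B Kos kres i"
proof -
 have Fl: "F : left_hom B (Kos i) (regular_module B)" using F by (simp add: cocycle_iff)
 have Fh: "mhom B (Kos i) (regular_module B) F" "F : extensional (carrier (Kos i))"
  using Fl by (auto simp: left_hom_regular)
 let ?psi = "dual_chain i F"
 have psi: "chain N i U ?psi" by (rule dual_chain_chain[OF Fh(1)])
 consider "i < N" | "i > N" using i by linarith
 thus ?thesis
 proof cases
  case 1
  have "chain N (Suc (N - Suc i)) U (cmp ?psi)" using cmp_chain[OF psi] 1 by (simp add: Suc_diff_Suc)
  then obtain \<eta> where \<eta>: "chain N (Suc (Suc (N - Suc i))) U \<eta>" "cmp ?psi = kd N lc \<eta>"
   using lc_exact cocycle_dual[OF F 1] by blast
  show ?thesis
  proof (cases i)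
   case 0
   hence "\<eta> = (%T. 0)" using chain_beyond[OF _ \<eta>(1)] 1 by simp
   hence "cmp ?psi = (%T. 0)" using \<eta>(2) additive_on_0[OF lc_additive] by (auto simp: kd_def)
   hence "cmp (cmp ?psi) = cmp (%T. 0)" by (simp only:)
   moreover have "cmp (%T. 0) = (%T. 0)" by (auto simp: cmp_def fun_eq_iff)
   ultimately have z: "?psi = (%T. 0)" using cmp_cmp[OF psi] by simp
   have "F = (\<lambda>x \<in> carrier (Kos 0). \<zero>)"
   proof (rule extensionalityI)
    show "F : extensional (carrier (Kos 0))" using Fh(2) 0 by simp
    fix x assume x: "x |: (Kos 0)"
    then obtain f where f: "chain N 0 U f" "x = en f" by (auto simp: Kos_carrier)
    have "F x = dual_hom 0 (%T. 0) x" using dual_hom_chain[OF Fh(1)] x z 0 by simp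
    also have "... = \<zero>" using f by (simp add: dual_hom_en chain_in[OF f(1)])
    finally show "F x = (\<lambda>x \<in> carrier (Kos 0). \<zero>) x" using x by simp
   qed simp
   thus ?thesis using 0 by simp
  next
   case (Suc j)
   have "N - j = Suc (Suc (N - Suc i))" using 1 Suc by simp
   thus ?thesis using dual_boundary[of F j \<eta>] Fl 1 \<eta> Suc by simp
  qed
 next
  case 2
  then obtain j where j: "i = Suc j" by (cases i) auto
  have zh: "mhom B (Kos j) (regular_module B) (%x. \<zero>)" by (simp add: mhom_def)
  let ?g = "restrict (%x. \<zero>) (carrier (Kos j))"
  have "F = (\<lambda>x \<in> carrier (Kos (Suc j)). ?g (kdiff x))"
  proof (rule extensionalityI)
   show "F : extensional (carrier (Kos (Suc j)))" using Fh(2) j by simp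
   fix x assume x: "x |: (Kos (Suc j))"
   hence "x = 0[Kos i]" using Kos_beyond[OF 2] j by simp
   hence "F x = \<zero>" using mhom_zero[OF Kos_module regular_left_module Fh(1)] by simp
   thus "F x = (\<lambda>x \<in> carrier (Kos (Suc j)). ?g (kdiff x)) x" using x mhomD(1)[OF kdiff_hom x] by simp
  qed simp
  thus ?thesis unfolding j using coboundary_Suc_iff restrict_left_hom[OF Kos_module zh] by blast
 qed
qed

abbreviation "full \<equiv> {..<N}"

lemma Ix_top: "S : Ix N <-> S = {..<N}"
 using card_subset_eq[of "{..<N}" S] by (auto simp: Ix_def)

text \<open>The dual complex is again a cube, with left multiplications; hence its cohomology is concentrated in the top degree, where it is the ring modulo the augmentation ideal.\<close>

theorem koszul_gorenstein: "gorenstein B N"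
 unfolding gorenstein_def
proof (intro exI conjI allI impI)
 show "projective_resolution B (trivial_module B) Kos kres eres" by (rule koszul_resolution)
 show "cocycles B Kos kres i = coboundaries B Kos kres i" if "i ~= N" for i
  using cocycle_boundary[OF _ that] coboundary_cocycle by blast
 let ?Psi = "%F. aug (F (en (bas full)))"
 have full: "full : Ix N" by (simp add: Ix_top)
 have bt: "en (bas full) |: (Kos N)" using bas_chain[OF full] by simp
 have cl: "F (en (bas full)) |: B" if "F : cocycles B Kos kres N" for F
 proof -
  have "F : left_hom B (Kos N) (regular_module B)" using that by (simp add: cocycle_iff)
  from mhomD(1)[OF left_hom_mhom[OF this] bt] show ?thesis by simp
 qed
 show "ALL f:cocycles B Kos kres N. ALL g:cocycles B Kos kres N.
   ?Psi (\<lambda>x \<in> carrier (Kos N). f x \<oplus> g x) = ?Psi f + ?Psi g"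
  using bt cl by (simp add: aug_add)
 show "ALL f:cocycles B Kos kres N. ALL a:carrier B. ?Psi (\<lambda>x \<in> carrier (Kos N). f x \<otimes> a) = ?Psi f * aug a"
  using bt cl by (simp add: aug_mult)
 have all: "F : cocycles B Kos kres N" if "F : left_hom B (Kos N) (regular_module B)" for F
 proof -
  have "kdiff x = 0[Kos N]" if x: "x |: (Kos (Suc N))" for x
   using Kos_beyond[of "Suc N"] x mhom_zero[OF Kos_module Kos_module kdiff_hom] by simp
  thus ?thesis using that mhom_zero[OF Kos_module regular_left_module left_hom_mhom[OF that]] by (simp add: cocycle_iff)
 qed
 show "?Psi ` cocycles B Kos kres N = UNIV"
 proof (intro equalityI subsetI)
  fix z :: complex
  obtain a where a: "a |: B" "aug a = z" using aug_surj by blast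
  define psi where "psi S = (if S = full then co a else 0)" for S
  have psi: "chain N N U psi" using a by (auto simp: chain_def psi_def U0)
  let ?F = "restrict (dual_hom N psi) (carrier (Kos N))"
  have "?F : cocycles B Kos kres N" by (rule all[OF restrict_left_hom[OF Kos_module dual_hom_hom[OF psi]]])
  moreover have "?Psi ?F = z" using bt dual_hom_bas[OF psi full] a by (simp add: psi_def)
  ultimately show "z : ?Psi ` cocycles B Kos kres N" using image_eqI[of z ?Psi ?F] by simp
 qed simp
 obtain j where j: "N = Suc j" using N_pos by (cases N) auto
 have key: "F : coboundaries B Kos kres N <-> ?Psi F = 0" if F: "F : cocycles B Kos kres N" for F
 proof -
  have Fl: "F : left_hom B (Kos N) (regular_module B)" using F by (simp add: cocycle_iff)
  have Fh: "mhom B (Kos N) (regular_module B) F" using Fl by (rule left_hom_mhom)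
  let ?psi = "dual_chain N F"
  have psi: "chain N N U ?psi" by (rule dual_chain_chain[OF Fh])
  have ch: "chain N 0 U (cmp ?psi)" using cmp_chain[OF psi] by simp
  have "cmp ?psi {} = co (F (en (bas full)))" by (simp add: cmp_def dual_chain_def Ix_top)
  hence "?Psi F = 0 <-> cmp ?psi {} : span_below lc U {} N" using aug_left[OF cl[OF F]] by simp
  also have "... <-> (EX \<eta>. chain N (Suc 0) U \<eta> & cmp ?psi = kd N lc \<eta>)" by (rule degree_zero_image[OF lc_additive ch])
  also have "... <-> F : coboundaries B Kos kres N"
  proof
   assume "EX \<eta>. chain N (Suc 0) U \<eta> & cmp ?psi = kd N lc \<eta>"
   thus "F : coboundaries B Kos kres N" using dual_boundary[of F j] Fl j by auto
  next
   assume "F : coboundaries B Kos kres N"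
   then obtain g where g: "g : left_hom B (Kos j) (regular_module B)" "F = (\<lambda>x \<in> carrier (Kos (Suc j)). g (kdiff x))"
    using coboundary_Suc_iff j by auto
   have gh: "mhom B (Kos j) (regular_module B) g" using g(1) by (rule left_hom_mhom)
   let ?\<xi> = "dual_chain j g"
   have \<xi>: "chain N j U ?\<xi>" by (rule dual_chain_chain[OF gh])
   have c\<xi>: "chain N (Suc 0) U (cmp ?\<xi>)" using cmp_chain[OF \<xi>] j by simp
   have tU: "dstar ?\<xi> full : U" unfolding dstar_def using chain_in[OF \<xi>] by (intro U_sum U_pm mul_in w_in)
   have "F (en (bas full)) = dual_hom j ?\<xi> (kdiff (en (bas full)))"
    using bt g(2) j dual_hom_chain[OF gh] mhomD(1)[OF kdiff_hom] by simp
   also have "... = dual_hom N (dstar ?\<xi>) (en (bas full))"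
    using dual_hom_kdiff[OF \<xi>, of "bas full"] bas_chain[OF full] j by simp
   also have "... = dec (dstar ?\<xi> full)"
   proof -
    have "Ix N = {full}" using Ix_top by blast
    thus ?thesis using dual_hom_en[OF bas_chain[OF full]] tU by (simp add: bas_def)
   qed
   finally have Ft: "co (F (en (bas full))) = dstar ?\<xi> full" using tU by simp
   have "cmp ?psi T = kd N lc (cmp ?\<xi>) T" for T
   proof (cases "T = {}")
    case True
    have "cmp ?psi {} = dstar ?\<xi> full" using Ft by (simp add: cmp_def dual_chain_def Ix_top)
    also have "... = kd N lc (cmp ?\<xi>) {}" using dstar_cmp[of full ?\<xi>] chain_in[OF \<xi>] by simp
    finally show ?thesis using True by simp
   next
    case False
    have "T ~: Ix 0" using False finite_subset[of T "{..<N}"] by (auto simp: Ix_def)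
    thus ?thesis using chain_zero_outside[OF ch] chain_zero_outside[OF kd_chain[OF lc_additive c\<xi>]] by simp
   qed
   thus "EX \<eta>. chain N (Suc 0) U \<eta> & cmp ?psi = kd N lc \<eta>" using c\<xi> by blast
  qed
  finally show ?thesis by blast
 qed
 show "{f : cocycles B Kos kres N. ?Psi f = 0} = coboundaries B Kos kres N"
  using key coboundary_cocycle by blast
qed

text \<open>The last differential of the Koszul complex has its entries in the augmentation ideal, so it does
 not split.\<close>

theorem koszul_global_dimension:
 fixes iot :: "complex => 'a"
 assumes iot: "inj iot"
 shows "enat N <= global_dimension B"
proof -
 let ?M = "transport iot (trivial_module B)"
 have i: "inj_on iot (carrier (trivial_module B))" using iot by (simp add: inj_on_def inj_def)
 have M: "lmod B ?M" by (rule transport_module[OF trivial_left_module i])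
 note r = projective_resolutionD[OF koszul_resolution]
 define eF where "eF x = iot (eres x)" for x
 have F: "projective_resolution B ?M Kos (%i. restrict (kres i) (carrier (Kos (Suc i)))) (restrict eF (carrier (Kos 0)))"
 proof (rule projective_resolutionI)
  show "mhom B (Kos 0) ?M eF" unfolding eF_def by (rule mhom_comp[OF r(3) transport_hom(1)[OF trivial_left_module i]])
  have "eF ` carrier (Kos 0) = iot ` (eres ` carrier (Kos 0))" by (auto simp: eF_def image_iff)
  thus "eF ` carrier (Kos 0) = carrier ?M" unfolding r(4) by simp
  show "eF x = 0[?M] <-> x : kres 0 ` carrier (Kos 1)" if "x |: (Kos 0)" for x
   unfolding r(5)[OF that, symmetric] eF_def using iot by (simp add: inj_eq)
 qed (use r in auto)
 have no: "\<not> (EX P dlt \<epsilon>. projective_resolution B ?M P dlt \<epsilon> & (ALL i > d. carrier (P i) = {0[P i]}))" if d: "d < N" for d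
 proof
  assume "EX P dlt \<epsilon>. projective_resolution B ?M P dlt \<epsilon> & (ALL i > d. carrier (P i) = {0[P i]})"
  then obtain P dlt \<epsilon> where P: "projective_resolution B ?M P dlt \<epsilon>" "ALL i > d. carrier (P i) = {0[P i]}" by blast
  obtain j where j: "N = Suc j" using N_pos by (cases N) auto
  obtain h where h: "mhom B (Kos j) (Kos (Suc j)) h" "!!x. x |: (Kos (Suc j)) ==> h (kdiff x) = x"
   using short_resolution_splits[OF M F P(1), of j] P(2) d j Kos_beyond[of "Suc (Suc j)"] by auto
  have full: "full : Ix N" by (simp add: Ix_top)
  let ?x = "en (bas full)" and ?f = "kd N rc (bas full)"
  have x: "?x |: (Kos N)" using bas_chain[OF full] by simp
  have kx: "kdiff ?x = en ?f" using kdiff_en bas_chain[OF full] j by simp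
  have fch: "chain N j U ?f" using kd_chain[OF rc_additive] bas_chain[OF full] j by simp
  have hx: "h (en ?f) = ?x" using h(2)[unfolded j[symmetric], OF x] kx by simp
  have fa: "aug (dec (?f S)) = 0" if S: "S : Ix j" for S
  proof -
   have "?f S = (\<Sum>s \<in> full - S. pm S s (mul (bas full (insert s S)) (w S s)))" by (simp add: kd_def rc_def)
   have "card S = j" "S <=: full" using S by (auto simp: Ix_def)
   hence "card (full - S) = 1" using card_Diff_subset[of S full] finite_subset[of S full] j by simp
   then obtain s where s: "full - S = {s}" by (auto simp: card_1_singleton_iff)
   have "insert s S = full" using s \<open>S <=: full\<close> by blast
   hence f: "?f S = pm S s (w S s)" using s w_in by (simp add: kd_def rc_def bas_def)
   have 1: "aug (dec (w S s)) = 0" using aug_w[of "dec (w S s)"] w_in by simp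
   have "aug (dec (w S s) \<oplus> dec (- w S s)) = aug (dec (w S s)) + aug (dec (- w S s))"
    using w_in U_neg by (intro aug_add) simp_all
   moreover have "dec (w S s) \<oplus> dec (- w S s) = \<zero>" using dec_add[of "w S s" "- w S s"] w_in U_neg by simp
   ultimately have "aug (dec (- w S s)) = 0" using 1 aug_zero by simp
   thus ?thesis using f 1 by (simp add: pm_def)
  qed
  have "eps_top (h (en g)) = 0" if "chain N j U g" "!!S. S : Ix j ==> aug (dec (g S)) = 0" "eps_top = (%x. aug (dec (de x full)))"
   for eps_top g
  proof -
   have hom: "mhom B (Kos N) (trivial_module B) eps_top"
   proof (rule mhomI)
    fix x assume "x |: (Kos N)"
    then obtain f where f: "chain N N U f" "x = en f" by (auto simp: Kos_carrier)
    have de: "de (en f) = f" if "chain N N U f" for f using de_en[OF chain_FS[OF that]] .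
    show "eps_top x |: (trivial_module B)" by simp
    show "eps_top (a **[Kos N] x) = a **[trivial_module B] eps_top x" if "a |: B" for a
     using f that chain_smult[OF co_in[OF that] f(1)] \<open>eps_top = _\<close>
     by (simp add: Kos_smult de mul_dec chain_in[OF f(1)] aug_mult)
    fix y assume "y |: (Kos N)"
    then obtain g where g: "chain N N U g" "y = en g" by (auto simp: Kos_carrier)
    show "eps_top (x +[Kos N] y) = eps_top x +[trivial_module B] eps_top y"
     using f g chain_add[OF f(1) g(1)] \<open>eps_top = _\<close>
     by (simp add: Kos_add de dec_add chain_in[OF f(1)] chain_in[OF g(1)] aug_add)
   qed
   have hh: "mhom B (Kos j) (trivial_module B) (%x. eps_top (h x))" using mhom_comp[OF h(1)] hom j by simp
   interpret T: left_module B "trivial_module B" by (rule trivial_left_module)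
   have "eps_top (h (en g)) = finsum (trivial_module B) (%S. dec (g S) **[trivial_module B] eps_top (h (en (bas S)))) (Ix j)"
    by (rule Kos_hom_expand[OF trivial_left_module hh that(1)])
   also have "... = finsum (trivial_module B) (%S. 0[trivial_module B]) (Ix j)"
    by (rule T.M.finsum_cong') (simp_all add: that(2))
   also have "... = 0[trivial_module B]" by (rule T.M.finsum_zero)
   finally show ?thesis by simp
  qed
  from this[OF fch fa refl] have "aug (dec (de ?x full)) = 0" using hx by simp
  moreover have "de ?x full = co \<one>" using de_en[OF chain_FS[OF bas_chain[OF full]]] by (simp add: bas_def)
  ultimately show False using aug_one by simp
 qed
 have "enat N <= projective_dimension B ?M"
  unfolding projective_dimension_def
 proof (rule Inf_greatest)
  fix x assume "x : {enat d | d. EX P dlt \<epsilon>. projective_resolution B ?M P dlt \<epsilon> & (ALL i > d. carrier (P i) = {0[P i]})}"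
  then obtain d where "x = enat d" "EX P dlt \<epsilon>. projective_resolution B ?M P dlt \<epsilon> & (ALL i > d. carrier (P i) = {0[P i]})" by blast
  thus "enat N <= x" using no[of d] by (cases "d < N") auto
 qed
 also have "... <= global_dimension B" unfolding global_dimension_def using M by (intro Sup_upper) blast
 finally show ?thesis .
qed

end

abbreviation smult where "smult \<equiv> Polynomial.smult"

section \<open>Linear extension of maps on monomials\<close>

lemma poly_mapping_decompose: "f = (\<Sum>k \<in> keys f. single k (lookup f k))"
 by (rule poly_mapping_eqI) (simp add: lookup_sum lookup_single when_def in_keys_iff)
lemma poly_mapping_induct [case_names zero single add]:
 fixes f :: "'k \<Rightarrow>\<^sub>0 'c :: comm_monoid_add"
 assumes "P 0" "!!k c. P (single k c)" "!!f g. P f ==> P g ==> P (f + g)"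
 shows "P f"
proof -
 have "P (\<Sum>k \<in> K. single k (lookup f k))" if "finite K" for K
  using that by (induction K rule: finite_induct) (auto intro: assms)
 from this[of "keys f"] show ?thesis using poly_mapping_decompose[of f] by simp
qed

text \<open>\<open>lift_lin iot phi\<close> is the linear map with values \<open>phi k\<close> on the basis, where \<open>iot\<close> embeds the scalars into the target.\<close>

definition lift_lin :: "(complex => 'b) => ('k => 'b) => ('k \<Rightarrow>\<^sub>0 complex) => 'b :: ring_1" where
 "lift_lin iot phi f = (\<Sum>k \<in> keys f. iot (lookup f k) * phi k)"

locale scalars =
 fixes iot :: "complex => 'b :: ring_1"
 assumes iot_0 [simp]: "iot 0 = 0" and iot_1 [simp]: "iot 1 = 1" and iot_add: "iot (c + d) = iot c + iot d"
  and iot_mult: "iot (c * d) = iot c * iot d" and iot_central: "iot c * b = b * iot c"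
begin

lemma lift_0 [simp]: "lift_lin iot phi 0 = 0" by (simp add: lift_lin_def)
lemma lift_single [simp]: "lift_lin iot phi (single k c) = iot c * phi k"
 by (simp add: lift_lin_def)
lemma lift_superset:
 "finite K ==> keys f <=: K ==> lift_lin iot phi f = (\<Sum>k \<in> K. iot (lookup f k) * phi k)"
 unfolding lift_lin_def by (rule sum.mono_neutral_left) (auto simp: in_keys_iff)

lemma lift_add: "lift_lin iot phi (f + g) = lift_lin iot phi f + lift_lin iot phi g"
proof -
 let ?K = "keys f \<union> keys g"
 have "keys (f + g) <=: ?K" by (rule Poly_Mapping.keys_add)
 thus ?thesis
  by (simp add: lift_superset[of ?K] lookup_add iot_add distrib_right sum.distrib)
qed

lemma lift_neg: "lift_lin iot phi (- f) = - lift_lin iot phi f"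
 using lift_add[of phi f "- f"] by (simp add: eq_neg_iff_add_eq_0 add.commute)
lemma lift_diff: "lift_lin iot phi (f - g) = lift_lin iot phi f - lift_lin iot phi g"
 using lift_add[of phi f "- g"] lift_neg[of phi g] by simp
lemma lift_scale:
 fixes f :: "'k :: monoid_add \<Rightarrow>\<^sub>0 complex"
 shows "lift_lin iot phi (single 0 c * f) = iot c * lift_lin iot phi f"
 by (induction f rule: poly_mapping_induct) (simp_all add: mult_single iot_mult mult.assoc distrib_left lift_add)

text \<open>The linear extension of a monoid homomorphism is multiplicative.\<close>

lemma lift_mult:
 fixes f :: "'k :: monoid_add \<Rightarrow>\<^sub>0 complex"
 assumes "!!k l. phi (k + l) = phi k * phi l"
 shows "lift_lin iot phi (f * g) = lift_lin iot phi f * lift_lin iot phi g"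
proof (induction f rule: poly_mapping_induct)
 case (single k c)
 show ?case
 proof (induction g rule: poly_mapping_induct)
  case (single l d)
  show ?case by (simp add: mult_single iot_mult assms) (metis iot_central mult.assoc)
 qed (simp_all add: distrib_left lift_add)
qed (simp_all add: distrib_right lift_add)

end

section \<open>Polynomials in \<open>y\<^sub>1, ..., y\<^sub>n\<close>\<close>

type_synonym ypoly = "nat multiset \<Rightarrow>\<^sub>0 complex"

definition yc :: "complex => ypoly" where "yc c = single {#} c"
definition ym :: "nat multiset => ypoly" where "ym M = single M 1"
definition yv :: "nat => ypoly" where "yv i = ym {#i#}"

lemma yc_simps [simp]: "yc 0 = 0" "yc 1 = 1" "yc (c + d) = yc c + yc d" "yc (c * d) = yc c * yc d" "yc (- c) = - yc c"
 "yc (c - d) = yc c - yc d"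
 by (simp_all add: yc_def single_add mult_single single_uminus single_diff flip: Multiset.empty_neutral)

lemma yc_numeral [simp]: "yc (numeral k) = numeral k" "yc (of_nat m) = of_nat m"
proof -
 show *: "yc (of_nat m) = of_nat m" for m by (induction m) simp_all
 show "yc (numeral k) = numeral k" using *[of "numeral k"] by simp
qed

interpretation Y: scalars yc
 by standard (simp_all add: mult.commute)

lemma single_ym: "single M c = yc c * ym M"
 by (simp add: yc_def ym_def mult_single)
lemma ym_simps [simp]: "ym {#} = 1" "ym (M + N) = ym M * ym N"
 by (simp_all add: ym_def mult_single flip: Multiset.empty_neutral)
lemma ym_add [simp]: "ym (add_mset i M) = yv i * ym M"
 using ym_simps(2)[of "{#i#}" M] by (simp add: yv_def)
lemma ypoly_induct [case_names zero mono add]: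
 assumes "P 0" "!!c M. P (yc c * ym M)" "!!f g. P f ==> P g ==> P (f + g)"
 shows "P f"
 by (induction f rule: poly_mapping_induct) (auto simp: single_ym assms)

text \<open>Substitution of polynomials for the variables.\<close>

definition ysub :: "(nat => ypoly) => ypoly => ypoly" where
 "ysub s = lift_lin yc (%M. \<Prod>i \<in># M. s i)"

lemma ysub_yc [simp]: "ysub s (yc c) = yc c"
proof -
 have "ysub s (single {#} c) = yc c * 1" unfolding ysub_def Y.lift_single by simp
 thus ?thesis by (simp add: yc_def)
qed

lemma ysub_ym [simp]: "ysub s (ym M) = (\<Prod>i \<in># M. s i)"
 unfolding ysub_def ym_def Y.lift_single by simp
lemma ysub_yv [simp]: "ysub s (yv i) = s i"
 unfolding yv_def ysub_ym by simp
lemma ysub_simps [simp]: "ysub s 0 = 0" "ysub s (f + g) = ysub s f + ysub s g" "ysub s (f - g) = ysub s f - ysub s g"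
 "ysub s (- f) = - ysub s f" "ysub s (f * g) = ysub s f * ysub s g"
 by (simp_all add: ysub_def Y.lift_add Y.lift_diff Y.lift_neg Y.lift_mult)

lemma ysub_1 [simp]: "ysub s 1 = 1" using ysub_yc[of s 1] by (simp del: ysub_yc)
lemma ysub_numeral [simp]: "ysub s (numeral k) = numeral k" "ysub s (of_nat m) = of_nat m"
 using ysub_yc[of s "numeral k"] ysub_yc[of s "of_nat m"] by (simp_all del: ysub_yc)
lemma ysub_sum: "ysub s (sum f I) = (\<Sum>i \<in> I. ysub s (f i))"
 by (induction I rule: infinite_finite_induct) simp_all

text \<open>The derivation with given values on the variables, as the linear coefficient of a substitution of
 dual numbers.\<close>

definition dmono :: "(nat => ypoly) => nat multiset => ypoly" where
 "dmono d M = coeff (\<Prod>i \<in># M. [:yv i, d i:]) 1"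

definition yder :: "(nat => ypoly) => ypoly => ypoly" where
 "yder d = lift_lin yc (dmono d)"

lemma dmono_coeff_0: "coeff (\<Prod>i \<in># M. [:yv i, d i:]) 0 = ym M"
 by (induction M) (simp_all add: coeff_mult)
lemma dmono_simps [simp]: "dmono d {#} = 0" "dmono d (add_mset i M) = yv i * dmono d M + d i * ym M"
 using dmono_coeff_0[of d M] by (simp_all add: dmono_def)
lemma dmono_plus: "dmono d (M + N) = dmono d M * ym N + ym M * dmono d N"
 by (induction M) (simp_all add: algebra_simps)
lemma yder_yc [simp]: "yder d (yc c) = 0"
proof -
 have "yder d (single {#} c) = yc c * 0" unfolding yder_def Y.lift_single by simp
 thus ?thesis by (simp add: yc_def)
qed

lemma yder_ym [simp]: "yder d (ym M) = dmono d M"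
 unfolding yder_def ym_def Y.lift_single by simp
lemma yder_yv [simp]: "yder d (yv i) = d i"
 unfolding yv_def yder_ym by simp
lemma yder_simps [simp]: "yder d 0 = 0" "yder d (f + g) = yder d f + yder d g" "yder d (f - g) = yder d f - yder d g"
 "yder d (- f) = - yder d f"
 by (simp_all add: yder_def Y.lift_add Y.lift_diff Y.lift_neg)

lemma yder_scale: "yder d (yc c * f) = yc c * yder d f"
 using Y.lift_scale[of "dmono d" c f] by (simp add: yder_def yc_def)
lemma yder_mult: "yder d (f * g) = yder d f * g + f * yder d g"
proof (induction f rule: ypoly_induct)
 case (mono c M)
 have "yder d (ym M * g) = dmono d M * g + ym M * yder d g"
 proof (induction g rule: ypoly_induct)
  case (mono e N)
  have "yder d (ym M * (yc e * ym N)) = yder d (yc e * ym (M + N))" by (simp add: algebra_simps)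
  also have "... = yc e * (dmono d M * ym N + ym M * dmono d N)" by (simp only: yder_scale yder_ym dmono_plus)
  finally show ?case by (simp add: yder_scale algebra_simps)
 qed (simp_all add: distrib_left distrib_right)
 thus ?case by (simp add: yder_scale mult.assoc distrib_left)
qed (simp_all add: algebra_simps)

lemma yder_1 [simp]: "yder d 1 = 0" using yder_yc[of d 1] by (simp del: yder_yc)
lemma yder_numeral [simp]: "yder d (numeral k) = 0" "yder d (of_nat m) = 0"
 using yder_yc[of d "numeral k"] yder_yc[of d "of_nat m"] by (simp_all del: yder_yc)

section \<open>Right action of the tensor algebra on the space with basis \<open>v\<^sup>j y\<^sup>M\<close>\<close>

type_synonym ppoly = "ypoly poly"

definition pc :: "complex => ppoly" where "pc c = [:yc c:]"

lemma pc_simps [simp]: "pc 0 = 0" "pc 1 = 1" "pc (c + d) = pc c + pc d" "pc (c * d) = pc c * pc d" "pc (- c) = - pc c"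
 "pc (c - d) = pc c - pc d"
 by (simp_all add: pc_def one_pCons)

lemma pc_mult: "pc c * u = smult (yc c) u"
 by (simp add: pc_def)

interpretation P: scalars pc
 by standard (simp_all add: mult.commute)

definition var_v :: ppoly where "var_v = [:0, 1:]"

definition yv0 :: "nat => ypoly" where "yv0 i = (if i = 0 then 0 else yv i)"

locale pbw_model =
 fixes n :: nat and p q :: complex
 assumes pq: "p * q = 0"
begin

definition ysum :: ypoly where "ysum = (\<Sum>j = 1..n. yv j)"

definition ydelta :: "ypoly => ypoly" where "ydelta z = z * (of_nat (n + 1) * z - 2 * ysum)"

definition sig :: "ypoly => ypoly" where "sig = ysub (%i. yc (1 + p) * yv i)"

definition D :: "ypoly => ypoly" where "D = yder (%i. - ydelta (yv i))"

text \<open>Right multiplication by \<open>v\<close> in terms of the basis \<open>v\<^sup>j y\<^sup>M\<close>: the relations say \<open>f v = v sig(f) + q D(f)\<close>.\<close>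

definition V :: "ppoly => ppoly" where
 "V u = var_v * map_poly sig u + smult (yc q) (map_poly D u)"

lemma sig_simps [simp]: "sig 0 = 0" "sig (f + g) = sig f + sig g" "sig (f * g) = sig f * sig g" "sig (yc c) = yc c" "sig 1 = 1"
 "sig (yv i) = yc (1 + p) * yv i"
 by (simp_all add: sig_def)

lemma D_simps [simp]: "D 0 = 0" "D (f + g) = D f + D g" "D (f * g) = D f * g + f * D g" "D (yc c) = 0" "D 1 = 0"
 "D (yv i) = - ydelta (yv i)"
 by (simp_all add: D_def yder_mult)

lemma sig_id: "q ~= 0 ==> sig f = f"
proof (induction f rule: ypoly_induct)
 case (mono c M)
 have "yc (1 + p) = 1" using mono pq by simp
 hence "sig (ym M) = ym M" by (induction M) (simp_all del: yc_simps(3))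
 thus ?case by simp
qed simp_all

lemma coeff_var_v: "coeff (var_v * u) j = (case j of 0 => 0 | Suc k => coeff u k)"
 by (simp add: var_v_def coeff_pCons)
lemma coeff_V: "coeff (V u) j = (case j of 0 => 0 | Suc k => sig (coeff u k)) + yc q * D (coeff u j)"
 by (cases j) (simp_all add: V_def coeff_var_v coeff_map_poly pc_def)
lemma V_add: "V (u + w) = V u + V w"
 by (rule poly_eqI) (simp add: coeff_V algebra_simps split: nat.split)
lemma V_0 [simp]: "V 0 = 0"
 using V_add[of 0 0] by simp
lemma V_smult: "V (smult f u) = smult (sig f) (V u) + smult (yc q * D f) u"
proof (rule poly_eqI)
 fix j
 have "yc q * sig f = yc q * f" using sig_id[of f] by (cases "q = 0") simp_all
 hence *: "yc q * (sig f * x) = yc q * (f * x)" for x by (metis mult.assoc)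
 show "coeff (V (smult f u)) j = coeff (smult (sig f) (V u) + smult (yc q * D f) u) j"
  by (simp add: coeff_V distrib_left mult_ac * split: nat.split)
qed

lemma V_scale: "V (smult (yc c) u) = smult (yc c) (V u)"
 by (simp add: V_smult)
lemma V_var_v: "V (var_v * u) = var_v * V u"
 by (rule poly_eqI) (simp add: coeff_V coeff_var_v split: nat.split)

text \<open>The variable \<open>x_i\<close> is \<open>(v + \<Sum>y_j)/(n + 1) - y_i\<close>.\<close>

definition X :: "nat => ppoly => ppoly" where
 "X i u = smult (yc (1 / of_nat (n + 1))) (V u + smult ysum u) - smult (yv0 i) u"

lemma X_add: "X i (u + w) = X i u + X i w"
 by (simp add: X_def V_add smult_add_right)
lemma X_scale: "X i (smult (yc c) u) = smult (yc c) (X i u)"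
 by (simp add: X_def V_scale smult_add_right smult_diff_right mult_ac)

definition actw :: "ppoly => nat list => ppoly" where "actw u w = foldl (%u i. X i u) u w"

definition act :: "ppoly => ncpoly => ppoly" where "act u = lift_lin pc (actw u)"

lemma actw_add: "actw (u + u') w = actw u w + actw u' w"
 unfolding actw_def by (induction w arbitrary: u u') (simp_all add: X_add)
lemma actw_scale: "actw (smult (yc c) u) w = smult (yc c) (actw u w)"
 unfolding actw_def by (induction w arbitrary: u) (simp_all add: X_scale)
lemma actw_append: "actw u (w @ w') = actw (actw u w) w'"
 by (simp add: actw_def)
lemma act_simps [simp]: "act u 0 = 0" "act u (f + g) = act u f + act u g" "act u (f - g) = act u f - act u g"
 "act u (- f) = - act u f"
 "act u (const c) = smult (yc c) u" "act u (xx i) = X i u"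
 by (simp_all add: act_def P.lift_add P.lift_diff P.lift_neg const_def xx_def actw_def pc_mult)

lemma act_single: "act u (single w c) = smult (yc c) (actw u w)"
 by (simp add: act_def pc_mult)
lemma act_add_left: "act (u + u') f = act u f + act u' f"
 by (simp add: act_def lift_lin_def actw_add distrib_left sum.distrib)
lemma act_scale_left: "act (smult (yc c) u) f = smult (yc c) (act u f)"
proof -
 have *: "actw (pc c * u) w = pc c * actw u w" for w by (simp only: pc_mult actw_scale)
 have "act (pc c * u) f = pc c * act u f"
  by (simp add: act_def lift_lin_def * sum_distrib_left mult.left_commute)
 thus ?thesis by (simp add: pc_mult)
qed

lemma act_0_left [simp]: "act 0 f = 0"
 using act_add_left[of 0 0 f] by simp
lemma act_mult: "act u (f * g) = act (act u f) g"
proof (induction f rule: poly_mapping_induct)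
 case (single w c)
 show ?case
 proof (induction g rule: poly_mapping_induct)
  case (single w' d)
  show ?case by (simp add: act_single mult_single plus_list_def actw_append actw_scale mult.commute)
 qed (simp_all add: distrib_left)
qed (simp_all add: distrib_right act_add_left)

lemma act_1 [simp]: "act u 1 = u"
 using act_simps(5)[of u 1] by (simp add: const_def zero_list_def[symmetric] del: act_simps)
lemma act_sum: "act u (sum f I) = (\<Sum>i \<in> I. act u (f i))"
 by (induction I rule: infinite_finite_induct) simp_all
lemma act_yy: "act u (yy i) = smult (yv0 i) u"
 by (simp add: yy_def X_def yv0_def)
lemma sum_yv0: "(\<Sum>i = 0..n. yv0 i) = ysum"
proof -
 have "(\<Sum>i = 0..n. yv0 i) = yv0 0 + (\<Sum>i = Suc 0..n. yv0 i)" by (rule sum.atLeast_Suc_atMost) simp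
 also have "(\<Sum>i = Suc 0..n. yv0 i) = ysum" unfolding ysum_def by (rule sum.cong) (simp_all add: yv0_def)
 finally show ?thesis by (simp add: yv0_def)
qed

lemma sum_smult: "(\<Sum>i \<in> I. smult (f i) u) = smult (\<Sum>i \<in> I. f i) u"
 by (induction I rule: infinite_finite_induct) (simp_all add: smult_add_left)
lemma act_vv: "act u (vv n) = V u"
proof -
 have 1: "of_nat (n + 1) * yc (1 / of_nat (n + 1)) = 1"
  using yc_simps(4)[of "of_nat (n + 1)" "1 / of_nat (n + 1)"] by (simp del: yc_simps(4) of_nat_Suc of_nat_add)
 have sc: "of_nat m * w = smult (of_nat m) w" for m and w :: ppoly by (induction m) (simp_all add: smult_add_left distrib_right)
 have "act u (vv n) = (\<Sum>i = 0..n. X i u)" by (simp add: vv_def act_sum)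
 also have "... = of_nat (n + 1) * smult (yc (1 / of_nat (n + 1))) (V u + smult ysum u) - smult (\<Sum>i = 0..n. yv0 i) u"
  by (simp add: X_def sum_subtractf sum_smult)
 also have "... = V u" by (simp only: sc smult_smult 1 sum_yv0 smult_1_left add_diff_cancel_right')
 finally show ?thesis .
qed

lemma act_yy': "1 <= i ==> act u (yy i) = smult (yv i) u"
 by (simp add: act_yy yv0_def)
lemma act_delta: "1 <= i ==> i <= n ==> act u (delta_poly n i) = smult (ydelta (yv i)) u"
proof -
 assume i: "1 <= i" "i <= n"
 have s: "(\<Sum>j \<in> {1..n} - {i}. yv0 j) = ysum - yv i"
 proof -
  have "(\<Sum>j \<in> {1..n} - {i}. yv0 j) = (\<Sum>j \<in> {1..n} - {i}. yv j)" by (rule sum.cong) (auto simp: yv0_def)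
  thus ?thesis using i by (simp add: ysum_def sum_diff1)
 qed
 have yi: "yv0 i = yv i" using i by (simp add: yv0_def)
 let ?u = "smult (yv i) u"
 have "act u (delta_poly n i) = smult (yv i) (smult (yc (of_nat n - 1)) ?u) - (\<Sum>j \<in> {1..n} - {i}. smult (yv0 j) (smult (yc 2) ?u))"
  unfolding delta_poly_def act_mult act_simps act_sum act_yy yi ..
 also have "... = smult (yv i) (smult (yc (of_nat n - 1)) ?u) - smult (ysum - yv i) (smult (yc 2) ?u)"
  unfolding sum_smult s ..
 also have "... = smult (ydelta (yv i)) u" by (simp add: ydelta_def smult_diff_left[symmetric]) (simp add: algebra_simps)
 finally show ?thesis .
qed

text \<open>This is where \<open>V\<close> was designed for: \<open>V (y_i u)\<close> is \<open>y_i\<close> times a combination of \<open>V u\<close> and \<open>u\<close>.\<close>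

lemma act_relation:
 assumes "1 <= i" "i <= n"
 shows "act u (yy i * vv n - const (1 + p) * vv n * yy i + const q * delta_poly n i) = 0"
 using assms
 by (simp add: act_mult act_vv act_yy' act_delta V_smult V_scale act_scale_left smult_add_left distrib_right mult.commute del: yc_simps(3))

lemma act_commutator:
 assumes "1 <= i" "1 <= j"
 shows "act u (yy i * yy j - yy j * yy i) = 0"
 using assms by (simp add: act_mult act_yy' mult_ac)

end

section \<open>The tensor algebra as a ring\<close>

abbreviation TT :: "nat => ncpoly set" where "TT n \<equiv> carrier (tensor_alg n)"

lemma TT_iff: "f : TT n <-> (ALL w:keys f. set w <=: {0..n})"
 by (simp add: tensor_alg_def)
lemma tensor_alg_simps [simp]: "f *[tensor_alg n] g = f * g" "f +[tensor_alg n] g = f + g"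
 "1[tensor_alg n] = 1" "0[tensor_alg n] = 0"
 by (simp_all add: tensor_alg_def)

lemma TT_add [simp]: "f : TT n ==> g : TT n ==> f + g : TT n"
 using Poly_Mapping.keys_add[of f g] by (auto simp: TT_iff)
lemma TT_neg [simp]: "f : TT n ==> - f : TT n"
 by (auto simp: TT_iff in_keys_iff)
lemma TT_diff [simp]: "f : TT n ==> g : TT n ==> f - g : TT n"
 using TT_add[of f n "- g"] by simp
lemma TT_mult [simp]: assumes "f : TT n" "g : TT n" shows "f * g : TT n"
 unfolding TT_iff
proof
 fix w assume "w : keys (f * g)"
 then obtain a b where "a : keys f" "b : keys g" "w = a @ b"
  using keys_mult[of f g] by (auto simp: plus_list_def)
 thus "set w <=: {0..n}" using assms by (auto simp: TT_iff)
qed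
lemma TT_const [simp]: "const c : TT n" by (simp add: TT_iff const_def)
lemma TT_01 [simp]: "0 : TT n" "1 : TT n" by (simp_all add: TT_iff zero_list_def)
lemma TT_xx [simp]: "i <= n ==> xx i : TT n" by (simp add: TT_iff xx_def)
lemma TT_sum [simp]: "(!!i. i : I ==> f i : TT n) ==> sum f I : TT n"
 by (induction I rule: infinite_finite_induct) simp_all
lemma TT_power [simp]: "f : TT n ==> f ^ k : TT n" by (induction k) simp_all
lemma TT_yy [simp]: "i <= n ==> yy i : TT n" by (simp add: yy_def)
lemma TT_vv [simp]: "vv n : TT n" unfolding vv_def by (rule TT_sum) simp
lemma TT_delta [simp]: "i <= n ==> delta_poly n i : TT n"
 unfolding delta_poly_def by (intro TT_mult TT_diff TT_sum TT_yy TT_const) auto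
lemma tensor_ring: "ring (tensor_alg n)"
proof (rule ringI)
 show "abelian_group (tensor_alg n)"
  by (rule abelian_groupI) (auto simp: add_ac intro!: bexI[of _ "- _"])
 show "Group.monoid (tensor_alg n)"
  by (rule monoidI) (auto simp: mult.assoc)
qed (auto simp: algebra_simps)

lemma tensor_minus: assumes "f : TT n" shows "-[tensor_alg n] f = - f"
proof -
 interpret ring "tensor_alg n" by (rule tensor_ring)
 show ?thesis by (rule minus_equality) (use assms in auto)
qed

lemma const_simps [simp]: "const 0 = 0" "const 1 = 1" "const (c + d) = const c + const d" "const (c * d) = const c * const d"
 "const (- c) = - const c" "const (c - d) = const c - const d"
 by (simp_all add: const_def single_add mult_single single_uminus single_diff flip: zero_list_def)

lemma const_central: "const c * f = f * const c"
proof (induction f rule: poly_mapping_induct)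
 case (single w d)
 show ?case by (simp add: const_def mult_single plus_list_def mult.commute)
qed (simp_all add: distrib_left distrib_right)

interpretation Tens: scalars const
 by standard (auto intro: const_central)

lemma TT_induct [consumes 1, case_names one const xx add]:
 assumes f: "f : TT n" and one: "P 1" and const: "!!c g. g : TT n ==> P g ==> P (const c * g)"
  and xx: "!!i g. i <= n ==> g : TT n ==> P g ==> P (g * xx i)"
  and add: "!!f g. f : TT n ==> g : TT n ==> P f ==> P g ==> P (f + g)"
 shows "P f"
proof -
 have 1: "P (single w 1) & single w 1 : TT n" if "set w <=: {0..n}" for w
  using that
 proof (induction w rule: rev_induct)
  case Nil
  show ?case using one by (simp flip: zero_list_def)
 next
  case (snoc i w)
  have "single (w @ [i]) 1 = single w 1 * xx i" by (simp add: xx_def mult_single plus_list_def)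
  thus ?case using snoc xx[of i "single w 1"] by simp
 qed
 have 2: "P (single w c) & single w c : TT n" if "set w <=: {0..n}" for w c
 proof -
  have "single w c = const c * single w 1" by (simp add: const_def mult_single plus_list_def)
  thus ?thesis using 1[OF that] const[of "single w 1" c] by simp
 qed
 have P0: "P 0" using const[of 1 0] one by simp
 have "P (\<Sum>w \<in> W. single w (lookup f w)) & (\<Sum>w \<in> W. single w (lookup f w)) : TT n"
  if "finite W" "W <=: keys f" for W
  using that
 proof (induction W rule: finite_induct)
  case (insert w W)
  hence "set w <=: {0..n}" using f by (auto simp: TT_iff)
  thus ?case using insert 2[of w] by (simp add: add)
 qed (simp add: P0)
 from this[of "keys f"] show ?thesis using poly_mapping_decompose[of f] by simp
qed

section \<open>The space with basis \<open>v\<^sup>j y\<^sup>M\<close>\<close>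

definition Yn :: "nat => ypoly set" where "Yn n = {f. ALL M:keys f. set_mset M <=: {1..n}}"

definition Pn :: "nat => ppoly set" where "Pn n = {u. ALL j. coeff u j : Yn n}"

lemma Yn_simps [simp]: "0 : Yn n" "f : Yn n ==> g : Yn n ==> f + g : Yn n" "f : Yn n ==> - f : Yn n"
 "set_mset M <=: {1..n} ==> ym M : Yn n" "yc c : Yn n"
 using Poly_Mapping.keys_add[of f g] by (auto simp: Yn_def in_keys_iff ym_def yc_def lookup_single when_def)

lemma Yn_mult [simp]: assumes "f : Yn n" "g : Yn n" shows "f * g : Yn n"
proof -
 have "set_mset M <=: {1..n}" if "M : keys (f * g)" for M
 proof -
  from that obtain a b where "a : keys f" "b : keys g" "M = a + b"
   using keys_mult[of f g] by auto
  thus ?thesis using assms by (auto simp: Yn_def)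
 qed
 thus ?thesis by (simp add: Yn_def)
qed

lemma Yn_yv [simp]: "1 <= i ==> i <= n ==> yv i : Yn n" unfolding yv_def by (rule Yn_simps(4)) simp
lemma Yn_one [simp]: "1 : Yn n" using Yn_simps(5)[of 1 n] by simp
lemma Yn_sum [simp]: "(!!i. i : I ==> f i : Yn n) ==> sum f I : Yn n"
 by (induction I rule: infinite_finite_induct) simp_all
lemma Yn_induct [consumes 1, case_names zero mono add]:
 assumes f: "f : Yn n" and 0: "P 0" and m: "!!c M. set_mset M <=: {1..n} ==> P (yc c * ym M)"
  and add: "!!f g. f : Yn n ==> g : Yn n ==> P f ==> P g ==> P (f + g)"
 shows "P f"
proof -
 have "P (\<Sum>w \<in> W. single w (lookup f w)) & (\<Sum>w \<in> W. single w (lookup f w)) : Yn n"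
  if "finite W" "W <=: keys f" for W
  using that
 proof (induction W rule: finite_induct)
  case (insert M W)
  hence "set_mset M <=: {1..n}" using f by (auto simp: Yn_def)
  thus ?case using insert by (simp add: add m single_ym)
 qed (simp add: 0)
 from this[of "keys f"] show ?thesis using poly_mapping_decompose[of f] by simp
qed

lemma Pn_simps [simp]: "0 : Pn n" "u : Pn n ==> w : Pn n ==> u + w : Pn n" "u : Pn n ==> - u : Pn n"
 "f : Yn n ==> u : Pn n ==> smult f u : Pn n" "f : Yn n ==> monom f j : Pn n" "u : Pn n ==> var_v * u : Pn n"
 "f : Yn n ==> [:f:] : Pn n" "1 : Pn n"
 by (auto simp: Pn_def var_v_def coeff_pCons split: nat.split)

lemma Pn_diff [simp]: "u : Pn n ==> w : Pn n ==> u - w : Pn n"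
 using Pn_simps(2)[of u n "- w"] by simp
lemma Pn_sum [simp]: "(!!i. i : I ==> f i : Pn n) ==> sum f I : Pn n"
 by (induction I rule: infinite_finite_induct) simp_all
lemma Pn_induct [consumes 1, case_names zero mono add]:
 assumes u: "u : Pn n" and 0: "P 0" and m: "!!c M j. set_mset M <=: {1..n} ==> P (monom (yc c * ym M) j)"
  and add: "!!u w. u : Pn n ==> w : Pn n ==> P u ==> P w ==> P (u + w)"
 shows "P u"
proof -
 have 1: "P (monom f j)" if "f : Yn n" for f j
  using that
 proof (induction rule: Yn_induct)
  case (add f g)
  thus ?case using assms(4)[of "monom f j" "monom g j"] by (simp add: add_monom)
 qed (simp_all add: 0 m)
 have "P (\<Sum>j \<in> J. monom (coeff u j) j) & (\<Sum>j \<in> J. monom (coeff u j) j) : Pn n" if "finite J" for J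
  using that
 proof (induction J rule: finite_induct)
  case (insert j J)
  have "coeff u j : Yn n" using u by (simp add: Pn_def)
  thus ?case using insert by (simp add: add 1)
 qed (simp add: 0)
 from this[of "{..Polynomial.degree u}"] show ?thesis by (simp add: poly_as_sum_of_monoms)
qed

section \<open>The PBW basis\<close>

definition yl :: "nat list => ncpoly" where "yl l = prod_list (map yy l)"

definition yw :: "nat multiset => ncpoly" where "yw M = yl (sorted_list_of_multiset M)"

text \<open>The linear section of the action on the unit given by ordered monomials.\<close>

definition normal :: "nat => ppoly => ncpoly" where
 "normal n u = (\<Sum>j \<le> Polynomial.degree u. vv n ^ j * lift_lin const yw (coeff u j))"

lemma TT_yl [simp]: "set l <=: {1..n} ==> yl l : TT n"
 by (induction l) (simp_all add: yl_def)
lemma yl_append: "yl (l @ l') = yl l * yl l'" by (simp add: yl_def)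
lemma TT_yw [simp]: "set_mset M <=: {1..n} ==> yw M : TT n" by (simp add: yw_def)
lemma normal_bound: "Polynomial.degree u <= d ==> normal n u = (\<Sum>j \<le> d. vv n ^ j * lift_lin const yw (coeff u j))"
 unfolding normal_def by (rule sum.mono_neutral_left) (auto simp: coeff_eq_0 not_le)
lemma normal_add: "normal n (u + w) = normal n u + normal n w"
proof -
 let ?d = "max (Polynomial.degree u) (Polynomial.degree w)"
 have "Polynomial.degree (u + w) <= ?d" by (rule degree_add_le_max)
 thus ?thesis by (simp add: normal_bound[of _ ?d] Tens.lift_add distrib_left sum.distrib)
qed

lemma normal_0 [simp]: "normal n 0 = 0" by (simp add: normal_def)
lemma normal_neg: "normal n (- u) = - normal n u"
 using normal_add[of n u "- u"] by (simp add: eq_neg_iff_add_eq_0 add.commute)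
lemma normal_diff: "normal n (u - w) = normal n u - normal n w"
 using normal_add[of n u "- w"] by (simp add: normal_neg)
lemma normal_scale: "normal n (smult (yc c) u) = const c * normal n u"
proof -
 have "lift_lin const yw (yc c * f) = const c * lift_lin const yw f" for f
  using Tens.lift_scale[of yw c f] by (simp add: yc_def)
 moreover have "t * (const c * x) = const c * (t * x)" for t x by (metis const_central mult.assoc)
 moreover have "Polynomial.degree (smult (yc c) u) <= Polynomial.degree u" by (rule degree_smult_le)
 ultimately show ?thesis
  by (simp only: normal_bound[of _ "Polynomial.degree u"] sum_distrib_left coeff_smult order_refl)
qed

lemma normal_var_v: "normal n (var_v * u) = vv n * normal n u"
proof (cases "u = 0")
 case False
 have v: "var_v * u = pCons 0 u" by (simp add: var_v_def)
 have "normal n (pCons 0 u) = (\<Sum>j \<le> Suc (Polynomial.degree u). vv n ^ j * lift_lin const yw (coeff (pCons 0 u) j))"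
  by (rule normal_bound) (simp add: False)
 also have "... = (\<Sum>j \<le> Polynomial.degree u. vv n ^ Suc j * lift_lin const yw (coeff u j))"
  by (subst sum.atMost_Suc_shift) simp
 finally show ?thesis unfolding v by (simp add: normal_def sum_distrib_left mult.assoc)
qed simp

lemma normal_mono: "normal n (monom (yc c * ym M) j) = vv n ^ j * (const c * yw M)"
proof (cases "yc c * ym M = 0")
 case True
 hence "const c = 0 \<or> c = 0" by (metis lookup_single_eq lookup_zero single_ym)
 thus ?thesis using True by (auto simp: normal_def)
next
 case False
 hence "normal n (monom (yc c * ym M) j) = (\<Sum>i \<le> j. vv n ^ i * lift_lin const yw (coeff (monom (yc c * ym M) j) i))"
  by (intro normal_bound) (simp add: degree_monom_le)
 also have "... = (\<Sum>i \<le> j. if i = j then vv n ^ j * (const c * yw M) else 0)"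
  by (rule sum.cong) (auto simp: coeff_monom simp flip: single_ym)
 finally show ?thesis by simp
qed

lemma TT_normal: "u : Pn n ==> normal n u : TT n"
 by (induction u rule: Pn_induct) (simp_all add: normal_add normal_mono)
lemma normal_1: "normal n 1 = 1"
 using normal_mono[of n 1 "{#}" 0] by (simp add: yw_def yl_def monom_0 one_pCons)

context pbw_model
begin

definition rel_set :: "ncpoly set" where
 "rel_set = {yy i * vv n - const (1 + p) * vv n * yy i + const q * delta_poly n i | i. 1 <= i & i <= n} \<union> y_commutators n"

lemma family_ideal_eq: "family_ideal n (p, q) = Idl\<^bsub>tensor_alg n\<^esub> rel_set"
 by (simp add: family_ideal_def rel_set_def)
lemma rel_set_TT: "rel_set <=: TT n"
 by (auto simp: rel_set_def y_commutators_def simp del: const_simps)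

abbreviation I where "I \<equiv> family_ideal n (p, q)"

lemma I_ideal: "ideal I (tensor_alg n)"
 unfolding family_ideal_eq by (rule ring.genideal_ideal[OF tensor_ring rel_set_TT])
lemma rel_in_I: "r : rel_set ==> r : I"
 unfolding family_ideal_eq using ring.genideal_self[OF tensor_ring rel_set_TT] by blast

end

lemma ideal_tensorD:
 assumes "ideal J (tensor_alg n)"
 shows "f : J ==> f : TT n" "0 : J" "f : J ==> g : J ==> f + g : J" "f : J ==> - f : J"
  "f : J ==> g : J ==> f - g : J"
  "f : J ==> t : TT n ==> t * f : J" "f : J ==> t : TT n ==> f * t : J"
proof -
 interpret ideal J "tensor_alg n" by fact
 show 1: "f : J ==> f : TT n" for f using Icarr by blast
 show "0 : J" using additive_subgroup.zero_closed[OF is_additive_subgroup] by simp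
 show 2: "f : J ==> g : J ==> f + g : J" for f g using additive_subgroup.a_closed[OF is_additive_subgroup, of f g] by simp
 show 3: "f : J ==> - f : J" for f
  using I_l_closed[of f "- 1"] by simp
 show "f : J ==> g : J ==> f - g : J" using 2[of f "- g"] 3 by simp
 show "f : J ==> t : TT n ==> t * f : J" using I_l_closed[of f t] by simp
 show "f : J ==> t : TT n ==> f * t : J" using I_r_closed[of f t] by simp
qed

lemma ideal_tensorI:
 assumes "J <=: TT n" "0 : J" "!!f g. f : J ==> g : J ==> f + g : J" "!!f. f : J ==> - f : J"
  "!!f t. f : J ==> t : TT n ==> t * f : J" "!!f t. f : J ==> t : TT n ==> f * t : J"
 shows "ideal J (tensor_alg n)"
proof (rule idealI[OF tensor_ring])
 interpret ring "tensor_alg n" by (rule tensor_ring)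
 show "subgroup J (add_monoid (tensor_alg n))"
 proof (rule group.subgroupI)
  show "Group.group (add_monoid (tensor_alg n))" by (rule a_group)
  fix f assume f: "f : J"
  have "inv\<^bsub>add_monoid (tensor_alg n)\<^esub> f = - f"
   using tensor_minus[of f n] f assms(1) by (auto simp: a_inv_def)
  thus "inv\<^bsub>add_monoid (tensor_alg n)\<^esub> f : J" using f assms(4) by simp
 qed (use assms in auto)
qed (use assms in auto)

context pbw_model
begin

definition cong :: "ncpoly => ncpoly => bool" (infix \<open>\<approx>\<close> 50) where "f \<approx> g <-> f - g : I"

lemmas I_simps = ideal_tensorD[OF I_ideal]

lemma cong_refl [simp]: "f \<approx> f" using I_simps(2) by (simp add: cong_def)
lemma cong_sym: "f \<approx> g ==> g \<approx> f" using I_simps(4)[of "f - g"] by (simp add: cong_def)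
lemma cong_trans [trans]: "f \<approx> g ==> g \<approx> h ==> f \<approx> h" using I_simps(3)[of "f - g" "g - h"] by (simp add: cong_def)
lemma cong_eq [trans]: "f \<approx> g ==> g = h ==> f \<approx> h" "f = g ==> g \<approx> h ==> f \<approx> h" by simp_all
lemma cong_add: "f \<approx> g ==> f' \<approx> g' ==> f + f' \<approx> g + g'"
 using I_simps(3)[of "f - g" "f' - g'"] by (simp add: cong_def algebra_simps)
lemma cong_diff: "f \<approx> g ==> f' \<approx> g' ==> f - f' \<approx> g - g'"
 using I_simps(5)[of "f - g" "f' - g'"] by (simp add: cong_def algebra_simps)
lemma cong_left: "f \<approx> g ==> t : TT n ==> t * f \<approx> t * g"
 using I_simps(6)[of "f - g" t] by (simp add: cong_def right_diff_distrib)
lemma cong_right: "f \<approx> g ==> t : TT n ==> f * t \<approx> g * t"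
 using I_simps(7)[of "f - g" t] by (simp add: cong_def left_diff_distrib)
lemma act_I: assumes "f : I" shows "act u f = 0"
proof -
 let ?J = "{f : TT n. ALL u. act u f = 0}"
 have "ideal ?J (tensor_alg n)"
  by (rule ideal_tensorI) (auto simp: act_mult)
 moreover have "rel_set <=: ?J"
  using rel_set_TT act_relation act_commutator by (auto simp: rel_set_def y_commutators_def simp del: act_simps)
 ultimately have "I <=: ?J" unfolding family_ideal_eq by (rule ring.genideal_minimal[OF tensor_ring])
 thus ?thesis using assms by blast
qed

lemma yy_commute: assumes "i : {1..n}" "j : {1..n}" shows "yy i * yy j \<approx> yy j * yy i"
proof -
 have *: "yy i * yy j - yy j * yy i : I" if "1 <= i" "i < j" "j <= n" for i j
  by (rule rel_in_I) (use that in "auto simp: rel_set_def y_commutators_def")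
 consider "i = j" | "i < j" | "j < i" by linarith
 thus ?thesis
 proof cases
  case 3
  thus ?thesis using *[of j i] assms cong_sym by (auto simp: cong_def)
 qed (use *[of i j] assms in "auto simp: cong_def I_simps(2)")
qed

lemma yy_yl: assumes i: "i : {1..n}" shows "set l <=: {1..n} ==> yl l * yy i \<approx> yy i * yl l"
proof (induction l)
 case (Cons j l)
 hence j: "j : {1..n}" and l: "set l <=: {1..n}" by auto
 have "yl (j # l) * yy i = yy j * (yl l * yy i)" by (simp add: yl_def mult.assoc)
 also have "... \<approx> yy j * (yy i * yl l)" by (rule cong_left) (use Cons j l in auto)
 also have "... = yy j * yy i * yl l" by (simp add: mult.assoc)
 also have "... \<approx> yy i * yy j * yl l" by (rule cong_right[OF yy_commute]) (use i j l in auto)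
 also have "... = yy i * yl (j # l)" by (simp add: yl_def mult.assoc)
 finally show ?case .
qed (simp add: yl_def)

text \<open>Modulo the commutators the order of the factors does not matter.\<close>

lemma yl_perm: "mset l = mset l' ==> set l <=: {1..n} ==> yl l \<approx> yl l'"
proof (induction l arbitrary: l')
 case (Cons i l)
 hence i: "i : {1..n}" and l: "set l <=: {1..n}" by auto
 have "i : set l'" using Cons.prems(1) by (metis list.set_intros(1) mset_eq_setD)
 then obtain l1 l2 where l': "l' = l1 @ i # l2" by (meson split_list)
 have m: "mset l = mset (l1 @ l2)" using Cons.prems(1) l' by simp
 have s: "set l1 <=: {1..n}" "set l2 <=: {1..n}" using mset_eq_setD[OF m] l by auto
 have "yl (i # l) = yy i * yl l" by (simp add: yl_def)
 also have "... \<approx> yy i * yl (l1 @ l2)" by (rule cong_left[OF Cons.IH[OF m l]]) (use i in auto)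
 also have "... = yy i * yl l1 * yl l2" by (simp add: yl_append mult.assoc)
 also have "... \<approx> yl l1 * yy i * yl l2" by (rule cong_right[OF cong_sym[OF yy_yl[OF i s(1)]]]) (use s in auto)
 also have "... = yl l'" by (simp add: l' yl_def mult.assoc)
 finally show ?case .
qed simp

lemma yw_yy: assumes "i : {1..n}" "set_mset M <=: {1..n}" shows "yw M * yy i \<approx> yw (add_mset i M)"
proof -
 have "yw M * yy i = yl (sorted_list_of_multiset M @ [i])" by (simp add: yw_def yl_def)
 also have "... \<approx> yw (add_mset i M)" unfolding yw_def by (rule yl_perm) (use assms in auto)
 finally show ?thesis .
qed

text \<open>The elements whose right multiplication agrees with the action, up to the ideal.\<close>

definition good :: "ncpoly => bool" where
 "good g <-> g : TT n & (ALL u:Pn n. act u g : Pn n & normal n u * g \<approx> normal n (act u g))"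

lemma good_add: "good f ==> good g ==> good (f + g)"
 by (auto simp: good_def distrib_left normal_add intro: cong_add)
lemma good_diff: "good f ==> good g ==> good (f - g)"
 by (auto simp: good_def right_diff_distrib normal_diff intro: cong_diff)
lemma good_const: "good (const c)"
 by (auto simp: good_def normal_scale) (simp add: const_central[symmetric])
lemma good_mult: assumes "good f" "good g" shows "good (f * g)"
 unfolding good_def
proof (intro conjI ballI)
 fix u assume u: "u : Pn n"
 have "normal n u * (f * g) = normal n u * f * g" by (simp add: mult.assoc)
 also have "... \<approx> normal n (act u f) * g" using assms u by (intro cong_right) (auto simp: good_def)
 also have "... \<approx> normal n (act (act u f) g)" using assms u by (auto simp: good_def)
 finally show "normal n u * (f * g) \<approx> normal n (act u (f * g))" by (simp add: act_mult)
 show "act u (f * g) : Pn n" using assms u by (auto simp: act_mult good_def)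
qed (use assms in "auto simp: good_def")
lemma good_0: "good 0" using good_const[of 0] by simp
lemma good_sum: "(!!i. i : J ==> good (f i)) ==> good (sum f J)"
 by (induction J rule: infinite_finite_induct) (simp_all add: good_0 good_add)
lemma good_yy: assumes i: "i : {1..n}" shows "good (yy i)"
 unfolding good_def
proof (intro conjI ballI)
 fix u assume u: "u : Pn n"
 show "act u (yy i) : Pn n" using u i by (simp add: act_yy')
 have "normal n u * yy i \<approx> normal n (smult (yv i) u)" using u
 proof (induction u rule: Pn_induct)
  case (mono c M j)
  have "normal n (monom (yc c * ym M) j) * yy i = vv n ^ j * const c * (yw M * yy i)" by (simp add: normal_mono mult.assoc)
  also have "... \<approx> vv n ^ j * const c * yw (add_mset i M)" by (rule cong_left[OF yw_yy[OF i mono]]) simp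
  also have "... = normal n (monom (yc c * ym (add_mset i M)) j)" by (simp only: normal_mono mult.assoc)
  also have "monom (yc c * ym (add_mset i M)) j = smult (yv i) (monom (yc c * ym M) j)" by (simp add: smult_monom mult.left_commute)
  finally show ?case .
 next
  case (add u w)
  thus ?case by (auto simp: normal_add distrib_right smult_add_right intro: cong_add)
 qed simp
 thus "normal n u * yy i \<approx> normal n (act u (yy i))" using i by (simp add: act_yy')
qed (use i in simp)

lemma good_delta: assumes i: "i : {1..n}" shows "good (delta_poly n i)"
 unfolding delta_poly_def by (intro good_mult good_diff good_sum good_const good_yy) (use i in auto)
lemma yy_vv: assumes i: "i : {1..n}" shows "yy i * vv n \<approx> const (1 + p) * vv n * yy i - const q * delta_poly n i"
proof -
 have "yy i * vv n - const (1 + p) * vv n * yy i + const q * delta_poly n i : I"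
  by (rule rel_in_I) (use i in "auto simp: rel_set_def")
 thus ?thesis by (simp add: cong_def algebra_simps del: const_simps)
qed

lemma ysum_Yn: "ysum : Yn n" unfolding ysum_def by (rule Yn_sum) simp
lemma ydelta_Yn: assumes "f : Yn n" shows "ydelta f : Yn n"
proof -
 have "ydelta f = f * (yc (of_nat (n + 1)) * f + - (yc 2 * ysum))" by (simp add: ydelta_def)
 thus ?thesis using assms ysum_Yn by (simp only: Yn_mult Yn_simps)
qed

lemma yw_vv: "set_mset M <=: {1..n} ==> yw M * vv n \<approx> normal n (V [:ym M:]) & V [:ym M:] : Pn n"
proof (induction M)
 case empty
 have "V [:ym {#}:] = var_v * 1"
  by (rule poly_eqI) (simp add: coeff_V coeff_var_v coeff_pCons del: mult_1_right split: nat.split)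
 moreover have "var_v * 1 : Pn n" by (intro Pn_simps)
 ultimately show ?case using normal_var_v[of n 1] by (simp add: normal_1 yw_def yl_def)
next
 case (add i M)
 hence i: "i : {1..n}" and M: "set_mset M <=: {1..n}" by auto
 let ?m = "[:ym M:]"
 have m: "?m : Pn n" using M by simp
 have IH: "yw M * vv n \<approx> normal n (V ?m)" "V ?m : Pn n" using add M by auto
 have Vm: "V [:ym (add_mset i M):] = smult (yc (1 + p) * yv i) (V ?m) - smult (yc q * ydelta (yv i)) ?m"
  using V_smult[of "yv i" ?m] by simp
 have "yw (add_mset i M) * vv n \<approx> yw M * yy i * vv n" by (rule cong_right[OF cong_sym[OF yw_yy[OF i M]]]) simp
 also have "... = yw M * (yy i * vv n)" by (simp add: mult.assoc)
 also have "... \<approx> yw M * (const (1 + p) * vv n * yy i - const q * delta_poly n i)"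
  by (rule cong_left[OF yy_vv[OF i]]) (use M in simp)
 also have "... = const (1 + p) * (yw M * vv n * yy i) - const q * (normal n ?m * delta_poly n i)"
 proof -
  have "normal n ?m = yw M" using normal_mono[of n 1 M 0] by (simp add: monom_0)
  moreover have "yw M * (const (1 + p) * vv n * yy i) = const (1 + p) * (yw M * vv n * yy i)"
   "yw M * (const q * delta_poly n i) = const q * (yw M * delta_poly n i)"
   by (metis const_central mult.assoc)+
  ultimately show ?thesis by (simp only: right_diff_distrib)
 qed
 also have "... \<approx> const (1 + p) * normal n (smult (yv i) (V ?m)) - const q * normal n (smult (ydelta (yv i)) ?m)"
 proof (intro cong_diff cong_left TT_const)
  have "yw M * vv n * yy i \<approx> normal n (V ?m) * yy i" by (rule cong_right[OF IH(1)]) (use i in simp)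
  also have "... \<approx> normal n (act (V ?m) (yy i))" using good_yy[OF i] IH(2) by (simp add: good_def)
  finally show "yw M * vv n * yy i \<approx> normal n (smult (yv i) (V ?m))" using i by (simp add: act_yy')
  show "normal n ?m * delta_poly n i \<approx> normal n (smult (ydelta (yv i)) ?m)"
   using good_delta[OF i] m act_delta[of i ?m] i unfolding good_def by auto
 qed
 also have "... = normal n (V [:ym (add_mset i M):])"
  unfolding Vm normal_diff normal_scale[symmetric] smult_smult ..
 finally have "yw (add_mset i M) * vv n \<approx> normal n (V [:ym (add_mset i M):])" .
 moreover have "V [:ym (add_mset i M):] : Pn n"
  unfolding Vm using i IH(2) m by (intro Pn_diff Pn_simps(4) Yn_mult Yn_simps(5) ydelta_Yn) auto
 ultimately show ?case by blast
qed

lemma V_monom: "V (monom f (Suc j)) = var_v * V (monom f j)"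
 using V_var_v[of "monom f j"] by (simp add: var_v_def monom_Suc)
lemma good_vv: "good (vv n)"
 unfolding good_def
proof (intro conjI ballI)
 have *: "V u : Pn n & normal n u * vv n \<approx> normal n (V u)" if "u : Pn n" for u
  using that
 proof (induction u rule: Pn_induct)
  case (mono c M j)
  show ?case
  proof (induction j)
   case 0
   have s: "monom (yc c * ym M) 0 = smult (yc c) [:ym M:]" by (simp add: monom_0)
   have "normal n (monom (yc c * ym M) 0) * vv n = const c * (yw M * vv n)" by (simp add: normal_mono mult.assoc)
   also have "... \<approx> const c * normal n (V [:ym M:])" using yw_vv[OF mono] by (intro cong_left) auto
   also have "... = normal n (V (monom (yc c * ym M) 0))" unfolding s V_scale normal_scale ..
   finally show ?case using yw_vv[OF mono] by (simp only: s V_scale) simp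
  next
   case (Suc j)
   have s: "monom (yc c * ym M) (Suc j) = var_v * monom (yc c * ym M) j" by (simp add: var_v_def monom_Suc)
   have "normal n (monom (yc c * ym M) (Suc j)) * vv n = vv n * (normal n (monom (yc c * ym M) j) * vv n)"
    unfolding s normal_var_v by (simp add: mult.assoc)
   also have "... \<approx> vv n * normal n (V (monom (yc c * ym M) j))" using Suc by (intro cong_left) auto
   also have "... = normal n (V (monom (yc c * ym M) (Suc j)))" unfolding V_monom normal_var_v ..
   finally show ?case using Suc by (simp add: V_monom)
  qed
 next
  case (add u w)
  thus ?case by (auto simp: V_add normal_add distrib_right intro: cong_add)
 qed simp
 fix u assume "u : Pn n"
 thus "act u (vv n) : Pn n" "normal n u * vv n \<approx> normal n (act u (vv n))" using * by (auto simp: act_vv)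
qed simp

lemma xx_expand: "const (of_nat (n + 1)) * xx 0 = vv n + (\<Sum>j = 1..n. yy j)"
proof -
 have c: "const (of_nat m) = of_nat m" for m by (induction m) simp_all
 have "vv n = xx 0 + (\<Sum>j = 1..n. xx j)" unfolding vv_def by (subst sum.atLeast_Suc_atMost) simp_all
 thus ?thesis by (simp add: c yy_def sum_subtractf distrib_right del: of_nat_Suc of_nat_add) (simp add: distrib_right)
qed

lemma good_xx: assumes "i <= n" shows "good (xx i)"
proof -
 have "const (1 / of_nat (n + 1)) * (vv n + (\<Sum>j = 1..n. yy j)) = const (1 / of_nat (n + 1) * of_nat (n + 1)) * xx 0"
  by (simp only: xx_expand[symmetric] mult.assoc const_simps)
 also have "1 / of_nat (n + 1) * of_nat (n + 1) = (1 :: complex)" by (simp del: of_nat_Suc of_nat_add)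
 finally have "xx 0 = const (1 / of_nat (n + 1)) * (vv n + (\<Sum>j = 1..n. yy j))" by simp
 moreover have "good (const (1 / of_nat (n + 1)) * (vv n + (\<Sum>j = 1..n. yy j)))"
  by (intro good_mult good_const good_add good_vv good_sum good_yy)
 ultimately have 0: "good (xx 0)" by simp
 show ?thesis
 proof (cases "i = 0")
  case False
  have "xx i = xx 0 - yy i" by (simp add: yy_def)
  thus ?thesis using good_diff[OF 0 good_yy[of i]] False assms by simp
 qed (simp add: 0)
qed

text \<open>The good elements form a subalgebra that contains the generators.\<close>

lemma good_TT: "f : TT n ==> good f"
proof (induction rule: TT_induct)
 case one
 show ?case using good_const[of 1] by simp
qed (auto intro: good_mult good_const good_add good_xx)

definition prj :: "ncpoly => ppoly" where "prj f = act 1 f"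

lemma prj_Pn: "f : TT n ==> prj f : Pn n"
 using good_TT[of f] by (auto simp: good_def prj_def)
lemma act_Pn: "f : TT n ==> u : Pn n ==> act u f : Pn n"
 using good_TT[of f] by (auto simp: good_def)
lemma cong_normal: "f : TT n ==> f \<approx> normal n (prj f)"
 using good_TT[of f] by (auto simp: good_def prj_def normal_1 dest!: bspec[of _ _ 1])

text \<open>The PBW theorem: the relations generate the annihilator of the unit.\<close>

theorem family_ideal_kernel: "family_ideal n (p, q) = {f : TT n. prj f = 0}"
proof
 show "I <=: {f : TT n. prj f = 0}" using act_I I_simps(1) by (auto simp: prj_def)
 show "{f : TT n. prj f = 0} <=: I"
 proof
  fix f assume "f : {f : TT n. prj f = 0}"
  thus "f : I" using cong_normal[of f] by (auto simp: cong_def)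
 qed
qed

lemma actw_yl: "set l <=: {1..n} ==> act u (yl l) = smult (ym (mset l)) u"
proof (induction l arbitrary: u)
 case (Cons i l)
 have "act u (yl (i # l)) = act (act u (yy i)) (yl l)" by (simp add: yl_def act_mult)
 also have "... = smult (ym (mset l)) (smult (yv i) u)" using Cons by (simp add: act_yy')
 finally show ?case by (simp add: mult.commute)
qed (simp add: yl_def)

lemma prj_vv_power: "act u (vv n ^ j * f) = act ((V ^^ j) u) f"
proof (induction j arbitrary: u)
 case (Suc j)
 have "vv n ^ Suc j * f = vv n * (vv n ^ j * f)" by (simp add: mult.assoc)
 hence "act u (vv n ^ Suc j * f) = act (V u) (vv n ^ j * f)" by (simp only: act_mult act_vv)
 thus ?case by (simp only: Suc funpow_Suc_right o_def)
qed simp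

lemma act_vv_power: "act u (vv n ^ j) = (V ^^ j) u"
 using prj_vv_power[of u j 1] by simp
lemma V_power_1: "(V ^^ j) 1 = monom 1 j"
proof (induction j)
 case (Suc j)
 have "V (monom 1 j) = monom 1 (Suc j)"
 proof (induction j)
  case 0
  show ?case by (rule poly_eqI) (auto simp: coeff_V coeff_monom split: nat.split)
 next
  case (Suc j)
  thus ?case by (simp add: V_monom) (simp add: var_v_def monom_Suc)
 qed
 thus ?case using Suc by simp
qed (simp add: monom_0 one_pCons)

lemma prj_normal: "u : Pn n ==> prj (normal n u) = u"
proof (induction u rule: Pn_induct)
 case (mono c M j)
 have "prj (normal n (monom (yc c * ym M) j)) = smult (ym M) (smult (yc c) (monom 1 j))"
  using mono actw_yl[of "sorted_list_of_multiset M"]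
  by (simp only: prj_def normal_mono act_vv_power V_power_1 act_mult act_simps yw_def set_sorted_list_of_multiset mset_sorted_list_of_multiset)
 thus ?case by (simp add: smult_monom mult.commute)
qed (simp_all add: normal_add prj_def)

end

section \<open>Quotients of the tensor algebra by homogeneous ideals\<close>

lemma lookup_hom_component: "lookup (hom_component k f) w = (if length w = k then lookup f w else 0)"
proof -
 have "lookup (hom_component k f) w =
  (\<Sum>u \<in> {u : keys f. length u = k}. if u = w then lookup f w else 0)"
  by (auto simp: hom_component_def lookup_sum lookup_single when_def intro: sum.cong)
 thus ?thesis by (simp add: in_keys_iff)
qed

lemma keys_hom_component: "keys (hom_component k f) = {w : keys f. length w = k}"
 by (auto simp: in_keys_iff lookup_hom_component split: if_splits)
lemma hom_component_add: "hom_component k (f + g) = hom_component k f + hom_component k g"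
 by (rule poly_mapping_eqI) (simp add: lookup_hom_component lookup_add)
lemma hom_component_0 [simp]: "hom_component k 0 = 0"
 by (rule poly_mapping_eqI) (simp add: lookup_hom_component)
lemma hom_component_diff: "hom_component k (f - g) = hom_component k f - hom_component k g"
 by (rule poly_mapping_eqI) (simp add: lookup_hom_component lookup_minus)
lemma hom_component_sum: "hom_component k (sum f I) = (\<Sum>i \<in> I. hom_component k (f i))"
 by (induction I rule: infinite_finite_induct) (simp_all add: hom_component_add)
lemma piece_iff: "f : TP n k <-> f : TT n & (ALL w:keys f. length w = k)"
 by (simp add: tensor_piece_def)
lemma hom_component_piece: "f : TT n ==> hom_component k f : TP n k"
 by (auto simp: piece_iff TT_iff keys_hom_component)
lemma hom_component_of_piece: "f : TP n l ==> hom_component k f = (if k = l then f else 0)"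
 by (rule poly_mapping_eqI) (auto simp: piece_iff lookup_hom_component in_keys_iff)
lemma sum_hom_components:
 assumes "finite K" "length ` keys f <=: K"
 shows "(\<Sum>k \<in> K. hom_component k f) = f"
proof (rule poly_mapping_eqI)
 fix w
 have "lookup (\<Sum>k \<in> K. hom_component k f) w = (\<Sum>k \<in> K. if k = length w then lookup f w else 0)"
  by (auto simp: lookup_sum lookup_hom_component intro: sum.cong)
 also have "... = lookup f w"
 proof (cases "length w : K")
  case False
  hence "w ~: keys f" using assms(2) by blast
  thus ?thesis using assms(1) False by (simp add: in_keys_iff)
 qed (use assms(1) in simp)
 finally show "lookup (\<Sum>k \<in> K. hom_component k f) w = lookup f w" .
qed

lemma piece_simps [simp]: "0 : TP n k" "f : TP n k ==> g : TP n k ==> f + g : TP n k"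
 "f : TP n k ==> - f : TP n k" "const c : TP n 0" "i <= n ==> xx i : TP n 1"
proof -
 show "f + g : TP n k" if "f : TP n k" "g : TP n k"
  using that Poly_Mapping.keys_add[of f g] TT_add[of f n g] by (auto simp: piece_iff)
qed (auto simp: piece_iff const_def xx_def TT_iff in_keys_iff)

lemma piece_mult: assumes "f : TP n k" "g : TP n l" shows "f * g : TP n (k + l)"
proof -
 have "length w = k + l" if "w : keys (f * g)" for w
 proof -
  from that obtain a b where "a : keys f" "b : keys g" "w = a @ b"
   using keys_mult[of f g] by (auto simp: plus_list_def)
  thus ?thesis using assms by (auto simp: piece_iff)
 qed
 thus ?thesis using assms by (simp add: piece_iff)
qed

lemma piece_scale: "f : TP n k ==> const c * f : TP n k"
 using piece_mult[of "const c" n 0 f k] by simp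
lemma piece_diff: "f : TP n k ==> g : TP n k ==> f - g : TP n k"
 using piece_simps(2)[of f n k "- g"] by simp
lemma piece_sum: "(!!i. i : I ==> f i : TP n k) ==> sum f I : TP n k"
 by (induction I rule: infinite_finite_induct) simp_all
lemma piece_TT: "f : TP n k ==> f : TT n" by (simp add: piece_iff)
lemma piece_0: "TP n 0 = range const"
proof (intro equalityI subsetI)
 fix f assume f: "f : TP n 0"
 have "lookup f w = 0" if "w ~= []" for w
  using f that unfolding piece_iff by (metis in_keys_iff length_0_conv)
 hence "f = const (lookup f [])"
  by (intro poly_mapping_eqI) (auto simp: const_def lookup_single when_def)
 thus "f : range const" by blast
qed auto

lemma lookup_Nil_mult: "lookup (f * g) [] = lookup f [] * lookup g []"
proof (induction f rule: poly_mapping_induct)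
 case (single w c)
 show ?case
 proof (induction g rule: poly_mapping_induct)
  case (single w' d)
  show ?case by (auto simp: mult_single plus_list_def lookup_single when_def)
 qed (simp_all add: distrib_left lookup_add)
qed (simp_all add: distrib_right lookup_add)

locale tensor_quotient =
 fixes n :: nat and R :: "ncpoly set"
 assumes R_ideal: "ideal R (tensor_alg n)"
begin

lemmas R_simps = ideal_tensorD[OF R_ideal]

abbreviation Q where "Q \<equiv> quotient_alg n R"

definition cls :: "ncpoly => ncpoly set" where "cls f = R +>\<^bsub>tensor_alg n\<^esub> f"

lemma cls_eq: "cls f = {r + f | r. r : R}"
 by (auto simp: cls_def a_r_coset_def' tensor_alg_def)
lemma cls_eq_iff: assumes "f : TT n" "g : TT n" shows "cls f = cls g <-> f - g : R"
proof
 assume "cls f = cls g"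
 moreover have "f : cls f" using R_simps(2) by (auto simp: cls_eq intro!: exI[of _ 0])
 ultimately obtain r where "r : R" "f = r + g" by (auto simp: cls_eq)
 thus "f - g : R" by simp
next
 assume fg: "f - g : R"
 have "r + f : cls g" if "r : R" for r
  using R_simps(3)[OF that fg] by (auto simp: cls_eq intro!: exI[of _ "r + (f - g)"])
 moreover have "r + g : cls f" if "r : R" for r
  using R_simps(5)[OF that fg] by (auto simp: cls_eq intro!: exI[of _ "r - (f - g)"])
 ultimately show "cls f = cls g" by (auto simp: cls_eq)
qed

lemma Q_sel: "carrier Q = cls ` TT n" "1[Q] = cls 1" "0[Q] = cls 0" "scal Q c = cls (const c)"
 "piece Q k = cls ` TP n k"
proof -
 have "cls 0 = R" by (simp add: cls_eq)
 thus "carrier Q = cls ` TT n" "1[Q] = cls 1" "0[Q] = cls 0" "scal Q c = cls (const c)" "piece Q k = cls ` TP n k"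
  by (auto simp: quotient_alg_def ring.defs graded_algebra.defs FactRing_def cls_def A_RCOSETS_def')
qed

lemma Q_add: assumes "f : TT n" "g : TT n" shows "cls f +[Q] cls g = cls (f + g)"
proof -
 interpret ideal R "tensor_alg n" by (rule R_ideal)
 have "cls f <+>\<^bsub>tensor_alg n\<^esub> cls g = cls (f + g)"
  using a_rcos_sum[OF assms] by (simp add: cls_def)
 thus ?thesis by (simp add: quotient_alg_def ring.defs graded_algebra.defs FactRing_def)
qed

lemma Q_mult: assumes "f : TT n" "g : TT n" shows "cls f *[Q] cls g = cls (f * g)"
proof -
 interpret ideal R "tensor_alg n" by (rule R_ideal)
 have "rcoset_mult (tensor_alg n) R (cls f) (cls g) = cls (f * g)"
  using rcoset_mult_add[OF assms] by (simp add: cls_def)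
 thus ?thesis by (simp add: quotient_alg_def ring.defs graded_algebra.defs FactRing_def)
qed

lemma cls_in [simp]: "f : TT n ==> cls f |: Q" by (simp add: Q_sel)
lemma Q_cases: assumes "X |: Q" obtains f where "f : TT n" "X = cls f"
 using assms by (auto simp: Q_sel)
lemma Q_ring: "ring Q"
proof (rule ringI)
 show "abelian_group Q"
 proof (rule abelian_groupI)
  fix X assume "X |: Q"
  then obtain f where "f : TT n" "X = cls f" by (rule Q_cases)
  thus "EX Y:carrier Q. Y +[Q] X = 0[Q]" by (intro bexI[of _ "cls (- f)"]) (simp_all add: Q_add Q_sel(3))
 qed (auto simp: Q_sel(1,3) Q_add add_ac)
 show "Group.monoid Q" by (rule monoidI) (auto simp: Q_sel(1,2) Q_mult mult.assoc)
qed (auto simp: Q_sel(1) Q_add Q_mult algebra_simps)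

lemma Q_minus: assumes "f : TT n" shows "-[Q] cls f = cls (- f)"
proof -
 interpret Q: ring Q by (rule Q_ring)
 show ?thesis by (rule Q.minus_equality) (use assms in "simp_all add: Q_add Q_sel(3)")
qed

lemma Q_diff: assumes "f : TT n" "g : TT n" shows "cls f -[Q] cls g = cls (f - g)"
 using assms by (simp add: a_minus_def Q_minus Q_add)
lemma Q_finsum: assumes "!!i. i : K ==> g i : TT n" shows "finsum Q (%i. cls (g i)) K = cls (sum g K)"
proof -
 interpret Q: ring Q by (rule Q_ring)
 show ?thesis using assms
  by (induction K rule: infinite_finite_induct) (simp_all add: Q_sel(3) Q_add Pi_def)
qed

end

locale graded_quotient = tensor_quotient +
 assumes homogeneous: "f : R ==> hom_component k f : R" and no_const: "f : R ==> lookup f [] = 0"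
begin

lemma Q_nontrivial: "1[Q] ~= 0[Q]"
 using no_const[of 1] by (auto simp: Q_sel(2,3) cls_eq_iff lookup_one zero_list_def)
text \<open>Homogeneity of the ideal lets the components of a representative be read off modulo the ideal.\<close>

lemma Q_direct_sum:
 assumes X: "X |: Q"
 shows "EX! F. (ALL k. F k : piece Q k) & finite {k. F k ~= 0[Q]} & X = finsum Q F {k. F k ~= 0[Q]}"
proof -
 interpret Q: ring Q by (rule Q_ring)
 obtain f where f: "f : TT n" "X = cls f" using X by (rule Q_cases)
 have hTT: "hom_component k f : TT n" for k using hom_component_piece[OF f(1)] by (rule piece_TT)
 let ?F = "%k. cls (hom_component k f)"
 show ?thesis
 proof (rule ex1I[of _ ?F])
  let ?L = "length ` keys f" and ?S = "{k. ?F k ~= 0[Q]}"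
  have S: "?S <=: ?L"
  proof
   fix k assume "k : ?S"
   hence "hom_component k f ~= 0" by (auto simp: Q_sel(3))
   hence "keys (hom_component k f) ~= {}" by simp
   thus "k : ?L" by (auto simp: keys_hom_component)
  qed
  have fin: "finite ?L" by simp
  have "finsum Q ?F ?L = finsum Q ?F ?S"
   by (rule Q.add.finprod_mono_neutral_cong_left[OF fin S, symmetric]) (use hTT in auto)
  moreover have "finsum Q ?F ?L = cls f" by (simp add: Q_finsum hTT sum_hom_components)
  ultimately have "X = finsum Q ?F ?S" using f(2) by simp
  thus "(ALL k. ?F k : piece Q k) & finite ?S & X = finsum Q ?F ?S"
   using finite_subset[OF S fin] hom_component_piece[OF f(1)] by (auto simp: Q_sel(5))
 next
  fix G assume G: "(ALL k. G k : piece Q k) & finite {k. G k ~= 0[Q]} & X = finsum Q G {k. G k ~= 0[Q]}"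
  have "EX g. g : TP n k & G k = cls g" for k using G by (auto simp: Q_sel(5))
  then obtain g where g: "!!k. g k : TP n k" "!!k. G k = cls (g k)" by metis
  let ?S = "{k. G k ~= 0[Q]}"
  have gT: "g k : TT n" for k using g(1) by (rule piece_TT)
  have "G = (%k. cls (g k))" using g(2) by blast
  hence "X = cls (sum g ?S)" using G Q_finsum[of ?S g] gT by simp
  hence "cls (sum g ?S) = cls f" using f(2) by simp
  hence "sum g ?S - f : R" using cls_eq_iff[of "sum g ?S" f] f(1) gT by simp
  hence 1: "hom_component k (sum g ?S) - hom_component k f : R" for k using homogeneous by (metis hom_component_diff)
  have 2: "hom_component k (sum g ?S) = (if k : ?S then g k else 0)" for k
  proof -
   have "hom_component k (sum g ?S) = (\<Sum>l \<in> ?S. if k = l then g l else 0)"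
    unfolding hom_component_sum using hom_component_of_piece[OF g(1)] by (intro sum.cong) auto
   thus ?thesis using G by simp
  qed
  show "G = ?F"
  proof
   fix k
   show "G k = ?F k"
   proof (cases "k : ?S")
    case True
    thus ?thesis using 1[of k] 2[of k] g gT hTT by (simp add: cls_eq_iff)
   next
    case False
    hence "0 - hom_component k f : R" using 1[of k] 2[of k] by simp
    hence "cls 0 = ?F k" using cls_eq_iff[of 0 "hom_component k f"] hTT by simp
    thus ?thesis using False by (simp add: Q_sel(3))
   qed
  qed
 qed
qed

lemma Q_connected_graded: "connected_graded_algebra Q"
proof -
 interpret Q: ring Q by (rule Q_ring)
 have sub: "additive_subgroup (piece Q k) Q" for k
 proof (rule additive_subgroup.intro, rule group.subgroupI)
  show "Group.group (add_monoid Q)" by (rule Q.a_group)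
  show "piece Q k <=: carrier (add_monoid Q)" by (auto simp: Q_sel piece_TT)
  show "piece Q k ~= {}" by (auto simp: Q_sel intro: piece_simps(1))
  fix X assume "X : piece Q k"
  then obtain f where f: "f : TP n k" "X = cls f" by (auto simp: Q_sel)
  show "inv\<^bsub>add_monoid Q\<^esub> X : piece Q k"
   using f Q_minus[OF piece_TT[OF f(1)]] by (auto simp: a_inv_def Q_sel)
  fix Y assume "Y : piece Q k"
  then obtain g where g: "g : TP n k" "Y = cls g" by (auto simp: Q_sel)
  show "X *[add_monoid Q] Y : piece Q k"
   using f g Q_add[OF piece_TT[OF f(1)] piece_TT[OF g(1)]] by (auto simp: Q_sel)
 qed
 show ?thesis
 proof (rule connected_graded_algebra.intro[OF Q_ring], rule connected_graded_algebra_axioms.intro)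
  show "scal Q c |: Q" "scal Q (c + d) = scal Q c +[Q] scal Q d" "scal Q (c * d) = scal Q c *[Q] scal Q d"
   "scal Q 1 = 1[Q]" for c d by (simp_all add: Q_sel(4,2) Q_add Q_mult)
  show "scal Q c *[Q] X = X *[Q] scal Q c" if "X |: Q" for X c
   using that const_central[of c] by (auto simp: Q_sel(1,4) Q_mult)
  show "additive_subgroup (piece Q k) Q" for k by (rule sub)
  show "X *[Q] Y : piece Q (k + l)" if "X : piece Q k" "Y : piece Q l" for X Y k l
   using that piece_mult by (auto simp: Q_sel(5) Q_mult piece_TT)
  show "EX! f. (ALL k. f k : piece Q k) & finite {k. f k ~= 0[Q]} & X = finsum Q f {k. f k ~= 0[Q]}"
   if "X |: Q" for X by (rule Q_direct_sum[OF that])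
  show "piece Q 0 = range (scal Q)" by (auto simp: Q_sel piece_0)
  show "1[Q] ~= 0[Q]" by (rule Q_nontrivial)
 qed
qed

text \<open>The ideal generated by the elements of positive degree consists of the classes without constant term.\<close>

lemma Q_augmentation:
 assumes f: "f : TT n"
 shows "augmentation Q (cls f) = lookup f []"
proof -
 interpret Q: ring Q by (rule Q_ring)
 let ?P = "\<Union>k \<in> {1..}. piece Q k"
 let ?J = "{cls f | f. f : TT n & lookup f [] = 0}"
 have PQ: "?P <=: carrier Q" by (auto simp: Q_sel piece_TT)
 have J: "ideal ?J Q"
 proof (rule idealI[OF Q_ring])
  show "subgroup ?J (add_monoid Q)"
  proof (rule group.subgroupI[OF Q.a_group])
   show "?J ~= {}" by (auto intro!: exI[of _ 0])
   show "inv\<^bsub>add_monoid Q\<^esub> X : ?J" if "X : ?J" for X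
   proof -
    from that obtain g where g: "g : TT n" "lookup g [] = 0" "X = cls g" by auto
    thus ?thesis using Q_minus[OF g(1)] by (auto simp: a_inv_def intro!: exI[of _ "- g"])
   qed
   show "X *[add_monoid Q] Y : ?J" if "X : ?J" "Y : ?J" for X Y
   proof -
    from that obtain g h where "g : TT n" "lookup g [] = 0" "X = cls g"
     "h : TT n" "lookup h [] = 0" "Y = cls h" by auto
    thus ?thesis by (auto simp: Q_add lookup_add intro!: exI[of _ "g + h"])
   qed
  qed auto
  fix X Y assume "X : ?J" "Y |: Q"
  then obtain g h where gh: "g : TT n" "lookup g [] = 0" "X = cls g" "h : TT n" "Y = cls h"
   by (auto simp: Q_sel)
  show "Y *[Q] X : ?J" using gh by (auto simp: Q_mult lookup_Nil_mult intro!: exI[of _ "h * g"])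
  show "X *[Q] Y : ?J" using gh by (auto simp: Q_mult lookup_Nil_mult intro!: exI[of _ "g * h"])
 qed
 have "?P <=: ?J"
 proof
  fix X assume "X : ?P"
  then obtain k g where g: "k >= 1" "g : TP n k" "X = cls g" by (auto simp: Q_sel)
  hence "[] ~: keys g" by (auto simp: piece_iff)
  hence "lookup g [] = 0" by (simp add: in_keys_iff)
  thus "X : ?J" using g piece_TT by blast
 qed
 hence sub: "Idl\<^bsub>Q\<^esub> ?P <=: ?J" by (rule Q.genideal_minimal[OF J])
 interpret G: ideal "Idl\<^bsub>Q\<^esub> ?P" Q by (rule Q.genideal_ideal[OF PQ])
 have sup: "cls g : Idl\<^bsub>Q\<^esub> ?P" if g: "g : TT n" "lookup g [] = 0" for g
 proof -
  let ?K = "length ` keys g"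
  have hp: "hom_component k g : TP n k" for k by (rule hom_component_piece[OF g(1)])
  have "cls (\<Sum>k \<in> K. hom_component k g) : Idl\<^bsub>Q\<^esub> ?P" if "finite K" "K <=: {1..}" for K
   using that
  proof (induction K rule: finite_induct)
   case empty
   show ?case using additive_subgroup.zero_closed[OF G.is_additive_subgroup] by (simp add: Q_sel(3))
  next
   case (insert k K)
   have "cls (hom_component k g) : ?P" using hp[of k] insert.prems by (auto simp: Q_sel(5))
   hence "cls (hom_component k g) : Idl\<^bsub>Q\<^esub> ?P" using Q.genideal_self[OF PQ] by blast
   moreover have "cls (\<Sum>k \<in> K. hom_component k g) : Idl\<^bsub>Q\<^esub> ?P" using insert by simp
   ultimately have "cls (hom_component k g) +[Q] cls (\<Sum>k \<in> K. hom_component k g) : Idl\<^bsub>Q\<^esub> ?P"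
    by (rule additive_subgroup.a_closed[OF G.is_additive_subgroup])
   thus ?case using insert.hyps piece_TT[OF hp] by (simp add: Q_add)
  qed
  moreover have "?K <=: {1..}" using g(2) by (auto simp: in_keys_iff Suc_le_eq)
  moreover have "(\<Sum>k \<in> ?K. hom_component k g) = g" by (rule sum_hom_components) auto
  ultimately show ?thesis by (metis finite_imageI finite_keys)
 qed
 have iff: "cls f -[Q] scal Q c : Idl\<^bsub>Q\<^esub> ?P <-> c = lookup f []" for c
 proof -
  have eq: "cls f -[Q] scal Q c = cls (f - const c)" using f by (simp add: Q_sel(4) Q_diff)
  have lk: "lookup (f - const c) [] = lookup f [] - c" by (simp add: lookup_minus const_def)
  show ?thesis
  proof
   assume "cls f -[Q] scal Q c : Idl\<^bsub>Q\<^esub> ?P"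
   hence "cls (f - const c) : ?J" using sub eq by auto
   then obtain g where g: "g : TT n" "lookup g [] = 0" "cls (f - const c) = cls g" by blast
   hence "f - const c - g : R" using cls_eq_iff[of "f - const c" g] f by simp
   from no_const[OF this] show "c = lookup f []" using lk g(2) by (simp add: lookup_minus)
  next
   assume "c = lookup f []"
   thus "cls f -[Q] scal Q c : Idl\<^bsub>Q\<^esub> ?P" using sup[of "f - const c"] f lk eq by simp
  qed
 qed
 show ?thesis unfolding augmentation_def by (rule the_equality) (simp_all only: iff)
qed

end

section \<open>The grading of the model\<close>

definition hy :: "nat => ypoly => bool" where "hy k f <-> (ALL M:keys f. size M = k)"

lemma hy_simps [simp]: "hy k 0" "hy k f ==> hy k g ==> hy k (f + g)" "hy k f ==> hy k (- f)" "hy 0 (yc c)" "size M = k ==> hy k (ym M)"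
 using Poly_Mapping.keys_add[of f g] by (auto simp: hy_def in_keys_iff ym_def yc_def lookup_single when_def)
lemma hy_one [simp]: "hy 0 1" using hy_simps(4)[of 1] by simp
lemma hy_mult: assumes "hy k f" "hy l g" shows "hy (k + l) (f * g)"
proof -
 have "size M = k + l" if "M : keys (f * g)" for M
 proof -
  from that obtain a b where "a : keys f" "b : keys g" "M = a + b"
   using keys_mult[of f g] by auto
  thus ?thesis using assms by (auto simp: hy_def)
 qed
 thus ?thesis by (simp add: hy_def)
qed

lemma hy_scale: "hy k f ==> hy k (yc c * f)" using hy_mult[of 0 "yc c" k f] by simp
lemma hy_yv [simp]: "hy 1 (yv i)" unfolding yv_def by (rule hy_simps(5)) simp
lemma hy_yv' [simp]: "hy (Suc 0) (yv i)" using hy_yv[of i] by simp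
lemma hy_sum: "(!!i. i : I ==> hy k (f i)) ==> hy k (sum f I)"
 by (induction I rule: infinite_finite_induct) simp_all
lemma hy_linear:
 assumes "hy k f" "Phi 0 = 0" "!!f g. Phi (f + g) = Phi f + Phi g" "!!c M. Phi (yc c * ym M) = yc c * Phi (ym M)"
  "!!M. hy (size M + d) (Phi (ym M))"
 shows "hy (k + d) (Phi f)"
proof -
 have sum: "Phi (sum g K) = (\<Sum>i \<in> K. Phi (g i))" for g and K :: "nat multiset set"
  by (induction K rule: infinite_finite_induct) (simp_all add: assms(2,3))
 have "Phi f = (\<Sum>M \<in> keys f. yc (lookup f M) * Phi (ym M))"
  using poly_mapping_decompose[of f] by (metis (no_types, lifting) sum assms(4) single_ym sum.cong)
 also have "hy (k + d) ..."
 proof (rule hy_sum, rule hy_scale)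
  fix M assume "M : keys f"
  hence "size M = k" using assms(1) by (simp add: hy_def)
  thus "hy (k + d) (Phi (ym M))" using assms(5)[of M] by simp
 qed
 finally show ?thesis .
qed

text \<open>Homogeneity of degree \<open>k\<close> of a combination of the basis elements \<open>v\<^sup>j y\<^sup>M\<close>.\<close>

definition hp :: "nat => ppoly => bool" where
 "hp k u <-> (ALL j. ALL M:keys (coeff u j). size M + j = k)"

lemma hp_lookup: "hp k u <-> (ALL j M. size M + j ~= k --> lookup (coeff u j) M = 0)"
 unfolding hp_def by (metis in_keys_iff)
lemma hp_iff: "hp k u <-> (ALL j. coeff u j ~= 0 --> j <= k & hy (k - j) (coeff u j))"
 unfolding hp_def hy_def
proof (intro iff_allI iffI ballI impI)
 fix j assume *: "ALL M:keys (coeff u j). size M + j = k" "coeff u j ~= 0"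
 then obtain M where "M : keys (coeff u j)" by fastforce
 thus "j <= k & (ALL M:keys (coeff u j). size M = k - j)" using * by auto
next
 fix j M assume *: "coeff u j ~= 0 --> j <= k & (ALL M:keys (coeff u j). size M = k - j)"
  "M : keys (coeff u j)"
 hence "coeff u j ~= 0" by auto
 thus "size M + j = k" using * by auto
qed

lemma hp_simps [simp]: "hp k 0" "hp 0 1"
 by (auto simp: hp_iff coeff_pCons one_pCons split: nat.split)
lemma hp_add: assumes "hp k u" "hp k w" shows "hp k (u + w)"
 unfolding hp_def
proof (intro allI ballI)
 fix j M assume "M : keys (coeff (u + w) j)"
 hence "M : keys (coeff u j) \<or> M : keys (coeff w j)"
  using Poly_Mapping.keys_add[of "coeff u j" "coeff w j"] by auto
 thus "size M + j = k" using assms by (auto simp: hp_def)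
qed
lemma hp_neg: "hp k u ==> hp k (- u)" by (auto simp: hp_def in_keys_iff)
lemma hp_smult: "hp k u ==> hy l f ==> hp (k + l) (smult f u)"
 unfolding hp_iff by (auto simp: dest!: hy_mult[of l f]) (metis Nat.add_diff_assoc2 add.commute)
lemma hp_scale: "hp k u ==> hp k (smult (yc c) u)" using hp_smult[of k u 0 "yc c"] by simp

context pbw_model
begin

lemma hy_ydelta: "hy (1 + 1) (ydelta (yv i))"
proof -
 have "hy 1 (yc (of_nat (n + 1)) * yv i + - (yc 2 * ysum))"
  unfolding ysum_def by (intro hy_simps(2,3) hy_scale hy_sum hy_yv)
 hence "hy (1 + 1) (yv i * (yc (of_nat (n + 1)) * yv i + - (yc 2 * ysum)))" by (intro hy_mult hy_yv)
 moreover have "ydelta (yv i) = yv i * (yc (of_nat (n + 1)) * yv i + - (yc 2 * ysum))" by (simp add: ydelta_def)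
 ultimately show ?thesis by simp
qed

lemma hy_sig: "hy k f ==> hy k (sig f)"
 using hy_linear[of k f sig 0]
proof -
 assume f: "hy k f"
 have "hy (size M) (sig (ym M))" for M
 proof (induction M)
  case (add i M)
  have "hy (1 + size M) (yc (1 + p) * yv i * sig (ym M))" by (intro hy_mult[OF hy_scale[OF hy_yv] add])
  thus ?case by simp
 qed simp
 thus ?thesis using hy_linear[of k f sig 0] f by simp
qed

lemma hy_D: assumes "hy k f" shows "hy (k + 1) (D f)"
proof (rule hy_linear[OF assms])
 show "hy (size M + 1) (D (ym M))" for M
 proof (induction M)
  case (add i M)
  have "hy (size M + 1 + 1) (yv i * D (ym M))" using hy_mult[OF hy_yv add] by (simp add: add_ac)
  moreover have "hy (size M + 1 + 1) (- (ydelta (yv i) * ym M))"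
   using hy_simps(3)[OF hy_mult[OF hy_ydelta[of i] hy_simps(5)[of M, OF refl]]] by (simp add: add_ac)
  ultimately have "hy (size M + 1 + 1) (yv i * D (ym M) + - (ydelta (yv i) * ym M))" by (rule hy_simps(2))
  thus ?case by (simp add: add.commute)
 qed simp
qed simp_all

lemma hp_V: assumes "hp k u" shows "hp (k + 1) (V u)"
 unfolding hp_def
proof (intro allI ballI)
 fix j M assume M: "M : keys (coeff (V u) j)"
 consider (a) l where "j = Suc l" "M : keys (sig (coeff u l))" | (b) "M : keys (yc q * D (coeff u j))"
  using M Poly_Mapping.keys_add[of "case j of 0 => 0 | Suc k => sig (coeff u k)" "yc q * D (coeff u j)"]
  by (cases j) (auto simp: coeff_V)
 thus "size M + j = k + 1"
 proof cases
  case a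
  hence "coeff u l ~= 0" by auto
  hence "l <= k" "hy (k - l) (sig (coeff u l))" using assms hy_sig by (auto simp: hp_iff)
  thus ?thesis using a by (auto simp: hy_def)
 next
  case b
  hence "coeff u j ~= 0" by auto
  hence "j <= k" "hy (k - j + 1) (yc q * D (coeff u j))" using assms hy_D hy_scale by (auto simp: hp_iff)
  thus ?thesis using b by (auto simp: hy_def)
 qed
qed

lemma hp_X: assumes "hp k u" shows "hp (k + 1) (X i u)"
proof -
 have s: "hy 1 ysum" unfolding ysum_def by (intro hy_sum hy_yv)
 have y: "hy 1 (yv0 i)" by (simp add: yv0_def)
 have "hp (k + 1) (smult (yc (1 / of_nat (n + 1))) (V u + smult ysum u) + - smult (yv0 i) u)"
  by (intro hp_add hp_neg hp_scale hp_V hp_smult assms s y)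
 thus ?thesis by (simp add: X_def)
qed

lemma hp_actw: "hp k u ==> hp (k + length w) (actw u w)"
proof (induction w arbitrary: k u)
 case (Cons i w)
 thus ?case using Cons.IH[OF hp_X[OF Cons.prems], of i] by (simp add: actw_def)
qed (simp add: actw_def)

lemma prj_single: "hp (length w) (prj (single w c))"
 using hp_scale[OF hp_actw[OF hp_simps(2), of w], of c] by (simp add: prj_def act_single)
lemma prj_simps [simp]: "prj 0 = 0" "prj (f + g) = prj f + prj g" "prj (f - g) = prj f - prj g" "prj (- f) = - prj f" "prj (const c) = [:yc c:]" "prj 1 = 1"
 by (simp_all add: prj_def)
lemma prj_const_mult [simp]: "prj (const c * f) = smult (yc c) (prj f)"
 by (simp only: prj_def act_mult act_simps(5) act_scale_left)
lemma prj_sum: "prj (sum f K) = (\<Sum>i \<in> K. prj (f i))" by (simp add: prj_def act_sum)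
lemma prj_mult: "prj (f * g) = act (prj f) g" by (simp add: prj_def act_mult)
lemma hom_component_single: "hom_component k (single w c) = (if length w = k then single w c else 0)"
 by (rule poly_mapping_eqI) (auto simp: lookup_hom_component lookup_single when_def)
lemma lookup_prj_hom_component:
 "lookup (coeff (prj (hom_component k f)) j) M = (if size M + j = k then lookup (coeff (prj f) j) M else 0)"
proof (induction f rule: poly_mapping_induct)
 case (single w c)
 have "lookup (coeff (prj (single w c)) j) M = 0" if "size M + j ~= length w"
  using prj_single[of w c] that by (simp add: hp_lookup)
 thus ?case by (auto simp: hom_component_single)
qed (simp_all add: hom_component_add lookup_add)

lemma hp_prj: assumes "f : TP n k" shows "hp k (prj f)"
proof -
 have "hom_component k f = f" using hom_component_of_piece[OF assms, of k] by simp
 hence "lookup (coeff (prj f) j) M = (if size M + j = k then lookup (coeff (prj f) j) M else 0)" for j M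
  using lookup_prj_hom_component[of k f j M] by metis
 thus ?thesis unfolding hp_lookup by metis
qed

lemma piece_of_hp: assumes f: "f : TT n" and h: "hp k (prj f)" shows "prj (hom_component k f) = prj f"
proof (rule poly_eqI, rule poly_mapping_eqI)
 fix j M
 show "lookup (coeff (prj (hom_component k f)) j) M = lookup (coeff (prj f) j) M"
  using h by (simp add: lookup_prj_hom_component hp_lookup)
qed

lemma lookup_prj_const: "lookup (coeff (prj f) 0) {#} = lookup f []"
proof -
 have "hom_component 0 f = const (lookup f [])"
  by (rule poly_mapping_eqI) (auto simp: lookup_hom_component const_def lookup_single when_def)
 thus ?thesis using lookup_prj_hom_component[of 0 f 0 "{#}"] by (simp add: yc_def)
qed

lemma I_graded: "graded_quotient n I"
proof (rule graded_quotient.intro, rule tensor_quotient.intro, rule I_ideal, rule graded_quotient_axioms.intro)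
 show "hom_component k f : I" if "f : I" for f k
 proof -
  have f: "f : TT n" "prj f = 0" using that by (auto simp: family_ideal_kernel)
  have "prj (hom_component k f) = 0"
   by (rule poly_eqI, rule poly_mapping_eqI) (simp add: lookup_prj_hom_component f)
  thus ?thesis using piece_TT[OF hom_component_piece[OF f(1), of k]] by (simp add: family_ideal_kernel)
 qed
 show "lookup f [] = 0" if "f : I" for f
  using that lookup_prj_const[of f] by (simp add: family_ideal_kernel)
qed

end

sublocale pbw_model \<subseteq> graded_quotient n "family_ideal n (p, q)" by (rule I_graded)

section \<open>Symmetry of the model\<close>

context pbw_model
begin

text \<open>The substitution induced by a permutation of \<open>x\<^sub>0, ..., x\<^sub>n\<close>, where \<open>yv0 0 = 0\<close>.\<close>

definition ysym :: "(nat => nat) => ypoly => ypoly" where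
 "ysym s = ysub (%i. yv0 (s i) - yv0 (s 0))"

definition psym :: "(nat => nat) => ppoly => ppoly" where "psym s = map_poly (ysym s)"

lemma ysym_simps [simp]: "ysym s 0 = 0" "ysym s (f + g) = ysym s f + ysym s g" "ysym s (f - g) = ysym s f - ysym s g"
 "ysym s (- f) = - ysym s f" "ysym s (f * g) = ysym s f * ysym s g" "ysym s (yc c) = yc c" "ysym s 1 = 1"
 "ysym s (numeral k) = numeral k" "ysym s (of_nat m) = of_nat m"
 by (simp_all add: ysym_def)

lemma ysym_yv0: "ysym s (yv0 i) = (if i = 0 then 0 else yv0 (s i) - yv0 (s 0))"
 by (simp add: yv0_def ysym_def)
lemma ysym_yv0': "ysym s (yv0 i) = yv0 (s i) - yv0 (s 0)"
 by (simp add: ysym_yv0)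
lemma ysym_sum: "ysym s (sum f K) = (\<Sum>i \<in> K. ysym s (f i))"
 by (simp add: ysym_def ysub_sum)
lemma ysum_yv0: "ysum = (\<Sum>i = 0..n. yv0 i)" by (simp add: sum_yv0)
lemma ysym_ysum: assumes "s permutes {0..n}" shows "ysym s ysum = ysum - of_nat (n + 1) * yv0 (s 0)"
proof -
 have "ysym s ysum = (\<Sum>i = 0..n. yv0 (s i)) - (\<Sum>i = 0..n. yv0 (s 0))"
  unfolding ysum_yv0 ysym_sum ysym_yv0' sum_subtractf ..
 also have "(\<Sum>i = 0..n. yv0 (s i)) = ysum"
  unfolding ysum_yv0 using sum.permute[OF assms, of yv0] by (simp add: o_def)
 finally show ?thesis by simp
qed

lemma coeff_psym [simp]: "coeff (psym s u) j = ysym s (coeff u j)"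
 by (simp add: psym_def coeff_map_poly)
lemma psym_simps [simp]: "psym s 0 = 0" "psym s (u + w) = psym s u + psym s w" "psym s (u - w) = psym s u - psym s w"
 "psym s (smult f u) = smult (ysym s f) (psym s u)" "psym s 1 = 1"
 by (rule poly_eqI; simp add: coeff_pCons one_pCons split: nat.split)+

lemma ysym_sig: "f : Yn n ==> ysym s (sig f) = sig (ysym s f)"
proof (induction f rule: Yn_induct)
 case (mono c M)
 have y: "sig (yv0 i) = yc (1 + p) * yv0 i" for i by (simp add: yv0_def)
 have "ysym s (sig (ym M)) = sig (ysym s (ym M))" using mono
 proof (induction M)
  case (add i M)
  hence "yv i = yv0 i" by (simp add: yv0_def)
  moreover have "sig (f - g) = sig f - sig g" for f g by (simp add: sig_def)
  ultimately show ?case using add by (simp add: y ysym_yv0' right_diff_distrib)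
 qed simp
 thus ?case by simp
qed simp_all

lemma D_yv0: "D (yv0 i) = - ydelta (yv0 i)"
 by (simp add: yv0_def ydelta_def)
lemma ysym_D: assumes s: "s permutes {0..n}" shows "f : Yn n ==> ysym s (D f) = D (ysym s f)"
proof (induction f rule: Yn_induct)
 case (mono c M)
 have Dd: "D (f - g) = D f - D g" for f g by (simp add: D_def)
 have y: "ysym s (D (yv0 i)) = D (ysym s (yv0 i))" for i
  by (simp add: D_yv0 ysym_yv0' Dd ydelta_def ysym_ysum[OF s] algebra_simps)
 have "ysym s (D (ym M)) = D (ysym s (ym M))" using mono
 proof (induction M)
  case (add i M)
  hence "yv i = yv0 i" by (simp add: yv0_def)
  moreover from this have "- ydelta (yv i) = D (yv0 i)" by (simp add: D_yv0)
  ultimately show ?case using add y[of i] by simp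
 qed simp
 thus ?case by simp
qed simp_all

text \<open>The derivation is equivariant, since \<open>\<delta>\<close> is given by the same formula at every difference of two variables \<open>x\<close>.\<close>

lemma psym_V: assumes "s permutes {0..n}" "u : Pn n" shows "psym s (V u) = V (psym s u)"
proof (rule poly_eqI)
 fix j
 have "coeff u j : Yn n" for j using assms(2) by (simp add: Pn_def)
 thus "coeff (psym s (V u)) j = coeff (V (psym s u)) j"
  using ysym_sig ysym_D[OF assms(1)] by (simp add: coeff_V split: nat.split)
qed

lemma psym_X: assumes "s permutes {0..n}" "u : Pn n" shows "psym s (X i u) = X (s i) (psym s u)"
proof -
 have 1: "yc (1 / of_nat (n + 1)) * of_nat (n + 1) = 1"
  using yc_simps(4)[of "1 / of_nat (n + 1)" "of_nat (n + 1)"] by (simp del: yc_simps(4) of_nat_Suc of_nat_add)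
 have "psym s (X i u) = smult (yc (1 / of_nat (n + 1))) (V (psym s u) + smult (ysum - of_nat (n + 1) * yv0 (s 0)) (psym s u))
   - smult (yv0 (s i) - yv0 (s 0)) (psym s u)"
  unfolding X_def psym_simps ysym_simps(6) psym_V[OF assms] ysym_ysum[OF assms(1)] ysym_yv0' ..
 also have "... = X (s i) (psym s u)
   - smult (yc (1 / of_nat (n + 1)) * of_nat (n + 1) * yv0 (s 0)) (psym s u) + smult (yv0 (s 0)) (psym s u)"
  unfolding X_def smult_diff_left smult_add_right smult_diff_right smult_smult by (simp only: mult.assoc) simp
 also have "... = X (s i) (psym s u)" unfolding 1 by simp
 finally show ?thesis .
qed

lemma perm_act_lift: "perm_act s f = lift_lin const (%w. single (map s w) 1) f"
 by (simp add: perm_act_def lift_lin_def const_def mult_single plus_list_def)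
lemma perm_act_simps [simp]: "perm_act s 0 = 0" "perm_act s (f + g) = perm_act s f + perm_act s g" "perm_act s (f - g) = perm_act s f - perm_act s g"
 "perm_act s (f * g) = perm_act s f * perm_act s g" "perm_act s (const c) = const c" "perm_act s (xx i) = xx (s i)"
 "perm_act s (single w c) = single (map s w) c"
proof -
 show 1: "perm_act s (single w c) = single (map s w) c" for w c
  by (simp add: perm_act_lift const_def mult_single plus_list_def)
 show "perm_act s (f * g) = perm_act s f * perm_act s g"
  unfolding perm_act_lift by (rule Tens.lift_mult) (simp add: mult_single plus_list_def)
 show "perm_act s (const c) = const c" "perm_act s (xx i) = xx (s i)" by (simp_all add: const_def xx_def 1)
qed (simp_all add: perm_act_lift Tens.lift_add Tens.lift_diff)

lemma prj_perm_act:
 assumes s: "s permutes {0..n}" and f: "f : TT n"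
 shows "prj (perm_act s f) = psym s (prj f)"
 using f
proof (induction f rule: TT_induct)
 case one
 show ?case using perm_act_simps(5)[of s 1] by simp
next
 case (xx i g)
 have "psym s (prj (g * xx i)) = X (s i) (psym s (prj g))"
  using psym_X[OF s prj_Pn[OF xx(2)], of i] by (simp add: prj_mult)
 thus ?case using xx by (simp add: prj_mult)
qed simp_all

end

lemma perm_act_inverse: assumes "s permutes {0..n}" shows "perm_act s (perm_act (inv_into UNIV s) f) = f" "perm_act (inv_into UNIV s) (perm_act s f) = f"
proof -
 interpret pbw_model n 0 0 by standard simp
 have "map s (map (inv_into UNIV s) w) = w" "map (inv_into UNIV s) (map s w) = w" for w :: "nat list"
  using permutes_inverses[OF assms] by (simp_all add: map_idI)
 thus "perm_act s (perm_act (inv_into UNIV s) f) = f" "perm_act (inv_into UNIV s) (perm_act s f) = f"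
  by (induction f rule: poly_mapping_induct) simp_all
qed

lemma perm_act_TT: assumes "s permutes {0..n}" "f : TT n" shows "perm_act s f : TT n"
 using assms(2)
proof (induction f rule: TT_induct)
 interpret pbw_model n 0 0 by standard simp
 case (xx i g)
 have "s i <= n" using permutes_in_image[OF assms(1), of i] xx(1) by simp
 thus ?case using xx by simp
next
 interpret pbw_model n 0 0 by standard simp
 case one
 show ?case using perm_act_simps(5)[of s 1] by simp
next
 interpret pbw_model n 0 0 by standard simp
 case (const c g)
 thus ?case by simp
next
 interpret pbw_model n 0 0 by standard simp
 case (add f g)
 thus ?case by simp
qed

lemma perm_act_piece: assumes "s permutes {0..n}" "f : TP n k" shows "perm_act s f : TP n k"
proof -
 have "length w = k" if w: "w : keys (perm_act s f)" for w
 proof -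
  have "keys (perm_act s f) <=: (\<Union>u \<in> keys f. keys (single (map s u) (lookup f u)))"
   unfolding perm_act_def by (rule keys_sum)
  with w obtain u where "u : keys f" "w = map s u" by (auto split: if_splits)
  thus ?thesis using assms(2) by (simp add: piece_iff)
 qed
 thus ?thesis using assms perm_act_TT by (simp add: piece_iff)
qed

section \<open>Multiplication in PBW coordinates\<close>

context pbw_model
begin

text \<open>The PBW coordinates of a class.\<close>

definition co :: "ncpoly set => ppoly" where "co Z = prj (SOME f. f : TT n & cls f = Z)"

definition mul :: "ppoly => ppoly => ppoly" where "mul u w = act u (normal n w)"

lemma cls_eq_prj: "f : TT n ==> g : TT n ==> cls f = cls g <-> prj f = prj g"
 by (simp add: cls_eq_iff) (simp add: family_ideal_kernel)
lemma co_cls [simp]: assumes "f : TT n" shows "co (cls f) = prj f"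
proof -
 let ?g = "SOME g. g : TT n & cls g = cls f"
 have "?g : TT n & cls ?g = cls f" by (rule someI[of _ f]) (use assms in simp)
 thus ?thesis using cls_eq_prj[of ?g f] assms by (simp add: co_def)
qed

lemma co_bij: "bij_betw co (carrier Q) (Pn n)"
proof (rule bij_betw_imageI)
 show "inj_on co (carrier Q)"
  by (rule inj_onI) (metis Q_cases cls_eq_prj co_cls)
 show "co ` carrier Q = Pn n"
 proof (intro equalityI subsetI)
  fix u assume u: "u : Pn n"
  hence "normal n u : TT n" by (rule TT_normal)
  thus "u : co ` carrier Q" using u prj_normal[OF u] by (intro image_eqI[of _ _ "cls (normal n u)"]) simp_all
 qed (auto simp: Q_sel(1) prj_Pn)
qed

lemma act_normal_prj: assumes "f : TT n" shows "act u (normal n (prj f)) = act u f"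
proof -
 have "f - normal n (prj f) : I" using cong_normal[OF assms] by (simp add: cong_def)
 from act_I[OF this, of u] show ?thesis by simp
qed

lemma co_ring: assumes "Z |: Q" "W |: Q"
 shows "co (Z +[Q] W) = co Z + co W" "co (Z *[Q] W) = mul (co Z) (co W)"
proof -
 obtain f g where fg: "f : TT n" "Z = cls f" "g : TT n" "W = cls g" using assms by (metis Q_cases)
 show "co (Z +[Q] W) = co Z + co W" using fg by (simp add: Q_add)
 show "co (Z *[Q] W) = mul (co Z) (co W)" using fg by (simp add: Q_mult mul_def prj_mult act_normal_prj)
qed

lemma co_simps [simp]: "co 1[Q] = 1" "co 0[Q] = 0" "co (scal Q c) = [:yc c:]"
 by (simp_all add: Q_sel)
lemma co_in: "Z |: Q ==> co Z : Pn n" using co_bij by (auto simp: bij_betw_def)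
lemma co_eq: "Z |: Q ==> W |: Q ==> co Z = co W <-> Z = W"
 using co_bij by (auto simp: bij_betw_def dest: inj_onD)
lemma mul_simps [simp]: "mul u 0 = 0" "mul 0 w = 0" "mul (u + u') w = mul u w + mul u' w" "mul u (w + w') = mul u w + mul u w'"
 "mul u (w - w') = mul u w - mul u w'" "mul u (- w) = - mul u w" "mul u (smult (yc c) w) = smult (yc c) (mul u w)"
 "mul u 1 = u" "mul (smult (yc c) u) w = smult (yc c) (mul u w)"
 by (simp_all add: mul_def act_add_left normal_add normal_diff normal_neg normal_scale normal_1 act_mult act_scale_left)

lemma mul_neg_left [simp]: "mul (- u) w = - mul u w" "mul (u - u') w = mul u w - mul u' w"
proof -
 show *: "mul (- u) w = - mul u w" for u using mul_simps(3)[of u "- u" w] by (simp add: eq_neg_iff_add_eq_0 add.commute)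
 show "mul (u - u') w = mul u w - mul u' w" using mul_simps(3)[of u "- u'" w] by (simp add: *)
qed

lemma mul_sum: "mul u (sum f K) = (\<Sum>i \<in> K. mul u (f i))"
 by (induction K rule: infinite_finite_induct) simp_all
lemma mul_Pn: "u : Pn n ==> w : Pn n ==> mul u w : Pn n"
 by (simp add: mul_def act_Pn TT_normal)
lemma mul_1 [simp]: "w : Pn n ==> mul 1 w = w"
 using prj_normal[of w] by (simp add: mul_def prj_def)
lemma mul_var_right [simp]: "mul u (var_v * w) = mul (V u) w"
 by (simp add: mul_def normal_var_v act_mult act_vv)
lemma mul_var_left [simp]: "mul (var_v * u) w = var_v * mul u w"
proof -
 have "X i (var_v * u) = var_v * X i u" for i u
  by (simp add: X_def V_var_v algebra_simps smult_add_right)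
 hence "actw (var_v * u) l = var_v * actw u l" for u l
  unfolding actw_def by (induction l arbitrary: u) simp_all
 thus ?thesis by (simp add: mul_def act_def lift_lin_def sum_distrib_left mult.left_commute)
qed

lemma mul_monom: "f : Yn n ==> mul u (monom f j) = smult f ((V ^^ j) u)"
proof (induction f rule: Yn_induct)
 case (mono c M)
 thus ?case using actw_yl[of "sorted_list_of_multiset M"]
  by (simp only: mul_def normal_mono act_vv_power act_mult act_simps yw_def set_sorted_list_of_multiset mset_sorted_list_of_multiset)
   (simp add: mult.commute)
next
 case (add f g)
 thus ?case by (simp add: add_monom[symmetric] smult_add_left)
qed simp

lemma mul_const: "f : Yn n ==> mul u [:f:] = smult f u"
 using mul_monom[of f u 0] by (simp add: monom_0)
lemma mul_var [simp]: "mul u var_v = V u"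
 using mul_var_right[of u 1] by (simp del: mul_var_right)
lemma mul_smult_right: assumes f: "f : Yn n" and w: "w : Pn n" shows "mul u (smult f w) = smult f (mul u w)"
 using w
proof (induction w rule: Pn_induct)
 case (mono c M j)
 hence "yc c * ym M : Yn n" by simp
 thus ?case using f mul_monom[of "f * (yc c * ym M)" u j] mul_monom[of "yc c * ym M" u j] by (simp add: smult_monom)
qed (simp_all add: smult_add_right)

text \<open>Right multiplication by \<open>v\<close> is \<open>V\<close>, and by the variables \<open>y\<close> it is the multiplication of coefficients.\<close>

lemma mul_expand: assumes "w : Pn n" shows "mul u w = (\<Sum>j \<le> Polynomial.degree w. smult (coeff w j) ((V ^^ j) u))"
proof -
 have "coeff w j : Yn n" for j using assms by (simp add: Pn_def)
 hence "mul u (\<Sum>j \<le> Polynomial.degree w. monom (coeff w j) j) = (\<Sum>j \<le> Polynomial.degree w. smult (coeff w j) ((V ^^ j) u))"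
  by (simp add: mul_sum mul_monom)
 thus ?thesis by (simp add: poly_as_sum_of_monoms)
qed

lemma mul_assoc: assumes "u : Pn n" "w : Pn n" "z : Pn n" shows "mul (mul u w) z = mul u (mul w z)"
proof -
 have "mul (mul u w) z = act u (normal n w * normal n z)" by (simp add: mul_def act_mult)
 also have "... = act u (normal n (prj (normal n w * normal n z)))"
  by (rule act_normal_prj[symmetric]) (simp add: assms TT_normal)
 also have "prj (normal n w * normal n z) = mul w z" using prj_normal[OF assms(2)] by (simp add: prj_mult mul_def)
 finally show ?thesis by (simp add: mul_def)
qed

section \<open>Absence of zero divisors\<close>

lemma sig_inj: assumes "1 + p ~= 0" "sig f = 0" shows "f = 0"
proof -
 have "ysub (%i. yc (1 / (1 + p)) * yv i) (sig f) = f"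
 proof (induction f rule: ypoly_induct)
  case (mono c M)
  have "yc (1 + p) * (yc (1 / (1 + p)) * g) = g" for g
   using assms(1) yc_simps(4)[of "1 + p" "1 / (1 + p)"] by (simp del: yc_simps(4) yc_simps(3) add: mult.assoc[symmetric])
  hence "ysub (%i. yc (1 / (1 + p)) * yv i) (sig (ym M)) = ym M"
   by (induction M) (simp_all add: mult.assoc del: yc_simps(3))
  thus ?case by simp
 qed simp_all
 thus ?thesis using assms(2) by simp
qed

lemma V_top: assumes p: "1 + p ~= 0" and d: "!!j. j > d ==> coeff u j = 0" "coeff u d ~= 0"
 shows "j > Suc d ==> coeff (V u) j = 0" "coeff (V u) (Suc d) ~= 0"
 using d sig_inj[OF p] by (auto simp: coeff_V split: nat.split)

lemma V_power_top: assumes p: "1 + p ~= 0" and d: "!!j. j > d ==> coeff u j = 0" "coeff u d ~= 0"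
 shows "(ALL j > d + k. coeff ((V ^^ k) u) j = 0) & coeff ((V ^^ k) u) (d + k) ~= 0"
proof (induction k)
 case (Suc k)
 hence k: "!!j. j > d + k ==> coeff ((V ^^ k) u) j = 0" "coeff ((V ^^ k) u) (d + k) ~= 0" by auto
 from V_top[OF p k] show ?case by simp
qed (use d in simp)

text \<open>The leading coefficient in \<open>v\<close> of a product is the product of the leading coefficients, up to the injective substitution \<open>y \<mapsto> (1 + p) y\<close>.\<close>

lemma mul_nonzero: assumes p: "1 + p ~= 0" and w: "w : Pn n" and nz: "u ~= 0" "w ~= 0" shows "mul u w ~= 0"
proof -
 let ?d = "Polynomial.degree u" and ?e = "Polynomial.degree w"
 have d: "coeff u ?d ~= 0" using nz by simp
 have top: "(ALL j > ?d + k. coeff ((V ^^ k) u) j = 0) & coeff ((V ^^ k) u) (?d + k) ~= 0" for k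
  by (rule V_power_top[OF p _ d]) (rule coeff_eq_0)
 have "coeff (mul u w) (?d + ?e) = (\<Sum>j \<le> ?e. coeff w j * coeff ((V ^^ j) u) (?d + ?e))"
  by (simp add: mul_expand[OF w] coeff_sum)
 also have "... = (\<Sum>j \<le> ?e. if j = ?e then coeff w ?e * coeff ((V ^^ ?e) u) (?d + ?e) else 0)"
  using top by (intro sum.cong) auto
 also have "... ~= 0" using top nz by simp
 finally show ?thesis by auto
qed

lemma Q_domain: assumes "1 + p ~= 0" shows "nc_domain Q"
 unfolding nc_domain_def
proof (intro conjI ballI impI Q_ring Q_nontrivial)
 interpret Q: ring Q by (rule Q_ring)
 fix Z W assume *: "Z |: Q" "W |: Q" "Z *[Q] W = 0[Q]"
 have "mul (co Z) (co W) = 0" using co_ring(2)[OF *(1,2)] *(3) by simp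
 hence "co Z = 0 \<or> co W = 0" using mul_nonzero[OF assms co_in[OF *(2)]] by blast
 thus "Z = 0[Q] \<or> W = 0[Q]" using *(1,2) co_eq[of _ "0[Q]"] by auto
qed

section \<open>Growth\<close>

definition pbw_mono :: "nat \<times> nat multiset => ncpoly" where "pbw_mono = (%(j, M). vv n ^ j * yw M)"
definition pbw_index :: "nat => (nat \<times> nat multiset) set" where
 "pbw_index k = {(j, M). size M + j = k & set_mset M <=: {1..n}}"

lemma pbw_index_card: "finite (pbw_index k) & card (pbw_index k) <= (k + 1) ^ (n + 1)"
proof -
 let ?F = "{0..k} \<times> ({1..n} \<rightarrow>\<^sub>E {0..k})"
 let ?h = "%(j, M). (j, \<lambda>i \<in> {1..n}. count M i)"
 have inj: "inj_on ?h (pbw_index k)"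
 proof (rule inj_onI, clarsimp simp: pbw_index_def)
  fix M N assume M: "set_mset M <=: {Suc 0..n}" "set_mset N <=: {Suc 0..n}"
   and eq: "(\<lambda>i \<in> {Suc 0..n}. count M i) = (\<lambda>i \<in> {Suc 0..n}. count N i)"
  show "M = N"
  proof (rule multiset_eqI)
   fix i
   show "count M i = count N i"
    using fun_cong[OF eq, of i] M by (cases "i : {Suc 0..n}") (simp, metis count_inI subsetD)
  qed
 qed
 have sub: "?h ` pbw_index k <=: ?F"
 proof
  fix x assume "x : ?h ` pbw_index k"
  then obtain j M where jM: "size M + j = k" "x = (j, \<lambda>i \<in> {1..n}. count M i)" by (auto simp: pbw_index_def)
  have "count M i <= k" for i using count_le_size[of M i] jM(1) by linarith
  thus "x : ?F" using jM by auto
 qed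
 have F: "finite ?F" by (intro finite_cartesian_product finite_PiE) auto
 have "card (?h ` pbw_index k) <= card ?F" by (rule card_mono[OF F sub])
 moreover have "card ?F = (k + 1) ^ (n + 1)" by (simp add: card_cartesian_product card_PiE)
 ultimately show ?thesis using card_image[OF inj] finite_imageD[OF finite_subset[OF sub F] inj] by simp
qed

lemma pbw_mono_TT: assumes "t : pbw_index k" shows "pbw_mono t : TT n"
 using assms by (auto simp: pbw_mono_def pbw_index_def yw_def)
lemma prj_pbw_mono: assumes "(j, M) : pbw_index k" shows "prj (pbw_mono (j, M)) = monom (ym M) j"
proof -
 have "pbw_mono (j, M) = normal n (monom (yc 1 * ym M) j)" using normal_mono[of n 1 M j] by (simp add: pbw_mono_def)
 thus ?thesis using assms prj_normal[of "monom (ym M) j"] by (simp add: pbw_index_def)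
qed

lemma pbw_mono_piece: assumes "t : pbw_index k" shows "cls (pbw_mono t) : piece Q k"
proof -
 obtain j M where t: "t = (j, M)" by force
 have "hp k (monom (ym M) j)" using assms t
  by (auto simp: hp_def pbw_index_def coeff_monom ym_def lookup_single when_def in_keys_iff split: if_splits)
 hence h: "prj (hom_component k (pbw_mono t)) = prj (pbw_mono t)"
  using piece_of_hp[OF pbw_mono_TT[OF assms], of k] prj_pbw_mono assms t by simp
 have "hom_component k (pbw_mono t) : TP n k" by (rule hom_component_piece[OF pbw_mono_TT[OF assms]])
 moreover from this have "cls (hom_component k (pbw_mono t)) = cls (pbw_mono t)"
  using h pbw_mono_TT[OF assms] by (simp add: cls_eq_prj piece_TT)
 ultimately show ?thesis by (metis Q_sel(5) imageI)
qed

lemma pbw_expand: assumes f: "f : TP n k"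
 shows "prj f = (\<Sum>(j, M) \<in> pbw_index k. smult (yc (lookup (coeff (prj f) j) M)) (monom (ym M) j))"
proof (rule poly_eqI, rule poly_mapping_eqI)
 fix j M
 let ?c = "%j M. lookup (coeff (prj f) j) M"
 have fin: "finite (pbw_index k)" using pbw_index_card by blast
 have lk: "lookup (yc c * ym N) M = (if N = M then c else 0)" for c N
  by (simp add: single_ym[symmetric] lookup_single when_def)
 have "lookup (coeff (\<Sum>(j, M) \<in> pbw_index k. smult (yc (?c j M)) (monom (ym M) j)) j) M
   = (\<Sum>(j', M') \<in> pbw_index k. if (j', M') = (j, M) then ?c j M else 0)"
  unfolding coeff_sum lookup_sum by (rule sum.cong) (auto simp: coeff_monom lk split: prod.split)
 also have "... = (if (j, M) : pbw_index k then ?c j M else 0)"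
  using sum.delta[OF fin, of "(j, M)" "%_. ?c j M"] by (simp add: case_prod_unfold prod_eq_iff eq_commute)
 also have "... = ?c j M"
 proof (cases "?c j M = 0")
  case False
  hence "size M + j = k" using hp_prj[OF f] by (auto simp: hp_lookup)
  moreover have "coeff (prj f) j : Yn n" using prj_Pn[OF piece_TT[OF f]] by (simp add: Pn_def)
  hence "set_mset M <=: {1..n}" using False by (auto simp: Yn_def in_keys_iff)
  ultimately show ?thesis by (simp add: pbw_index_def)
 qed simp
 finally show "lookup (coeff (prj f) j) M = lookup (coeff (\<Sum>(j, M) \<in> pbw_index k. smult (yc (?c j M)) (monom (ym M) j)) j) M" ..
qed

text \<open>The basis elements of degree \<open>k\<close> are determined by \<open>n + 1\<close> exponents not exceeding \<open>k\<close>.\<close>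

lemma Q_growth: "polynomial_growth Q"
 unfolding polynomial_growth_def
proof (rule exI[of _ 1], rule exI[of _ "n + 1"], rule allI)
 fix k
 interpret Q: ring Q by (rule Q_ring)
 let ?g = "%t. cls (pbw_mono t)" and ?T = "pbw_index k"
 let ?S = "?g ` ?T"
 have fin: "finite ?T" "card ?T <= (k + 1) ^ (n + 1)" using pbw_index_card by auto
 have inj: "inj_on ?g ?T"
 proof (rule inj_onI)
  fix s t assume s: "s : ?T" "t : ?T" "?g s = ?g t"
  obtain i M j N where st: "s = (i, M)" "t = (j, N)" by force
  have "prj (pbw_mono s) = prj (pbw_mono t)" using s by (simp add: cls_eq_prj[symmetric] pbw_mono_TT)
  hence "monom (ym M) i = monom (ym N) j" using prj_pbw_mono s st by metis
  moreover have "ym M ~= 0" "ym N ~= 0" unfolding ym_def by (metis lookup_single_eq lookup_zero zero_neq_one)+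
  ultimately have "i = j" "ym M = ym N" by (metis coeff_monom)+
  thus "s = t" using st unfolding ym_def by (metis keys_single singleton_inject zero_neq_one)
 qed
 show "EX S. finite S & card S <= 1 * (k + 1) ^ (n + 1) & S <=: piece Q k &
  piece Q k <=: {finsum Q (%s. scal Q (c s) *[Q] s) S | c. True}"
 proof (rule exI[of _ ?S], intro conjI subsetI)
  show "finite ?S" using fin by simp
  show "card ?S <= 1 * (k + 1) ^ (n + 1)" using card_image[OF inj] fin by simp
  show "Z : piece Q k" if "Z : ?S" for Z using that pbw_mono_piece by auto
  fix Z assume "Z : piece Q k"
  then obtain f where f: "f : TP n k" "Z = cls f" by (auto simp: Q_sel(5))
  define a where "a = (%(j, M). lookup (coeff (prj f) j) M)"
  define c where "c = (%s. a (inv_into ?T ?g s))"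
  have c: "c (?g t) = a t" if "t : ?T" for t using inv_into_f_f[OF inj that] by (simp add: c_def)
  have T: "pbw_mono t : TT n" if "t : ?T" for t using pbw_mono_TT[OF that] .
  have "finsum Q (%s. scal Q (c s) *[Q] s) ?S = finsum Q (%t. scal Q (c (?g t)) *[Q] ?g t) ?T"
   by (rule Q.finsum_reindex[OF _ inj]) (auto simp: Q_sel(4) Q_mult T)
  also have "... = finsum Q (%t. cls (const (a t) * pbw_mono t)) ?T"
   by (rule Q.finsum_cong') (auto simp: Q_sel(4) Q_mult T c)
  also have "... = cls (\<Sum>t \<in> ?T. const (a t) * pbw_mono t)" by (rule Q_finsum) (simp add: T)
  also have "... = cls f"
  proof -
   have "prj (\<Sum>t \<in> ?T. const (a t) * pbw_mono t) = (\<Sum>t \<in> ?T. smult (yc (a t)) (prj (pbw_mono t)))" by (simp add: prj_sum)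
   also have "... = (\<Sum>(j, M) \<in> ?T. smult (yc (lookup (coeff (prj f) j) M)) (monom (ym M) j))"
    by (rule sum.cong) (auto simp: a_def prj_pbw_mono)
   also have "... = prj f" by (rule pbw_expand[OF f(1), symmetric])
   finally show ?thesis using piece_TT[OF f(1)] by (subst cls_eq_prj) (simp_all add: T)
  qed
  finally show "Z : {finsum Q (%s. scal Q (c s) *[Q] s) ?S | c. True}" using f(2) by auto
 qed
qed

section \<open>Deformations\<close>

lemma perm_I: assumes s: "s permutes {0..n}" shows "perm_act s ` I = I"
proof -
 have *: "perm_act r f : I" if "r permutes {0..n}" "f : I" for r f
 proof -
  have "psym r 0 = 0" by simp
  thus ?thesis using that prj_perm_act[OF that(1), of f] perm_act_TT[OF that(1), of f] by (simp add: family_ideal_kernel)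
 qed
 show ?thesis
 proof (intro equalityI subsetI)
  fix f assume f: "f : I"
  have "perm_act (inv_into UNIV s) f : I" by (rule *[OF permutes_inv[OF s] f])
  moreover have "perm_act s (perm_act (inv_into UNIV s) f) = f" by (rule perm_act_inverse[OF s])
  ultimately show "f : perm_act s ` I" by (metis imageI)
 qed (auto intro: *[OF s])
qed

end

text \<open>An isomorphism of quotients given on representatives.\<close>

lemma piece_isoI:
 assumes I: "ideal I (tensor_alg n)" and J: "ideal J (tensor_alg n)"
  and I_perm: "!!s. s permutes {0..n} ==> perm_act s ` I = I" and J_perm: "!!s. s permutes {0..n} ==> perm_act s ` J = J"
  and h: "!!f. f : TP n k ==> h f : TP n k"
  and ker: "!!f. f : TP n k ==> h f : J <-> f : I"
  and add: "!!f g. f : TP n k ==> g : TP n k ==> h (f + g) - (h f + h g) : J"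
  and scale: "!!c f. f : TP n k ==> h (const c * f) - const c * h f : J"
  and surj: "!!g. g : TP n k ==> EX f:TP n k. g - h f : J"
  and equi: "!!s f. s permutes {0..n} ==> f : TP n k ==> h (perm_act s f) - perm_act s (h f) : J"
 shows "piece_iso n I J k"
proof -
 interpret A: tensor_quotient n I by (rule tensor_quotient.intro[OF I])
 interpret B: tensor_quotient n J by (rule tensor_quotient.intro[OF J])
 interpret pbw_model n 0 0 by standard simp
 note TT = piece_TT[of _ n k]
 have eq: "B.cls (h f) = B.cls (h g) <-> A.cls f = A.cls g" if fg: "f : TP n k" "g : TP n k" for f g
 proof -
  have d: "f - g : TP n k" using fg by (rule piece_diff)
  have "h ((f - g) + g) - (h (f - g) + h g) : J" by (rule add[OF d fg(2)])
  hence e: "h f - h g - h (f - g) : J" by (simp add: algebra_simps)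
  have "h f - h g : J <-> h (f - g) : J"
   using B.R_simps(5)[OF _ e, of "h f - h g"] B.R_simps(3)[OF _ e, of "h (f - g)"] by (auto simp: algebra_simps)
  thus ?thesis using ker[OF d] fg h by (simp add: B.cls_eq_iff A.cls_eq_iff TT)
 qed
 define rep where "rep Z = (SOME f. f : TP n k & A.cls f = Z)" for Z
 define phi where "phi Z = B.cls (h (rep Z))" for Z
 have phi: "phi (A.cls f) = B.cls (h f)" if f: "f : TP n k" for f
 proof -
  have "rep (A.cls f) : TP n k & A.cls (rep (A.cls f)) = A.cls f"
   unfolding rep_def by (rule someI[of _ f]) (use f in simp)
  thus ?thesis using eq[of "rep (A.cls f)" f] f by (simp add: phi_def)
 qed
 have perm: "perm_act s ` tensor_quotient.cls n K f = tensor_quotient.cls n K (perm_act s f)"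
  if K: "ideal K (tensor_alg n)" "perm_act s ` K = K" for s f K
 proof -
  interpret K: tensor_quotient n K by (rule tensor_quotient.intro[OF K(1)])
  have "perm_act s ` (%r. r + f) ` K = (%r. r + perm_act s f) ` perm_act s ` K" by (simp add: image_image)
  thus ?thesis by (simp add: K.cls_eq K(2) Setcompr_eq_image)
 qed
 show ?thesis
  unfolding piece_iso_def
 proof (rule exI[of _ phi], intro conjI ballI allI impI)
  show "bij_betw phi (piece (quotient_alg n I) k) (piece (quotient_alg n J) k)"
  proof (rule bij_betw_imageI)
   show "inj_on phi (piece (quotient_alg n I) k)"
    by (rule inj_onI) (auto simp: A.Q_sel(5) phi eq)
   show "phi ` piece (quotient_alg n I) k = piece (quotient_alg n J) k"
   proof (intro equalityI subsetI)
    fix Z assume "Z : piece (quotient_alg n J) k"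
    then obtain g where g: "g : TP n k" "Z = B.cls g" by (auto simp: B.Q_sel(5))
    from surj[OF g(1)] obtain f where f: "f : TP n k" "g - h f : J" by blast
    hence "Z = phi (A.cls f)" using g h by (simp add: phi B.cls_eq_iff TT)
    thus "Z : phi ` piece (quotient_alg n I) k" using f by (auto simp: A.Q_sel(5))
   qed (auto simp: A.Q_sel(5) B.Q_sel(5) phi h)
  qed
  fix Z assume "Z : piece (quotient_alg n I) k"
  then obtain f where f: "f : TP n k" "Z = A.cls f" by (auto simp: A.Q_sel(5))
  show "phi (scal (quotient_alg n I) c *[quotient_alg n I] Z) = scal (quotient_alg n J) c *[quotient_alg n J] phi Z" for c
   using f scale[OF f(1), of c] h[OF f(1)] h[OF piece_scale[OF f(1), of c]]
   by (simp add: A.Q_sel(4) B.Q_sel(4) A.Q_mult B.Q_mult TT phi piece_scale B.cls_eq_iff)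
  show "phi (perm_act s ` Z) = perm_act s ` phi Z" if s: "s permutes {0..n}" for s
   using f equi[OF s f(1)] h perm_act_piece[OF s] perm[OF I I_perm[OF s]] perm[OF J J_perm[OF s]]
   by (simp add: phi B.cls_eq_iff TT)
  fix W assume "W : piece (quotient_alg n I) k"
  then obtain g where g: "g : TP n k" "W = A.cls g" by (auto simp: A.Q_sel(5))
  show "phi (Z +[quotient_alg n I] W) = phi Z +[quotient_alg n J] phi W"
   using f g add[OF f(1) g(1)] h by (simp add: A.Q_add B.Q_add TT phi B.cls_eq_iff)
 qed
qed

lemma comm_ideal_family: "comm_ideal n = family_ideal n (0, 0)"
proof
 interpret pbw_model n 0 0 by standard simp
 interpret T: ring "tensor_alg n" by (rule tensor_ring)
 let ?G = "{f * g - g * f | f g. f : TP n 1 & g : TP n 1}"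
 have G: "?G <=: TT n" by (auto simp: piece_TT)
 have V1: "V u = var_v * u" for u
 proof (rule poly_eqI)
  have "sig f = f" for f
  proof (induction f rule: ypoly_induct)
   case (mono c M)
   have "sig (ym M) = ym M" by (induction M) simp_all
   thus ?case by simp
  qed simp_all
  thus "coeff (V u) j = coeff (var_v * u) j" for j by (simp add: coeff_V coeff_var_v split: nat.split)
 qed
 have act: "act u f = u * prj f" for u f
 proof (induction f rule: poly_mapping_induct)
  case (single w c)
  have "actw u w = u * actw 1 w"
  proof (induction w arbitrary: u)
   case (Cons i w)
   have "X i u = u * X i 1" by (simp add: X_def V1 algebra_simps smult_add_right)
   thus ?case using Cons[of "X i u"] Cons[of "X i 1"] by (simp add: actw_def mult.assoc)
  qed (simp add: actw_def)
  thus ?case by (simp add: prj_def act_single)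
 qed (simp_all add: algebra_simps)
 have "?G <=: I"
 proof
  fix x assume "x : ?G"
  then obtain f g where "f : TT n" "g : TT n" "x = f * g - g * f" by (auto dest: piece_TT)
  moreover have "prj (f * g - g * f) = 0" by (simp add: prj_mult) (simp add: act[of "prj f" g] act[of "prj g" f] mult.commute)
  ultimately show "x : I" by (simp add: family_ideal_kernel)
 qed
 thus "comm_ideal n <=: I" unfolding comm_ideal_def by (rule T.genideal_minimal[OF I_ideal])
 have C: "ideal (comm_ideal n) (tensor_alg n)" unfolding comm_ideal_def by (rule T.genideal_ideal[OF G])
 have gen: "f * g - g * f : comm_ideal n" if "f : TP n 1" "g : TP n 1" for f g
  using T.genideal_self[OF G] that unfolding comm_ideal_def by blast
 have y: "yy i : TP n 1" if "i <= n" for i unfolding yy_def by (intro piece_diff piece_simps) (use that in auto)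
 have v: "vv n : TP n 1" unfolding vv_def by (intro piece_sum piece_simps) auto
 show "I <=: comm_ideal n"
  unfolding family_ideal_def prod.case
  by (rule T.genideal_minimal[OF C]) (auto simp: y_commutators_def intro!: gen y v)
qed

lemma piece_1_expand: assumes f: "f : TP n 1" shows "f = (\<Sum>i = 0..n. const (lookup f [i]) * xx i)"
proof (rule poly_mapping_eqI)
 fix w
 have t: "const c * xx i = single [i] c" for c i by (simp add: const_def xx_def mult_single plus_list_def)
 have "lookup (\<Sum>i = 0..n. const (lookup f [i]) * xx i) w
   = (\<Sum>i = 0..n. if [i] = w then lookup f w else 0)"
  unfolding lookup_sum t by (rule sum.cong) (auto simp: lookup_single when_def)
 also have "... = lookup f w"
 proof (cases "w : keys f")
  case True
  hence "length w = 1" "set w <=: {0..n}" using f by (auto simp: piece_iff TT_iff)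
  then obtain i where "w = [i]" "i : {0..n}" by (cases w) auto
  thus ?thesis by simp
 next
  case False
  hence 0: "lookup f w = 0" by (simp add: in_keys_iff)
  show ?thesis unfolding 0 by simp
 qed
 finally show "lookup f w = lookup (\<Sum>i = 0..n. const (lookup f [i]) * xx i) w" ..
qed

context pbw_model
begin

lemma I_piece_1: assumes f: "f : TP n 1" "prj f = 0" shows "f = 0"
proof -
 define a where "a i = lookup f [i]" for i
 have f_eq: "f = (\<Sum>i = 0..n. const (a i) * xx i)" unfolding a_def by (rule piece_1_expand[OF f(1)])
 have V1: "V 1 = var_v" using V_power_1[of 1] by (simp add: var_v_def monom_Suc monom_0)
 have x: "prj (xx i) = smult (yc (1 / of_nat (n + 1))) (var_v + [:ysum:]) - [:yv0 i:]" for i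
  by (simp add: prj_def X_def V1)
 have lk: "lookup (yc c * f) M = c * lookup f M" for c f M
  by (induction f rule: poly_mapping_induct) (simp_all add: yc_def mult_single distrib_left lookup_add lookup_single when_def)
 have 0: "(\<Sum>i = 0..n. smult (yc (a i)) (prj (xx i))) = 0"
  using f(2) by (subst (asm) f_eq) (simp add: prj_sum)
 have c1: "coeff (prj (xx i)) 1 = yc (1 / of_nat (n + 1))" for i by (simp add: x var_v_def)
 have "(\<Sum>i = 0..n. yc (a i) * yc (1 / of_nat (n + 1))) = 0"
  using arg_cong[OF 0, of "%u. coeff u 1"] by (simp only: coeff_sum coeff_smult c1 coeff_0)
 hence "lookup (\<Sum>i = 0..n. yc (a i) * yc (1 / of_nat (n + 1))) {#} = 0" by simp
 hence "(\<Sum>i = 0..n. a i * (1 / of_nat (n + 1))) = 0"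
  by (simp only: lookup_sum lk) (simp add: yc_def)
 hence s: "(\<Sum>i = 0..n. a i) = 0" by (simp add: sum_divide_distrib[symmetric] del: of_nat_Suc of_nat_add)
 have j: "a j = 0" if j: "j : {1..n}" for j
 proof -
  let ?l = "%u. lookup (coeff u 0) {#j#}"
  have y: "lookup (yv0 i) {#j#} = (if i = j then 1 else 0)" for i
   using j by (auto simp: yv0_def yv_def ym_def lookup_single when_def)
  have "lookup ysum {#j#} = (\<Sum>i = 0..n. if i = j then 1 else 0)" unfolding sum_yv0[symmetric] lookup_sum y ..
  hence ys: "lookup ysum {#j#} = 1" using j by simp
  have l: "?l (prj (xx i)) = 1 / of_nat (n + 1) - (if i = j then 1 else 0)" for i
   by (simp add: x var_v_def lookup_minus lk ys y del: of_nat_Suc of_nat_add)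
  have "(\<Sum>i = 0..n. a i * (1 / of_nat (n + 1) - (if i = j then 1 else 0))) = 0"
   using arg_cong[OF 0, of ?l] by (simp only: coeff_sum coeff_smult lookup_sum lk l coeff_0 lookup_zero)
  moreover have "(\<Sum>i = 0..n. a i * (b - (if i = j then 1 else 0))) = (\<Sum>i = 0..n. a i) * b - (\<Sum>i = 0..n. if i = j then a j else 0)" for b
   unfolding sum_distrib_right sum_subtractf[symmetric] by (rule sum.cong) (auto simp: algebra_simps)
  ultimately show ?thesis using s j by simp
 qed
 have "(\<Sum>i = 0..n. a i) = a 0 + (\<Sum>i = Suc 0..n. a i)" by (rule sum.atLeast_Suc_atMost) simp
 hence "a 0 = 0" using s j by simp
 hence "a i = 0" if "i : {0..n}" for i using j[of i] that by (cases "i = 0") auto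
 thus ?thesis by (subst f_eq) simp
qed

text \<open>PBW coordinates exist for every parameter, in particular for the commutative ring; the comparison sends an element to the element with the same coordinates there, and the symmetry of coordinates does not depend on the parameters.\<close>

theorem Q_S_deformation: "S_deformation n I"
 unfolding S_deformation_def
proof (intro conjI ballI allI impI I_ideal)
 interpret C: pbw_model n 0 0 by standard simp
 show "hom_component k f : I" if "f : I" for f k using that by (rule homogeneous)
 show "perm_act s ` I = I" if "s permutes {0..n}" for s using that by (rule perm_I)
 have id: "ideal {0} (tensor_alg n)" by (rule ideal_tensorI) auto
 have z: "perm_act s ` {0} = {0}" for s by simp
 have I1: "f = 0" if "f : TP n 1" "f : I" for f
  using I_piece_1[OF that(1)] that(2) by (simp add: family_ideal_kernel)
 show "piece_iso n I {0} 1"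
  by (rule piece_isoI[where h = "%f. f"]) (use I1 in "auto simp: I_ideal id perm_I z I_simps(2)")
 fix k
 define h where "h f = hom_component k (normal n (prj f))" for f
 have N: "normal n (prj f) : TT n" "prj f : Pn n" "hp k (prj f)" if "f : TP n k" for f
  using that by (simp_all add: TT_normal prj_Pn piece_TT hp_prj)
 have prjh: "C.prj (h f) = prj f" if "f : TP n k" for f
  unfolding h_def using C.piece_of_hp[OF N(1)[OF that], of k] C.prj_normal[OF N(2)[OF that]] N(3)[OF that] by simp
 have h: "h f : TP n k" if "f : TP n k" for f unfolding h_def by (rule hom_component_piece[OF N(1)[OF that]])
 note T = piece_TT[of _ n k]
 have J: "f : comm_ideal n <-> C.prj f = 0" if "f : TP n k" for f
  using T[OF that] by (simp add: comm_ideal_family C.family_ideal_kernel)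
 show "piece_iso n I (comm_ideal n) k"
 proof (rule piece_isoI[where h = h])
  show "ideal (comm_ideal n) (tensor_alg n)" unfolding comm_ideal_family by (rule C.I_ideal)
  show "perm_act s ` comm_ideal n = comm_ideal n" if "s permutes {0..n}" for s
   unfolding comm_ideal_family using that by (rule C.perm_I)
  show "h f : comm_ideal n <-> f : I" if "f : TP n k" for f
   using that J[OF h[OF that]] T[OF that] prjh[OF that] by (simp add: family_ideal_kernel)
  show "h (f + g) - (h f + h g) : comm_ideal n" if "f : TP n k" "g : TP n k" for f g
   using that h by (subst J) (simp_all add: piece_diff prjh)
  show "h (const c * f) - const c * h f : comm_ideal n" if "f : TP n k" for f c
   using that h by (subst J) (simp_all add: piece_diff piece_scale prjh)
  show "EX f:TP n k. g - h f : comm_ideal n" if g: "g : TP n k" for g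
  proof -
   let ?f = "hom_component k (normal n (C.prj g))"
   have u: "C.prj g : Pn n" "hp k (C.prj g)" using g by (simp_all add: C.prj_Pn T C.hp_prj)
   have f: "?f : TP n k" by (rule hom_component_piece[OF TT_normal[OF u(1)]])
   have "prj ?f = C.prj g" using piece_of_hp[OF TT_normal[OF u(1)], of k] prj_normal[OF u(1)] u(2) by simp
   hence "g - h ?f : comm_ideal n" using g h[OF f] prjh[OF f] by (subst J) (simp_all add: piece_diff)
   thus ?thesis using f by blast
  qed
  show "h (perm_act s f) - perm_act s (h f) : comm_ideal n" if "s permutes {0..n}" "f : TP n k" for s f
   using that h perm_act_piece[OF that(1)]
   by (subst J) (simp_all add: piece_diff prjh prj_perm_act C.prj_perm_act T)
 qed (simp_all add: I_ideal perm_I h)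
qed

end

section \<open>Iterated Ore extensions\<close>

lemma ring_on_subset:
 assumes B: "ring B" and A: "A <=: carrier B" "1[B] : A" and neg: "!!a. a : A ==> -[B] a : A"
  and add: "!!a b. a : A ==> b : A ==> a +[B] b : A" and mult: "!!a b. a : A ==> b : A ==> a *[B] b : A"
 shows "ring ((B on: A))"
proof -
 interpret ring B by (rule B)
 have A': "a |: B" if "a : A" for a using A that by auto
 have "1[B] +[B] -[B] 1[B] : A" using add neg A(2) by blast
 hence 0: "0[B] : A" by (simp add: r_neg)
 show ?thesis
 proof (rule ringI)
  show "abelian_group ((B on: A))"
   by (rule abelian_groupI) (auto simp: A' 0 add a_ac intro!: bexI[of _ "-[B] _"] neg r_neg)
  show "Group.monoid ((B on: A))" by (rule monoidI) (auto simp: A' A mult m_assoc)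
 qed (auto simp: A' l_distr r_distr)
qed

text \<open>The coefficient of \<open>y\<^sub>i\<^sup>j\<close>, as a polynomial in the other variables.\<close>

definition yco :: "nat => nat => ypoly => ypoly" where
 "yco i j = lift_lin yc (%M. if count M i = j then ym (filter_mset (%x. x ~= i) M) else 0)"

lemma yco_simps [simp]: "yco i j 0 = 0" "yco i j (f + g) = yco i j f + yco i j g"
 by (simp_all add: yco_def Y.lift_add)
lemma yco_mono: "yco i j (yc c * ym M) = (if count M i = j then yc c * ym (filter_mset (%x. x ~= i) M) else 0)"
 unfolding yco_def single_ym[symmetric] Y.lift_single by (simp add: single_ym)
lemma lookup_yco: "lookup (yco i j f) N = (if i \<in># N then 0 else lookup f (N + replicate_mset j i))"
proof (induction f rule: poly_mapping_induct)
 case (single M c)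
 have "count M i = j & filter_mset (%x. x ~= i) M = N <-> i \<notin># N & M = N + replicate_mset j i"
  unfolding multiset_eq_iff by (auto simp: count_replicate_mset not_in_iff split: if_splits)
 moreover have "lookup (yco i j (single M c)) N = (if count M i = j & filter_mset (%x. x ~= i) M = N then c else 0)"
  unfolding single_ym yco_mono by (simp add: single_ym[symmetric] lookup_single when_def)
 ultimately show ?case by (auto simp: lookup_single when_def)
qed (simp_all add: lookup_add)

lemma yco_mult: "(!!N. N : keys g ==> i \<notin># N) ==> yco i j (f * g) = yco i j f * g"
proof (induction f rule: ypoly_induct)
 case (mono c M)
 have "yco i j (yc c * ym M * g') = yco i j (yc c * ym M) * g'" if "!!N. N : keys g' ==> N : keys g" for g'
 proof -
  have "yco i j (yc c * ym M * (\<Sum>N \<in> K. single N (b N))) = yco i j (yc c * ym M) * (\<Sum>N \<in> K. single N (b N))"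
   if "finite K" "!!N. N : K ==> i \<notin># N" for K b
   using that
  proof (induction K rule: finite_induct)
   case (insert N K)
   have iN: "i \<notin># N" using insert.prems[of N] by simp
   hence N: "count N i = 0" "filter_mset (%x. x ~= i) N = N" by (auto intro: count_inI simp: filter_mset_eq_conv count_eq_zero_iff)
   have "yc c * ym M * single N (b N) = yc (c * b N) * ym (M + N)" by (simp add: single_ym mult_ac)
   hence "yco i j (yc c * ym M * single N (b N)) = yco i j (yc c * ym M) * single N (b N)"
    using N by (simp only: yco_mono) (simp add: single_ym mult_ac)
   thus ?case using insert by (simp add: distrib_left)
  qed simp
  from this[of "keys g'" "lookup g'"] show ?thesis
   using that mono poly_mapping_decompose[of g'] by simp
 qed
 from this[of g] show ?case by simp
qed (simp_all add: distrib_right)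

lemma yco_yv: "yco i 0 (yv i * f) = 0" "yco i (Suc j) (yv i * f) = yco i j f"
proof -
 have "yco i 0 (yv i * f) = 0 & yco i (Suc j) (yv i * f) = yco i j f"
 proof (induction f rule: ypoly_induct)
  case (mono c M)
  have "yv i * (yc c * ym M) = yc c * ym (add_mset i M)" by simp
  thus ?case by (simp only: yco_mono) simp
 qed (simp_all add: distrib_left)
 thus "yco i 0 (yv i * f) = 0" "yco i (Suc j) (yv i * f) = yco i j f" by auto
qed

lemma yco_const: assumes "f : Yn k" shows "yco (Suc k) 0 f = f" "yco (Suc k) (Suc j) f = 0"
proof -
 have "yco (Suc k) 0 f = f & yco (Suc k) (Suc j) f = 0" using assms
 proof (induction f rule: Yn_induct)
  case (mono c M)
  hence "Suc k \<notin># M" by auto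
  hence "count M (Suc k) = 0" "filter_mset (%x. x ~= Suc k) M = M" by (auto simp: count_eq_zero_iff filter_mset_eq_conv)
  thus ?case by (simp add: yco_mono)
 qed simp_all
 thus "yco (Suc k) 0 f = f" "yco (Suc k) (Suc j) f = 0" by auto
qed

lemma yco_Yn: assumes "f : Yn (Suc k)" shows "yco (Suc k) j f : Yn k"
 unfolding Yn_def
proof (clarify)
 fix N x assume N: "N : keys (yco (Suc k) j f)" "x \<in># N"
 hence "Suc k \<notin># N" "N + replicate_mset j (Suc k) : keys f"
  by (auto simp: in_keys_iff lookup_yco split: if_splits)
 hence "x ~= Suc k" "x : {1..Suc k}" using N(2) assms by (auto simp: Yn_def subset_iff)
 thus "x : {1..k}" by auto
qed

lemma yco_bounded: "EX m. ALL j >= m. yco i j f = 0"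
proof (induction f rule: ypoly_induct)
 case (mono c M)
 show ?case by (rule exI[of _ "Suc (count M i)"]) (simp add: yco_mono)
next
 case (add f g)
 then obtain k l where "ALL j >= k. yco i j f = 0" "ALL j >= l. yco i j g = 0" by auto
 thus ?case by (intro exI[of _ "max k l"]) simp
qed simp

lemma yco_zero: assumes "!!j. yco i j f = 0" shows "f = 0"
proof (rule poly_mapping_eqI)
 fix M
 let ?N = "filter_mset (%x. x ~= i) M"
 have "?N + replicate_mset (count M i) i = M" unfolding multiset_eq_iff by (simp add: count_replicate_mset)
 thus "lookup f M = lookup 0 M" using lookup_yco[of i "count M i" f ?N] assms by simp
qed

lemma Yn_mono: "f : Yn k ==> k <= l ==> f : Yn l" by (fastforce simp: Yn_def)
lemma Yn_0: assumes "f : Yn 0" shows "EX c. f = yc c"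
 using assms
proof (induction f rule: Yn_induct)
 case (mono c M)
 thus ?case by auto
next
 case (add f g)
 thus ?case by (metis yc_simps(3))
qed (auto intro: exI[of _ 0])

lemma infinite_quotient_type: "inj (%c. {const c})" "infinite (UNIV :: ncpoly set set)"
proof -
 show 1: "inj (%c. {const c})" by (rule injI) (metis const_def lookup_single_eq singleton_inject)
 show "infinite (UNIV :: ncpoly set set)"
 proof
  assume "finite (UNIV :: ncpoly set set)"
  hence "finite (range (%c. {const c}))" by (rule finite_subset[OF subset_UNIV])
  thus False using 1 infinite_UNIV_char_0[where 'a = complex] finite_imageD by blast
 qed
qed

context pbw_model
begin

definition dec :: "ppoly => ncpoly set" where "dec u = cls (normal n u)"

lemma dec: "u : Pn n ==> dec u |: Q" "u : Pn n ==> co (dec u) = u"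
 by (simp_all add: dec_def TT_normal prj_normal)
lemma co_neg: assumes "Z |: Q" shows "co (-[Q] Z) = - co Z"
proof -
 interpret Q: ring Q by (rule Q_ring)
 have "co (-[Q] Z) + co Z = 0" using assms co_ring(1)[of "-[Q] Z" Z] by (simp add: Q.l_neg)
 thus ?thesis by (simp add: eq_neg_iff_add_eq_0)
qed

text \<open>The subalgebra generated by \<open>y\<^sub>1, ..., y\<^sub>k\<close>.\<close>

definition ysubalg :: "nat => ncpoly set set" where "ysubalg k = {Z : carrier Q. EX f:Yn k. co Z = [:f:]}"

lemma eq_dec: "Z |: Q ==> co Z : Pn n ==> Z = dec (co Z)"
 using co_eq[of Z "dec (co Z)"] dec[of "co Z"] by simp
lemma eq_decI: "Z |: Q ==> co Z = u ==> u : Pn n ==> Z = dec u"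
 using eq_dec[of Z] by simp
lemma ysubalg_iff: assumes k: "k <= n" shows "Z : ysubalg k <-> (EX f:Yn k. Z = dec [:f:])"
proof -
 have P: "[:f:] : Pn n" if "f : Yn k" for f using Yn_mono[OF that k] by simp
 show ?thesis unfolding ysubalg_def using dec[OF P] eq_decI[OF _ _ P] by blast
qed

lemma dec_ops: assumes "f : Yn n" "g : Yn n"
 shows "dec [:f:] +[Q] dec [:g:] = dec [:f + g:]" "dec [:f:] *[Q] dec [:g:] = dec [:f * g:]" "-[Q] dec [:f:] = dec [:- f:]"
  "dec [:f:] = dec [:g:] <-> f = g" "dec [:0:] = 0[Q]" "dec [:1:] = 1[Q]" "dec [:f:] |: Q" "co (dec [:f:]) = [:f:]"
proof -
 interpret Q: ring Q by (rule Q_ring)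
 have P: "[:h:] : Pn n" if "h : Yn n" for h using that by simp
 note d = dec[OF P]
 show c: "dec [:f:] |: Q" "co (dec [:f:]) = [:f:]" using d[OF assms(1)] .
 have c': "dec [:g:] |: Q" "co (dec [:g:]) = [:g:]" using d[OF assms(2)] .
 show "dec [:f:] +[Q] dec [:g:] = dec [:f + g:]"
  by (rule eq_decI) (use assms in "simp_all add: c c' co_ring(1)")
 have "mul [:f:] [:g:] = [:f * g:]" using mul_const[OF assms(2), of "[:f:]"] by (simp add: mult.commute)
 thus "dec [:f:] *[Q] dec [:g:] = dec [:f * g:]"
  by (intro eq_decI) (use assms in "simp_all add: c c' co_ring(2)")
 show "-[Q] dec [:f:] = dec [:- f:]"
 proof (rule eq_decI[OF Q.a_inv_closed[OF c(1)]])
  show "co (-[Q] dec [:f:]) = [:- f:]" unfolding co_neg[OF c(1)] c(2) minus_pCons minus_zero ..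
  show "[:- f:] : Pn n" by (rule P[OF Yn_simps(3)[OF assms(1)]])
 qed
 show "dec [:f:] = dec [:g:] <-> f = g" by (metis c(2) c'(2) pCons_eq_iff)
 show "dec [:0:] = 0[Q]" "dec [:1:] = 1[Q]"
  by (rule eq_decI[symmetric]; simp add: one_pCons)+
qed

lemma ysubalg_ring: assumes k: "k <= n" shows "ring ((Q on: ysubalg k))" "ysubalg k <=: carrier Q"
proof -
 note [simp] = ysubalg_iff[OF k]
 have Y: "f : Yn n" if "f : Yn k" for f using that k by (rule Yn_mono)
 show s: "ysubalg k <=: carrier Q" by (auto simp: ysubalg_def)
 show "ring ((Q on: ysubalg k))"
 proof (rule ring_on_subset[OF Q_ring s])
  show "1[Q] : ysubalg k" using dec_ops(6)[of 1 1] by (auto intro!: bexI[of _ 1])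
  fix Z W assume "Z : ysubalg k"
  then obtain f where f: "f : Yn k" "Z = dec [:f:]" by auto
  show "-[Q] Z : ysubalg k" using f dec_ops(3)[OF Y Y, OF f(1) f(1)] by (auto intro!: bexI[of _ "- f"])
  assume "W : ysubalg k"
  then obtain g where g: "g : Yn k" "W = dec [:g:]" by auto
  show "Z +[Q] W : ysubalg k" using f g dec_ops(1)[OF Y Y, OF f(1) g(1)] by (auto intro!: bexI[of _ "f + g"])
  show "Z *[Q] W : ysubalg k" using f g dec_ops(2)[OF Y Y, OF f(1) g(1)] by (auto intro!: bexI[of _ "f * g"])
 qed
qed

text \<open>Adjoining a commuting variable; the coordinate functions are the coefficients of its powers.\<close>

lemma ysubalg_ore:
 assumes k: "k < n"
 shows "ore_extension ((Q on: ysubalg (Suc k))) (ysubalg k) (dec [:yv (Suc k):])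
  (%j Z. dec [:yco (Suc k) j (coeff (co Z) 0):])"
proof -
 have S: "Suc k <= n" "k <= n" using k by auto
 have Y: "f : Yn n" if "f : Yn (Suc k)" for f using that S(1) by (rule Yn_mono)
 have Y0: "f : Yn (Suc k)" if "f : Yn k" for f using that by (rule Yn_mono) simp
 have nk: "Suc k \<notin># N" if "g : Yn k" "N : keys g" for g N using that by (fastforce simp: Yn_def)
 have c: "coeff (co (dec [:f:])) 0 = f" if "f : Yn (Suc k)" for f using dec_ops(8)[OF Y[OF that] Y[OF that]] by simp
 note it = ysubalg_iff[OF S(1)] ysubalg_iff[OF S(2)]
 have yv: "yv (Suc k) : Yn (Suc k)" by simp
 note yvn = Y[OF yv]
 note o1 = dec_ops(1)[OF Y Y] and o2 = dec_ops(2)[OF Y Y]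
 have yk: "yco (Suc k) j f : Yn k" if "f : Yn (Suc k)" for f j using that by (rule yco_Yn)
 have z: "dec [:0:] = 0[Q]" using dec_ops(5)[of 0 0] by simp
 show ?thesis
 proof (rule ore_extension.intro[OF ysubalg_ring(1)[OF S(1)]], rule ore_extension_axioms.intro)
  show "ring (Q\<lparr>carrier := ysubalg (Suc k), carrier := ysubalg k\<rparr>)" using ysubalg_ring(1)[OF S(2)] by simp
  show "ysubalg k <=: carrier ((Q on: ysubalg (Suc k)))" by (auto simp: it intro!: bexI[OF refl Y0])
  show "dec [:yv (Suc k):] |: ((Q on: ysubalg (Suc k)))" using yv by (auto simp: it)
  fix b j assume "b |: ((Q on: ysubalg (Suc k)))"
  then obtain f where f: "f : Yn (Suc k)" "b = dec [:f:]" by (auto simp: it)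
  show "dec [:yco (Suc k) j (coeff (co b) 0):] : ysubalg k" using f by (auto simp: it c intro: yk)
  show "dec [:yco (Suc k) 0 (coeff (co (dec [:yv (Suc k):] *[(Q on: ysubalg (Suc k))] b)) 0):] = 0[(Q on: ysubalg (Suc k))]"
   "dec [:yco (Suc k) (Suc j) (coeff (co (dec [:yv (Suc k):] *[(Q on: ysubalg (Suc k))] b)) 0):] = dec [:yco (Suc k) j (coeff (co b) 0):]"
   using f yv by (simp_all add: o2 c yco_yv z del: pCons_0_0)
  show "EX m. ALL j >= m. dec [:yco (Suc k) j (coeff (co b) 0):] = 0[(Q on: ysubalg (Suc k))]"
  proof -
   obtain m where "ALL j >= m. yco (Suc k) j f = 0" using yco_bounded by blast
   thus ?thesis using f by (intro exI[of _ m]) (simp add: c z del: pCons_0_0)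
  qed
  show "b = 0[(Q on: ysubalg (Suc k))]"
   if "!!j. dec [:yco (Suc k) j (coeff (co b) 0):] = 0[(Q on: ysubalg (Suc k))]"
  proof -
   have "yco (Suc k) j f = 0" for j
    using that[of j] f dec_ops(4)[OF Y[OF Y0[OF yk]], of f 0 j] by (simp add: c z del: pCons_0_0)
   hence "f = 0" by (rule yco_zero)
   thus ?thesis using f z by simp
  qed
  show "dec [:yco (Suc k) j (coeff (co (b +[(Q on: ysubalg (Suc k))] b')) 0):]
    = dec [:yco (Suc k) j (coeff (co b) 0):] +[(Q on: ysubalg (Suc k))] dec [:yco (Suc k) j (coeff (co b') 0):]"
   if b': "b' |: ((Q on: ysubalg (Suc k)))" for b'
  proof -
   from b' obtain g where g: "g : Yn (Suc k)" "b' = dec [:g:]" by (auto simp: it)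
   show ?thesis using f g Y0[OF yk[OF f(1)]] Y0[OF yk[OF g(1)]] by (simp add: o1 c del: add_pCons)
  qed
  show "dec [:yco (Suc k) j (coeff (co (b *[(Q on: ysubalg (Suc k))] a)) 0):]
    = dec [:yco (Suc k) j (coeff (co b) 0):] *[(Q on: ysubalg (Suc k))] a"
   if a: "a : ysubalg k" for a
  proof -
   from a obtain g where g: "g : Yn k" "a = dec [:g:]" by (auto simp: it)
   show ?thesis using f g Y0[OF g(1)] Y0[OF yk[OF f(1)]] by (simp add: o2 c yco_mult[OF nk[OF g(1)]])
  qed
 next
  fix a j assume "a : ysubalg k"
  then obtain g where g: "g : Yn k" "a = dec [:g:]" by (auto simp: it)
  note g' = Y0[OF g(1)]
  show "dec [:yco (Suc k) 0 (coeff (co a) 0):] = a" "dec [:yco (Suc k) (Suc j) (coeff (co a) 0):] = 0[(Q on: ysubalg (Suc k))]"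
   using g g' by (simp_all add: c yco_const z del: pCons_0_0)
  have "yco (Suc k) (Suc 0) (g * yv (Suc k)) = g" "yco (Suc k) 0 (g * yv (Suc k)) = 0"
   using yco_yv(1)[of "Suc k" g] yco_yv(2)[of "Suc k" 0 g] yco_const(1)[OF g(1)] by (simp_all add: mult.commute)
  thus "a *[(Q on: ysubalg (Suc k))] dec [:yv (Suc k):]
   = dec [:yv (Suc k):] *[(Q on: ysubalg (Suc k))]
     dec [:yco (Suc k) (Suc 0) (coeff (co (a *[(Q on: ysubalg (Suc k))] dec [:yv (Suc k):])) 0):]
    +[(Q on: ysubalg (Suc k))] dec [:yco (Suc k) 0 (coeff (co (a *[(Q on: ysubalg (Suc k))] dec [:yv (Suc k):])) 0):]"
   using g g' yv by (simp add: o1 o2 c del: pCons_0_0) (simp add: mult.commute)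
 qed
qed

lemma V_const: "V [:f:] = [:yc q * D f, sig f:]"
 by (rule poly_eqI) (simp add: coeff_V coeff_pCons split: nat.split)
lemma Q_ore: "ore_extension Q (ysubalg n) (dec var_v) (%j Z. dec [:coeff (co Z) j:])"
proof -
 interpret Q: ring Q by (rule Q_ring)
 have v: "var_v : Pn n" using Pn_simps(6)[OF Pn_simps(8)] by simp
 have Yc: "coeff (co Z) j : Yn n" if "Z |: Q" for Z j using co_in[OF that] by (simp add: Pn_def)
 note it = ysubalg_iff[OF order_refl]
 note d = dec[OF v]
 note c = dec_ops(7,8)
 have z: "dec [:0:] = 0[Q]" using dec_ops(5)[of 0 0] by simp
 have vl: "co (dec var_v *[Q] Z) = var_v * co Z" if "Z |: Q" for Z
  using co_ring(2)[OF d(1) that] d(2) mul_var_left[of 1 "co Z"] co_in[OF that] by simp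
 show ?thesis
 proof (rule ore_extension.intro[OF Q_ring], rule ore_extension_axioms.intro)
  show "ring ((Q on: ysubalg n))" "ysubalg n <=: carrier Q" using ysubalg_ring[OF order_refl] .
  show "dec var_v |: Q" by (rule d)
  fix b j assume b: "b |: Q"
  show "dec [:coeff (co b) j:] : ysubalg n" using Yc[OF b] by (auto simp: it)
  show "dec [:coeff (co (dec var_v *[Q] b)) 0:] = 0[Q]"
   "dec [:coeff (co (dec var_v *[Q] b)) (Suc j):] = dec [:coeff (co b) j:]"
   by (simp_all add: vl[OF b] coeff_var_v z del: pCons_0_0)
  show "EX m. ALL j >= m. dec [:coeff (co b) j:] = 0[Q]"
   by (rule exI[of _ "Suc (Polynomial.degree (co b))"]) (simp add: coeff_eq_0 z del: pCons_0_0)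
  show "b = 0[Q]" if "!!j. dec [:coeff (co b) j:] = 0[Q]"
  proof -
   have "coeff (co b) j = 0" for j using that[of j] dec_ops(4)[OF Yc[OF b], of 0 j] z by simp
   hence "co b = 0" by (intro poly_eqI) simp
   thus ?thesis using co_eq[OF b Q.zero_closed] by simp
  qed
  show "dec [:coeff (co (b +[Q] b')) j:] = dec [:coeff (co b) j:] +[Q] dec [:coeff (co b') j:]" if b': "b' |: Q" for b'
   using dec_ops(1)[OF Yc[OF b] Yc[OF b']] co_ring(1)[OF b b'] by simp
  show "dec [:coeff (co (b *[Q] a)) j:] = dec [:coeff (co b) j:] *[Q] a" if a: "a : ysubalg n" for a
  proof -
   from a obtain g where g: "g : Yn n" "a = dec [:g:]" by (auto simp: it)
   have "co (b *[Q] a) = smult g (co b)" using co_ring(2)[OF b, of a] g c[OF g(1) g(1)] by (simp add: mul_const)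
   thus ?thesis using g dec_ops(2)[OF Yc[OF b] g(1)] by (simp add: mult.commute)
  qed
 next
  fix a j assume "a : ysubalg n"
  then obtain g where g: "g : Yn n" "a = dec [:g:]" by (auto simp: it)
  note cg = c[OF g(1) g(1)]
  show "dec [:coeff (co a) 0:] = a" "dec [:coeff (co a) (Suc j):] = 0[Q]" using g cg by (simp_all add: z del: pCons_0_0)
  have ad: "a |: Q" using g cg by simp
  have co1: "co (a *[Q] dec var_v) = [:yc q * D g, sig g:]"
   using co_ring(2)[OF ad d(1)] g cg d(2) by (simp add: V_const)
  have Y: "yc q * D g : Yn n" "sig g : Yn n"
   using Yc[OF Q.m_closed[OF ad d(1)], of 0] Yc[OF Q.m_closed[OF ad d(1)], of "Suc 0"] unfolding co1 by simp_all
  note cD = c[OF Y(1) Y(1)] and cs = c[OF Y(2) Y(2)]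
  have "co (dec var_v *[Q] dec [:sig g:] +[Q] dec [:yc q * D g:]) = [:yc q * D g, sig g:]"
   using cD cs d by (simp add: co_ring(1) vl) (simp add: var_v_def)
  hence "a *[Q] dec var_v = dec var_v *[Q] dec [:sig g:] +[Q] dec [:yc q * D g:]"
   using co_eq[of "a *[Q] dec var_v" "dec var_v *[Q] dec [:sig g:] +[Q] dec [:yc q * D g:]"] co1 ad d cD cs by simp
  thus "a *[Q] dec var_v = dec var_v *[Q] dec [:coeff (co (a *[Q] dec var_v)) (Suc 0):]
    +[Q] dec [:coeff (co (a *[Q] dec var_v)) 0:]" unfolding co1 by simp
 qed
qed

theorem Q_global_dimension_le: "global_dimension Q <= enat (n + 1)"
proof -
 note inf = infinite_quotient_type(2)
 have base: "pdle ((Q on: ysubalg 0)) 0 N" if N: "lmod ((Q on: ysubalg 0)) (N :: (ncpoly set, ncpoly set) module)" for N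
 proof -
  have "proj ((Q on: ysubalg 0)) N"
  proof (rule division_ring_proj[OF N])
   fix a assume a: "a |: ((Q on: ysubalg 0))" "a ~= 0[(Q on: ysubalg 0)]"
   then obtain f where "f : Yn 0" "a = dec [:f:]" by (auto simp: ysubalg_iff)
   then obtain c where c: "a = dec [:yc c:]" using Yn_0 by blast
   have "c ~= 0"
   proof
    assume "c = 0"
    hence "a = dec [:0:]" using c by simp
    thus False using a(2) dec_ops(5)[of 0 0] by simp
   qed
   hence "dec [:yc (1 / c):] *[Q] a = 1[Q]"
    using dec_ops(2)[of "yc (1 / c)" "yc c"] dec_ops(6)[of 1 1] yc_simps(4)[of "1 / c" c] unfolding c by (simp del: yc_simps(4))
   moreover have "dec [:yc (1 / c):] : ysubalg 0" by (auto simp: ysubalg_iff)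
   ultimately show "EX b:carrier ((Q on: ysubalg 0)). b *[(Q on: ysubalg 0)] a = 1[(Q on: ysubalg 0)]" by auto
  qed
  thus ?thesis by simp
 qed
 have step: "k <= n ==> left_module ((Q on: ysubalg k)) (N :: (ncpoly set, ncpoly set) module) ==> pdle ((Q on: ysubalg k)) k N" for k N
 proof (induction k arbitrary: N)
  case 0
  thus ?case using base by simp
 next
  case (Suc k)
  have "Q\<lparr>carrier := ysubalg (Suc k), carrier := ysubalg k\<rparr> = (Q on: ysubalg k)" by simp
  thus ?case using ore_extension.ore_extension_pdle[OF ysubalg_ore inf, of k k N] Suc by simp
 qed
 have "pdle Q (Suc n) M" if "lmod Q (M :: (ncpoly set, ncpoly set) module)" for M
  by (rule ore_extension.ore_extension_pdle[OF Q_ore inf _ that]) (rule step[OF order_refl])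
 thus ?thesis using global_dimension_le[of Q "n + 1"] by simp
qed

end

section \<open>The Koszul complex of the family\<close>

text \<open>Setting \<open>y\<^sub>1 = ... = y\<^sub>k = 0\<close>.\<close>

definition zk :: "nat => ypoly => ypoly" where "zk k = ysub (%i. if i <= k then 0 else yv i)"

definition zp :: "nat => ppoly => ppoly" where "zp k = map_poly (zk k)"

definition Jk :: "nat => nat => ppoly set" where "Jk n k = {u : Pn n. zp k u = 0}"

lemma zk_simps [simp]: "zk k 0 = 0" "zk k (f + g) = zk k f + zk k g" "zk k (f - g) = zk k f - zk k g" "zk k (- f) = - zk k f"
 "zk k (f * g) = zk k f * zk k g" "zk k (yc c) = yc c" "zk k 1 = 1" "zk k (yv i) = (if i <= k then 0 else yv i)"
 "zk k (numeral m) = numeral m"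
 by (simp_all add: zk_def)

lemma coeff_zp [simp]: "coeff (zp k u) j = zk k (coeff u j)"
 by (simp add: zp_def coeff_map_poly)
lemma zp_simps [simp]: "zp k 0 = 0" "zp k (u + w) = zp k u + zp k w" "zp k (u - w) = zp k u - zp k w" "zp k (- u) = - zp k u"
 "zp k (smult f u) = smult (zk k f) (zp k u)" "zp k (var_v * u) = var_v * zp k u" "zp k [:f:] = [:zk k f:]"
 by (rule poly_eqI; simp add: var_v_def coeff_pCons split: nat.split)+

lemma zp_sum: "zp k (sum f K) = (\<Sum>i \<in> K. zp k (f i))"
 by (induction K rule: infinite_finite_induct) simp_all
lemma zk_constant: "f : Yn n ==> zk n f = yc (lookup f {#})"
proof (induction f rule: Yn_induct)
 case (mono c M)
 have "zk n (ym M) = (if M = {#} then 1 else 0)"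
  using mono by (cases M) (auto simp: Suc_le_eq)
 moreover have "lookup (yc c * ym M) {#} = (if M = {#} then c else 0)"
  by (simp add: single_ym[symmetric] lookup_single when_def)
 ultimately show ?case by simp
qed (simp_all add: lookup_add)

lemma yv_nonzero [simp]: "yv i ~= 0"
 unfolding yv_def ym_def by (metis lookup_single_eq lookup_zero zero_neq_one)
text \<open>The ideal \<open>(y_1, \<dots>, y_k)\<close> is the kernel of a substitution: subtracting the value of the substitution leaves the monomials that contain one of the variables.\<close>

lemma Jk_iff: assumes "k <= n" shows "u : Jk n k <-> (EX g. (ALL s. g s : Pn n) & u = (\<Sum>s<k. smult (yv (Suc s)) (g s)))"
proof
 have y: "yv (Suc s) : Yn n" if "s < k" for s using that assms by simp
 assume "EX g. (ALL s. g s : Pn n) & u = (\<Sum>s<k. smult (yv (Suc s)) (g s))"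
 thus "u : Jk n k" using y by (auto simp: Jk_def zp_sum intro!: Pn_sum Pn_simps(4) sum.neutral)
next
 have C: "EX g. (ALL s. g s : Pn n) & u - zp k u = (\<Sum>s<k. smult (yv (Suc s)) (g s))" if "u : Pn n" for u
  using that
 proof (induction u rule: Pn_induct)
  case (mono c M j)
  show ?case
  proof (cases "EX s < k. Suc s \<in># M")
   case True
   then obtain s where s: "s < k" "Suc s \<in># M" by blast
   let ?N = "M - {#Suc s#}"
   have M: "M = add_mset (Suc s) ?N" using s(2) by simp
   have N: "set_mset ?N <=: {1..n}" using mono by (meson in_diffD subset_iff)
   have e: "yc c * ym M = yv (Suc s) * (yc c * ym ?N)" by (subst M) (simp add: mult.left_commute)
   have "zk k (yc c * ym M) = 0" unfolding e using s(1) by simp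
   hence "zp k (monom (yc c * ym M) j) = 0" by (intro poly_eqI) (simp add: coeff_monom)
   moreover have "(\<Sum>r<k. smult (yv (Suc r)) (if r = s then monom (yc c * ym ?N) j else 0)) = (\<Sum>r<k. if r = s then monom (yc c * ym M) j else 0)"
    by (rule sum.cong) (simp_all add: smult_monom e)
   ultimately show ?thesis using s(1) N by (intro exI[of _ "%r. if r = s then monom (yc c * ym ?N) j else 0"]) simp
  next
   case False
   have "\<forall>i \<in># M. i > k"
   proof
    fix i assume i: "i \<in># M"
    hence "i = Suc (i - 1)" using mono by fastforce
    thus "i > k" using i False by (metis Suc_le_eq not_le)
   qed
   hence "zk k (ym M) = ym M" by (induction M) auto
   hence "zp k (monom (yc c * ym M) j) = monom (yc c * ym M) j" by (intro poly_eqI) (simp add: coeff_monom)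
   thus ?thesis by (intro exI[of _ "%_. 0"]) simp
  qed
 next
  case (add u w)
  then obtain g h where "ALL s. g s : Pn n" "u - zp k u = (\<Sum>s<k. smult (yv (Suc s)) (g s))"
   "ALL s. h s : Pn n" "w - zp k w = (\<Sum>s<k. smult (yv (Suc s)) (h s))" by blast
  moreover have "(u + w) - zp k (u + w) = (u - zp k u) + (w - zp k w)" by simp
  ultimately have "(ALL s. g s + h s : Pn n) & (u + w) - zp k (u + w) = (\<Sum>s<k. smult (yv (Suc s)) (g s + h s))"
   by (simp only: smult_add_right sum.distrib) simp
  thus ?case by (rule exI[of _ "%s. g s + h s"])
 qed (auto intro: exI[of _ "%_. 0"])
 assume "u : Jk n k"
 thus "EX g. (ALL s. g s : Pn n) & u = (\<Sum>s<k. smult (yv (Suc s)) (g s))" using C[of u] by (simp add: Jk_def)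
qed

locale pbw_domain = pbw_model +
 assumes p_ne: "1 + p ~= 0"
begin

definition yl_factor :: "nat => ypoly" where "yl_factor i = of_nat (n + 1) * yv i - 2 * ysum"

lemma ydelta_factor: "ydelta (yv i) = yv i * yl_factor i" by (simp add: ydelta_def yl_factor_def)
lemma yl_factor_Yn: assumes "1 <= i" "i <= n" shows "yl_factor i : Yn n"
proof -
 have "yl_factor i = yc (of_nat (n + 1)) * yv i + - (yc 2 * ysum)" by (simp add: yl_factor_def)
 thus ?thesis using assms ysum_Yn by (simp only: Yn_mult Yn_simps Yn_yv)
qed

lemma V_yv: "V (smult (yv i) u) = smult (yv i) (smult (yc (1 + p)) (V u) - smult (yc q * yl_factor i) u)"
 by (simp add: V_smult ydelta_factor smult_diff_right algebra_simps)

definition wsum :: "nat set => ypoly" where "wsum T = yc q * (\<Sum>i \<in> T \<inter> {..<n}. yl_factor (Suc i))"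

text \<open>For \<open>s = n\<close> this is the linear form that \<open>v\<close> becomes after it has been moved past the product of the \<open>y_i\<close> with \<open>i - 1\<close> in \<open>T\<close>.\<close>

definition wt :: "nat set => nat => ppoly" where
 "wt T s = (if s < n then [:yv (Suc s):] else smult (yc ((1 + p) ^ card (T \<inter> {..<n}))) var_v - [:wsum T:])"

lemma var_v_Pn: "var_v : Pn n" using Pn_simps(6)[OF Pn_simps(8)] by simp
lemma wsum_Yn: "wsum T : Yn n" unfolding wsum_def
 by (intro Yn_mult Yn_simps Yn_sum yl_factor_Yn) auto
lemma wt_Pn: "wt T s : Pn n"
 using wsum_Yn var_v_Pn by (auto simp: wt_def intro!: Pn_diff)
lemma V_1: "V 1 = var_v" using V_power_1[of 1] by (simp add: var_v_def monom_Suc monom_0)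
lemma zk_ysum: "zk n ysum = 0" unfolding ysum_def by (induction n) (simp_all add: zk_def ysub_sum)
lemma zp_V: assumes "u : Pn n" shows "zp n (V u) = var_v * zp n u"
proof -
 have D: "zk n (D f) = 0" if "f : Yn n" for f using that
 proof (induction f rule: Yn_induct)
  case (mono c M)
  hence "zk n (D (ym M)) = 0"
  proof (induction M)
   case (add i M)
   thus ?case by (simp add: ydelta_factor)
  qed simp
  thus ?case by simp
 qed simp_all
 have s: "zk n (sig f) = zk n f" if "f : Yn n" for f using that
 proof (induction f rule: Yn_induct)
  case (mono c M)
  hence "zk n (sig (ym M)) = zk n (ym M)" by (induction M) simp_all
  thus ?case by simp
 qed simp_all
 have "coeff u j : Yn n" for j using assms by (simp add: Pn_def)
 thus ?thesis by (intro poly_eqI) (simp add: coeff_V coeff_var_v D s split: nat.split)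
qed

text \<open>The square of \<open>y_i\<close> and \<open>v\<close> commutes by the defining relation; moreover \<open>(1 + p)\<^sup>c q = q\<close>, because \<open>p q = 0\<close>.\<close>

lemma wt_comm_v:
 assumes s: "s < n" "s ~: T"
 shows "mul (wt (insert s T) n) (wt T s) = mul (wt (insert n T) s) (wt T n)"
proof -
 let ?a = "1 + p" and ?y = "yv (Suc s)" and ?c = "card (T \<inter> {..<n})"
 have c: "card (insert s T \<inter> {..<n}) = Suc ?c" using s by (simp add: Int_insert_left)
 have ws: "wsum (insert s T) = wsum T + yc q * yl_factor (Suc s)"
  using s by (simp add: wsum_def Int_insert_left distrib_left add.commute)
 have V: "V [:?y:] = smult ?y (smult (yc ?a) var_v - [:yc q * yl_factor (Suc s):])"
  using V_yv[of "Suc s" 1] by (simp add: V_1)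
 have y: "?y : Yn n" using s by simp
 have q: "yc (?a ^ ?c) * yc q = yc q"
 proof (cases "q = 0")
  case False
  thus ?thesis using pq by simp
 qed simp
 have "mul (wt (insert n T) s) (wt T n) = smult (yc (?a ^ ?c)) (V [:?y:]) - smult (wsum T) [:?y:]"
  using s mul_const[OF wsum_Yn, of "[:?y:]" T] by (simp add: wt_def)
 also have "... = smult ?y (smult (yc (?a ^ Suc ?c)) var_v - [:yc (?a ^ ?c) * yc q * yl_factor (Suc s):]) - smult ?y [:wsum T:]"
  unfolding V by (simp only: power_Suc2 yc_simps(4)) (simp add: smult_diff_right mult_ac del: yc_simps(3))
 also have "... = smult ?y (wt (insert s T) n)"
  unfolding q by (simp add: wt_def c ws smult_diff_right[symmetric] del: power_Suc yc_simps) (simp add: smult_diff_right smult_add_right algebra_simps del: power_Suc yc_simps)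
 also have "... = mul (wt (insert s T) n) (wt T s)" using s mul_const[OF y] by (simp add: wt_def)
 finally show ?thesis ..
qed

lemma wt_comm:
 assumes "s ~: T" "r ~: T" "s ~= r" "s < Suc n" "r < Suc n"
 shows "mul (wt (insert s T) r) (wt T s) = mul (wt (insert r T) s) (wt T r)"
proof -
 consider "s < n" "r < n" | "s < n" "r = n" | "r < n" "s = n" using assms by linarith
 thus ?thesis
 proof cases
  case 1
  have "yv (Suc s) : Yn n" "yv (Suc r) : Yn n" using 1 by simp_all
  thus ?thesis using 1 by (simp add: wt_def mul_const mult.commute)
 qed (use wt_comm_v[of s T] wt_comm_v[of r T] assms in simp_all)
qed

text \<open>Left multiplication by \<open>y\<^sub>i\<close> has the same image as right multiplication.\<close>

lemma y_normal: assumes i: "1 <= i" "i <= n" shows "g : Pn n ==> EX h:Pn n. smult (yv i) g = mul [:yv i:] h"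
proof -
 define S where "S = {g : Pn n. EX h:Pn n. smult (yv i) g = mul [:yv i:] h}"
 have S_add: "g + g' : S" if gg: "g : S" "g' : S" for g g'
 proof -
  from gg obtain h h' where "h : Pn n" "smult (yv i) g = mul [:yv i:] h" "h' : Pn n" "smult (yv i) g' = mul [:yv i:] h'"
   by (auto simp: S_def)
  thus ?thesis using gg by (auto simp: S_def smult_add_right intro!: bexI[of _ "h + h'"])
 qed
 have S_smult: "smult f g : S" if f: "f : Yn n" and g: "g : S" for f g
 proof -
  from g obtain h where h: "g : Pn n" "h : Pn n" "smult (yv i) g = mul [:yv i:] h" by (auto simp: S_def)
  have "smult (yv i) (smult f g) = smult f (smult (yv i) g)" by (simp add: mult.commute)
  also have "... = mul [:yv i:] (smult f h)" unfolding h(3) mul_smult_right[OF f h(2)] ..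
  finally show ?thesis using h f by (auto simp: S_def intro!: bexI[of _ "smult f h"])
 qed
 have VPn: "V u : Pn n" if "u : Pn n" for u using act_Pn[OF TT_vv that] by (simp add: act_vv)
 have S_V: "V g : S" if g: "g : S" for g
 proof -
  from g obtain h where h: "g : Pn n" "h : Pn n" "smult (yv i) g = mul [:yv i:] h" by (auto simp: S_def)
  let ?w = "smult (yc (1 + p)) (V g) - smult (yc q * yl_factor i) g"
  have l: "yc q * yl_factor i : Yn n" using yl_factor_Yn[OF i] by simp
  have "smult (yv i) ?w = V (mul [:yv i:] h)" unfolding h(3)[symmetric] V_yv ..
  also have "... = mul [:yv i:] (V h)"
   using mul_assoc[of "[:yv i:]" h var_v] h i var_v_Pn by simp
  finally have "?w : S" using h VPn l by (auto simp: S_def simp del: yc_simps)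
  hence "?w + smult (yc q * yl_factor i) g : S" by (rule S_add[OF _ S_smult[OF l g]])
  hence "smult (yc (1 + p)) (V g) : S" by (simp del: yc_simps)
  from S_smult[OF Yn_simps(5) this] have "smult (yc (1 / (1 + p))) (smult (yc (1 + p)) (V g)) : S" .
  moreover have "yc (1 / (1 + p)) * yc (1 + p) = 1" using p_ne yc_simps(4)[of "1 / (1 + p)" "1 + p"] by (simp del: yc_simps(4) yc_simps(3))
  ultimately show ?thesis by (simp del: yc_simps(3))
 qed
 have y: "yv i : Yn n" using i by simp
 have S1: "1 : S" using i by (auto simp: S_def intro!: bexI[of _ 1])
 have Sm: "monom 1 j : S" for j
 proof -
  have "(V ^^ j) 1 : S" using S1 S_V by (induction j) simp_all
  thus ?thesis by (simp add: V_power_1)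
 qed
 show "EX h:Pn n. smult (yv i) g = mul [:yv i:] h" if "g : Pn n"
 proof -
  have "g : S" using that
  proof (induction g rule: Pn_induct)
   case (mono c M j)
   have "smult (yc c * ym M) (monom 1 j) : S" using mono by (intro S_smult Sm) simp
   thus ?case by (simp add: smult_monom)
  next
   case (add u w)
   thus ?case by (blast intro: S_add)
  qed (simp add: S_def bexI[of _ 0])
  thus ?thesis by (auto simp: S_def)
 qed
qed

lemma V_power_y: "coeff ((V ^^ j) [:yv i:]) j = yc ((1 + p) ^ j) * yv i & (ALL l > j. coeff ((V ^^ j) [:yv i:]) l = 0)
  & (EX u. (V ^^ j) [:yv i:] = smult (yv i) u)"
proof (induction j)
 case (Suc j)
 then obtain u where u: "(V ^^ j) [:yv i:] = smult (yv i) u" by blast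
 have "(V ^^ Suc j) [:yv i:] = smult (yv i) (smult (yc (1 + p)) (V u) - smult (yc q * yl_factor i) u)" using u V_yv by simp
 moreover have "coeff ((V ^^ Suc j) [:yv i:]) (Suc j) = yc ((1 + p) ^ Suc j) * yv i"
  using Suc by (simp add: coeff_V mult_ac del: yc_simps(3))
 moreover have "ALL l > Suc j. coeff ((V ^^ Suc j) [:yv i:]) l = 0" using Suc by (auto simp: coeff_V split: nat.split)
 ultimately show ?case by blast
qed (auto simp: coeff_pCons split: nat.split intro!: exI[of _ 1])

lemma mul_y_left: assumes "u : Pn n" shows "EX h. mul [:yv i:] u = smult (yv i) h"
proof -
 have "ALL j. EX h. (V ^^ j) [:yv i:] = smult (yv i) h" using V_power_y by blast
 then obtain h where h: "!!j. (V ^^ j) [:yv i:] = smult (yv i) (h j)" by metis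
 have s: "smult c (sum f K) = (\<Sum>j \<in> K. smult c (f j))" for c and f :: "nat => ppoly" and K
  by (induction K rule: infinite_finite_induct) (simp_all add: smult_add_right)
 have "mul [:yv i:] u = smult (yv i) (\<Sum>j \<le> Polynomial.degree u. smult (coeff u j) (h j))"
  unfolding mul_expand[OF assms] h s by (simp add: mult.commute)
 thus ?thesis by blast
qed

lemma mul_y_left_zero: assumes u: "u : Pn n" and i: "i <= k" shows "zp k (mul [:yv i:] u) = 0"
proof -
 obtain h where "mul [:yv i:] u = smult (yv i) h" using mul_y_left[OF u] by blast
 thus ?thesis using i by simp
qed

text \<open>Modulo \<open>y_1, \<dots>, y_k\<close> the leading coefficient in \<open>v\<close> is multiplied by a nonzero multiple of \<open>y_i\<close>.\<close>

lemma mul_y_left_cancel: assumes u: "u : Pn n" and i: "i > k" and z: "zp k (mul [:yv i:] u) = 0" shows "zp k u = 0"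
proof (rule ccontr)
 assume nz: "zp k u ~= 0"
 let ?d = "Polynomial.degree (zp k u)"
 have d: "zk k (coeff u ?d) ~= 0" using nz leading_coeff_0_iff[of "zp k u"] by simp
 have top: "zk k (coeff u j) = 0" if "j > ?d" for j using coeff_eq_0[OF that] by simp
 have d': "?d <= Polynomial.degree u" using d by (intro le_degree) auto
 have "0 = zk k (coeff (mul [:yv i:] u) ?d)" using arg_cong[OF z, of "%u. coeff u ?d"] by simp
 also have "... = (\<Sum>j \<le> Polynomial.degree u. zk k (coeff u j) * zk k (coeff ((V ^^ j) [:yv i:]) ?d))"
 proof -
  have "zk k (sum f K) = (\<Sum>j \<in> K. zk k (f j))" for f and K :: "nat set" by (simp add: zk_def ysub_sum)
  thus ?thesis by (simp add: mul_expand[OF u] coeff_sum)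
 qed
 also have "... = (\<Sum>j \<le> Polynomial.degree u. if j = ?d then zk k (coeff u ?d) * (yc ((1 + p) ^ ?d) * yv i) else 0)"
 proof (rule sum.cong)
  fix j
  show "zk k (coeff u j) * zk k (coeff ((V ^^ j) [:yv i:]) ?d) = (if j = ?d then zk k (coeff u ?d) * (yc ((1 + p) ^ ?d) * yv i) else 0)"
   using V_power_y[of j i] top[of j] i by (cases j ?d rule: linorder_cases) (simp_all del: yc_simps)
 qed simp
 also have "... = zk k (coeff u ?d) * (yc ((1 + p) ^ ?d) * yv i)" using d' by simp
 finally have "yc ((1 + p) ^ ?d) = 0" using d by simp
 hence "lookup (yc ((1 + p) ^ ?d)) {#} = 0" by simp
 thus False using p_ne by (simp add: yc_def)
qed

lemma zp_mul_left: assumes f: "f : Yn n" "zk n f = 0" and u: "u : Pn n" shows "zp n (mul [:f:] u) = 0"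
proof -
 have "[:f:] : Jk n n" using f by (simp add: Jk_def)
 then obtain g where g: "ALL s. g s : Pn n" "[:f:] = (\<Sum>s<n. smult (yv (Suc s)) (g s))" using Jk_iff[OF order_refl] by blast
 have sum: "mul (sum h K) u = (\<Sum>s \<in> K. mul (h s) u)" for h and K :: "nat set"
  by (induction K rule: infinite_finite_induct) simp_all
 have "zp n (mul (smult (yv (Suc s)) (g s)) u) = 0" if s: "s < n" for s
 proof -
  obtain h where h: "h : Pn n" "smult (yv (Suc s)) (g s) = mul [:yv (Suc s):] h" using y_normal[of "Suc s" "g s"] s g(1) by auto
  have "mul (mul [:yv (Suc s):] h) u = mul [:yv (Suc s):] (mul h u)" using s h(1) u by (intro mul_assoc) simp_all
  thus ?thesis unfolding h(2) using mul_y_left_zero[of "mul h u" "Suc s" n] mul_Pn[OF h(1) u] s by simp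
 qed
 thus ?thesis unfolding g(2) sum zp_sum by (intro sum.neutral) auto
qed

lemma zk_wsum: "zk n (wsum T) = 0"
proof -
 have "zk n (yl_factor (Suc i)) = 0" if "i < n" for i using that zk_ysum unfolding yl_factor_def
  by (simp add: zk_def)
 thus ?thesis by (simp add: wsum_def zk_def ysub_sum sum.neutral)
qed

lemma var_v_nonzero [simp]: "var_v ~= 0" by (simp add: var_v_def)
lemma V_Pn: "u : Pn n ==> V u : Pn n" using act_Pn[OF TT_vv] by (simp add: act_vv)
text \<open>Setting all \<open>y\<close> to zero leaves a polynomial in \<open>v\<close>.\<close>

lemma zp_decompose: assumes u: "u : Pn n" and 0: "zk n (coeff u 0) = 0"
 shows "EX g:Pn n. zp n u = var_v * g & zp n g = g"
proof -
 have Y: "coeff u j : Yn n" for j using u by (simp add: Pn_def)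
 obtain a g where ag: "zp n u = pCons a g" by (cases "zp n u")
 have "a = 0" using 0 arg_cong[OF ag, of "%u. coeff u 0"] by simp
 hence g: "zp n u = var_v * g" using ag by (simp add: var_v_def)
 have c: "coeff g j = zk n (coeff u (Suc j))" for j
  using arg_cong[OF ag, of "%u. coeff u (Suc j)"] by simp
 have "zp n g = g" "g : Pn n" using zk_constant[OF Y] by (auto simp: c Pn_def intro!: poly_eqI)
 thus ?thesis using g by blast
qed

interpretation Qr: ring Q by (rule Q_ring)

interpretation K: koszul Q "Pn n" co mul "Suc n" wt
proof (rule koszul.intro[OF Q_ring], rule subgroup_set.intro, simp_all, rule koszul_axioms.intro)
 show "bij_betw co (carrier Q) (Pn n)" by (rule co_bij)
 show "infinite (UNIV :: ncpoly set set)" by (rule infinite_quotient_type)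
qed (simp_all add: co_ring wt_Pn wt_comm del: One_nat_def Suc_eq_plus1_left)

lemma span_right: "k <= n ==> span_below K.rc (Pn n) T k = Jk n k"
proof -
 assume k: "k <= n"
 have "K.rc T s g = smult (yv (Suc s)) g" if "s < k" for s g
  using that k mul_const[of "yv (Suc s)" g] by (simp add: K.rc_def wt_def)
 hence "(\<Sum>s<k. K.rc T s (g s)) = (\<Sum>s<k. smult (yv (Suc s)) (g s))" for g by simp
 thus ?thesis using Jk_iff[OF k] by (auto simp: span_below_def)
qed

lemma span_left: "k <= n ==> span_below K.lc (Pn n) T k = Jk n k"
proof -
 assume k: "k <= n"
 let ?e = "%s (g :: ppoly). if even (n - s) then g else - g"
 have lc: "K.lc T s g = mul [:yv (Suc s):] (?e s g)" if "s < k" for s g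
  using that k by (simp add: K.lc_def wt_def)
 show ?thesis
 proof (intro equalityI subsetI)
  fix u assume "u : span_below K.lc (Pn n) T k"
  then obtain g where g: "ALL s. g s : Pn n" "u = (\<Sum>s<k. mul [:yv (Suc s):] (?e s (g s)))" by (auto simp: span_below_def lc)
  have "zp k u = 0" unfolding g(2) zp_sum using g(1) by (intro sum.neutral ballI mul_y_left_zero) auto
  moreover have "u : Pn n" unfolding g(2) using g(1) k by (intro Pn_sum mul_Pn) auto
  ultimately show "u : Jk n k" by (simp add: Jk_def)
 next
  fix u assume "u : Jk n k"
  then obtain g where g: "ALL s. g s : Pn n" "u = (\<Sum>s<k. smult (yv (Suc s)) (g s))" using Jk_iff[OF k] by blast
  have "EX h. h : Pn n & (s < k --> smult (yv (Suc s)) (g s) = mul [:yv (Suc s):] h)" for s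
   using y_normal[of "Suc s" "g s"] g(1) k by (cases "s < k") auto
  then obtain h where h: "!!s. h s : Pn n" "!!s. s < k ==> smult (yv (Suc s)) (g s) = mul [:yv (Suc s):] (h s)" by metis
  have "u = (\<Sum>s<k. K.lc T s (?e s (h s)))" unfolding g(2) by (rule sum.cong) (simp_all add: h lc)
  moreover have "ALL s. ?e s (h s) : Pn n" using h(1) by simp
  ultimately show "u : span_below K.lc (Pn n) T k" unfolding span_below_def mem_Collect_eq
   by (intro exI[of _ "%s. ?e s (h s)"] conjI)
 qed
qed

lemma span_Suc: "span_below c (Pn n) T (Suc n) = {x + c T n g | x g. x : span_below c (Pn n) T n & g : Pn n}"
proof (intro equalityI subsetI)
 fix u assume "u : {x + c T n g | x g. x : span_below c (Pn n) T n & g : Pn n}"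
 then obtain h g where hg: "ALL s. h s : Pn n" "g : Pn n" "u = (\<Sum>s<n. c T s (h s)) + c T n g" by (auto simp: span_below_def)
 have "u = (\<Sum>s<Suc n. c T s ((h(n := g)) s))" using hg by simp
 moreover have "ALL s. (h(n := g)) s : Pn n" using hg by simp
 ultimately show "u : span_below c (Pn n) T (Suc n)" unfolding span_below_def by blast
qed (auto simp: span_below_def)

lemma aug_co: assumes "b |: Q" shows "augmentation Q b = lookup (coeff (co b) 0) {#}"
proof -
 obtain f where "f : TT n" "b = cls f" using assms by (rule Q_cases)
 thus ?thesis by (simp add: Q_augmentation lookup_prj_const)
qed

lemma aug_zero: assumes "b |: Q" shows "augmentation Q b = 0 <-> zk n (coeff (co b) 0) = 0"
proof -
 have "coeff (co b) 0 : Yn n" using co_in[OF assms] by (simp add: Pn_def)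
 hence z: "zk n (coeff (co b) 0) = yc (augmentation Q b)" using zk_constant aug_co[OF assms] by simp
 show ?thesis unfolding z by (auto simp: yc_def dest!: arg_cong[of _ _ "%f. lookup f {#}"])
qed

text \<open>Modulo the \<open>y_i\<close> the last weight is a multiple of \<open>v\<close>, so the weights generate all elements without constant term.\<close>

lemma span_top:
 assumes c: "!!g. g : Pn n ==> c {} n g : Pn n & zp n (c {} n g) = smult (yc e) (var_v * zp n g)" and e: "e ~= 0"
  and J: "span_below c (Pn n) {} n = Jk n n" and u: "u : Pn n"
 shows "u : span_below c (Pn n) {} (Suc n) <-> zk n (coeff u 0) = 0"
proof
 assume "u : span_below c (Pn n) {} (Suc n)"
 then obtain x g where xg: "u = x + c {} n g" "zp n x = 0" "g : Pn n" using span_Suc[of c "{}"] J by (auto simp: Jk_def)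
 hence "zp n u = smult (yc e) (var_v * zp n g)" using c by simp
 from arg_cong[OF this, of "%u. coeff u 0"] show "zk n (coeff u 0) = 0" by (simp add: coeff_var_v)
next
 assume "zk n (coeff u 0) = 0"
 then obtain g where g: "g : Pn n" "zp n u = var_v * g" "zp n g = g" using zp_decompose[OF u] by blast
 let ?g = "smult (yc (1 / e)) g"
 have ee: "yc e * yc (1 / e) = 1" using e yc_simps(4)[of e "1 / e"] by (simp del: yc_simps(4))
 have gP: "?g : Pn n" using g by simp
 have "zp n (c {} n ?g) = var_v * g" using c[OF gP] g ee by (simp add: mult.assoc[symmetric])
 hence "u - c {} n ?g : Jk n n" using u g c[OF gP] by (simp add: Jk_def)
 hence "(u - c {} n ?g) + c {} n ?g : span_below c (Pn n) {} (Suc n)" unfolding span_Suc J using gP by blast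
 thus "u : span_below c (Pn n) {} (Suc n)" by simp
qed

lemma rc_top: "g : Pn n ==> K.rc {} n g = V g" by (simp add: K.rc_def wt_def wsum_def)
lemma lc_top: assumes g: "g : Pn n"
 shows "K.lc {} n g : Pn n & zp n (K.lc {} n g) = smult (yc ((1 + p) ^ n)) (var_v * zp n g)"
proof -
 have "{..<Suc n} - {} - {n} = {..<n}" by auto
 hence "K.lc {} n g = mul (wt {..<n} n) g" by (simp add: K.lc_def)
 moreover have "mul (wt {..<n} n) g = smult (yc ((1 + p) ^ n)) (var_v * g) - mul [:wsum {..<n}:] g"
  using g mul_var_left[of 1 g] by (simp add: wt_def)
 ultimately show ?thesis using g zp_mul_left[OF wsum_Yn zk_wsum g] mul_Pn[OF wt_Pn g, of "{..<n}" n] by simp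
qed

interpretation KR: koszul_regular Q "Pn n" co mul "Suc n" wt
proof (rule koszul_regular.intro[OF K.koszul_axioms], rule koszul_regular_axioms.intro)
 fix k T u assume k: "k < Suc n" and T: "T <=: {k<..<Suc n}" and u: "u : Pn n"
 hence k': "k <= n" by simp
 show "u : span_below K.rc (Pn n) (insert k T) k" if r: "K.rc T k u : span_below K.rc (Pn n) T k"
 proof (cases "k = n")
  case True
  have "{n<..<Suc n} = {}" by auto
  hence "T = {}" using T True by simp
  hence "zp n (V u) = 0" using r rc_top[OF u] True by (simp add: span_right Jk_def)
  thus ?thesis using u True by (simp add: span_right Jk_def zp_V)
 next
  case False
  hence kn: "k < n" using k by simp
  hence "K.rc T k u = smult (yv (Suc k)) u" using mul_const[of "yv (Suc k)" u] by (simp add: K.rc_def wt_def)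
  thus ?thesis using r u k' by (simp add: span_right Jk_def)
 qed
 show "u : span_below K.lc (Pn n) (insert k T) k" if r: "K.lc T k u : span_below K.lc (Pn n) T k"
 proof (cases "k = n")
  case True
  have "{n<..<Suc n} = {}" by auto
  hence "T = {}" using T True by simp
  hence "smult (yc ((1 + p) ^ n)) (var_v * zp n u) = 0" using r lc_top[OF u] True by (simp add: span_left Jk_def)
  moreover have "yc ((1 + p) ^ n) ~= 0" using p_ne by (auto simp: yc_def dest!: arg_cong[of _ _ "%f. lookup f {#}"])
  ultimately show ?thesis using u True by (simp add: span_left Jk_def)
 next
  case False
  hence kn: "k < n" using k by simp
  hence "zp k (mul [:yv (Suc k):] u) = 0" using r k' by (simp add: K.lc_def wt_def span_left Jk_def split: if_splits)
  hence "zp k u = 0" using mul_y_left_cancel[OF u, of k "Suc k"] by simp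
  thus ?thesis using u k' by (simp add: span_left Jk_def)
 qed
next
 fix a b assume ab: "a |: Q" "b |: Q"
 then obtain f g where "f : TT n" "a = cls f" "g : TT n" "b = cls g" by (metis Q_cases)
 thus "augmentation Q (a +[Q] b) = augmentation Q a + augmentation Q b" "augmentation Q (a *[Q] b) = augmentation Q a * augmentation Q b"
  by (simp_all add: Q_augmentation Q_add Q_mult lookup_add lookup_Nil_mult)
next
 show "augmentation Q 1[Q] = 1" by (simp add: Q_sel(2) Q_augmentation lookup_one zero_list_def)
 show "EX a:carrier Q. augmentation Q a = z" for z
  by (rule bexI[of _ "cls (const z)"]) (simp_all add: Q_augmentation const_def[THEN arg_cong[of _ _ "%f. lookup f []"]])
 fix b assume b: "b |: Q"
 note bP = co_in[OF b]
 show "augmentation Q b = 0 <-> co b : span_below K.rc (Pn n) {} (Suc n)"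
  using span_top[of K.rc 1 "co b"] bP rc_top V_Pn zp_V by (simp add: aug_zero[OF b] span_right)
 show "augmentation Q b = 0 <-> co b : span_below K.lc (Pn n) {} (Suc n)"
  using span_top[of K.lc "(1 + p) ^ n" "co b"] bP lc_top p_ne by (simp add: aug_zero[OF b] span_left)
 show "augmentation Q b = 0" if "co b = wt T s" for T s
  using that zk_wsum by (simp add: aug_zero[OF b] wt_def var_v_def)
qed

theorem Q_AS_regular: "AS_regular Q (n + 1)"
proof -
 have "global_dimension Q = enat (n + 1)"
  using Q_global_dimension_le[unfolded Suc_eq_plus1[symmetric]] unfolding Suc_eq_plus1[symmetric]
  using KR.koszul_global_dimension[OF infinite_quotient_type(1)] by (rule order_antisym)
 thus ?thesis unfolding AS_regular_def using Q_connected_graded Q_growth KR.koszul_gorenstein by simp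
qed

end

section \<open>The commutative polynomial ring as a representation\<close>

text \<open>Here the variables \<open>yv 0, ..., yv n\<close> stand for \<open>x\<^sub>0, ..., x\<^sub>n\<close>.\<close>

definition rho :: "ncpoly => ypoly" where "rho = lift_lin yc (%w. ym (mset w))"

definition xperm :: "(nat => nat) => ypoly => ypoly" where "xperm s = lift_lin yc (%M. ym (image_mset s M))"

lemma rho_simps [simp]: "rho 0 = 0" "rho (f + g) = rho f + rho g" "rho (f - g) = rho f - rho g" "rho (f * g) = rho f * rho g"
 "rho (const c) = yc c" "rho (- f) = - rho f" "rho (single w c) = yc c * ym (mset w)"
proof -
 show m: "rho (f * g) = rho f * rho g" for f g
  unfolding rho_def by (rule Y.lift_mult) (simp add: plus_list_def)
 show "rho (const c) = yc c" by (simp add: rho_def const_def)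
qed (simp_all add: rho_def Y.lift_add Y.lift_diff Y.lift_neg)

lemma xperm_simps [simp]: "xperm s 0 = 0" "xperm s (f + g) = xperm s f + xperm s g" "xperm s (yc c * ym M) = yc c * ym (image_mset s M)"
proof -
 show "xperm s (yc c * ym M) = yc c * ym (image_mset s M)" unfolding single_ym[symmetric] xperm_def Y.lift_single by (simp add: single_ym)
qed (simp_all add: xperm_def Y.lift_add)

lemma rho_perm_act: "rho (perm_act s f) = xperm s (rho f)"
proof -
 interpret pbw_model n 0 0 for n by standard simp
 show ?thesis by (induction f rule: poly_mapping_induct) simp_all
qed

lemma lookup_scale: "lookup (yc c * f) M = c * lookup f M"
 by (induction f rule: poly_mapping_induct) (simp_all add: yc_def mult_single distrib_left lookup_add lookup_single when_def)
lemma lookup_mono: "lookup (yc c * ym N) M = (if N = M then c else 0)"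
 by (simp add: single_ym[symmetric] lookup_single when_def)
lemma lookup_xperm: assumes s: "inj s" shows "lookup (xperm s f) (image_mset s M) = lookup f M"
proof (induction f rule: ypoly_induct)
 case (mono c N)
 have "image_mset s N = image_mset s M <-> N = M" by (metis multiset.inj_map injD s)
 thus ?case by (simp add: lookup_mono)
qed (simp_all add: lookup_add)

definition xpiece :: "nat => nat => ypoly set" where
 "xpiece n k = {f. ALL M:keys f. size M = k & set_mset M <=: {0..n}}"

lemma xpiece_simps: "0 : xpiece n k" "f : xpiece n k ==> g : xpiece n k ==> f + g : xpiece n k"
 "size M = k ==> set_mset M <=: {0..n} ==> yc c * ym M : xpiece n k"
 using Poly_Mapping.keys_add[of f g] by (auto simp: xpiece_def single_ym[symmetric])

lemma rho_xpiece: assumes f: "f : TP n k" shows "rho f : xpiece n k"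
proof -
 have "(\<Sum>w \<in> W. yc (lookup f w) * ym (mset w)) : xpiece n k" if "finite W" "W <=: keys f" for W
  using that
 proof (induction W rule: finite_induct)
  case (insert w W)
  hence "length w = k" "set w <=: {0..n}" using f by (auto simp: piece_iff TT_iff)
  thus ?case using insert by (simp add: xpiece_simps)
 qed (simp add: xpiece_simps)
 thus ?thesis by (simp add: rho_def lift_lin_def)
qed

lemma xpiece_rho: assumes "u : xpiece n k" shows "EX f:TP n k. rho f = u"
proof -
 let ?f = "\<Sum>M \<in> keys u. single (sorted_list_of_multiset M) (lookup u M)"
 have "rho (\<Sum>M \<in> K. single (sorted_list_of_multiset M) (b M)) = (\<Sum>M \<in> K. single M (b M))" if "finite K" for K and b :: "nat multiset => complex"
  using that by (induction K rule: finite_induct) (simp_all add: single_ym)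
 hence "rho ?f = u" using poly_mapping_decompose[of u] by simp
 moreover have "?f : TP n k"
 proof (rule piece_sum)
  fix M assume "M : keys u"
  hence "size M = k" "set_mset M <=: {0..n}" using assms by (auto simp: xpiece_def)
  thus "single (sorted_list_of_multiset M) (lookup u M) : TP n k"
   by (auto simp: piece_iff TT_iff simp flip: size_mset)
 qed
 ultimately show ?thesis by blast
qed

lemma comm_ideal_rho: assumes f: "f : TT n" shows "f : comm_ideal n <-> rho f = 0"
proof
 interpret T: ring "tensor_alg n" by (rule tensor_ring)
 let ?J = "{f : TT n. rho f = 0}"
 have J: "ideal ?J (tensor_alg n)"
  by (rule ideal_tensorI) auto
 have "comm_ideal n <=: ?J" unfolding comm_ideal_def
  by (rule T.genideal_minimal[OF J]) (auto simp: mult.commute piece_TT)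
 thus "f : comm_ideal n ==> rho f = 0" by blast
next
 interpret pbw_model n 0 0 by standard simp
 define Psi where "Psi = lift_lin pc (%M. \<Prod>i \<in># M. prj (xx i))"
 have V1: "V u = u * V 1" for u
 proof -
  have "sig f = f" for f
  proof (induction f rule: ypoly_induct)
   case (mono c M)
   have "sig (ym M) = ym M" by (induction M) simp_all
   thus ?case by simp
  qed simp_all
  hence "V u = var_v * u" for u by (intro poly_eqI) (simp add: coeff_V coeff_var_v split: nat.split)
  thus ?thesis by (simp add: mult.commute)
 qed
 have Xu: "X i u = u * X i 1" for i u
  by (simp add: X_def V1[of u] algebra_simps smult_add_right)
 have w: "actw 1 w = (\<Prod>i \<in># mset w. prj (xx i))" for w
 proof -
  have "actw u w = u * (\<Prod>i \<in># mset w. prj (xx i))" for u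
  proof (induction w arbitrary: u)
   case (Cons i w)
   thus ?case using Xu[of i u] by (simp add: actw_def prj_def mult.assoc)
  qed (simp add: actw_def)
  thus ?thesis by simp
 qed
 have "prj f = Psi (rho f)" for f
 proof (induction f rule: poly_mapping_induct)
  case (single l c)
  show ?case unfolding rho_simps Psi_def single_ym[symmetric] P.lift_single by (simp add: prj_def act_single w pc_mult)
 qed (simp_all add: Psi_def P.lift_add)
 moreover have "Psi 0 = 0" by (simp add: Psi_def)
 moreover assume "rho f = 0"
 ultimately show "f : comm_ideal n" using f by (simp add: comm_ideal_family family_ideal_kernel)
qed

section \<open>Comparing dimensions\<close>

interpretation YV: vector_space "%c (f :: ypoly). yc c * f"
 by standard (simp_all add: algebra_simps)

definition piece_map :: "nat => nat => (ncpoly => ypoly) => bool" where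
 "piece_map n k P <-> (ALL f:TP n k. ALL g:TP n k. P (f + g) = P f + P g) &
  (ALL c. ALL f:TP n k. P (const c * f) = yc c * P f) & P ` TP n k = xpiece n k"

lemma piece_map_sum:
 assumes P: "piece_map n k P" and g: "!!i. i : K ==> g i : TP n k"
 shows "P (\<Sum>i \<in> K. const (c i) * g i) = (\<Sum>i \<in> K. yc (c i) * P (g i))"
 using g
proof (induction K rule: infinite_finite_induct)
 case (insert i K)
 thus ?case using P by (simp add: piece_map_def piece_sum piece_scale)
qed (use P in "force simp: piece_map_def dest!: spec[of _ 0] bspec[of _ _ 0]")+

text \<open>Otherwise the images under \<open>P\<close> of preimages of a basis under \<open>Q\<close>, together with \<open>P f0\<close>, would be too many independent vectors.\<close>

lemma piece_map_kernel:
 assumes P: "piece_map n k P" and Q: "piece_map n k Q"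
  and ker: "!!f. f : TP n k ==> P f = 0 ==> Q f = 0"
  and f0: "f0 : TP n k" "Q f0 = 0"
 shows "P f0 = 0"
proof (rule ccontr)
 assume nz: "P f0 ~= 0"
 let ?T = "TP n k"
 define B where "B = {M. size M = k & set_mset M <=: {0..n}}"
 have finB: "finite B"
 proof (rule finite_subset)
  show "B <=: mset ` {w. set w <=: {0..n} & length w = k}"
  proof
   fix M assume M: "M : B"
   obtain w where "M = mset w" using ex_mset[of M] by blast
   thus "M : mset ` {w. set w <=: {0..n} & length w = k}" using M by (auto simp: B_def)
  qed
  show "finite (mset ` {w. set w <=: {0..n} & length w = k})" by (intro finite_imageI finite_lists_length_eq) simp
 qed
 have "EX h. h : ?T & Q h = ym M" if "M : B" for M
 proof -
  have "ym M : xpiece n k" using that xpiece_simps(3)[of M k n 1] by (simp add: B_def)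
  hence "ym M : Q ` ?T" using Q by (simp add: piece_map_def)
  thus ?thesis by auto
 qed
 then obtain h where h: "!!M. M : B ==> h M : ?T & Q (h M) = ym M" by metis
 have ym0: "ym M ~= 0" for M unfolding ym_def by (metis lookup_single_eq lookup_zero zero_neq_one)
 have ymi: "ym M = ym N ==> M = N" for M N unfolding ym_def by (metis keys_single singleton_inject zero_neq_one)
 have lin: "P (f - g) = P f - P g" if "f : ?T" "g : ?T" "piece_map n k P" for f g P
 proof -
  have "P (f - g + g) = P (f - g) + P g" using that piece_diff by (simp only: piece_map_def)
  thus ?thesis by simp
 qed
 have PQ: "Q f = Q g" if "f : ?T" "g : ?T" "P f = P g" for f g
  using ker[of "f - g"] lin[OF that(1,2) P] lin[OF that(1,2) Q] that piece_diff by simp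
 let ?v = "P f0" and ?S = "P ` h ` B"
 have injh: "inj_on (%M. P (h M)) B"
  by (rule inj_onI) (metis PQ h ymi)
 have vS: "?v ~: ?S" using PQ[OF f0(1)] h f0(2) ym0 by force
 have S: "finite ?S" "card ?S = card B" using finB card_image[OF injh] by (simp_all add: image_image)
 have "YV.independent (insert ?v ?S)"
 proof (rule ccontr)
  assume "\<not> YV.independent (insert ?v ?S)"
  then obtain a where a: "EX x:insert ?v ?S. a x ~= 0" "(\<Sum>x \<in> insert ?v ?S. yc (a x) * x) = 0"
   using YV.dependent_finite[of "insert ?v ?S"] S(1) by auto
  let ?s = "\<Sum>M \<in> B. const (a (P (h M))) * h M"
  have s: "?s : ?T" using h by (intro piece_sum piece_scale) auto
  have "(\<Sum>x \<in> ?S. yc (a x) * x) = (\<Sum>M \<in> B. yc (a (P (h M))) * P (h M))"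
   unfolding image_image by (subst sum.reindex[OF injh]) simp
  also have "... = P ?s" using piece_map_sum[OF P, of B h] h by simp
  finally have 0: "yc (a ?v) * ?v + P ?s = 0" using a(2) S(1) vS by simp
  have f: "const (a ?v) * f0 : ?T" by (rule piece_scale[OF f0(1)])
  have "P (const (a ?v) * f0 + ?s) = 0" using 0 P f f0(1) s by (simp add: piece_map_def)
  hence "Q (const (a ?v) * f0 + ?s) = 0" using ker[of "const (a ?v) * f0 + ?s"] f s by simp
  hence "Q ?s = 0" using Q f f0 s by (simp add: piece_map_def)
  hence e: "(\<Sum>M \<in> B. yc (a (P (h M))) * ym M) = 0" using piece_map_sum[OF Q, of B h] h by simp
  have aM: "a (P (h M)) = 0" if "M : B" for M
  proof -
   have "lookup (\<Sum>N \<in> B. yc (a (P (h N))) * ym N) M = (\<Sum>N \<in> B. if N = M then a (P (h M)) else 0)"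
    unfolding lookup_sum by (rule sum.cong) (auto simp: single_ym[symmetric] lookup_single when_def)
   thus ?thesis using e that finB by simp
  qed
  hence "P ?s = 0" using piece_map_sum[OF P, of B h "%M. a (P (h M))"] h by simp
  hence "yc (a ?v) * ?v = 0" using 0 by simp
  hence "a ?v = 0" using YV.scale_eq_0_iff nz by blast
  thus False using a(1) aM by auto
 qed
 moreover have "insert ?v ?S <=: YV.span (ym ` B)"
 proof -
  have "u : YV.span (ym ` B)" if u: "u : xpiece n k" for u
  proof -
   have "(\<Sum>M \<in> keys u. yc (lookup u M) * ym M) : YV.span (ym ` B)"
    using u by (intro YV.span_sum YV.span_scale YV.span_base) (auto simp: xpiece_def B_def)
   thus ?thesis using poly_mapping_decompose[of u] by (simp add: single_ym)
  qed
  thus ?thesis using P h f0(1) unfolding piece_map_def by blast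
 qed
 moreover have "finite (ym ` B)" using finB by simp
 ultimately have "card (insert ?v ?S) <= card (ym ` B)" using YV.independent_span_bound by blast
 also have "... <= card B" by (rule card_image_le[OF finB])
 finally show False using S vS by simp
qed

lemma perm_cls:
 assumes K: "ideal K (tensor_alg n)" "perm_act s ` K = K"
 shows "perm_act s ` tensor_quotient.cls n K f = tensor_quotient.cls n K (perm_act s f)"
proof -
 interpret K: tensor_quotient n K by (rule tensor_quotient.intro[OF K(1)])
 interpret pbw_model n 0 0 by standard simp
 have "perm_act s ` (%r. r + f) ` K = (%r. r + perm_act s f) ` perm_act s ` K" by (simp add: image_image)
 thus ?thesis by (simp add: K.cls_eq K(2) Setcompr_eq_image)
qed

section \<open>Consequences of being a deformation\<close>

locale deformation =
 fixes n :: nat and R :: "ncpoly set"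
 assumes deformation: "S_deformation n R"
begin

lemma R_ideal: "ideal R (tensor_alg n)" and R_homogeneous: "f : R ==> hom_component k f : R"
 and R_perm: "s permutes {0..n} ==> perm_act s ` R = R" and R_iso: "piece_iso n R (comm_ideal n) k"
 using deformation by (auto simp: S_deformation_def)

lemmas R_simps = ideal_tensorD[OF R_ideal]

text \<open>The isomorphism of representations, read as a map on homogeneous noncommutative polynomials.\<close>

lemma comparison:
 obtains Phi where "piece_map n k Phi" "!!f. f : TP n k ==> Phi f = 0 <-> f : R"
  "!!s f. s permutes {0..n} ==> f : TP n k ==> Phi (perm_act s f) = xperm s (Phi f)"
proof -
 interpret A: tensor_quotient n R by (rule tensor_quotient.intro[OF R_ideal])
 have C: "ideal (comm_ideal n) (tensor_alg n)"
  unfolding comm_ideal_family by (rule pbw_model.I_ideal[unfolded pbw_model_def]) simp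
 interpret B: tensor_quotient n "comm_ideal n" by (rule tensor_quotient.intro[OF C])
 have C_perm: "perm_act s ` comm_ideal n = comm_ideal n" if "s permutes {0..n}" for s
  unfolding comm_ideal_family by (rule pbw_model.perm_I[unfolded pbw_model_def, OF _ that]) simp
 note TT = piece_TT[of _ n k]
 obtain phi where phi': "bij_betw phi (piece A.Q k) (piece B.Q k) &
  (ALL Y:piece A.Q k. ALL Z:piece A.Q k. phi (Y +[A.Q] Z) = phi Y +[B.Q] phi Z) &
  (ALL c. ALL Z:piece A.Q k. phi (scal A.Q c *[A.Q] Z) = scal B.Q c *[B.Q] phi Z) &
  (ALL s. s permutes {0..n} --> (ALL Z:piece A.Q k. phi (perm_act s ` Z) = perm_act s ` phi Z))"
  using R_iso[of k] unfolding piece_iso_def ..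
 have phi: "bij_betw phi (piece A.Q k) (piece B.Q k)"
  "!!Y Z. Y : piece A.Q k ==> Z : piece A.Q k ==> phi (Y +[A.Q] Z) = phi Y +[B.Q] phi Z"
  "!!c Z. Z : piece A.Q k ==> phi (scal A.Q c *[A.Q] Z) = scal B.Q c *[B.Q] phi Z"
  "!!s Z. s permutes {0..n} ==> Z : piece A.Q k ==> phi (perm_act s ` Z) = perm_act s ` phi Z"
  using phi' by blast+
 have pA: "A.cls f : piece A.Q k" if "f : TP n k" for f using that by (simp add: A.Q_sel(5))
 have "EX g. f : TP n k --> g : TP n k & phi (A.cls f) = B.cls g" for f
  using bij_betwE[OF phi(1)] pA[of f] by (auto simp: B.Q_sel(5))
 then obtain r where r: "!!f. f : TP n k ==> r f : TP n k & phi (A.cls f) = B.cls (r f)" by metis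
 have eq: "B.cls f = B.cls g <-> rho f = rho g" if "f : TP n k" "g : TP n k" for f g
  using that comm_ideal_rho[of "f - g" n] by (simp add: B.cls_eq_iff TT)
 let ?Phi = "%f. rho (r f)"
 have Phi: "?Phi f = rho g" if "f : TP n k" "g : TP n k" "phi (A.cls f) = B.cls g" for f g
  using eq[of "r f" g] r[OF that(1)] that by simp
 have inj: "?Phi f = ?Phi g <-> f - g : R" if "f : TP n k" "g : TP n k" for f g
 proof -
  have "?Phi f = ?Phi g <-> phi (A.cls f) = phi (A.cls g)" using r[OF that(1)] r[OF that(2)] eq by simp
  also have "... <-> A.cls f = A.cls g" by (rule inj_on_eq_iff[OF bij_betw_imp_inj_on[OF phi(1)] pA[OF that(1)] pA[OF that(2)]])
  finally show ?thesis using that by (simp add: A.cls_eq_iff TT)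
 qed
 have add: "?Phi (f + g) = ?Phi f + ?Phi g" if fg: "f : TP n k" "g : TP n k" for f g
 proof -
  have "phi (A.cls (f + g)) = B.cls (r f + r g)"
   using phi(2)[OF pA[OF fg(1)] pA[OF fg(2)]] r[OF fg(1)] r[OF fg(2)] fg by (simp add: A.Q_add B.Q_add TT)
  thus ?thesis using Phi[of "f + g" "r f + r g"] r fg by simp
 qed
 have scale: "?Phi (const c * f) = yc c * ?Phi f" if f: "f : TP n k" for f c
 proof -
  have "phi (A.cls (const c * f)) = B.cls (const c * r f)"
   using phi(3)[OF pA[OF f], of c] r[OF f] f by (simp add: A.Q_sel(4) B.Q_sel(4) A.Q_mult B.Q_mult TT)
  thus ?thesis using Phi[of "const c * f" "const c * r f"] r f by (simp add: piece_scale)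
 qed
 have 0: "?Phi 0 = 0" using scale[of 0 0] by simp
 show ?thesis
 proof (rule that[of ?Phi])
  have "?Phi ` TP n k = xpiece n k"
  proof (intro equalityI subsetI)
   fix u assume "u : xpiece n k"
   then obtain g where g: "g : TP n k" "rho g = u" using xpiece_rho by blast
   hence "B.cls g : phi ` piece A.Q k" using phi(1) by (auto simp: bij_betw_def B.Q_sel(5))
   then obtain f where "f : TP n k" "phi (A.cls f) = B.cls g" by (auto simp: A.Q_sel(5))
   thus "u : ?Phi ` TP n k" using Phi[of f g] g by auto
  qed (use r rho_xpiece in auto)
  thus "piece_map n k ?Phi" using add scale by (simp add: piece_map_def)
  show "?Phi f = 0 <-> f : R" if "f : TP n k" for f using inj[OF that, of 0] 0 by simp
  show "?Phi (perm_act s f) = xperm s (?Phi f)" if s: "s permutes {0..n}" and f: "f : TP n k" for s f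
  proof -
   have "perm_act s ` A.cls f = A.cls (perm_act s f)" "perm_act s ` B.cls (r f) = B.cls (perm_act s (r f))"
    using perm_cls[OF R_ideal R_perm[OF s]] perm_cls[OF C C_perm[OF s]] by simp_all
   hence "phi (A.cls (perm_act s f)) = B.cls (perm_act s (r f))" using phi(4)[OF s pA[OF f]] r[OF f] by simp
   thus ?thesis using Phi[OF perm_act_piece[OF s f] perm_act_piece[OF s]] r[OF f] by (simp add: rho_perm_act)
  qed
 qed
qed

text \<open>Source and target of the comparison in degree one have the same dimension.\<close>

lemma R_piece_1: assumes "f : TP n 1" "f : R" shows "f = 0"
proof -
 obtain Phi where Phi: "piece_map n 1 Phi" "!!f. f : TP n 1 ==> Phi f = 0 <-> f : R" by (rule comparison[of 1]) (use that in blast)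
 have inj: "g = 0" if g: "g : TP n 1" "rho g = 0" for g
 proof (rule poly_mapping_eqI)
  fix w
  have t: "rho (const c * xx i) = single {#i#} c" for c i by (simp add: xx_def single_ym)
  have r0: "rho (sum h K) = (\<Sum>i \<in> K. rho (h i))" for h and K :: "nat set" by (induction K rule: infinite_finite_induct) simp_all
  have "lookup (rho g) {#i#} = lookup g [i]" if i: "i : {0..n}" for i
  proof -
   have "rho g = (\<Sum>j = 0..n. single {#j#} (lookup g [j]))"
    using arg_cong[OF piece_1_expand[OF g(1)], of rho] unfolding r0 t .
   hence "lookup (rho g) {#i#} = (\<Sum>j = 0..n. if j = i then lookup g [i] else 0)"
    by (simp only: lookup_sum) (auto simp: lookup_single when_def intro: sum.cong)
   thus ?thesis using i by simp
  qed
  hence "lookup g [i] = 0" if "i : {0..n}" for i using g(2) that by simp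
  hence "g = (\<Sum>i = 0..n. const 0 * xx i)" by (subst piece_1_expand[OF g(1)]) simp
  thus "lookup g w = lookup 0 w" by simp
 qed
 have rho: "piece_map n 1 rho" unfolding piece_map_def using rho_xpiece[of _ n 1] xpiece_rho[of _ n 1] by fastforce
 have "rho f = 0"
  by (rule piece_map_kernel[OF rho Phi(1) _ assms(1)]) (use inj Phi(2) R_simps(2) assms in auto)
 thus ?thesis using inj assms by blast
qed

text \<open>Both ideals have quotients of the same dimension in every degree.\<close>

lemma R_eqI:
 assumes F: "S_deformation n F" and sub: "F <=: R"
 shows "R = F"
proof
 interpret F: deformation n F by standard (rule F)
 show "R <=: F"
 proof
  fix f assume f: "f : R"
  hence fT: "f : TT n" using R_simps(1) by blast
  have "hom_component k f : F" for k
  proof -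
   obtain P where P: "piece_map n k P" "!!f. f : TP n k ==> P f = 0 <-> f : F" by (rule F.comparison[of k]) (use that in blast)
   obtain Q where Q: "piece_map n k Q" "!!f. f : TP n k ==> Q f = 0 <-> f : R" by (rule comparison[of k]) (use that in blast)
   have h: "hom_component k f : TP n k" by (rule hom_component_piece[OF fT])
   have "P (hom_component k f) = 0"
    by (rule piece_map_kernel[OF P(1) Q(1) _ h]) (use P(2) Q(2) sub h R_homogeneous[OF f] in auto)
   thus ?thesis using P(2)[OF h] by simp
  qed
  hence "(\<Sum>k \<in> K. hom_component k f) : F" for K
   by (induction K rule: infinite_finite_induct) (simp_all add: F.R_simps(2,3))
  thus "f : F" using sum_hom_components[of "length ` keys f" f] by (metis finite_imageI finite_keys order_refl)
 qed
qed (rule sub)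

end

section \<open>Invariants in degree two\<close>

text \<open>The cross product is a solution; if it vanishes, the two equations are proportional.\<close>

lemma two_equations:
 fixes a1 a2 a3 b1 b2 b3 :: complex
 shows "EX c1 c2 c3. (c1, c2, c3) ~= (0, 0, 0) & c1 * a1 + c2 * a2 + c3 * a3 = 0 & c1 * b1 + c2 * b2 + c3 * b3 = 0"
proof -
 consider "a1 * b2 ~= a2 * b1 \<or> a1 * b3 ~= a3 * b1 \<or> a2 * b3 ~= a3 * b2"
  | (par) "a1 * b2 = a2 * b1" "a1 * b3 = a3 * b1" "a2 * b3 = a3 * b2" by blast
 thus ?thesis
 proof cases
  case 1
  thus ?thesis
   by (intro exI[of _ "a2 * b3 - a3 * b2"] exI[of _ "a3 * b1 - a1 * b3"] exI[of _ "a1 * b2 - a2 * b1"]) (auto simp: algebra_simps)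
 next
  case par
  consider "a1 = 0" "b1 = 0" | "a1 ~= 0" | "b1 ~= 0" by blast
  thus ?thesis
  proof cases
   case 1
   thus ?thesis by (intro exI[of _ 1] exI[of _ 0]) simp
  next
   case 2
   thus ?thesis using par by (intro exI[of _ "- a2"] exI[of _ a1] exI[of _ 0]) (simp add: algebra_simps)
  next
   case 3
   thus ?thesis using par by (intro exI[of _ "- b2"] exI[of _ b1] exI[of _ 0]) (simp add: algebra_simps)
  qed
 qed
qed

text \<open>The linear form \<open>L_i\<close> with \<open>\<delta>_i = y_i L_i\<close>.\<close>

definition ylin :: "nat => nat => ncpoly" where "ylin n i = const (of_nat (n + 1)) * yy i - const 2 * (\<Sum>j = 1..n. yy j)"

lemma delta_ylin: assumes "i : {1..n}" shows "delta_poly n i = yy i * ylin n i"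
proof -
 have "(\<Sum>j = 1..n. yy j) = yy i + (\<Sum>j \<in> {1..n} - {i}. yy j)" using assms by (intro sum.remove) auto
 hence "ylin n i = const (of_nat n - 1) * yy i - const 2 * (\<Sum>j \<in> {1..n} - {i}. yy j)"
  using const_simps(3)[of "of_nat n - 1" 2] unfolding ylin_def by (simp add: distrib_left distrib_right del: const_simps)
 thus ?thesis by (simp add: delta_poly_def)
qed

lemma yy_piece: "i <= n ==> yy i : TP n 1" unfolding yy_def by (intro piece_diff piece_simps) auto
lemma vv_piece: "vv n : TP n 1" unfolding vv_def by (intro piece_sum piece_simps) auto
lemma ylin_piece: "i <= n ==> ylin n i : TP n 1" unfolding ylin_def by (intro piece_diff piece_scale piece_sum yy_piece) auto
lemma ylin_TT [simp]: "i <= n ==> ylin n i : TT n" using ylin_piece by (rule piece_TT)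

interpretation C: pbw_model n 0 0 for n by standard simp

lemma xx_sum: "(\<Sum>j = 1..n. yy j) = const (of_nat (n + 1)) * xx 0 - vv n"
 using C.xx_expand[of n] by simp
lemma ylin_x: "ylin n 1 = const 2 * vv n - const (of_nat (n + 1)) * (xx 0 + xx 1)"
proof -
 have "const 2 * (const (of_nat (n + 1)) * xx 0) = const (of_nat (n + 1)) * xx 0 + const (of_nat (n + 1)) * xx 0"
  by (metis const_simps(2,3) one_add_one distrib_right mult_1)
 thus ?thesis unfolding ylin_def xx_sum by (simp add: yy_def algebra_simps del: const_simps(3) of_nat_Suc of_nat_add)
qed

lemma perm_vv: assumes s: "s permutes {0..n}" shows "perm_act s (vv n) = vv n"
proof -
 have "perm_act s (sum f K) = (\<Sum>i \<in> K. perm_act s (f i))" for f and K :: "nat set"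
  by (induction K rule: infinite_finite_induct) simp_all
 hence "perm_act s (vv n) = (\<Sum>i = 0..n. xx (s i))" by (simp add: vv_def)
 also have "... = vv n" unfolding vv_def using sum.permute[OF s, of xx] by (simp add: o_def)
 finally show ?thesis .
qed

lemma perm_ylin: assumes s: "s permutes {0..n}" "s 0 = 0" shows "perm_act s (ylin n i) = ylin n (s i)"
 unfolding ylin_def xx_sum by (simp add: yy_def s(2) perm_vv[OF s(1)] del: const_simps(3) of_nat_Suc of_nat_add)
lemma linear_independent:
 assumes n: "n >= 2" and 0: "const b * vv n + const c * ylin n 1 = 0" shows "b = 0 & c = 0"
proof -
 let ?l = "of_nat (n + 1) * yv 1 - 2 * C.ysum n"
 have v: "C.prj n (vv n) = var_v" using C.V_power_1[of 1 n] by (simp add: C.prj_def C.act_vv var_v_def monom_Suc monom_0)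
 have y: "C.prj n (yy i) = [:yv0 i:]" for i by (simp add: C.prj_def C.act_yy)
 have p: "(\<Sum>i \<in> K. [:f i:]) = [:sum f K:]" for f :: "nat => ypoly" and K by (induction K rule: infinite_finite_induct) simp_all
 have s: "(\<Sum>j = 1..n. yv0 j) = C.ysum n" unfolding C.ysum_def by (rule sum.cong) (simp_all add: yv0_def)
 have l: "C.prj n (ylin n 1) = [:?l:]"
  unfolding ylin_def C.prj_simps(3) C.prj_const_mult C.prj_sum y p s by (simp add: yv0_def)
 have e: "smult (yc b) var_v + [:yc c * ?l:] = 0" using arg_cong[OF 0, of "C.prj n"] by (simp add: v l del: One_nat_def of_nat_Suc of_nat_add)
 have "coeff (smult (yc b) var_v + [:yc c * ?l:]) 1 = yc b" by (simp add: var_v_def)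
 hence "yc b = 0" by (simp only: e coeff_0)
 hence b: "b = 0" by (auto simp: yc_def dest!: arg_cong[of _ _ "%f. lookup f {#}"])
 have lk: "lookup (yv i) {#2#} = (if i = 2 then 1 else 0)" for i
  by (simp add: yv_def ym_def lookup_single when_def)
 have "lookup (C.ysum n) {#2#} = (\<Sum>i = 1..n. if i = 2 then 1 else 0)" unfolding C.ysum_def lookup_sum lk ..
 hence "lookup (C.ysum n) {#2#} = 1" using n by simp
 hence "lookup (yc (of_nat (n + 1)) * yv 1 - yc 2 * C.ysum n) {#2#} = - 2"
  by (simp only: lookup_minus lookup_scale lk) simp
 hence "lookup (yc c * ?l) {#2#} = c * (- 2)" unfolding lookup_scale by simp
 moreover have "yc c * ?l = 0" using e b by (simp del: mult_eq_0_iff of_nat_Suc of_nat_add)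
 ultimately have "c * (- 2) = 0" by (simp only: lookup_zero)
 thus ?thesis using b by simp
qed

lemma yy_nonzero: assumes "i : {1..n}" shows "yy i ~= 0"
proof
 assume "yy i = 0"
 hence "smult (yv i) 1 = 0" using C.act_yy'[of i n 1] assms by simp
 thus False by simp
qed

lemma lookup_const_mult: "lookup (const c * f) w = c * lookup f w"
 by (induction f rule: poly_mapping_induct)
  (simp_all add: const_def mult_single plus_list_def distrib_left lookup_add lookup_single when_def)

context deformation
begin

lemma perm_transpose: "a <= n ==> b <= n ==> Transposition.transpose a b permutes {0..n}"
 by (rule permutes_swap_id) auto

text \<open>The values of the comparison map on a degree two element that changes sign under a transposition.\<close>

lemma sign_lookup:
 assumes Phi: "piece_map n 2 Phi" "ALL s f. s permutes {0..n} --> f : TP n 2 --> Phi (perm_act s f) = xperm s (Phi f)"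
  and f: "f : TP n 2" and ab: "a <= n" "b <= n" and e: "perm_act (Transposition.transpose a b) f = const e * f"
 shows "e * lookup (Phi f) (image_mset (Transposition.transpose a b) M) = lookup (Phi f) M"
proof -
 let ?t = "Transposition.transpose a b"
 have "xperm ?t (Phi f) = yc e * Phi f"
  using Phi(2)[rule_format, OF perm_transpose[OF ab] f] Phi(1) f unfolding e by (simp add: piece_map_def)
 moreover have "inj ?t" by (rule injI) (metis Transposition.transpose_involutory)
 ultimately show ?thesis using lookup_xperm[of ?t "Phi f" M] by (simp add: lookup_scale)
qed

lemma size_two_cases: assumes "size M = 2" shows "EX x y. M = {#x, y#}"
proof -
 have "size M = Suc 1" using assms by simp
 then obtain x N where M: "M = add_mset x N" using size_eq_Suc_imp_eq_union by blast
 hence "size N = 1" using assms by simp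
 then obtain y where "N = {#y#}" using size_1_singleton_mset by blast
 thus ?thesis using M by blast
qed

text \<open>The exponents of three letters in a quadratic monomial cannot be distinct, so one of the transpositions fixes the monomial and its coefficient equals its negative.\<close>

lemma alternating_in_R:
 assumes f: "f : TP n 2" and abc: "a <= n" "b <= n" "c <= n" "a ~= b" "a ~= c" "b ~= c"
  and e: "perm_act (Transposition.transpose a b) f = - f" "perm_act (Transposition.transpose a c) f = - f"
   "perm_act (Transposition.transpose b c) f = - f"
 shows "f : R"
proof -
 obtain Phi where Phi: "piece_map n 2 Phi" "!!f. f : TP n 2 ==> Phi f = 0 <-> f : R"
  "!!s f. s permutes {0..n} ==> f : TP n 2 ==> Phi (perm_act s f) = xperm s (Phi f)" by (rule comparison[of 2]) (use that in blast)
 have Phi3: "ALL s f. s permutes {0..n} --> f : TP n 2 --> Phi (perm_act s f) = xperm s (Phi f)" using Phi(3) by blast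
 have m: "const (- 1) * f = - f" by simp
 note sl = sign_lookup[OF Phi(1) Phi3 f, where e = "- 1", unfolded m]
 have "lookup (Phi f) M = 0" for M
 proof (cases "size M = 2")
  case True
  then obtain x y where M: "M = {#x, y#}" using size_two_cases by blast
  have "image_mset (Transposition.transpose a b) M = M \<or> image_mset (Transposition.transpose a c) M = M
   \<or> image_mset (Transposition.transpose b c) M = M"
   using abc unfolding M by (auto simp: Transposition.transpose_def add_mset_commute)
  thus ?thesis using sl[OF abc(1,2) e(1), of M] sl[OF abc(1,3) e(2), of M] sl[OF abc(2,3) e(3), of M] by auto
 next
  case False
  have "Phi f : xpiece n 2" using Phi(1) f by (auto simp: piece_map_def)
  thus ?thesis using False by (auto simp: xpiece_def in_keys_iff)
 qed
 hence "Phi f = 0" by (intro poly_mapping_eqI) simp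
 thus ?thesis using Phi(2)[OF f] by simp
qed

lemma yy_commutator: assumes "i : {1..n}" "j : {1..n}" shows "yy i * yy j - yy j * yy i : R"
proof (cases "i = j")
 case False
 have p: "perm_act s (yy k) = xx (s 0) - xx (s k)" for s k by (simp add: yy_def)
 have "yy i * yy j - yy j * yy i : TP n 2"
  using piece_mult[OF yy_piece yy_piece, of i n j] piece_mult[OF yy_piece yy_piece, of j n i] assms
  by (intro piece_diff) (simp_all add: numeral_2_eq_2)
 thus ?thesis
  by (rule alternating_in_R[of _ 0 i j]) (use assms False in "auto simp: p Transposition.transpose_def yy_def algebra_simps")
qed (simp add: R_simps)

lemma ylin_commutator: assumes "i : {1..n}" "j : {1..n}" shows "ylin n i * yy j - yy j * ylin n i : R"
proof -
 have c: "yy j * (const e * f) = const e * (yy j * f)" for e f by (metis const_central mult.assoc)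
 have R_sum: "(!!k. k : K ==> g k : R) ==> sum g K : R" for g and K :: "nat set"
  by (induction K rule: infinite_finite_induct) (simp_all add: R_simps)
 have "ylin n i * yy j - yy j * ylin n i = const (of_nat (n + 1)) * (yy i * yy j - yy j * yy i)
   - const 2 * (\<Sum>k = 1..n. yy k * yy j - yy j * yy k)"
  unfolding ylin_def left_diff_distrib right_diff_distrib c mult.assoc sum_distrib_right sum_distrib_left sum_subtractf by simp
 also have "... : R" by (intro R_simps(5,6) R_sum yy_commutator TT_const assms)
 finally show ?thesis .
qed

text \<open>Here \<open>t = x_0 + x_1\<close>, \<open>s = x_2 + \<dots> + x_n\<close> and \<open>v = s + t\<close>.\<close>

lemma relation_identity:
 assumes t: "const N * t = const 2 * v - L" and s: "const N * s = const m * v + L"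
 shows "const N * (const c1 * (y * t + t * y) + const c2 * (y * s) + const c3 * (s * y))
  = const (2 * c1 + m * c2) * (y * v) + const (2 * c1 + m * c3) * (v * y) + const (c2 + c3 - 2 * c1) * (y * L)
   + const (c3 - c1) * (L * y - y * L)" (is "_ = ?rhs")
proof -
 have c: "const e * (g * h) = g * (const e * h)" for e g h by (metis const_central mult.assoc)
 have *: "const N * (y * t) = const 2 * (y * v) - y * L" "const N * (y * s) = const m * (y * v) + y * L"
  unfolding c[of _ y] t s by (simp_all only: distrib_left right_diff_distrib)
 have **: "const N * (t * y) = const 2 * (v * y) - L * y" "const N * (s * y) = const m * (v * y) + L * y"
  unfolding mult.assoc[symmetric] t s by (simp_all only: distrib_right left_diff_distrib)
 have "const N * (const c1 * (y * t + t * y) + const c2 * (y * s) + const c3 * (s * y))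
   = const c1 * (const N * (y * t) + const N * (t * y)) + const c2 * (const N * (y * s)) + const c3 * (const N * (s * y))"
  by (rule poly_mapping_eqI) (simp add: lookup_add lookup_const_mult algebra_simps del: const_simps)
 also have "... = ?rhs" unfolding * **
  by (rule poly_mapping_eqI) (simp add: lookup_add lookup_minus lookup_const_mult algebra_simps del: const_simps)
 finally show ?thesis .
qed

text \<open>The images of \<open>y t + t y\<close>, \<open>y s\<close> and \<open>s y\<close>, where \<open>y = x_0 - x_1\<close>, are determined by their coefficients at \<open>x_0\<^sup>2\<close> and \<open>x_0 x_2\<close>; three vectors in a plane are dependent.\<close>

lemma relation:
 assumes n: "n >= 2"
 obtains A B C where "(A, B, C) ~= (0, 0, 0)"
  "!!i. i : {1..n} ==> const A * (yy i * vv n) + const B * (vv n * yy i) + const C * (yy i * ylin n i) : R"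
proof -
 obtain Phi where Phi: "piece_map n 2 Phi" "!!f. f : TP n 2 ==> Phi f = 0 <-> f : R"
  "!!s f. s permutes {0..n} ==> f : TP n 2 ==> Phi (perm_act s f) = xperm s (Phi f)" by (rule comparison[of 2]) (use that in blast)
 have Phi3: "ALL s f. s permutes {0..n} --> f : TP n 2 --> Phi (perm_act s f) = xperm s (Phi f)" using Phi(3) by blast
 let ?y = "yy 1" and ?t = "xx 0 + xx 1" and ?s = "vv n - (xx 0 + xx 1)" and ?L = "ylin n 1" and ?v = "vv n"
 \<comment> \<open>the three elements of degree two that change sign under the transposition of 0 and 1\<close>
 let ?E1 = "?y * ?t + ?t * ?y" and ?E2 = "?y * ?s" and ?E3 = "?s * ?y"
 have p1: "?y : TP n 1" "?t : TP n 1" "?s : TP n 1"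
  using n by (intro yy_piece piece_simps piece_diff vv_piece; simp)+
 have p2: "f * g : TP n 2" if "f : TP n 1" "g : TP n 1" for f g
  using piece_mult[OF that] by (simp add: numeral_2_eq_2)
 have E: "?E1 : TP n 2" "?E2 : TP n 2" "?E3 : TP n 2" by (intro piece_simps(2) p2 p1)+
 let ?l = "%f. lookup (Phi f)"
 obtain c1 c2 c3 where c: "(c1, c2, c3) ~= (0, 0, 0)"
  "c1 * ?l ?E1 {#0, 0#} + c2 * ?l ?E2 {#0, 0#} + c3 * ?l ?E3 {#0, 0#} = 0"
  "c1 * ?l ?E1 {#0, 2#} + c2 * ?l ?E2 {#0, 2#} + c3 * ?l ?E3 {#0, 2#} = 0" using two_equations by blast
 define f where "f = const c1 * ?E1 + const c2 * ?E2 + const c3 * ?E3"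
 have f: "f : TP n 2" unfolding f_def by (intro piece_simps(2) piece_scale E)
 have "Phi f = yc c1 * Phi ?E1 + yc c2 * Phi ?E2 + yc c3 * Phi ?E3"
  using Phi(1) E unfolding f_def piece_map_def by (simp add: piece_scale piece_simps(2))
 hence 0: "?l f {#0, 0#} = 0" "?l f {#0, 2#} = 0" using c by (simp_all add: lookup_add lookup_scale)
 have pc: "perm_act s (const k * g) = const k * perm_act s g" for s k g by simp
 have anti: "perm_act (Transposition.transpose 0 1) f = const (- 1) * f"
 proof -
  have v: "perm_act (Transposition.transpose 0 1) ?v = ?v" using n by (intro perm_vv perm_transpose) auto
  show ?thesis unfolding f_def by (simp add: v yy_def algebra_simps del: One_nat_def)
 qed
 have inv: "perm_act (Transposition.transpose 2 j) f = const 1 * f" if j: "j : {2..n}" for j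
 proof -
  have v: "perm_act (Transposition.transpose 2 j) ?v = ?v" using n j by (intro perm_vv perm_transpose) auto
  have "Transposition.transpose 2 j 0 = 0" "Transposition.transpose 2 j 1 = 1" using j by (auto simp: Transposition.transpose_def)
  thus ?thesis unfolding f_def by (simp add: v yy_def)
 qed
 have a: "?l f (image_mset (Transposition.transpose 0 1) M) = - ?l f M" for M
  using sign_lookup[OF Phi(1) Phi3 f _ _ anti, of M] n by (simp add: minus_equation_iff)
 have 02: "?l f {#0, j#} = 0" if j: "j : {2..n}" for j
  using sign_lookup[OF Phi(1) Phi3 f _ _ inv[OF j], of "{#0, 2#}"] n j 0 by (simp add: Transposition.transpose_def split: if_splits)
 have 12: "?l f {#1, j#} = 0" if j: "j : {2..n}" for j
  using a[of "{#0, j#}"] 02[OF j] j by (simp add: Transposition.transpose_def)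
 have 11: "?l f {#1, 1#} = 0" using a[of "{#0, 0#}"] 0 by (simp add: Transposition.transpose_def)
 have zj: "?l f {#j, 0#} = 0" and uj: "?l f {#j, 1#} = 0" if "j : {2..n}" for j
  using 02[OF that] 12[OF that] by (simp_all only: add_mset_commute[of j])
 have 10: "?l f {#1, 0#} = - ?l f {#0, 1#}" using a[of "{#0, 1#}"] by (simp add: Transposition.transpose_def)
 have sw: "{#1, 0#} = {#0, 1 :: nat#}" by (rule add_mset_commute)
 have "?l f {#0, 1#} = - ?l f {#0, 1#}" using 10 by (simp only: sw)
 hence 01: "?l f {#0, 1#} = 0" by simp
 have "?l f M = 0" for M
 proof (rule ccontr)
  assume nz: "?l f M ~= 0"
  have "Phi f : xpiece n 2" using Phi(1) f by (auto simp: piece_map_def)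
  hence M': "size M = 2" "set_mset M <=: {0..n}" using nz by (auto simp: xpiece_def in_keys_iff)
  then obtain x y where M: "M = {#x, y#}" using size_two_cases by blast
  have fx: "image_mset (Transposition.transpose 0 1) M ~= M" using a[of M] nz by auto
  have "x : {0, 1} \<union> {2..n}" "y : {0, 1} \<union> {2..n}" using M' M by auto
  thus False using nz 0 02 zj 11 12 uj 01 10 fx unfolding M
   by (auto simp: Transposition.transpose_def)
 qed
 hence "Phi f = 0" by (intro poly_mapping_eqI) simp
 hence fR: "f : R" using Phi(2)[OF f] by simp
 let ?N = "of_nat (n + 1) :: complex"
 let ?m = "of_nat (n - 1) :: complex"
 have t: "const ?N * ?t = const 2 * ?v - ?L" unfolding ylin_x by simp
 have "?N = ?m + 2" using n by (simp add: of_nat_diff)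
 hence s: "const ?N * ?s = const ?m * ?v + ?L"
  unfolding right_diff_distrib t
  by (intro poly_mapping_eqI) (simp add: lookup_add lookup_minus lookup_const_mult algebra_simps del: const_simps of_nat_add of_nat_Suc)
 let ?A = "2 * c1 + ?m * c2" and ?B = "2 * c1 + ?m * c3" and ?C = "c2 + c3 - 2 * c1"
 let ?r = "const ?A * (?y * ?v) + const ?B * (?v * ?y) + const ?C * (?y * ?L)"
 have "const ?N * f = ?r + const (c3 - c1) * (?L * ?y - ?y * ?L)"
  unfolding f_def by (rule relation_identity[OF t s])
 hence "?r = const ?N * f - const (c3 - c1) * (?L * ?y - ?y * ?L)" by simp
 also have "... : R" using n by (intro R_simps(5,6) fR ylin_commutator TT_const) auto
 finally have r: "?r : R" .
 show ?thesis
 proof (rule that[of ?A ?B ?C])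
  show "(?A, ?B, ?C) ~= (0, 0, 0)"
  proof
   assume "(?A, ?B, ?C) = (0, 0, 0)"
   hence *: "2 * c1 + ?m * c2 = 0" "2 * c1 + ?m * c3 = 0" "c2 + c3 = 2 * c1" by simp_all
   have "0 = (2 * c1 + ?m * c2) + (2 * c1 + ?m * c3)" using *(1,2) by simp
   also have "... = 4 * c1 + ?m * (c2 + c3)" by (simp add: algebra_simps)
   also have "... = c1 * (2 * (?m + 2))" unfolding *(3) by (simp add: algebra_simps)
   also have "?m + 2 = of_nat (n + 1)" using n by (simp add: of_nat_diff)
   finally have "c1 = 0" by (simp del: of_nat_add of_nat_Suc)
   moreover have "?m ~= 0" using n by simp
   ultimately show False using * c(1) by auto
  qed
  fix i assume i: "i : {1..n}"
  let ?t = "Transposition.transpose 1 i"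
  have tp: "?t permutes {0..n}" using i n by (intro perm_transpose) auto
  have t0: "?t 0 = 0" "?t 1 = i" using i by (auto simp: Transposition.transpose_def)
  have y: "perm_act ?t (yy 1) = yy i" unfolding yy_def by (simp add: t0 del: One_nat_def)
  have "perm_act ?t ?r : R" using r R_perm[OF tp] by blast
  moreover have "perm_act ?t ?r = const ?A * (yy i * vv n) + const ?B * (vv n * yy i) + const ?C * (yy i * ylin n i)"
   unfolding C.perm_act_simps y perm_vv[OF tp] perm_ylin[OF tp t0(1)] t0(2) ..
  ultimately show "const ?A * (yy i * vv n) + const ?B * (vv n * yy i) + const ?C * (yy i * ylin n i) : R" by simp
 qed
qed

end

section \<open>Classification\<close>

locale domain_deformation = deformation +
 assumes n2: "n >= 2" and domain: "nc_domain (quotient_alg n R)"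
begin

lemma R_prime: assumes "f : TT n" "g : TT n" "f * g : R" shows "f : R \<or> g : R"
proof -
 interpret A: tensor_quotient n R by (rule tensor_quotient.intro[OF R_ideal])
 have z: "A.cls h = 0[A.Q] <-> h : R" if "h : TT n" for h using that by (simp add: A.Q_sel(3) A.cls_eq_iff)
 have "A.cls f *[A.Q] A.cls g = 0[A.Q]" using assms z[of "f * g"] by (simp add: A.Q_mult)
 hence "A.cls f = 0[A.Q] \<or> A.cls g = 0[A.Q]" using domain assms A.cls_in unfolding nc_domain_def by blast
 thus ?thesis using z assms by simp
qed

lemma R_scale: assumes "f : TT n" "const c * f : R" "c ~= 0" shows "f : R"
proof -
 have "const (1 / c) * (const c * f) : R" by (rule R_simps(6)[OF assms(2) TT_const])
 hence "const (1 / c * c) * f : R" by (simp only: const_simps(4) mult.assoc)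
 moreover have "1 / c * c = 1" using assms(3) by simp
 ultimately show ?thesis by (simp only: const_simps(2) mult_1_left)
qed

lemma yy_notin: "i : {1..n} ==> yy i ~: R"
 using R_piece_1[OF yy_piece] yy_nonzero by auto
lemma linear_notin: assumes "const b * vv n + const c * ylin n 1 : R" shows "b = 0 & c = 0"
proof (rule linear_independent[OF n2], rule R_piece_1[OF _ assms])
 show "const b * vv n + const c * ylin n 1 : TP n 1"
  using n2 by (intro piece_simps(2) piece_scale vv_piece ylin_piece) auto
qed

text \<open>If \<open>A\<close> or \<open>B\<close> vanished, \<open>y_1\<close> times a nonzero linear form would be a relation.\<close>

lemma normalised_relation:
 obtains a q where "a ~= 0" "!!i. i : {1..n} ==> yy i * vv n - const a * (vv n * yy i) + const q * (yy i * ylin n i) : R"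
proof -
 obtain A B C where ABC: "(A, B, C) ~= (0, 0, 0)"
  "!!i. i : {1..n} ==> const A * (yy i * vv n) + const B * (vv n * yy i) + const C * (yy i * ylin n i) : R" by (rule relation[OF n2]) (use that in blast)
 have 1: "1 : {1..n}" using n2 by simp
 note r = ABC(2)[OF 1]
 have cy: "const e * (g * h) = g * (const e * h)" for e g h by (metis const_central mult.assoc)
 have y1: "yy 1 : TT n" and L: "ylin n 1 : TT n" using n2 by simp_all
 have A: "A ~= 0"
 proof
  assume A: "A = 0"
  have "const C * (ylin n 1 * yy 1 - yy 1 * ylin n 1) : R" by (intro R_simps(6) ylin_commutator 1 TT_const)
  from R_simps(3)[OF r this] have "(const B * vv n + const C * ylin n 1) * yy 1 : R"
   by (simp add: A algebra_simps)
  hence "const B * vv n + const C * ylin n 1 : R" using R_prime[OF _ y1] yy_notin[OF 1] L by auto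
  thus False using linear_notin A ABC(1) by blast
 qed
 have B: "B ~= 0"
 proof
  assume B: "B = 0"
  have "const A * (yy 1 * vv n) + const C * (yy 1 * ylin n 1) : R" using r B by simp
  hence "yy 1 * (const A * vv n + const C * ylin n 1) : R" unfolding cy distrib_left .
  hence "const A * vv n + const C * ylin n 1 : R" using R_prime[OF y1] yy_notin[OF 1] L by auto
  thus False using linear_notin A by blast
 qed
 show ?thesis
 proof (rule that[of "- (B / A)" "C / A"])
  show "- (B / A) ~= 0" using A B by simp
  fix i assume i: "i : {1..n}"
  have e: "const (1 / A) * (const k * f) = const (k / A) * f" for k f
   by (simp only: mult.assoc[symmetric] const_simps(4)[symmetric]) simp
  have "const (1 / A) * (const A * (yy i * vv n) + const B * (vv n * yy i) + const C * (yy i * ylin n i)) : R"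
   by (intro R_simps(6) ABC(2) i TT_const)
  thus "yy i * vv n - const (- (B / A)) * (vv n * yy i) + const (C / A) * (yy i * ylin n i) : R"
   unfolding distrib_left e using A by simp
 qed
qed

text \<open>Reducing \<open>y_1 y_2 v\<close> and \<open>y_2 y_1 v\<close> gives the relation \<open>(a - 1) q y_1 y_2 (L_1 - L_2)\<close>, and \<open>L_1 - L_2\<close> is a multiple of \<open>y_1 - y_2\<close>.\<close>

lemma parameter_equation:
 assumes r: "!!i. i : {1..n} ==> yy i * vv n - const a * (vv n * yy i) + const q * (yy i * ylin n i) : R"
 shows "(a - 1) * q = 0"
proof (rule ccontr)
 assume nz: "(a - 1) * q ~= 0"
 define y z v L M where "y = yy 1" and "z = yy 2" and "v = vv n" and "L = ylin n 1" and "M = ylin n 2"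
 have 12: "1 : {1..n}" "2 : {1..n}" using n2 by auto
 have TT: "y : TT n" "z : TT n" "v : TT n" "L : TT n" "M : TT n" using n2 by (simp_all add: y_def z_def v_def L_def M_def)
 have r1: "y * v - const a * (v * y) + const q * (y * L) : R" (is "?r1 : R") using r[OF 12(1)] by (simp add: y_def v_def L_def)
 have r2: "z * v - const a * (v * z) + const q * (z * M) : R" (is "?r2 : R") using r[OF 12(2)] by (simp add: z_def v_def M_def)
 have c: "y * z - z * y : R" (is "?c : R") using yy_commutator[OF 12] by (simp add: y_def z_def)
 have Lz: "L * z - z * L : R" using ylin_commutator[OF 12(1,2)] by (simp add: z_def L_def)
 have My: "M * y - y * M : R" using ylin_commutator[OF 12(2,1)] by (simp add: y_def M_def)
 have cy: "y * (const e * h) = const e * (y * h)" "z * (const e * h) = const e * (z * h)" for e h by (metis const_central mult.assoc)+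
 \<comment> \<open>the difference of the two reductions, less the part that is a combination of commutators\<close>
 define W where "W = (y * ?r2 + const a * (?r1 * z)) - (z * ?r1 + const a * (?r2 * y)) - ?c * v + const a * (const a * (v * ?c))
  - const q * (?c * L) - const a * (const q * (y * (L * z - z * L) + ?c * M - z * (M * y - y * M)))"
 note w = R_simps(6)[OF r2 TT(1)] R_simps(6)[OF R_simps(7)[OF r1 TT(2)] TT_const] R_simps(6)[OF r1 TT(2)]
  R_simps(6)[OF R_simps(7)[OF r2 TT(1)] TT_const] R_simps(7)[OF c TT(3)] R_simps(6)[OF R_simps(6)[OF R_simps(6)[OF c TT(3)] TT_const] TT_const]
  R_simps(6)[OF R_simps(7)[OF c TT(4)] TT_const]
  R_simps(6)[OF R_simps(6)[OF R_simps(5)[OF R_simps(3)[OF R_simps(6)[OF Lz TT(1)] R_simps(7)[OF c TT(5)]] R_simps(6)[OF My TT(2)]] TT_const] TT_const]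
 have "W : R" unfolding W_def
  by (intro R_simps(3,5) w)
 also have "W = const ((a - 1) * q) * (y * z * (L - M))"
 proof (rule poly_mapping_eqI)
  fix w
  show "lookup W w = lookup (const ((a - 1) * q) * (y * z * (L - M))) w"
   unfolding W_def distrib_left distrib_right left_diff_distrib right_diff_distrib mult.assoc cy lookup_add lookup_minus lookup_const_mult
   by (simp add: algebra_simps)
 qed
 also have "L - M = const (of_nat (n + 1)) * (y - z)" unfolding L_def M_def ylin_def y_def z_def by (simp add: right_diff_distrib)
 also have "const ((a - 1) * q) * (y * z * (const (of_nat (n + 1)) * (y - z))) = const ((a - 1) * q) * (const (of_nat (n + 1)) * (y * z * (y - z)))"
  unfolding mult.assoc cy ..
 finally have "const ((a - 1) * q) * (const (of_nat (n + 1)) * (y * z * (y - z))) : R" .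
 hence "const (of_nat (n + 1)) * (y * z * (y - z)) : R" using nz TT by (intro R_scale[of "const (of_nat (n + 1)) * (y * z * (y - z))" "(a - 1) * q"]) (simp_all del: const_simps)
 hence "y * z * (y - z) : R" by (intro R_scale[of "y * z * (y - z)" "of_nat (n + 1)"]) (use TT in "simp_all del: of_nat_add of_nat_Suc const_simps")
 hence "y : R \<or> z : R \<or> y - z : R" using R_prime[of "y * z" "y - z"] R_prime[of y z] TT by auto
 moreover have "y ~: R" "z ~: R" using yy_notin 12 by (simp_all add: y_def z_def)
 moreover have "y - z ~: R"
 proof
  assume "y - z : R"
  moreover have "y - z : TP n 1" using n2 unfolding y_def z_def by (intro piece_diff yy_piece) auto
  ultimately have "y - z = 0" by (intro R_piece_1)
  hence "C.act n 1 (yy 1) = C.act n 1 (yy 2)" by (simp add: y_def z_def)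
  hence "yv 1 = yv 2" by (simp add: C.act_yy' one_pCons)
  thus False unfolding yv_def ym_def
   by (metis keys_single singleton_inject zero_neq_one add_mset_eq_singleton_iff one_eq_numeral_iff num.distinct(1) single_eq_single)
 qed
 ultimately show False by blast
qed

theorem classification: "EX p q. p * q = 0 & 1 + p ~= 0 & R = family_ideal n (p, q)"
proof -
 obtain a q where aq: "a ~= 0" "!!i. i : {1..n} ==> yy i * vv n - const a * (vv n * yy i) + const q * (yy i * ylin n i) : R"
  by (rule normalised_relation) (use that in blast)
 have pq: "(a - 1) * q = 0" by (rule parameter_equation[OF aq(2)])
 interpret F: pbw_model n "a - 1" q by standard (rule pq)
 interpret T: ring "tensor_alg n" by (rule tensor_ring)
 have "family_ideal n (a - 1, q) <=: R" unfolding F.family_ideal_eq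
 proof (rule T.genideal_minimal[OF R_ideal], rule subsetI)
  fix f assume "f : F.rel_set"
  hence "(EX i. f = yy i * vv n - const (1 + (a - 1)) * vv n * yy i + const q * delta_poly n i & 1 <= i & i <= n)
    \<or> (EX i j. f = yy i * yy j - yy j * yy i & 1 <= i & i < j & j <= n)"
   unfolding F.rel_set_def y_commutators_def Un_iff mem_Collect_eq .
  thus "f : R"
  proof (elim disjE exE conjE)
   fix i assume "f = yy i * vv n - const (1 + (a - 1)) * vv n * yy i + const q * delta_poly n i" "1 <= i" "i <= n"
   thus ?thesis using aq(2)[of i] by (simp add: delta_ylin mult.assoc)
  next
   fix i j assume "f = yy i * yy j - yy j * yy i" "1 <= i" "i < j" "j <= n"
   thus ?thesis using yy_commutator[of i j] by simp
  qed
 qed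
 hence "R = family_ideal n (a - 1, q)" by (rule R_eqI[OF F.Q_S_deformation])
 thus ?thesis using pq aq(1) by (intro exI[of _ "a - 1"] exI[of _ q]) simp
qed

end

lemma family_ideal_inj:
 assumes n: "n >= 2" and pq: "p * q = 0" and eq: "family_ideal n (p, q) = family_ideal n (p', q')"
 shows "p = p' & q = q'"
proof -
 interpret F: pbw_model n p q by standard (rule pq)
 interpret T: ring "tensor_alg n" by (rule tensor_ring)
 define r where "r p q = yy 1 * vv n - const (1 + p) * vv n * yy 1 + const q * delta_poly n 1" for p q
 have "r p' q' : family_ideal n (p', q')"
  unfolding family_ideal_def prod.case r_def
  by (rule subsetD[OF T.genideal_self]) (use n in "auto simp: y_commutators_def")
 hence "r p' q' : F.I" unfolding eq .
 hence 0: "F.prj (r p' q') = 0" unfolding F.family_ideal_kernel by simp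
 have y0: "yc c = 0 ==> c = 0" for c by (auto simp: yc_def dest!: arg_cong[of _ _ "%f. lookup f {#}"])
 have V: "F.act 1 (const (1 + p') * vv n * yy 1) = smult (yv 1) (smult (yc (1 + p')) var_v)"
 proof -
  have "F.V 1 = var_v" using F.V_power_1[of 1] by (simp add: var_v_def monom_Suc monom_0)
  thus ?thesis unfolding F.act_mult F.act_simps(5) F.act_vv F.V_scale by (simp add: F.act_yy' del: yc_simps)
 qed
 have "F.act 1 (yy 1 * vv n) = F.V [:yv 1:]" by (simp add: F.act_mult F.act_vv F.act_yy')
 moreover have "F.act 1 (const q' * delta_poly n 1) = smult (yc q') [:F.ydelta (yv 1):]"
  using n unfolding F.act_mult F.act_simps(5) F.act_scale_left by (simp add: F.act_scale_left F.act_delta)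
 ultimately have prjr: "F.V [:yv 1:] - smult (yv 1) (smult (yc (1 + p')) var_v) + smult (yc q') [:F.ydelta (yv 1):] = 0"
  using 0 V unfolding r_def F.prj_def F.act_simps by simp
 from arg_cong[OF prjr, of "%u. coeff u 1"] have "yc (p - p') * yv 1 = 0"
  by (simp add: F.V_const var_v_def algebra_simps)
 hence "yc (p - p') = 0" using yv_nonzero[of 1] mult_eq_0_iff by blast
 hence p: "p - p' = 0" by (rule y0)
 from arg_cong[OF prjr, of "%u. coeff u 0"] have e: "yc (q' - q) * F.ydelta (yv 1) = 0"
  by (simp add: F.V_const var_v_def algebra_simps)
 have "F.ydelta (yv 1) ~= 0"
 proof
  assume "F.ydelta (yv 1) = 0"
  hence l: "of_nat (n + 1) * yv 1 - 2 * F.ysum = 0" using yv_nonzero[of 1] by (simp add: F.ydelta_def del: of_nat_Suc of_nat_add)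
  have lk: "lookup (yv i) {#2#} = (if i = 2 then 1 else 0)" for i
   by (simp add: yv_def ym_def lookup_single when_def)
  have "lookup F.ysum {#2#} = (\<Sum>i = 1..n. if i = 2 then 1 else 0)" unfolding F.ysum_def lookup_sum lk ..
  hence "lookup F.ysum {#2#} = 1" using n by simp
  hence "lookup (yc (of_nat (n + 1)) * yv 1 - yc 2 * F.ysum) {#2#} = - 2"
   by (simp only: lookup_minus lookup_scale lk) simp
  thus False using l by (simp del: of_nat_Suc of_nat_add)
 qed
 hence "yc (q' - q) = 0" using e mult_eq_0_iff by blast
 thus ?thesis using p y0 by fastforce
qed

lemma family_quantum: "family_ideal n (a - 1, 0) = quantum_ideal n a"
 by (simp add: family_ideal_def quantum_ideal_def)
lemma family_differential: "family_ideal n (0, c) = differential_ideal n c"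
proof -
 interpret T: ring "tensor_alg n" by (rule tensor_ring)
 let ?f = "%i. yy i * vv n - const (1 + 0) * vv n * yy i + const c * delta_poly n i"
 let ?g = "%i. vv n * yy i - yy i * vv n - const c * delta_poly n i"
 let ?A = "{?f i | i. 1 <= i & i <= n} \<union> y_commutators n" and ?B = "{?g i | i. 1 <= i & i <= n} \<union> y_commutators n"
 have fg: "?f i = - ?g i" "?g i = - ?f i" for i by simp_all
 have sub: "?A <=: TT n" "?B <=: TT n" by (auto simp: y_commutators_def)
 note I = T.genideal_ideal[OF sub(1)] T.genideal_ideal[OF sub(2)]
 note self = T.genideal_self[OF sub(1)] T.genideal_self[OF sub(2)]
 have fB: "?f i : Idl\<^bsub>tensor_alg n\<^esub> ?B" if "1 <= i" "i <= n" for i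
  unfolding fg(1)[of i] by (rule ideal_tensorD(4)[OF I(2)], rule subsetD[OF self(2)]) (use that in auto)
 have gA: "?g i : Idl\<^bsub>tensor_alg n\<^esub> ?A" if "1 <= i" "i <= n" for i
  unfolding fg(2)[of i] by (rule ideal_tensorD(4)[OF I(1)], rule subsetD[OF self(1)]) (use that in auto)
 have "Idl\<^bsub>tensor_alg n\<^esub> ?A <=: Idl\<^bsub>tensor_alg n\<^esub> ?B"
  by (rule T.genideal_minimal[OF I(2)]) (use fB self(2) in blast)
 moreover have "Idl\<^bsub>tensor_alg n\<^esub> ?B <=: Idl\<^bsub>tensor_alg n\<^esub> ?A"
  by (rule T.genideal_minimal[OF I(1)]) (use gA self(1) in blast)
 ultimately show ?thesis unfolding family_ideal_def differential_ideal_def prod.case by blast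
qed

theorem theorem4p0p2:
  fixes n :: nat
  assumes "n \<ge> 2"
  shows "inj_on (family_ideal n) V_xy
    \<and> {R. S_deformation n R \<and> AS_regular (quotient_alg n R) (n + 1) \<and> nc_domain (quotient_alg n R)}
        = family_ideal n ` (V_xy - {(-1, 0)})
    \<and> (\<forall>a. family_ideal n (a - 1, 0) = quantum_ideal n a)
    \<and> (\<forall>c. family_ideal n (0, c) = differential_ideal n c)"
proof (intro conjI allI family_quantum family_differential)
 show "inj_on (family_ideal n) V_xy"
  by (rule inj_onI) (auto simp: V_xy_def dest!: family_ideal_inj[OF assms, rotated])
 show "{R. S_deformation n R & AS_regular (quotient_alg n R) (n + 1) & nc_domain (quotient_alg n R)} = family_ideal n ` (V_xy - {(-1, 0)})"
  (is "?L = ?R")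
 proof (intro equalityI subsetI)
  fix R assume "R : ?L"
  hence "domain_deformation n R"
   by (intro domain_deformation.intro deformation.intro domain_deformation_axioms.intro assms) auto
  then obtain p q where pq: "p * q = 0" "1 + p ~= 0" "R = family_ideal n (p, q)" using domain_deformation.classification by blast
  have "(p, q) : V_xy - {(-1, 0)}" using pq by (auto simp: V_xy_def)
  thus "R : ?R" using pq(3) by blast
 next
  fix R assume "R : ?R"
  then obtain p q where pq: "(p, q) : V_xy - {(-1, 0)}" "R = family_ideal n (p, q)" by auto
  hence p: "p * q = 0" by (simp add: V_xy_def)
  have "1 + p ~= 0"
  proof
   assume "1 + p = 0"
   hence "p = - 1" by (simp add: add_eq_0_iff)
   thus False using pq p by simp
  qed
  then interpret F: pbw_domain n p q by unfold_locales (use p in auto)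
  show "R : ?L" using F.Q_S_deformation F.Q_AS_regular F.Q_domain[OF F.p_ne] pq(2) by simp
 qed
qed

end
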